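(* Fix $\epsilon>0$. There is an $(O(\log n/\epsilon),\,1+\epsilon)$-bicriteria approximation algorithm for the Heterogeneous Capacitated $k$-Center problem running in time $C_\epsilon^{\tilde O(\log^3 n)}$, where $C_\epsilon$ is a constant depending only on $\epsilon$. There is an $(O(\log n/\epsilon),\,1+\epsilon)$-bicriteria approximation algorithm for the Heterogeneous Capacitated $k$-Center problem with soft capacities running in time $n^{O(1/\epsilon)}$.
   Context: Heterogeneous Capacitated $k$-Center problem: the input is a finite metric space $(X=F\cup C,d)$, where $C$ is the set of clients and $F$ the set of facility locations, and a collection of capacities $(k_1,c_1),\dots,(k_P,c_P)$, meaning $k_p$ copies of capacity $c_p$. A solution installs the copies of capacities at locations in $F$, with at most one capacity installed per location, and assigns each client to a location with an installed capacity so that the number of clients assigned to a location is at most the capacity installed there; the objective is to minimize the maximum distance between a client and the location it is assigned to. Let $\mathrm{OPT}$ be the optimum value. In the version with soft capacities, several capacities may be installed at the same location (each installed copy is a separate facility with its own capacity bound). For $a,b\ge1$, an $(a,b)$-approximate solution installs at most $k_p$ copies of capacity $c_p$ for each $p$ (respecting the one-per-location rule in the non-soft version), assigns every client to a facility at distance at most $a\cdot\mathrm{OPT}$, and assigns at most $\lceil b c_p\rceil$ clients to each facility with installed capacity $c_p$. An $(a,b)$-bicriteria approximation algorithm always returns an $(a,b)$-approximate solution. Here $n$ denotes the size of the instance (number of points).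
   Formalization: The running times carry an extra term O(P) for reading the list of P capacities, since no bound in the number of points n alone can hold when P is unbounded; and 1/ε in the O-terms is read as max(1, 1/ε), since for huge ε the ratio O(log n/ε) would drop below 1. *)

theory Defs
  imports "HOL-Analysis.Analysis"
begin

section \<open>Heterogeneous capacitated k-center\<close>

text \<open>
  The list \<open>caps\<close> holds the pairs \<open>(k\<^sub>p, c\<^sub>p)\<close>: \<open>k\<^sub>p\<close> copies of capacity \<open>c\<^sub>p\<close>. A solution is a list
  \<open>fac\<close> of facilities \<open>(v, p)\<close>, meaning that one copy of the \<open>p\<close>-th capacity is installed at
  location \<open>v\<close>, and a map \<open>\<sigma>\<close> from clients to positions in \<open>fac\<close>. Thus with soft capacities every
  installed copy is a facility of its own. The function \<open>load\<close> gives the number of clients that a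
  facility of a given capacity may serve.
\<close>

type_synonym 'a facility = "'a \<times> nat"

definition hck_solution ::
    "bool \<Rightarrow> (nat \<Rightarrow> nat) \<Rightarrow> 'a set \<Rightarrow> 'a set \<Rightarrow> (nat \<times> nat) list \<Rightarrow>
     'a facility list \<Rightarrow> ('a \<Rightarrow> nat) \<Rightarrow> bool" where
  "hck_solution soft load F C caps fac \<sigma> \<longleftrightarrow>
     (\<forall>(v, p) \<in> set fac. v \<in> F \<and> p < length caps) \<and>
     (\<not> soft \<longrightarrow> distinct (map fst fac)) \<and>
     (\<forall>p < length caps. length (filter (\<lambda>f. snd f = p) fac) \<le> fst (caps ! p)) \<and>
     (\<forall>x \<in> C. \<sigma> x < length fac) \<and>
     (\<forall>i < length fac. card {x \<in> C. \<sigma> x = i} \<le> load (snd (caps ! snd (fac ! i))))"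

definition feasible_solution where
  "feasible_solution soft F C caps fac \<sigma> \<longleftrightarrow> hck_solution soft (\<lambda>c. c) F C caps fac \<sigma>"

text \<open>The \<open>insert 0\<close> only matters when there are no clients.\<close>

definition radius ::
    "'a set \<Rightarrow> ('a \<Rightarrow> 'a \<Rightarrow> real) \<Rightarrow> 'a facility list \<Rightarrow> ('a \<Rightarrow> nat) \<Rightarrow> real" where
  "radius C d fac \<sigma> = Max (insert 0 ((\<lambda>x. d x (fst (fac ! \<sigma> x))) ` C))"

text \<open>Meaningful only for instances that have a feasible solution.\<close>

definition OPT ::
    "bool \<Rightarrow> 'a set \<Rightarrow> 'a set \<Rightarrow> ('a \<Rightarrow> 'a \<Rightarrow> real) \<Rightarrow> (nat \<times> nat) list \<Rightarrow> real" where
  "OPT soft F C d caps = Inf {radius C d fac \<sigma> | fac \<sigma>. feasible_solution soft F C caps fac \<sigma>}"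

definition approximate_solution ::
    "bool \<Rightarrow> real \<Rightarrow> real \<Rightarrow> 'a set \<Rightarrow> 'a set \<Rightarrow> ('a \<Rightarrow> 'a \<Rightarrow> real) \<Rightarrow> (nat \<times> nat) list \<Rightarrow>
     'a facility list \<Rightarrow> ('a \<Rightarrow> nat) \<Rightarrow> bool" where
  "approximate_solution soft a b F C d caps fac \<sigma> \<longleftrightarrow>
     hck_solution soft (\<lambda>c. nat \<lceil>b * real c\<rceil>) F C caps fac \<sigma> \<and>
     (\<forall>x \<in> C. d x (fst (fac ! \<sigma> x)) \<le> a * OPT soft F C d caps)"


section \<open>Model of computation\<close>

text \<open>
  A unit-cost random access machine, programmed in a while language, with two kinds of memory:
  arrays of natural numbers and arrays of real numbers (the latter needed as distances are real).
  A scalar variable is cell \<open>0\<close> of the array of that name.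
  There is no multiplication and no rounding, since unit-cost versions of these would make the
  machine unreasonably powerful. Literals are naturals only, so that a program carries only
  finitely many bits of information.
\<close>

type_synonym vname = string
type_synonym state = "(vname \<Rightarrow> nat \<Rightarrow> nat) \<times> (vname \<Rightarrow> nat \<Rightarrow> real)"

datatype nexp = NLit nat | NGet vname nexp | NAdd nexp nexp | NSub nexp nexp

datatype rexp = RLit nat | RGet vname nexp | RAdd rexp rexp | RSub rexp rexp

datatype bexp = NLess nexp nexp | RLess rexp rexp | BNot bexp | BAnd bexp bexp

datatype com =
    Skip
  | NSet vname nexp nexp
  | RSet vname nexp rexp
  | Seq com com
  | Cond bexp com com
  | While bexp com

fun nval :: "nexp \<Rightarrow> state \<Rightarrow> nat" where
  "nval (NLit k) s = k"
| "nval (NGet x e) s = fst s x (nval e s)"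
| "nval (NAdd e e') s = nval e s + nval e' s"
| "nval (NSub e e') s = nval e s - nval e' s"

fun rval :: "rexp \<Rightarrow> state \<Rightarrow> real" where
  "rval (RLit k) s = real k"
| "rval (RGet x e) s = snd s x (nval e s)"
| "rval (RAdd e e') s = rval e s + rval e' s"
| "rval (RSub e e') s = rval e s - rval e' s"

fun bval :: "bexp \<Rightarrow> state \<Rightarrow> bool" where
  "bval (NLess e e') s \<longleftrightarrow> nval e s < nval e' s"
| "bval (RLess e e') s \<longleftrightarrow> rval e s < rval e' s"
| "bval (BNot b) s \<longleftrightarrow> \<not> bval b s"
| "bval (BAnd b b') s \<longleftrightarrow> bval b s \<and> bval b' s"

fun ncost :: "nexp \<Rightarrow> nat" where
  "ncost (NLit k) = 1"
| "ncost (NGet x e) = 1 + ncost e"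
| "ncost (NAdd e e') = 1 + ncost e + ncost e'"
| "ncost (NSub e e') = 1 + ncost e + ncost e'"

fun rcost :: "rexp \<Rightarrow> nat" where
  "rcost (RLit k) = 1"
| "rcost (RGet x e) = 1 + ncost e"
| "rcost (RAdd e e') = 1 + rcost e + rcost e'"
| "rcost (RSub e e') = 1 + rcost e + rcost e'"

fun bcost :: "bexp \<Rightarrow> nat" where
  "bcost (NLess e e') = 1 + ncost e + ncost e'"
| "bcost (RLess e e') = 1 + rcost e + rcost e'"
| "bcost (BNot b) = 1 + bcost b"
| "bcost (BAnd b b') = 1 + bcost b + bcost b'"

definition nupd :: "vname \<Rightarrow> nat \<Rightarrow> nat \<Rightarrow> state \<Rightarrow> state" where
  "nupd x i k s = ((fst s)(x := (fst s x)(i := k)), snd s)"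

definition rupd :: "vname \<Rightarrow> nat \<Rightarrow> real \<Rightarrow> state \<Rightarrow> state" where
  "rupd x i r s = (fst s, (snd s)(x := (snd s x)(i := r)))"

text \<open>\<open>exec c s t s'\<close>: started in \<open>s\<close>, the program \<open>c\<close> halts in \<open>s'\<close> after \<open>t\<close> steps.\<close>

inductive exec :: "com \<Rightarrow> state \<Rightarrow> nat \<Rightarrow> state \<Rightarrow> bool" where
  Skip: "exec Skip s 1 s"
| NSet: "exec (NSet x e e') s (1 + ncost e + ncost e') (nupd x (nval e s) (nval e' s) s)"
| RSet: "exec (RSet x e e') s (1 + ncost e + rcost e') (rupd x (nval e s) (rval e' s) s)"
| Seq: "exec c s t s' \<Longrightarrow> exec c' s' t' s'' \<Longrightarrow> exec (Seq c c') s (t + t') s''"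
| CondTrue: "bval b s \<Longrightarrow> exec c s t s' \<Longrightarrow> exec (Cond b c c') s (1 + bcost b + t) s'"
| CondFalse: "\<not> bval b s \<Longrightarrow> exec c' s t s' \<Longrightarrow> exec (Cond b c c') s (1 + bcost b + t) s'"
| WhileFalse: "\<not> bval b s \<Longrightarrow> exec (While b c) s (1 + bcost b) s"
| WhileTrue: "bval b s \<Longrightarrow> exec c s t s' \<Longrightarrow> exec (While b c) s' t' s'' \<Longrightarrow>
    exec (While b c) s (1 + bcost b + t + t') s''"

inductive_cases exec_elims:
  "exec Skip s t s'" "exec (NSet x e e') s t s'" "exec (RSet x e e') s t s'"
  "exec (Seq c c') s t s'" "exec (Cond b c c') s t s'" "exec (While b c) s t s'"

lemma exec_deterministic:
  "exec c s t s' \<Longrightarrow> exec c s u s'' \<Longrightarrow> u = t \<and> s'' = s'"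
proof (induction arbitrary: u s'' rule: exec.induct)
  case (Seq c s t s' c' t' sa)
  show ?case
  proof (rule exec_elims(4)[OF Seq.prems])
    fix t1 s1 t2
    assume u: "u = t1 + t2" and e: "exec c s t1 s1" "exec c' s1 t2 s''"
    have 1: "t1 = t \<and> s1 = s'" by (rule Seq.IH(1)[OF e(1)])
    have "t2 = t' \<and> s'' = sa" by (rule Seq.IH(2)) (use e(2) 1 in simp)
    with 1 u show ?thesis by simp
  qed
next
  case (CondTrue b s c t s' c')
  show ?case
  proof (rule exec_elims(5)[OF CondTrue.prems])
    fix t1
    assume u: "u = Suc (bcost b + t1)" and e: "exec c s t1 s''"
    show ?thesis using CondTrue.IH[OF e] u by simp
  qed (use CondTrue.hyps(1) in simp)
next
  case (CondFalse b s c' t s' c)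
  show ?case
  proof (rule exec_elims(5)[OF CondFalse.prems])
    fix t1
    assume u: "u = Suc (bcost b + t1)" and e: "exec c' s t1 s''"
    show ?thesis using CondFalse.IH[OF e] u by simp
  qed (use CondFalse.hyps(1) in simp)
next
  case (WhileFalse b s c)
  show ?case
    by (rule exec_elims(6)[OF WhileFalse.prems]) (use WhileFalse.hyps in simp_all)
next
  case (WhileTrue b s c t s' t' sa)
  show ?case
  proof (rule exec_elims(6)[OF WhileTrue.prems])
    fix t1 s1 t2
    assume u: "u = Suc (bcost b + t1 + t2)" and e: "exec c s t1 s1" "exec (While b c) s1 t2 s''"
    have 1: "t1 = t \<and> s1 = s'" by (rule WhileTrue.IH(1)[OF e(1)])
    have "t2 = t' \<and> s'' = sa" by (rule WhileTrue.IH(2)) (use e(2) 1 in simp)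
    with 1 u show ?thesis by simp
  qed (use WhileTrue.hyps(1) in simp)
qed (erule exec_elims, simp)+


section \<open>Bicriteria approximation algorithms\<close>

text \<open>
  The points of the input are numbered \<open>0, \<dots>, n - 1\<close>. Cells not used by the encoding contain \<open>0\<close>.
\<close>

definition input_state ::
    "nat \<Rightarrow> nat set \<Rightarrow> nat set \<Rightarrow> (nat \<Rightarrow> nat \<Rightarrow> real) \<Rightarrow> (nat \<times> nat) list \<Rightarrow> state" where
  "input_state n F C d caps =
     ((\<lambda>_ _. 0)
        (''n'' := (\<lambda>_. 0)(0 := n),
         ''P'' := (\<lambda>_. 0)(0 := length caps),
         ''F'' := (\<lambda>i. if i \<in> F then 1 else 0),
         ''C'' := (\<lambda>i. if i \<in> C then 1 else 0),
         ''k'' := (\<lambda>p. if p < length caps then fst (caps ! p) else 0),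
         ''c'' := (\<lambda>p. if p < length caps then snd (caps ! p) else 0)),
      (\<lambda>_ _. 0)
        (''d'' := (\<lambda>i. if i < n * n then d (i div n) (i mod n) else 0)))"

definition output_facilities :: "state \<Rightarrow> nat facility list" where
  "output_facilities s =
     map (\<lambda>i. (fst s ''location'' i, fst s ''type'' i)) [0..<fst s ''facilities'' 0]"

definition output_assignment :: "state \<Rightarrow> nat \<Rightarrow> nat" where
  "output_assignment s = fst s ''assignment''"

text \<open>
  The approximation factor \<open>a\<close> may depend on the number \<open>n\<close> of points, the time bound \<open>T\<close> on \<open>n\<close>
  and on the number of pairs \<open>(k\<^sub>p, c\<^sub>p)\<close>. The time bound has to hold on every input; on inputs without
  a feasible solution the output is irrelevant.
\<close>

definition bicriteria_algorithm ::
    "bool \<Rightarrow> (nat \<Rightarrow> real) \<Rightarrow> real \<Rightarrow> (nat \<Rightarrow> nat \<Rightarrow> real) \<Rightarrow> com \<Rightarrow> bool" where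
  "bicriteria_algorithm soft a b T prog \<longleftrightarrow>
     (\<forall>n F C d caps. F \<union> C = {..<n} \<and> Metric_space {..<n} d \<longrightarrow>
        (\<exists>t s. exec prog (input_state n F C d caps) t s \<and>
           real t \<le> T n (length caps) \<and>
           ((\<exists>fac \<sigma>. feasible_solution soft F C caps fac \<sigma>) \<longrightarrow>
              approximate_solution soft (a n) b F C d caps
                (output_facilities s) (output_assignment s))))"

text \<open>Shifting the argument makes the logarithm at least \<open>1\<close> for every \<open>n\<close>.\<close>

definition lg :: "nat \<Rightarrow> real" where
  "lg n = log 2 (real n + 2)"

text \<open>\<open>1/\<epsilon>\<close>, as the argument of an \<open>O\<close> for \<open>\<epsilon> \<rightarrow> 0\<close>; for \<open>\<epsilon> \<ge> 1\<close> it is constant.\<close>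

definition inv_eps :: "real \<Rightarrow> real" where
  "inv_eps \<epsilon> = max 1 (1 / \<epsilon>)"

end

theory Submission
  imports Defs "HOL-Library.Multiset" "HOL-Library.Discrete_Functions"
begin

text \<open>
  The optimum is guessed among the pairwise distances. For a guess \<open>R\<close>, a ball is grown from an
  unclustered client by adding alternately the free facilities and the free clients within distance
  \<open>R\<close>, until a round increases the number \<open>a\<close> of its clients by at most \<open>a div 2 ^ (e - 3)\<close>, where
  \<open>2 ^ e\<close> is of order \<open>1/\<epsilon>\<close>. This happens after \<open>O(2 ^ e * log n)\<close> rounds, and a solution of radius
  \<open>R\<close> serves the \<open>a\<close> clients from facilities in the cluster only. Since the clusters have disjoint
  facilities, it remains to cover bins, one per cluster and with demands slightly below \<open>a\<close>, by
  items, one per copy of a capacity; a facility serves slightly more clients than its capacity to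
  make up for the loss.

  A covering is found by breadth-first search, in which only the number of outstanding obligations of
  each rounded size is remembered. Rounding to \<open>e\<close> significant bits leaves \<open>O(2 ^ e * log n)\<close> sizes
  and hence quasipolynomially many states. With soft capacities a bin may use any number of copies,
  so obligations can be glued together and split again; going through the bins by decreasing
  magnitude of the demand, obligations much smaller than the demand can be rounded so coarsely that
  \<open>O(2 ^ e)\<close> sizes occur at a time, hence polynomially many states. Since the items are used in
  decreasing order, the greedy matching of obligations to items is optimal.
\<close>

section \<open>Programs with bounded loops\<close>

datatype prog =
    Nop
  | Put vname nexp nexp
  | PutR vname nexp rexp
  | Then prog prog (infixr ";;" 60)
  | If bexp prog prog
  | For vname vname prog

abbreviation var :: "vname \<Rightarrow> nexp" where "var x \<equiv> NGet x (NLit 0)"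

abbreviation Assign :: "vname \<Rightarrow> nexp \<Rightarrow> prog" where "Assign x e \<equiv> Put x (NLit 0) e"

abbreviation When :: "bexp \<Rightarrow> prog \<Rightarrow> prog" where "When b p \<equiv> If b p Nop"

definition NLe :: "nexp \<Rightarrow> nexp \<Rightarrow> bexp" where "NLe e e' = BNot (NLess e' e)"

definition NEq :: "nexp \<Rightarrow> nexp \<Rightarrow> bexp" where "NEq e e' = BAnd (NLe e e') (NLe e' e)"

lemma bval_NLe [simp]: "bval (NLe e e') s \<longleftrightarrow> nval e s \<le> nval e' s"
  by (auto simp: NLe_def)

lemma bval_NEq [simp]: "bval (NEq e e') s \<longleftrightarrow> nval e s = nval e' s"
  by (auto simp: NEq_def)

lemma nupd_simps [simp]:
  "fst (nupd x i k s) = (fst s)(x := (fst s x)(i := k))" "snd (nupd x i k s) = snd s"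
  by (simp_all add: nupd_def)

lemma rupd_simps [simp]:
  "snd (rupd x i r s) = (snd s)(x := (snd s x)(i := r))" "fst (rupd x i r s) = fst s"
  by (simp_all add: rupd_def)

fun compile :: "prog \<Rightarrow> com" where
  "compile Nop = Skip"
| "compile (Put x e e') = NSet x e e'"
| "compile (PutR x e e') = RSet x e e'"
| "compile (p ;; q) = Seq (compile p) (compile q)"
| "compile (If b p q) = Cond b (compile p) (compile q)"
| "compile (For x l p) =
     Seq (NSet x (NLit 0) (NLit 0))
       (While (NLess (var x) (var l)) (Seq (compile p) (NSet x (NLit 0) (NAdd (var x) (NLit 1)))))"

fun iter :: "vname \<Rightarrow> (state \<Rightarrow> state) \<Rightarrow> nat \<Rightarrow> state \<Rightarrow> state" where
  "iter x f 0 s = nupd x 0 0 s"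
| "iter x f (Suc i) s = nupd x 0 (Suc i) (f (iter x f i s))"

fun den :: "prog \<Rightarrow> state \<Rightarrow> state" where
  "den Nop s = s"
| "den (Put x e e') s = nupd x (nval e s) (nval e' s) s"
| "den (PutR x e e') s = rupd x (nval e s) (rval e' s) s"
| "den (p ;; q) s = den q (den p s)"
| "den (If b p q) s = (if bval b s then den p s else den q s)"
| "den (For x l p) s = iter x (den p) (fst s l 0) s"

declare den.simps(6) [simp del]

fun nwrites :: "prog \<Rightarrow> vname set" where
  "nwrites (Put x e e') = {x}"
| "nwrites (p ;; q) = nwrites p \<union> nwrites q"
| "nwrites (If b p q) = nwrites p \<union> nwrites q"
| "nwrites (For x l p) = insert x (nwrites p)"
| "nwrites _ = {}"

fun rwrites :: "prog \<Rightarrow> vname set" where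
  "rwrites (PutR x e e') = {x}"
| "rwrites (p ;; q) = rwrites p \<union> rwrites q"
| "rwrites (If b p q) = rwrites p \<union> rwrites q"
| "rwrites (For x l p) = rwrites p"
| "rwrites _ = {}"

fun limits :: "prog \<Rightarrow> vname set" where
  "limits (p ;; q) = limits p \<union> limits q"
| "limits (If b p q) = limits p \<union> limits q"
| "limits (For x l p) = insert l (limits p)"
| "limits _ = {}"

fun proper :: "prog \<Rightarrow> bool" where
  "proper (p ;; q) \<longleftrightarrow> proper p \<and> proper q"
| "proper (If b p q) \<longleftrightarrow> proper p \<and> proper q"
| "proper (For x l p) \<longleftrightarrow> proper p \<and> x \<noteq> l \<and> x \<notin> nwrites p \<and> l \<notin> nwrites p"
| "proper _ \<longleftrightarrow> True"

fun depth :: "prog \<Rightarrow> nat" where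
  "depth (p ;; q) = max (depth p) (depth q)"
| "depth (If b p q) = max (depth p) (depth q)"
| "depth (For x l p) = Suc (depth p)"
| "depth _ = 0"

fun pcost :: "prog \<Rightarrow> nat" where
  "pcost Nop = 1"
| "pcost (Put x e e') = 1 + ncost e + ncost e'"
| "pcost (PutR x e e') = 1 + ncost e + rcost e'"
| "pcost (p ;; q) = pcost p + pcost q"
| "pcost (If b p q) = 1 + bcost b + pcost p + pcost q"
| "pcost (For x l p) = 21 + pcost p"

lemma iter_nat_frame:
  assumes "\<And>s. fst (f s) y = fst s y" "y \<noteq> x"
  shows "fst (iter x f i s) y = fst s y"
  by (induction i) (use assms in auto)

lemma den_nat_frame: "y \<notin> nwrites p \<Longrightarrow> fst (den p s) y = fst s y"
  by (induction p arbitrary: s) (auto simp: den.simps intro!: iter_nat_frame)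

lemma iter_real_frame:
  assumes "\<And>s. snd (f s) y = snd s y"
  shows "snd (iter x f i s) y = snd s y"
  by (induction i) (use assms in auto)

lemma den_real_frame: "y \<notin> rwrites p \<Longrightarrow> snd (den p s) y = snd s y"
  by (induction p arbitrary: s) (auto simp: den.simps intro!: iter_real_frame)

definition agree :: "vname set \<Rightarrow> vname set \<Rightarrow> state \<Rightarrow> state \<Rightarrow> bool" where
  "agree W V s s' \<longleftrightarrow> (\<forall>y. y \<notin> W \<longrightarrow> fst s' y = fst s y) \<and> (\<forall>y. y \<notin> V \<longrightarrow> snd s' y = snd s y)"

lemma agree_den: "agree (nwrites p) (rwrites p) s (den p s)"
  by (simp add: agree_def den_nat_frame den_real_frame)

lemma For_rule:
  assumes "proper (For x l p)" "fst s l 0 = N"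
    and base: "I 0 s"
    and indep: "\<And>i k s. I i s \<Longrightarrow> I i (nupd x 0 k s)"
    and step: "\<And>i s'. i < N \<Longrightarrow> I i s' \<Longrightarrow> agree (insert x (nwrites p)) (rwrites p) s s' \<Longrightarrow>
      fst s' x 0 = i \<Longrightarrow> I (Suc i) (den p s')"
  shows "I N (den (For x l p) s)"
proof -
  have x: "x \<notin> nwrites p" using assms(1) by simp
  have "I i (iter x (den p) i s) \<and> fst (iter x (den p) i s) x 0 = i
    \<and> agree (insert x (nwrites p)) (rwrites p) s (iter x (den p) i s)" if "i \<le> N" for i
    using that
  proof (induction i)
    case 0
    then show ?case using base indep by (auto simp: agree_def)
  next
    case (Suc i)
    let ?s = "iter x (den p) i s"
    have IH: "I i ?s" "fst ?s x 0 = i" "agree (insert x (nwrites p)) (rwrites p) s ?s"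
      using Suc by auto
    have "I (Suc i) (den p ?s)" using step IH Suc by simp
    moreover have "agree (insert x (nwrites p)) (rwrites p) s (den p ?s)"
      using IH(3) agree_den[of p ?s] by (auto simp: agree_def)
    ultimately show ?case using indep by (auto simp: agree_def)
  qed
  then show ?thesis using assms(2) by (simp add: den.simps)
qed

lemma agreeD:
  assumes "agree W V s s'"
  shows "y \<notin> W \<Longrightarrow> fst s' y = fst s y" "y \<notin> V \<Longrightarrow> snd s' y = snd s y"
  using assms by (auto simp: agree_def)

definition post :: "prog \<Rightarrow> state \<Rightarrow> (state \<Rightarrow> bool) \<Rightarrow> bool" where
  "post p s Q \<longleftrightarrow> Q (den p s)"

lemma post_simps [simp]:
  "post Nop s Q \<longleftrightarrow> Q s"
  "post (Put x e e') s Q \<longleftrightarrow> Q (nupd x (nval e s) (nval e' s) s)"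
  "post (PutR x e r) s Q \<longleftrightarrow> Q (rupd x (nval e s) (rval r s) s)"
  "post (p ;; q) s Q \<longleftrightarrow> post p s (\<lambda>s. post q s Q)"
  "post (If b p q) s Q \<longleftrightarrow> (if bval b s then post p s Q else post q s Q)"
  by (simp_all add: post_def)

lemma post_weaken:
  assumes "post p s R" "\<And>s'. R s' \<Longrightarrow> agree (nwrites p) (rwrites p) s s' \<Longrightarrow> Q s'"
  shows "post p s Q"
  using assms agree_den[of p s] by (simp add: post_def)

lemma post_For:
  assumes "proper (For x l p)" "fst s l 0 = N" "I 0 s"
    and "\<And>i k s. I i s \<Longrightarrow> I i (nupd x 0 k s)"
    and "\<And>i s'. i < N \<Longrightarrow> I i s' \<Longrightarrow> agree (insert x (nwrites p)) (rwrites p) s s' \<Longrightarrow>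
      fst s' x 0 = i \<Longrightarrow> post p s' (I (Suc i))"
    and "\<And>s'. I N s' \<Longrightarrow> agree (insert x (nwrites p)) (rwrites p) s s' \<Longrightarrow> Q s'"
  shows "post (For x l p) s Q"
  using For_rule[of x l p s N I] agree_den[of "For x l p" s] assms
  by (simp add: post_def)

lemma exec_compile:
  assumes "proper p" "\<forall>l \<in> limits p. l \<notin> nwrites p \<and> fst s l 0 \<le> Z"
  shows "\<exists>t. exec (compile p) s t (den p s) \<and> t \<le> pcost p * Suc Z ^ depth p"
  using assms
proof (induction p arbitrary: s)
  case Nop
  show ?case by (auto intro: exec.intros)
next
  case (Put x e e')
  show ?case by (auto intro!: exI exec.NSet)
next
  case (PutR x e e')
  show ?case by (auto intro!: exI exec.RSet)
next
  case (Then p q)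
  obtain t where t: "exec (compile p) s t (den p s)" "t \<le> pcost p * Suc Z ^ depth p"
    using Then.IH(1)[of s] Then.prems by auto
  have "\<forall>l\<in>limits q. l \<notin> nwrites q \<and> fst (den p s) l 0 \<le> Z"
    using Then.prems by (auto simp: den_nat_frame)
  then obtain u where u: "exec (compile q) (den p s) u (den q (den p s))" "u \<le> pcost q * Suc Z ^ depth q"
    using Then.IH(2)[of "den p s"] Then.prems by auto
  have "t \<le> pcost p * Suc Z ^ max (depth p) (depth q)"
    by (rule order_trans[OF t(2)]) (intro mult_left_mono power_increasing; simp)
  moreover have "u \<le> pcost q * Suc Z ^ max (depth p) (depth q)"
    by (rule order_trans[OF u(2)]) (intro mult_left_mono power_increasing; simp)
  ultimately show ?case
    using exec.Seq[OF t(1) u(1)] by (auto simp: algebra_simps intro!: exI[of _ "t + u"] add_mono)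
next
  case (If b p q)
  have ge1: "1 \<le> Suc Z ^ max (depth p) (depth q)" by simp
  then have b: "1 + bcost b \<le> (1 + bcost b) * Suc Z ^ max (depth p) (depth q)"
    by (metis mult.right_neutral mult_le_mono2)
  show ?case
  proof (cases "bval b s")
    case True
    obtain t where t: "exec (compile p) s t (den p s)" "t \<le> pcost p * Suc Z ^ depth p"
      using If.IH(1)[of s] If.prems by auto
    have "t \<le> pcost p * Suc Z ^ max (depth p) (depth q)"
      by (rule order_trans[OF t(2)]) (intro mult_left_mono power_increasing; simp)
    with b have "1 + bcost b + t \<le> pcost (If b p q) * Suc Z ^ depth (If b p q)"
      by (simp add: algebra_simps)
    then show ?thesis using exec.CondTrue[OF True t(1)] True by auto
  next
    case False
    obtain t where t: "exec (compile q) s t (den q s)" "t \<le> pcost q * Suc Z ^ depth q"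
      using If.IH(2)[of s] If.prems by auto
    have "t \<le> pcost q * Suc Z ^ max (depth p) (depth q)"
      by (rule order_trans[OF t(2)]) (intro mult_left_mono power_increasing; simp)
    with b have "1 + bcost b + t \<le> pcost (If b p q) * Suc Z ^ depth (If b p q)"
      by (simp add: algebra_simps)
    then show ?thesis using exec.CondFalse[OF False t(1)] False by auto
  qed
next
  case (For x l p)
  let ?b = "NLess (var x) (var l)" and ?i = "NSet x (NLit 0) (NAdd (var x) (NLit 1))"
  let ?w = "While ?b (Seq (compile p) ?i)"
  let ?N = "fst s l 0" and ?it = "\<lambda>i. iter x (den p) i s"
  let ?c = "pcost p * Suc Z ^ depth p"
  have x: "x \<notin> nwrites p" "l \<noteq> x" "l \<notin> nwrites p" using For.prems by auto
  have N: "?N \<le> Z" using For.prems by auto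
  have itx: "fst (?it i) x 0 = i" for i by (cases i) auto
  have itf: "fst (?it i) y = fst s y" if "y \<notin> insert x (nwrites p)" for i y
    using that by (intro iter_nat_frame) (auto simp: den_nat_frame)
  have loop: "\<exists>t. exec ?w (?it (?N - k)) t (?it ?N) \<and> t \<le> 6 + k * (?c + 12)" if "k \<le> ?N" for k
    using that
  proof (induction k)
    case 0
    have "\<not> bval ?b (?it ?N)" using itx itf[of l] x by simp
    from exec.WhileFalse[OF this] show ?case by fastforce
  next
    case (Suc k)
    let ?j = "?N - Suc k"
    have j: "?N - k = Suc ?j" "?j < ?N" using Suc by auto
    have b: "bval ?b (?it ?j)" using itx itf[of l] x j by simp
    have "\<forall>l\<in>limits p. l \<notin> nwrites p \<and> fst (?it ?j) l 0 \<le> Z"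
      using For.prems itf by auto
    then obtain t where t: "exec (compile p) (?it ?j) t (den p (?it ?j))" "t \<le> ?c"
      using For.IH[of "?it ?j"] For.prems by auto
    have "nval (NAdd (var x) (NLit 1)) (den p (?it ?j)) = Suc ?j"
      using x(1) itx by (simp add: den_nat_frame)
    then have i: "exec ?i (den p (?it ?j)) 6 (?it (?N - k))"
      using exec.NSet[of x "NLit 0" "NAdd (var x) (NLit 1)" "den p (?it ?j)"] j
      by (simp add: numeral_eq_Suc)
    obtain u where u: "exec ?w (?it (?N - k)) u (?it ?N)" "u \<le> 6 + k * (?c + 12)"
      using Suc by auto
    show ?case
      using exec.WhileTrue[OF b exec.Seq[OF t(1) i] u(1)] t(2) u(2)
      by (intro exI[of _ "1 + bcost ?b + (t + 6) + u"]) auto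
  qed
  have c: "1 + ncost (NLit 0) + ncost (NLit 0) = 3" by simp
  have init: "exec (NSet x (NLit 0) (NLit 0)) s 3 (?it 0)"
    using exec.NSet[of x "NLit 0" "NLit 0" s] by (simp only: c nval.simps iter.simps)
  obtain t where t: "exec ?w (?it 0) t (?it ?N)" "t \<le> 6 + ?N * (?c + 12)"
    using loop[of ?N] by auto
  have "3 + t \<le> 9 + Z * (?c + 12)" using t(2) mult_le_mono1[OF N, of "?c + 12"] by linarith
  also have "\<dots> \<le> (21 + pcost p) * Suc Z ^ Suc (depth p)"
  proof -
    have "1 \<le> Suc Z ^ depth p" by simp
    then have "Suc Z * 1 \<le> Suc Z ^ Suc (depth p)" by (metis mult_le_mono2 power_Suc)
    moreover have "?c * Z \<le> pcost p * Suc Z ^ Suc (depth p)"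
    proof -
      have "Suc Z ^ depth p * Z \<le> Suc Z ^ Suc (depth p)" by (simp add: mult.commute)
      then show ?thesis by (metis mult.assoc mult_le_mono2)
    qed
    ultimately show ?thesis by (simp add: algebra_simps)
  qed
  finally show ?case
    using exec.Seq[OF init t(1)] by (auto simp: den.simps)
qed

section \<open>The covering search\<close>

locale cover_search =
  fixes soft :: bool and n N m top :: nat and ok :: "nat \<Rightarrow> nat \<Rightarrow> bool"
    and tau slots stg item :: "nat \<Rightarrow> nat"
begin

text \<open>
  A state \<open>y\<close> of the search counts in \<open>y v\<close>, for \<open>v \<le> n\<close>, the obligations of value \<open>v\<close> that still
  have to be met by an item of size at least \<open>v\<close>. The cells above \<open>n\<close> hold the stage, the number of
  bins passed in this stage, the demand of the last of these not yet turned into obligations, the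
  number of obligations it may still create, and the number of items used. The moves are: create an
  obligation, go to the next bin, meet an obligation with the next item, split an obligation (soft
  capacities only), go to the next stage.
\<close>

definition legal :: "nat \<Rightarrow> nat \<Rightarrow> nat \<Rightarrow> nat \<Rightarrow> (nat \<Rightarrow> nat) \<Rightarrow> bool" where
  "legal k v w w' y \<longleftrightarrow>
     (if k = 0 then 0 < v \<and> 0 < y (n + 4)
      else if k = 1 then y (n + 2) < m \<and> y (n + 3) = 0
      else if k = 2 then 0 < y v \<and> y (n + 5) < N \<and> v \<le> item (y (n + 5))
      else if k = 3 then soft \<and> 0 < y v \<and> 0 < w \<and> w < v \<and> 0 < w' \<and> w' < v \<and> v \<le> w + w'
      else 0 < y (n + 1) \<and> y (n + 2) = m \<and> y (n + 3) = 0)"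

definition next_state :: "nat \<Rightarrow> nat \<Rightarrow> nat \<Rightarrow> nat \<Rightarrow> (nat \<Rightarrow> nat) \<Rightarrow> nat \<Rightarrow> nat" where
  "next_state k v w w' y =
     (if k = 0 then y(v := Suc (y v), n + 3 := y (n + 3) - v,
        n + 4 := y (n + 4) - (if soft then 0 else 1))
      else if k = 1 then y(n + 2 := Suc (y (n + 2)),
        n + 3 := if stg (y (n + 2)) = y (n + 1) then tau (y (n + 2)) else 0,
        n + 4 := if stg (y (n + 2)) = y (n + 1) then slots (y (n + 2)) else 0)
      else if k = 2 then y(v := y v - 1, n + 5 := Suc (y (n + 5)))
      else if k = 3 then
        let y1 = y(v := y v - 1); y2 = y1(w := Suc (y1 w)) in y2(w' := Suc (y2 w'))
      else y(n + 1 := y (n + 1) - 1, n + 2 := 0, n + 4 := 0))"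

definition admissible :: "(nat \<Rightarrow> nat) \<Rightarrow> bool" where
  "admissible y \<longleftrightarrow> (\<forall>v \<le> n. 0 < y v \<longrightarrow> ok (y (n + 1)) v \<and> y v \<le> n)"

definition step :: "(nat \<Rightarrow> nat) \<Rightarrow> (nat \<Rightarrow> nat) \<Rightarrow> bool" where
  "step y y' \<longleftrightarrow> (\<exists>k<5. \<exists>v\<le>n. \<exists>w\<le>n. \<exists>w'\<le>n.
     legal k v w w' y \<and> y' = next_state k v w w' y \<and> admissible y')"

definition start :: "nat \<Rightarrow> nat" where
  "start = (\<lambda>_. 0)(n + 1 := top)"

definition final :: "(nat \<Rightarrow> nat) \<Rightarrow> bool" where
  "final y \<longleftrightarrow> y (n + 1) = 0 \<and> y (n + 2) = m \<and> y (n + 3) = 0 \<and> (\<forall>v \<le> n. y v = 0)"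

definition space :: "(nat \<Rightarrow> nat) set" where
  "space = {y. y (n + 1) \<le> top \<and> y (n + 2) \<le> m \<and> y (n + 3) \<le> n \<and> y (n + 4) \<le> n \<and> y (n + 5) \<le> N
     \<and> admissible y \<and> (\<forall>l \<ge> n + 6. y l = 0)}"

definition state_bound :: nat where
  "state_bound = (\<Sum>j\<le>top. Suc n ^ card {v. v \<le> n \<and> ok j v}) * (Suc m * Suc n * Suc n * Suc N)"

lemma start_space: "start \<in> space"
  by (auto simp: start_def space_def admissible_def)

lemma step_space:
  assumes "step y y'" "y \<in> space" "\<And>b. b < m \<Longrightarrow> tau b \<le> n \<and> slots b \<le> n"
  shows "y' \<in> space"
proof -
  obtain k v w w' where *: "k < 5" "v \<le> n" "w \<le> n" "w' \<le> n" "legal k v w w' y"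
    "y' = next_state k v w w' y" "admissible y'"
    using assms(1) unfolding step_def by blast
  have l: "k = 1 \<Longrightarrow> y (n + 2) < m" "k = 2 \<Longrightarrow> y (n + 5) < N" using *(5) by (simp_all add: legal_def)
  from * consider "k = 0" | "k = 1" | "k = 2" | "k = 3" | "k = 4" by linarith
  then show ?thesis
    using *(1-4,6,7) l assms(2) assms(3)[of "y (n + 2)"] unfolding space_def
    by cases (auto simp: next_state_def legal_def Let_def)
qed

lemma space_card: "finite space \<and> card space \<le> state_bound"
proof -
  define A where "A = (\<lambda>j l. if l \<le> n then (if ok j l then {..n} else {0}) else if l = n + 1 then {j}
    else if l = n + 2 then {..m} else if l = n + 3 then {..n} else if l = n + 4 then {..n}
    else {..N})"
  define S where "S = (\<lambda>j. {y. (\<forall>l<n + 6. y l \<in> A j l) \<and> (\<forall>l\<ge>n + 6. y l = 0)})"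
  have card_S: "finite (S j) \<and> card (S j) \<le> Suc n ^ card {v. v \<le> n \<and> ok j v} * (Suc m * Suc n * Suc n * Suc N)"
    for j
  proof -
    have inj: "inj_on (\<lambda>y. restrict y {..<n + 6}) (S j)"
    proof (rule inj_onI)
      fix x y assume x: "x \<in> S j" "y \<in> S j" and e: "restrict x {..<n + 6} = restrict y {..<n + 6}"
      show "x = y"
      proof
        fix l show "x l = y l"
          using x fun_cong[OF e, of l] by (cases "l < n + 6") (auto simp: S_def)
      qed
    qed
    have sub: "(\<lambda>y. restrict y {..<n + 6}) ` S j \<subseteq> PiE {..<n + 6} (A j)"
      using restrict_PiE_iff[of _ "{..<n + 6}" "A j"] by (force simp: S_def)
    have fin: "finite (PiE {..<n + 6} (A j))"
      by (rule finite_PiE) (auto simp: A_def)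
    have split: "{..<n + 6} = {..n} \<union> {n + 1, n + 2, n + 3, n + 4, n + 5}" by auto
    have "card (PiE {..<n + 6} (A j)) = (\<Prod>l<n + 6. card (A j l))"
      by (rule card_PiE) simp
    also have "\<dots> = (\<Prod>l\<le>n. card (A j l)) * (\<Prod>l\<in>{n + 1, n + 2, n + 3, n + 4, n + 5}. card (A j l))"
      unfolding split by (rule prod.union_disjoint) auto
    also have "(\<Prod>l\<in>{n + 1, n + 2, n + 3, n + 4, n + 5}. card (A j l)) = Suc m * Suc n * Suc n * Suc N"
      by (simp add: A_def algebra_simps)
    also have "(\<Prod>l\<le>n. card (A j l)) = (\<Prod>l\<le>n. if ok j l then Suc n else 1)"
      by (rule prod.cong) (auto simp: A_def)
    also have "\<dots> = Suc n ^ card {v. v \<le> n \<and> ok j v}"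
      by (simp add: prod.If_cases Int_def)
    finally have c: "card (PiE {..<n + 6} (A j)) =
      Suc n ^ card {v. v \<le> n \<and> ok j v} * (Suc m * Suc n * Suc n * Suc N)" .
    have "finite (S j)"
      using finite_imageD[OF finite_subset[OF sub fin] inj] .
    moreover have "card (S j) \<le> card (PiE {..<n + 6} (A j))"
      by (rule card_inj_on_le[OF inj sub fin])
    ultimately show ?thesis using c by simp
  qed
  have sub: "space \<subseteq> (\<Union>j\<le>top. S j)"
  proof
    fix y assume y: "y \<in> space"
    have "y l \<in> A (y (n + 1)) l" if "l < n + 6" for l
    proof -
      have "l \<le> n \<or> l = n + 1 \<or> l = n + 2 \<or> l = n + 3 \<or> l = n + 4 \<or> l = n + 5"
        using that by presburger
      then show ?thesis using y by (elim disjE) (auto simp: space_def admissible_def A_def)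
    qed
    then show "y \<in> (\<Union>j\<le>top. S j)" using y by (auto simp: S_def space_def)
  qed
  have fin: "finite (\<Union>j\<le>top. S j)" using card_S by auto
  have "card space \<le> card (\<Union>j\<le>top. S j)" by (rule card_mono[OF fin sub])
  also have "\<dots> \<le> (\<Sum>j\<le>top. card (S j))" by (rule card_UN_le) simp
  also have "\<dots> \<le> (\<Sum>j\<le>top. Suc n ^ card {v. v \<le> n \<and> ok j v} * (Suc m * Suc n * Suc n * Suc N))"
    by (rule sum_mono) (use card_S in blast)
  finally show ?thesis using finite_subset[OF sub fin] by (simp only: state_bound_def sum_distrib_right)
qed

subsection \<open>Soundness\<close>

definition owed :: "(nat \<Rightarrow> nat) \<Rightarrow> nat \<Rightarrow> (nat \<Rightarrow> nat) \<Rightarrow> (nat \<Rightarrow> nat \<Rightarrow> nat) \<Rightarrow> nat" where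
  "owed h b y own = (\<Sum>v\<le>n. \<Sum>i<y v. if own v i = b then h v else 0)"

lemma owed_cong:
  "(\<And>v. v \<le> n \<Longrightarrow> y' v = y v) \<Longrightarrow> (\<And>v i. v \<le> n \<Longrightarrow> i < y v \<Longrightarrow> own' v i = own v i) \<Longrightarrow>
   owed h b y' own' = owed h b y own"
  unfolding owed_def by (intro sum.cong) auto

lemma owed_push:
  assumes "v \<le> n"
  shows "owed h b (y(v := Suc (y v))) (own(v := (own v)(y v := o'))) =
    owed h b y own + (if o' = b then h v else 0)"
proof -
  have "owed h b (y(v := Suc (y v))) (own(v := (own v)(y v := o'))) =
    (\<Sum>u\<le>n. (\<Sum>i<y u. if own u i = b then h u else 0) + (if u = v \<and> o' = b then h v else 0))"
    unfolding owed_def by (rule sum.cong) (auto intro!: sum.cong)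
  also have "\<dots> = owed h b y own + (\<Sum>u\<le>n. if u = v \<and> o' = b then h v else 0)"
    unfolding owed_def by (simp add: sum.distrib)
  also have "(\<Sum>u\<le>n. if u = v \<and> o' = b then h v else 0) = (if o' = b then h v else 0)"
    using assms by (cases "o' = b") (auto simp: sum.delta)
  finally show ?thesis .
qed

lemma owed_pop:
  assumes "v \<le> n" "0 < y v"
  shows "owed h b y own =
    owed h b (y(v := y v - 1)) own + (if own v (y v - 1) = b then h v else 0)"
proof -
  let ?y = "y(v := y v - 1)"
  have "owed h b (?y(v := Suc (?y v))) (own(v := (own v)(?y v := own v (y v - 1)))) =
    owed h b ?y own + (if own v (y v - 1) = b then h v else 0)"
    by (rule owed_push) fact
  then show ?thesis using assms by simp
qed

lemma push_bounded:
  assumes "\<forall>u\<le>n. \<forall>i<y u. own u i < m" "o' < m"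
  shows "\<forall>u\<le>n. \<forall>i<(y(v := Suc (y v))) u. (own(v := (own v)(y v := o'))) u i < m"
  using assms by (auto simp: less_Suc_eq)

definition entered :: "(nat \<Rightarrow> nat) \<Rightarrow> nat \<Rightarrow> bool" where
  "entered y b \<longleftrightarrow> y (n + 1) < stg b \<or> y (n + 1) = stg b \<and> b < y (n + 2)"

definition current :: "(nat \<Rightarrow> nat) \<Rightarrow> nat \<Rightarrow> bool" where
  "current y b \<longleftrightarrow> stg b = y (n + 1) \<and> y (n + 2) = Suc b"

definition weight :: "(nat \<Rightarrow> nat) \<Rightarrow> (nat \<Rightarrow> nat \<Rightarrow> nat) \<Rightarrow> (nat \<Rightarrow> nat) \<Rightarrow> nat \<Rightarrow> nat" where
  "weight y own asg b = owed (\<lambda>v. v) b y own + (\<Sum>t<y (n + 5). if asg t = b then item t else 0)"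

definition number :: "(nat \<Rightarrow> nat) \<Rightarrow> (nat \<Rightarrow> nat \<Rightarrow> nat) \<Rightarrow> (nat \<Rightarrow> nat) \<Rightarrow> nat \<Rightarrow> nat" where
  "number y own asg b = owed (\<lambda>v. 1) b y own + (\<Sum>t<y (n + 5). if asg t = b then 1 else 0)"

definition consistent :: "(nat \<Rightarrow> nat) \<Rightarrow> (nat \<Rightarrow> nat \<Rightarrow> nat) \<Rightarrow> (nat \<Rightarrow> nat) \<Rightarrow> bool" where
  "consistent y own asg \<longleftrightarrow>
     y (n + 2) \<le> m \<and>
     (0 < y (n + 4) \<longrightarrow> 0 < y (n + 2) \<and> current y (y (n + 2) - 1)) \<and>
     (\<forall>v\<le>n. \<forall>i<y v. own v i < m) \<and> (\<forall>t<y (n + 5). asg t < m) \<and>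
     (\<forall>b<m.
       (entered y b \<longrightarrow> tau b \<le> weight y own asg b + (if current y b then y (n + 3) else 0)) \<and>
       (\<not> entered y b \<longrightarrow> number y own asg b = 0) \<and>
       (if soft then (0 < number y own asg b \<or> current y b \<and> 0 < y (n + 4) \<longrightarrow> 0 < slots b)
        else number y own asg b + (if current y b then y (n + 4) else 0) \<le> slots b))"

lemma consistent_cong:
  assumes "consistent y own asg" "\<And>v i. v \<le> n \<Longrightarrow> i < y v \<Longrightarrow> own' v i = own v i"
    "\<And>t. t < y (n + 5) \<Longrightarrow> asg' t = asg t"
  shows "consistent y own' asg'"
proof -
  have "owed h b y own' = owed h b y own" for h b
    by (rule owed_cong) (use assms(2) in auto)
  then have "weight y own' asg' = weight y own asg" "number y own' asg' = number y own asg"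
    using assms(3) by (auto simp: weight_def number_def intro!: ext sum.cong)
  then show ?thesis using assms unfolding consistent_def by auto
qed

definition own_update ::
  "nat \<Rightarrow> nat \<Rightarrow> nat \<Rightarrow> nat \<Rightarrow> (nat \<Rightarrow> nat) \<Rightarrow> (nat \<Rightarrow> nat \<Rightarrow> nat) \<Rightarrow> nat \<Rightarrow> nat \<Rightarrow> nat" where
  "own_update k v w w' y own =
     (if k = 0 then own(v := (own v)(y v := y (n + 2) - 1))
      else if k = 3 then
        let o' = own v (y v - 1); own1 = own(w := (own w)(y w := o'));
            j = (if w = w' then Suc (y w) else y w')
        in own1(w' := (own1 w')(j := o'))
      else own)"

definition asg_update ::
  "nat \<Rightarrow> nat \<Rightarrow> (nat \<Rightarrow> nat) \<Rightarrow> (nat \<Rightarrow> nat \<Rightarrow> nat) \<Rightarrow> (nat \<Rightarrow> nat) \<Rightarrow> nat \<Rightarrow> nat" where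
  "asg_update k v y own asg =
     (if k = 2 then asg(y (n + 5) := own v (y v - 1)) else asg)"

lemma consistent_start: "(\<And>b. b < m \<Longrightarrow> stg b \<le> top) \<Longrightarrow> consistent start own asg"
  by (auto simp: consistent_def start_def entered_def current_def number_def owed_def dest: leD)

lemma consistent_step:
  assumes c: "consistent y own asg" and v: "v \<le> n" "w \<le> n" "w' \<le> n" and k: "k < 5"
    and l: "legal k v w w' y"
  shows "consistent (next_state k v w w' y) (own_update k v w w' y own) (asg_update k v y own asg)"
proof -
  let ?y = "next_state k v w w' y" and ?own = "own_update k v w w' y own" and ?asg = "asg_update k v y own asg"
  have c_ptr: "y (n + 2) \<le> m" and c_free: "0 < y (n + 4) \<Longrightarrow> 0 < y (n + 2)"
    "0 < y (n + 4) \<Longrightarrow> current y (y (n + 2) - 1)"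
    and c_own: "\<And>u i. u \<le> n \<Longrightarrow> i < y u \<Longrightarrow> own u i < m"
    and c_asg: "\<And>t. t < y (n + 5) \<Longrightarrow> asg t < m"
    and c_tau: "\<And>b. b < m \<Longrightarrow> entered y b \<Longrightarrow>
      tau b \<le> weight y own asg b + (if current y b then y (n + 3) else 0)"
    and c_zero: "\<And>b. b < m \<Longrightarrow> \<not> entered y b \<Longrightarrow> number y own asg b = 0"
    and c_slots: "\<And>b. b < m \<Longrightarrow>
      if soft then (0 < number y own asg b \<or> current y b \<and> 0 < y (n + 4) \<longrightarrow> 0 < slots b)
      else number y own asg b + (if current y b then y (n + 4) else 0) \<le> slots b"
    using c unfolding consistent_def by blast+
  note cs = c_ptr c_free c_own c_asg c_tau c_zero c_slots
  from k consider "k = 0" | "k = 1" | "k = 2" | "k = 3" | "k = 4" by linarith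
  then show ?thesis
  proof cases
    case 1
    let ?b = "y (n + 2) - 1"
    have l': "0 < v" "0 < y (n + 4)" using l 1 by (auto simp: legal_def)
    then have b: "0 < y (n + 2)" "current y ?b" "?b < m" using c_free c_ptr by auto
    have ow: "owed h b ?y ?own = owed h b y own + (if b = ?b then h v else 0)" for h b
    proof -
      have "owed h b ?y ?own = owed h b (y(v := Suc (y v))) (own(v := (own v)(y v := ?b)))"
        by (rule owed_cong) (use 1 v(1) in \<open>auto simp: next_state_def own_update_def\<close>)
      then show ?thesis using owed_push[OF v(1), of h b y own ?b] by auto
    qed
    have W: "weight ?y ?own ?asg b = weight y own asg b + (if b = ?b then v else 0)"
      "number ?y ?own ?asg b = number y own asg b + (if b = ?b then 1 else 0)" for b
      unfolding weight_def number_def ow using 1 v(1) by (auto simp: next_state_def asg_update_def)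
    have E: "entered ?y b = entered y b" "current ?y b = current y b" "current y b \<longleftrightarrow> b = ?b" if "b < m" for b
      using 1 v(1) b by (auto simp: entered_def current_def next_state_def)
    have "entered y ?b" using b by (auto simp: entered_def current_def)
    have R: "?y (n + 2) = y (n + 2)" "?y (n + 3) = y (n + 3) - v"
      "?y (n + 4) = y (n + 4) - (if soft then 0 else 1)" "?y (n + 5) = y (n + 5)" "?asg = asg"
      using 1 v(1) by (auto simp: next_state_def asg_update_def)
    show ?thesis unfolding consistent_def E W unfolding R
    proof (intro conjI allI impI)
      show "?own u i < m" if "u \<le> n" "i < ?y u" for u i
        using c_own b(3) that 1 by (auto simp: own_update_def next_state_def less_Suc_eq split: if_splits)
      show "current ?y (y (n + 2) - 1)" using b E by blast
    next
      fix b assume "b < m" "entered ?y b"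
      then have "tau b \<le> weight y own asg b + (if current y b then y (n + 3) else 0)"
        using c_tau E by auto
      then show "tau b \<le> weight y own asg b + (if b = ?b then v else 0) + (if current ?y b then y (n + 3) - v else 0)"
        using E[OF \<open>b < m\<close>] by (auto split: if_splits)
    next
      fix b assume "b < m" "\<not> entered ?y b"
      then show "number y own asg b + (if b = ?b then 1 else 0) = 0"
        using c_zero E[of b] \<open>entered y ?b\<close> by auto
    next
      fix b assume "b < m"
      then have "if soft then (0 < number y own asg b \<or> current y b \<and> 0 < y (n + 4) \<longrightarrow> 0 < slots b)
        else number y own asg b + (if current y b then y (n + 4) else 0) \<le> slots b"
        using c_slots by blast
      then show "if soft then 0 < number y own asg b + (if b = ?b then 1 else 0) \<or>
          current ?y b \<and> 0 < y (n + 4) - (if soft then 0 else 1) \<longrightarrow> 0 < slots b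
        else number y own asg b + (if b = ?b then 1 else 0) +
          (if current ?y b then y (n + 4) - (if soft then 0 else 1) else 0) \<le> slots b"
        using E[OF \<open>b < m\<close>] l'(2) by (auto split: if_splits)
    qed (use cs b R in auto)
  next
    case 2
    let ?i = "y (n + 2)"
    have l': "?i < m" "y (n + 3) = 0" using l 2 by (auto simp: legal_def)
    have ow: "owed h b ?y ?own = owed h b y own" for h b
      using 2 by (intro owed_cong) (auto simp: next_state_def own_update_def)
    have W: "weight ?y ?own ?asg b = weight y own asg b"
      "number ?y ?own ?asg b = number y own asg b" for b
      unfolding weight_def number_def ow using 2 by (auto simp: next_state_def asg_update_def)
    have E: "entered ?y b \<longleftrightarrow> entered y b \<or> (b = ?i \<and> stg b = y (n + 1))"
      "current ?y b \<longleftrightarrow> (b = ?i \<and> stg b = y (n + 1))" for b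
      using 2 by (auto simp: entered_def current_def next_state_def)
    have E': "current ?y b \<Longrightarrow> \<not> entered y b" for b
      using E by (auto simp: entered_def)
    have R: "?y (n + 2) = Suc ?i" "?y (n + 5) = y (n + 5)" "?own = own" "?asg = asg"
      "?y (n + 3) = (if stg ?i = y (n + 1) then tau ?i else 0)"
      "?y (n + 4) = (if stg ?i = y (n + 1) then slots ?i else 0)" "\<And>v. v \<le> n \<Longrightarrow> ?y v = y v"
      using 2 by (auto simp: next_state_def own_update_def asg_update_def)
    show ?thesis unfolding consistent_def W E(1)
    proof (intro conjI allI impI)
      show "?y (n + 2) \<le> m" using R l' by simp
      show "0 < ?y (n + 2)" if "0 < ?y (n + 4)" using R by simp
      show "current ?y (?y (n + 2) - 1)" if "0 < ?y (n + 4)" using R E that by (auto split: if_splits)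
      show "?own v i < m" if "v \<le> n" "i < ?y v" for v i using cs R that by auto
      show "?asg t < m" if "t < ?y (n + 5)" for t using cs R that by auto
    next
      fix b assume "b < m" "entered y b \<or> b = ?i \<and> stg b = y (n + 1)"
      then show "tau b \<le> weight y own asg b + (if current ?y b then ?y (n + 3) else 0)"
        using c_tau[of b] l' R E[of b] by (auto split: if_splits)
    next
      fix b assume "b < m" "\<not> (entered y b \<or> b = ?i \<and> stg b = y (n + 1))"
      then show "number y own asg b = 0" using c_zero by blast
    next
      fix b assume b: "b < m"
      then show "if soft then 0 < number y own asg b \<or> current ?y b \<and> 0 < ?y (n + 4) \<longrightarrow> 0 < slots b
        else number y own asg b + (if current ?y b then ?y (n + 4) else 0) \<le> slots b"
      proof (cases "current ?y b")
        case True
        then have *: "\<not> entered y b" "b = ?i" "stg ?i = y (n + 1)" using E E' by auto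
        have "number y own asg b = 0" using c_zero b *(1) by blast
        moreover have "?y (n + 4) = slots b" using R(6) *(2,3) by simp
        ultimately show ?thesis by (cases soft) simp_all
      next
        case False
        then show ?thesis using c_slots[OF b] by (cases soft) (simp_all split: if_splits)
      qed
    qed
  next
    case 3
    let ?t = "y (n + 5)" and ?o = "own v (y v - 1)"
    have l': "0 < y v" "?t < N" "v \<le> item ?t" using l 3 by (auto simp: legal_def)
    have om: "?o < m" using c_own v(1) l'(1) by auto
    have ow: "owed h b y own = owed h b ?y ?own + (if ?o = b then h v else 0)" for h b
      using owed_pop[of v y, OF v(1) l'(1), of h b own] owed_cong[of ?y "y(v := y v - 1)" own own h b] 3 v(1)
      by (auto simp: next_state_def own_update_def)
    have R: "?y (n + 5) = Suc ?t" "?y (n + 1) = y (n + 1)" "?y (n + 2) = y (n + 2)" "?y (n + 3) = y (n + 3)"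
      "?y (n + 4) = y (n + 4)" "?own = own" "?asg = asg(?t := ?o)"
      "\<And>u. u \<le> n \<Longrightarrow> ?y u \<le> y u"
      using 3 v(1) by (auto simp: next_state_def own_update_def asg_update_def)
    have W: "weight y own asg b \<le> weight ?y ?own ?asg b" "number ?y ?own ?asg b = number y own asg b" for b
      unfolding weight_def number_def ow R using l'(3) by auto
    have E: "entered ?y b = entered y b" "current ?y b = current y b" for b
      using R by (auto simp: entered_def current_def)
    show ?thesis unfolding consistent_def E W R(2-5)
    proof (intro conjI allI impI)
      show "?own u i < m" if "u \<le> n" "i < ?y u" for u i
        using c_own[OF that(1)] R(6) R(8)[OF that(1)] that by auto
      show "?asg t < m" if "t < ?y (n + 5)" for t
        using c_asg R om that by (auto simp: less_Suc_eq)
      show "tau b \<le> weight ?y ?own ?asg b + (if current y b then y (n + 3) else 0)"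
        if "b < m" "entered y b" for b
        using c_tau[OF that] W(1)[of b] by linarith
    qed (use cs in auto)
  next
    case 4
    let ?o = "own v (y v - 1)"
    have l': "soft" "0 < y v" "0 < w" "w < v" "0 < w'" "w' < v" "v \<le> w + w'"
      using l 4 by (auto simp: legal_def)
    have om: "?o < m" using c_own v(1) l'(2) by auto
    let ?y1 = "y(v := y v - 1)"
    let ?own1 = "own(w := (own w)(?y1 w := ?o))" and ?y2 = "?y1(w := Suc (?y1 w))"
    let ?own2 = "?own1(w' := (?own1 w')(?y2 w' := ?o))" and ?y3 = "?y2(w' := Suc (?y2 w'))"
    have Y: "?y = ?y3" "?own = ?own2" "?asg = asg"
      unfolding next_state_def own_update_def asg_update_def Let_def using 4 l'(2-) by auto
    have ow: "owed h b ?y ?own + (if ?o = b then h v else 0) =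
      owed h b y own + (if ?o = b then h w + h w' else 0)" for h b
    proof -
      have "owed h b ?y3 ?own2 = owed h b ?y2 ?own1 + (if ?o = b then h w' else 0)"
        by (rule owed_push) fact
      also have "owed h b ?y2 ?own1 = owed h b ?y1 own + (if ?o = b then h w else 0)"
        by (rule owed_push) fact
      finally have F: "owed h b ?y3 ?own2 =
        owed h b ?y1 own + (if ?o = b then h w else 0) + (if ?o = b then h w' else 0)" .
      show ?thesis
        unfolding Y(1,2) F owed_pop[of v y, OF v(1) l'(2), of h b own] by simp
    qed
    have R: "?y (n + 1) = y (n + 1)" "?y (n + 2) = y (n + 2)" "?y (n + 3) = y (n + 3)"
      "?y (n + 4) = y (n + 4)" "?y (n + 5) = y (n + 5)"
      using v unfolding Y by auto
    have W: "weight y own asg b \<le> weight ?y ?own ?asg b" for b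
      using ow[of "\<lambda>v. v" b] l'(7) unfolding weight_def R Y(3) by (auto split: if_splits)
    have Nb: "number ?y ?own ?asg b = number y own asg b + (if ?o = b then 1 else 0)" for b
      using ow[of "\<lambda>v. 1" b] unfolding number_def R Y(3) by (auto split: if_splits)
    have No: "0 < number y own asg ?o"
      using owed_pop[of v y, OF v(1) l'(2), of "\<lambda>v. 1" ?o own] by (simp add: number_def)
    have E: "entered ?y b = entered y b" "current ?y b = current y b" for b
      using R by (auto simp: entered_def current_def)
    have En: "entered y ?o" using c_zero om No by fastforce
    show ?thesis unfolding consistent_def E Nb R
    proof (intro conjI allI impI)
      show "?own u i < m" if "u \<le> n" "i < ?y u" for u i
      proof -
        have "\<forall>u\<le>n. \<forall>i<?y1 u. own u i < m" using c_own by auto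
        from push_bounded[OF push_bounded[OF this om] om, of w w'] that show ?thesis unfolding Y by blast
      qed
      show "?asg t < m" if "t < y (n + 5)" for t
        using c_asg that unfolding Y by auto
      show "tau b \<le> weight ?y ?own ?asg b + (if current y b then y (n + 3) else 0)"
        if "b < m" "entered y b" for b
        using c_tau[OF that] W[of b] by linarith
      show "number y own asg b + (if ?o = b then 1 else 0) = 0" if "b < m" "\<not> entered y b" for b
        using c_zero that En by auto
      show "if soft then 0 < number y own asg b + (if ?o = b then 1 else 0) \<or> current y b \<and> 0 < y (n + 4) \<longrightarrow> 0 < slots b
        else number y own asg b + (if ?o = b then 1 else 0) + (if current y b then y (n + 4) else 0) \<le> slots b"
        if "b < m" for b
        using c_slots[OF that] No l'(1) by (cases "?o = b") simp_all
    qed (use cs in auto)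
  next
    case 5
    have l': "0 < y (n + 1)" "y (n + 2) = m" "y (n + 3) = 0" using l 5 by (auto simp: legal_def)
    have ow: "owed h b ?y ?own = owed h b y own" for h b
      using 5 by (intro owed_cong) (auto simp: next_state_def own_update_def)
    have W: "weight ?y ?own ?asg b = weight y own asg b"
      "number ?y ?own ?asg b = number y own asg b" for b
      unfolding weight_def number_def ow using 5 by (auto simp: next_state_def asg_update_def)
    have E: "entered ?y b \<longleftrightarrow> entered y b" "\<not> current ?y b" if "b < m" for b
      using 5 l' that by (auto simp: entered_def current_def next_state_def)
    have R: "?y (n + 2) = 0" "?y (n + 5) = y (n + 5)" "?own = own" "?asg = asg"
      "?y (n + 4) = 0" "\<And>v. v \<le> n \<Longrightarrow> ?y v = y v"
      using 5 by (auto simp: next_state_def own_update_def asg_update_def)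
    show ?thesis unfolding consistent_def W
    proof (intro conjI allI impI)
      show "?y (n + 2) \<le> m" using R(1) by simp
      show "0 < ?y (n + 2)" "current ?y (?y (n + 2) - 1)" if "0 < ?y (n + 4)" using R(5) that by auto
      show "?own v i < m" if "v \<le> n" "i < ?y v" for v i using c_own R(3,6) that by auto
      show "?asg t < m" if "t < ?y (n + 5)" for t using c_asg R(2,4) that by auto
    next
      fix b assume b: "b < m" and "entered ?y b"
      then show "tau b \<le> weight y own asg b + (if current ?y b then ?y (n + 3) else 0)"
        using c_tau[OF b] E[OF b] l'(3) by (simp split: if_splits)
    next
      fix b assume "b < m" "\<not> entered ?y b"
      then show "number y own asg b = 0" using c_zero E by blast
    next
      fix b assume b: "b < m"
      show "if soft then 0 < number y own asg b \<or> current ?y b \<and> 0 < ?y (n + 4) \<longrightarrow> 0 < slots b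
        else number y own asg b + (if current ?y b then ?y (n + 4) else 0) \<le> slots b"
        using c_slots[OF b] R(5) by (cases soft) simp_all
    qed
  qed
qed

lemma consistent_final:
  assumes "consistent y own asg" "final y" "b < m"
  shows "tau b \<le> (\<Sum>t<y (n + 5). if asg t = b then item t else 0)"
    "\<And>t. t < y (n + 5) \<Longrightarrow> asg t < m"
    "soft \<Longrightarrow> 0 < tau b \<Longrightarrow> 0 < slots b"
    "\<not> soft \<Longrightarrow> card {t. t < y (n + 5) \<and> asg t = b} \<le> slots b"
proof -
  have o0: "owed h b y own = 0" for h using assms(2) by (simp add: owed_def final_def)
  have e: "entered y b" using assms(2,3) by (auto simp: entered_def final_def)
  show tau: "tau b \<le> (\<Sum>t<y (n + 5). if asg t = b then item t else 0)"
  proof -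
    have "tau b \<le> weight y own asg b + (if current y b then y (n + 3) else 0)"
      using assms(1,3) e unfolding consistent_def by blast
    then show ?thesis using assms(2) o0 by (simp add: weight_def final_def split: if_splits)
  qed
  show "\<And>t. t < y (n + 5) \<Longrightarrow> asg t < m" using assms(1) unfolding consistent_def by blast
  have sl: "if soft then (0 < number y own asg b \<or> current y b \<and> 0 < y (n + 4) \<longrightarrow> 0 < slots b)
    else number y own asg b + (if current y b then y (n + 4) else 0) \<le> slots b"
    using assms(1,3) unfolding consistent_def by blast
  have num: "number y own asg b = card {t. t < y (n + 5) \<and> asg t = b}"
  proof -
    have "(\<Sum>t<y (n + 5). if asg t = b then 1 else 0) = card ({..<y (n + 5)} \<inter> {t. asg t = b})"
      by (simp add: sum.If_cases)
    also have "{..<y (n + 5)} \<inter> {t. asg t = b} = {t. t < y (n + 5) \<and> asg t = b}" by auto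
    finally show ?thesis by (simp add: number_def o0)
  qed
  show "0 < slots b" if "soft" "0 < tau b"
  proof -
    have "(\<Sum>t<y (n + 5). if asg t = b then item t else 0) \<noteq> 0" using tau that by linarith
    then obtain t where "t < y (n + 5)" "asg t = b" by (auto split: if_splits)
    then have "0 < number y own asg b" unfolding num by (auto simp: card_gt_0_iff)
    then show ?thesis using sl that by simp
  qed
  show "card {t. t < y (n + 5) \<and> asg t = b} \<le> slots b" if "\<not> soft"
    using sl that unfolding num[symmetric] by simp
qed

end

subsection \<open>Completeness\<close>

datatype tree = Leaf nat | Node tree tree

fun val :: "tree \<Rightarrow> nat" where
  "val (Leaf w) = w"
| "val (Node l r) = val l + val r"

fun leaves :: "tree \<Rightarrow> nat multiset" where
  "leaves (Leaf w) = {#w#}"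
| "leaves (Node l r) = leaves l + leaves r"

lemma sum_leaves: "sum_mset (leaves T) = val T"
  by (induction T) auto

lemma leaves_le_val: "w \<in># leaves T \<Longrightarrow> w \<le> val T"
  by (metis sum_leaves multi_member_split le_add1 sum_mset.add_mset)

lemma leaves_nonempty: "leaves T \<noteq> {#}"
  by (induction T) auto

definition all_leaves :: "(nat \<times> tree) multiset \<Rightarrow> nat multiset" where
  "all_leaves M = (\<Sum>p\<in>#M. leaves (snd p))"

lemma all_leaves_simps [simp]:
  "all_leaves {#} = {#}" "all_leaves (add_mset p M) = leaves (snd p) + all_leaves M"
  "all_leaves (M + M') = all_leaves M + all_leaves M'"
  by (simp_all add: all_leaves_def)

lemma size_le_all_leaves: "size M \<le> size (all_leaves M)"
proof (induction M)
  case (add p M)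
  have "0 < size (leaves (snd p))" using leaves_nonempty by (simp flip: nonempty_has_size)
  with add show ?case by simp
qed simp

context cover_search
begin

definition vec :: "nat \<Rightarrow> nat \<Rightarrow> nat \<Rightarrow> nat \<Rightarrow> nat \<Rightarrow> (nat \<times> tree) multiset \<Rightarrow> nat \<Rightarrow> nat" where
  "vec j i r f t M = (\<lambda>l. if l \<le> n then count (image_mset fst M) l
     else if l = n + 1 then j else if l = n + 2 then i else if l = n + 3 then r
     else if l = n + 4 then f else if l = n + 5 then t else 0)"

lemma vec_regs [simp]:
  "vec j i r f t M (n + 1) = j" "vec j i r f t M (n + 2) = i" "vec j i r f t M (n + 3) = r"
  "vec j i r f t M (n + 4) = f" "vec j i r f t M (n + 5) = t" "vec j i r f t M (Suc n) = j"
  "vec j i r f t M (Suc (Suc n)) = i"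
  by (simp_all add: vec_def)

definition hall :: "nat \<Rightarrow> nat multiset \<Rightarrow> bool" where
  "hall t L \<longleftrightarrow> (\<forall>w\<in>#L. t + size (filter_mset (\<lambda>w'. w \<le> w') L) \<le> card {t'. t' < N \<and> w \<le> item t'})"

end

locale cover_levels = cover_search +
  fixes lev :: "nat \<Rightarrow> nat"
  assumes lev_mono: "v \<le> v' \<Longrightarrow> lev v \<le> lev v'"
    and ok_pos: "ok j v \<Longrightarrow> 0 < v \<and> v \<le> n"
    and ok_down: "ok j v \<Longrightarrow> lev v < j \<Longrightarrow> ok (j - 1) v"
    and ok_lev: "ok j v \<Longrightarrow> lev v \<le> j"
    and item_sorted: "t \<le> t' \<Longrightarrow> t' < N \<Longrightarrow> item t' \<le> item t"
begin

fun wf_tree :: "tree \<Rightarrow> bool" where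
  "wf_tree (Leaf w) \<longleftrightarrow> 0 < w"
| "wf_tree (Node l r) \<longleftrightarrow> wf_tree l \<and> wf_tree r \<and> soft \<and>
     lev (val l) < lev (val l + val r) \<and> lev (val r) < lev (val l + val r) \<and>
     ok (lev (val l + val r)) (val l) \<and> ok (lev (val l + val r)) (val r)"

definition good :: "nat \<Rightarrow> nat \<times> tree \<Rightarrow> bool" where
  "good j p \<longleftrightarrow> ok j (fst p) \<and> fst p \<le> val (snd p) \<and> lev (fst p) = lev (val (snd p)) \<and> wf_tree (snd p)"

lemma good_down: "good j p \<Longrightarrow> lev (fst p) < j \<Longrightarrow> good (j - 1) p"
  using ok_down by (auto simp: good_def)

lemma admissible_vec:
  assumes "\<forall>p\<in>#M. good j p" "size M \<le> n"
  shows "admissible (vec j i r f t M)"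
  unfolding admissible_def
proof (intro allI impI)
  fix v assume v: "v \<le> n" "0 < vec j i r f t M v"
  then have "v \<in># image_mset fst M" by (simp add: vec_def)
  then obtain p where "p \<in># M" "fst p = v" by auto
  then have "ok j v" using assms(1) by (auto simp: good_def)
  moreover have "vec j i r f t M v \<le> size M"
    using v(1) count_le_size[of "image_mset fst M" v] by (simp add: vec_def)
  ultimately show "ok (vec j i r f t M (n + 1)) v \<and> vec j i r f t M v \<le> n"
    using assms(2) by (simp add: vec_def)
qed

lemma stepI:
  assumes "legal k v w w' y" "y' = next_state k v w w' y" "admissible y'" "k < 5" "v \<le> n" "w \<le> n" "w' \<le> n"
  shows "step y y'"
  using assms unfolding step_def by blast

lemma step_emit:
  assumes "good j p" "\<forall>q\<in>#M. good j q" "size M < n" "0 < f"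
  shows "step (vec j i r f t M) (vec j i (r - fst p) (f - (if soft then 0 else 1)) t (add_mset p M))"
proof (rule stepI[of 0 "fst p" 0 0])
  have v: "0 < fst p" "fst p \<le> n" using assms(1) ok_pos by (auto simp: good_def)
  then show "fst p \<le> n" by simp
  show "legal 0 (fst p) 0 0 (vec j i r f t M)" using v assms(4) by (simp add: legal_def)
  show "vec j i (r - fst p) (f - (if soft then 0 else 1)) t (add_mset p M) = next_state 0 (fst p) 0 0 (vec j i r f t M)"
    unfolding next_state_def using v by (auto simp: vec_def fun_eq_iff)
  show "admissible (vec j i (r - fst p) (f - (if soft then 0 else 1)) t (add_mset p M))"
    by (rule admissible_vec) (use assms in auto)
qed simp_all

lemma steps_emit:
  assumes "\<forall>p\<in>#Q. good j p" "\<forall>q\<in>#M. good j q" "size Q + size M \<le> n"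
    "if soft then Q \<noteq> {#} \<longrightarrow> 0 < f else size Q \<le> f"
  shows "\<exists>f'. step\<^sup>*\<^sup>* (vec j i r f t M) (vec j i (r - sum_mset (image_mset fst Q)) f' t (Q + M))"
  using assms
proof (induction Q arbitrary: r f M)
  case empty
  then show ?case by auto
next
  case (add p Q)
  have f: "0 < f" using add.prems(4) by (cases soft) auto
  let ?f = "f - (if soft then 0 else 1)" and ?M = "add_mset p M"
  have 1: "step (vec j i r f t M) (vec j i (r - fst p) ?f t ?M)"
    using add.prems f by (intro step_emit) auto
  have f2: "if soft then Q \<noteq> {#} \<longrightarrow> 0 < ?f else size Q \<le> ?f"
    using add.prems(4) f by (cases soft) auto
  have "\<exists>f'. step\<^sup>*\<^sup>* (vec j i (r - fst p) ?f t ?M)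
      (vec j i (r - fst p - sum_mset (image_mset fst Q)) f' t (Q + ?M))"
    by (rule add.IH[OF _ _ _ f2]) (use add.prems in auto)
  then obtain f' where "step\<^sup>*\<^sup>* (vec j i (r - fst p) ?f t ?M)
      (vec j i (r - fst p - sum_mset (image_mset fst Q)) f' t (Q + ?M))" by blast
  with 1 have "step\<^sup>*\<^sup>* (vec j i r f t M) (vec j i (r - fst p - sum_mset (image_mset fst Q)) f' t (Q + ?M))"
    by (rule converse_rtranclp_into_rtranclp)
  then show ?case by (auto simp: diff_diff_left)
qed

lemma step_enter:
  assumes "i < m" "\<forall>q\<in>#M. good j q" "size M \<le> n"
  shows "step (vec j i 0 f t M) (vec j (Suc i) (if stg i = j then tau i else 0) (if stg i = j then slots i else 0) t M)"
proof (rule stepI[of 1 0 0 0])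
  show "legal 1 0 0 0 (vec j i 0 f t M)" using assms by (simp add: legal_def)
  show "vec j (Suc i) (if stg i = j then tau i else 0) (if stg i = j then slots i else 0) t M =
    next_state 1 0 0 0 (vec j i 0 f t M)"
    unfolding next_state_def by (auto simp: vec_def fun_eq_iff)
  show "admissible (vec j (Suc i) (if stg i = j then tau i else 0) (if stg i = j then slots i else 0) t M)"
    by (rule admissible_vec) (use assms in auto)
qed simp_all

lemma step_down:
  assumes "0 < j" "\<forall>q\<in>#M. good (j - 1) q" "size M \<le> n"
  shows "step (vec j m 0 f t M) (vec (j - 1) 0 0 0 t M)"
proof (rule stepI[of 4 0 0 0])
  show "legal 4 0 0 0 (vec j m 0 f t M)" using assms by (simp add: legal_def)
  show "vec (j - 1) 0 0 0 t M = next_state 4 0 0 0 (vec j m 0 f t M)"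
    unfolding next_state_def by (auto simp: vec_def fun_eq_iff)
  show "admissible (vec (j - 1) 0 0 0 t M)"
    by (rule admissible_vec) (use assms in auto)
qed simp_all

lemma step_match:
  assumes "\<forall>q\<in>#add_mset p M. good j q" "size M \<le> n" "t < N" "fst p \<le> item t"
  shows "step (vec j i r f t (add_mset p M)) (vec j i r f (Suc t) M)"
proof (rule stepI[of 2 "fst p" 0 0])
  have v: "0 < fst p" "fst p \<le> n" using assms(1) ok_pos by (auto simp: good_def)
  then show "fst p \<le> n" by simp
  show "legal 2 (fst p) 0 0 (vec j i r f t (add_mset p M))"
    using v assms by (simp add: legal_def vec_def)
  show "vec j i r f (Suc t) M = next_state 2 (fst p) 0 0 (vec j i r f t (add_mset p M))"
    unfolding next_state_def using v by (auto simp: vec_def fun_eq_iff)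
  show "admissible (vec j i r f (Suc t) M)"
    by (rule admissible_vec) (use assms in auto)
qed simp_all

lemma step_split:
  assumes "\<forall>q\<in>#M. good j q" "good j p" "good j q" "good j q'" "size M + 2 \<le> n"
    "soft" "fst q < fst p" "fst q' < fst p" "fst p \<le> fst q + fst q'"
  shows "step (vec j i r f t (add_mset p M)) (vec j i r f t (add_mset q (add_mset q' M)))"
proof (rule stepI[of 3 "fst p" "fst q" "fst q'"])
  have v: "0 < fst p" "fst p \<le> n" "0 < fst q" "fst q \<le> n" "0 < fst q'" "fst q' \<le> n"
    using assms(2-4) ok_pos unfolding good_def by blast+
  then show "fst p \<le> n" "fst q \<le> n" "fst q' \<le> n" by simp_all
  show "legal 3 (fst p) (fst q) (fst q') (vec j i r f t (add_mset p M))"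
    unfolding legal_def using v assms(6-) by (simp add: vec_def)
  show "vec j i r f t (add_mset q (add_mset q' M)) =
    next_state 3 (fst p) (fst q) (fst q') (vec j i r f t (add_mset p M))"
    unfolding next_state_def Let_def using v assms(7-) by (auto simp: vec_def fun_eq_iff)
  show "admissible (vec j i r f t (add_mset q (add_mset q' M)))"
    by (rule admissible_vec) (use assms in auto)
qed simp_all

lemma hall_match:
  assumes h: "hall t (add_mset w L)" and max: "\<forall>w'\<in>#L. w' \<le> w"
  shows "t < N" "w \<le> item t" "hall (Suc t) L"
proof -
  let ?S = "{t'. t' < N \<and> w \<le> item t'}"
  have "t + 1 \<le> card ?S" using h by (auto simp: hall_def)
  moreover have "?S \<subseteq> {..<t}" if "\<not> (t < N \<and> w \<le> item t)"
  proof
    fix t' assume t': "t' \<in> ?S"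
    show "t' \<in> {..<t}"
    proof (rule ccontr)
      assume "t' \<notin> {..<t}"
      then have "t \<le> t'" by simp
      then have "item t' \<le> item t" using item_sorted t' by simp
      then show False using that t' \<open>t \<le> t'\<close> by auto
    qed
  qed
  moreover have "card ?S \<le> t" if "?S \<subseteq> {..<t}"
    using card_mono[OF _ that] by simp
  ultimately show "t < N" "w \<le> item t" by auto
  show "hall (Suc t) L" unfolding hall_def
  proof
    fix x assume x: "x \<in># L"
    then have "t + size (filter_mset (\<lambda>w'. x \<le> w') (add_mset w L)) \<le> card {t'. t' < N \<and> x \<le> item t'}"
      using h by (auto simp: hall_def)
    then show "Suc t + size (filter_mset (\<lambda>w'. x \<le> w') L) \<le> card {t'. t' < N \<and> x \<le> item t'}"
      using max x by simp
  qed
qed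

text \<open>All obligations of the top level are split or matched; the leaves of the bins that have not
  been entered yet, which lie on lower levels, are collected in \<open>R\<close>.\<close>

lemma steps_level:
  assumes "\<forall>p\<in>#M. good j p" "size (all_leaves M) \<le> n" "hall t (all_leaves M + R)"
    "\<forall>w\<in>#R. lev w < j \<or> R = {#}" "m' = m"
  shows "\<exists>t' M'. step\<^sup>*\<^sup>* (vec j i r f t M) (vec j i r f t' M') \<and> (\<forall>p\<in>#M'. good j p \<and> lev (fst p) < j)
    \<and> hall t' (all_leaves M' + R) \<and> size (all_leaves M') \<le> size (all_leaves M)"
  using assms
proof (induction "\<Sum>p\<in>#M. 2 * size (snd p) + 1" arbitrary: M t rule: less_induct)
  case less
  show ?case
  proof (cases "\<exists>p l r. p \<in># M \<and> lev (fst p) = j \<and> snd p = Node l r")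
    case True
    then obtain p l r' where p: "p \<in># M" "lev (fst p) = j" "snd p = Node l r'" by blast
    then obtain M0 where M: "M = add_mset p M0" by (meson multi_member_split)
    let ?M = "add_mset (val l, l) (add_mset (val r', r') M0)"
    have gp: "good j p" using less.prems(1) p by auto
    have "lev (val (snd p)) = j" and w': "wf_tree (snd p)" and "fst p \<le> val (snd p)"
      using gp p(2) unfolding good_def by auto
    then have j: "lev (val l + val r') = j" and le: "fst p \<le> val l + val r'"
      unfolding p(3) by simp_all
    have w: "wf_tree (Node l r')" using w' unfolding p(3) .
    have w: "wf_tree l" "wf_tree r'" "soft" "lev (val l) < j" "lev (val r') < j" "ok j (val l)" "ok j (val r')"
      using w unfolding wf_tree.simps j by blast+
    have g: "good j (val l, l)" "good j (val r', r')" unfolding good_def using w by simp_all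
    have lt: "val l < fst p" "val r' < fst p"
      using w(4,5) p(2) lev_mono[of "fst p" "val l"] lev_mono[of "fst p" "val r'"] by (auto simp: not_less[symmetric])
    have lv: "all_leaves ?M = all_leaves M" by (simp add: M p(3))
    have sz: "size ?M \<le> n" using size_le_all_leaves[of ?M] less.prems(2) unfolding lv by linarith
    have st: "step (vec j i r f t M) (vec j i r f t ?M)"
      unfolding M by (rule step_split) (use less.prems(1) gp g lt le w(3) sz in \<open>auto simp: M\<close>)
    have "\<exists>t' M'. step\<^sup>*\<^sup>* (vec j i r f t ?M) (vec j i r f t' M') \<and> (\<forall>p\<in>#M'. good j p \<and> lev (fst p) < j)
      \<and> hall t' (all_leaves M' + R) \<and> size (all_leaves M') \<le> size (all_leaves ?M)"
    proof (rule less.hyps)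
      show "(\<Sum>p\<in>#?M. 2 * size (snd p) + 1) < (\<Sum>p\<in>#M. 2 * size (snd p) + 1)" by (simp add: M p(3))
      show "\<forall>p\<in>#?M. good j p" using g less.prems(1) by (auto simp: M)
    qed (use less.prems lv in auto)
    then show ?thesis using st lv by (metis converse_rtranclp_into_rtranclp)
  next
    case noN: False
    let ?J = "filter_mset (\<lambda>p. lev (fst p) = j) M"
    show ?thesis
    proof (cases "?J = {#}")
      case True
      have "lev (fst p) < j" if "p \<in># M" for p
      proof -
        have "lev (fst p) \<le> j" using less.prems(1) that ok_lev[of j "fst p"] unfolding good_def by blast
        moreover have "p \<notin># ?J" unfolding True by simp
        ultimately show ?thesis using that by simp
      qed
      then show ?thesis using less.prems by blast
    next
      case False
      let ?vs = "(\<lambda>p. val (snd p)) ` set_mset ?J"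
      have fin: "finite ?vs" "?vs \<noteq> {}" using False by auto
      obtain p where p: "p \<in># ?J" "val (snd p) = Max ?vs" using Max_in[OF fin] by auto
      then obtain w where w: "snd p = Leaf w" using noN by (cases "snd p") auto
      obtain M0 where M: "M = add_mset p M0" using p(1) multi_member_split[of p M] by auto
      have gp: "good j p" using less.prems(1) p by auto
      have lw: "lev w = j" using gp p w by (auto simp: good_def)
      have max: "\<forall>x\<in>#all_leaves M0 + R. x \<le> w"
      proof
        fix x assume "x \<in># all_leaves M0 + R"
        then consider "x \<in># all_leaves M0" | "x \<in># R" by auto
        then show "x \<le> w"
        proof cases
          case 1
          then obtain q where q: "q \<in># M0" "x \<in># leaves (snd q)" by (auto simp: all_leaves_def)
          have gq: "good j q" using less.prems(1) q M by auto
          show ?thesis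
          proof (cases "lev (fst q) = j")
            case True
            then have qJ: "q \<in># ?J" using q M by auto
            then have "val (snd q) \<le> Max ?vs" by (intro Max_ge fin) auto
            then show ?thesis using leaves_le_val[OF q(2)] p(2) w by simp
          next
            case False
            then have "lev (val (snd q)) < j" using gq ok_lev[of j "fst q"] by (auto simp: good_def)
            then have "lev x < lev w" using lev_mono[OF leaves_le_val[OF q(2)]] lw by simp
            then show ?thesis using lev_mono[of w x] by (meson leD le_cases)
          qed
        next
          case 2
          then have "lev x < lev w" using less.prems(4) lw by auto
          then show ?thesis using lev_mono[of w x] by (meson leD le_cases)
        qed
      qed
      have h: "hall t (add_mset w (all_leaves M0 + R))" using less.prems(3) by (simp add: M w)
      note hm = hall_match[OF h max]
      have "fst p \<le> w" using gp w by (auto simp: good_def)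
      have sz: "size M0 \<le> n" using size_le_all_leaves[of M] less.prems(2) by (simp add: M)
      have st: "step (vec j i r f t M) (vec j i r f (Suc t) M0)"
        unfolding M by (rule step_match) (use less.prems(1) hm \<open>fst p \<le> w\<close> sz in \<open>auto simp: M\<close>)
      have "\<exists>t' M'. step\<^sup>*\<^sup>* (vec j i r f (Suc t) M0) (vec j i r f t' M') \<and> (\<forall>p\<in>#M'. good j p \<and> lev (fst p) < j)
        \<and> hall t' (all_leaves M' + R) \<and> size (all_leaves M') \<le> size (all_leaves M0)"
      proof (rule less.hyps)
        show "(\<Sum>p\<in>#M0. 2 * size (snd p) + 1) < (\<Sum>p\<in>#M. 2 * size (snd p) + 1)" by (simp add: M w)
        show "\<forall>p\<in>#M0. good j p" using less.prems(1) by (auto simp: M)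
      qed (use less.prems hm M in auto)
      then obtain t' M' where "step\<^sup>*\<^sup>* (vec j i r f (Suc t) M0) (vec j i r f t' M')"
        "\<forall>p\<in>#M'. good j p \<and> lev (fst p) < j" "hall t' (all_leaves M' + R)"
        "size (all_leaves M') \<le> size (all_leaves M0)" by blast
      moreover have "size (all_leaves M0) \<le> size (all_leaves M)" by (simp add: M)
      ultimately show ?thesis using st by (meson converse_rtranclp_into_rtranclp order_trans)
    qed
  qed
qed

definition future :: "(nat \<Rightarrow> (nat \<times> tree) multiset) \<Rightarrow> nat \<Rightarrow> nat multiset" where
  "future plan j = (\<Sum>b\<in>{b. b < m \<and> stg b < j}. all_leaves (plan b))"

lemma all_leaves_sum: "all_leaves (\<Sum>b\<in>B. P b) = (\<Sum>b\<in>B. all_leaves (P b))"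
  by (induction B rule: infinite_finite_induct) auto

lemma steps_bins:
  assumes plan: "\<And>b p. b < m \<Longrightarrow> p \<in># plan b \<Longrightarrow> good (stg b) p"
    and cover: "\<And>b. b < m \<Longrightarrow> tau b \<le> sum_mset (image_mset fst (plan b))"
    and room: "\<And>b. b < m \<Longrightarrow> if soft then plan b \<noteq> {#} \<longrightarrow> 0 < slots b else size (plan b) \<le> slots b"
    and M: "\<forall>p\<in>#M. good j p" "size (M + (\<Sum>b\<in>{b. b < m \<and> stg b = j}. plan b)) \<le> n"
    and i: "i \<le> m"
  shows "\<exists>f. step\<^sup>*\<^sup>* (vec j 0 0 0 t M) (vec j i 0 f t (M + (\<Sum>b\<in>{b. b < i \<and> stg b = j}. plan b)))"
  using i
proof (induction i)
  case 0
  then show ?case by auto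
next
  case (Suc i)
  let ?M = "\<lambda>i. M + (\<Sum>b\<in>{b. b < i \<and> stg b = j}. plan b)"
  obtain f where f: "step\<^sup>*\<^sup>* (vec j 0 0 0 t M) (vec j i 0 f t (?M i))" using Suc by auto
  have good: "\<forall>p\<in>#?M i. good j p" using M(1) plan Suc.prems by (auto simp: set_mset_sum)
  have szle: "size (?M i') \<le> n" if "i' \<le> m" for i'
  proof -
    have "(\<Sum>b\<in>{b. b < i' \<and> stg b = j}. plan b) \<subseteq># (\<Sum>b\<in>{b. b < m \<and> stg b = j}. plan b)"
      by (subst (2) sum.subset_diff[of "{b. b < i' \<and> stg b = j}"]) (use that in auto)
    then show ?thesis using M(2) size_mset_mono[of "?M i'" "?M m"] by simp
  qed
  have e: "step (vec j i 0 f t (?M i)) (vec j (Suc i) (if stg i = j then tau i else 0)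
      (if stg i = j then slots i else 0) t (?M i))"
    by (rule step_enter) (use Suc.prems good szle[of i] in auto)
  show ?case
  proof (cases "stg i = j")
    case True
    have set: "{b. b < Suc i \<and> stg b = j} = insert i {b. b < i \<and> stg b = j}"
      using True by (auto simp: less_Suc_eq)
    have Mi: "?M (Suc i) = plan i + ?M i" unfolding set by (simp add: ac_simps)
    have "\<exists>f'. step\<^sup>*\<^sup>* (vec j (Suc i) (tau i) (slots i) t (?M i))
        (vec j (Suc i) (tau i - sum_mset (image_mset fst (plan i))) f' t (plan i + ?M i))"
    proof (rule steps_emit)
      show "size (plan i) + size (?M i) \<le> n" using szle[of "Suc i"] Suc.prems unfolding Mi by simp
    qed (use plan[of i] True good room[of i] Suc.prems in auto)
    moreover have "tau i - sum_mset (image_mset fst (plan i)) = 0" using cover[of i] Suc.prems by simp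
    ultimately obtain f' where
      f': "step\<^sup>*\<^sup>* (vec j (Suc i) (tau i) (slots i) t (?M i)) (vec j (Suc i) 0 f' t (?M (Suc i)))"
      unfolding Mi by auto
    have "step (vec j i 0 f t (?M i)) (vec j (Suc i) (tau i) (slots i) t (?M i))"
      using e True by simp
    with f f' have "step\<^sup>*\<^sup>* (vec j 0 0 0 t M) (vec j (Suc i) 0 f' t (?M (Suc i)))"
      by (meson rtranclp.rtrancl_into_rtrancl rtranclp_trans)
    then show ?thesis by blast
  next
    case False
    then have set: "{b. b < Suc i \<and> stg b = j} = {b. b < i \<and> stg b = j}"
      by (auto simp: less_Suc_eq)
    show ?thesis unfolding set using f e False by simp (meson rtranclp.rtrancl_into_rtrancl)
  qed
qed

theorem reach_final:
  assumes plan: "\<And>b p. b < m \<Longrightarrow> p \<in># plan b \<Longrightarrow> good (stg b) p"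
    and cover: "\<And>b. b < m \<Longrightarrow> tau b \<le> sum_mset (image_mset fst (plan b))"
    and room: "\<And>b. b < m \<Longrightarrow> if soft then plan b \<noteq> {#} \<longrightarrow> 0 < slots b else size (plan b) \<le> slots b"
    and stg: "\<And>b. b < m \<Longrightarrow> stg b \<le> top"
    and total: "size (\<Sum>b<m. all_leaves (plan b)) \<le> n"
    and hall: "hall 0 (\<Sum>b<m. all_leaves (plan b))"
  shows "\<exists>y. step\<^sup>*\<^sup>* start y \<and> final y"
proof -
  have main: "\<exists>y. step\<^sup>*\<^sup>* (vec j 0 0 0 t M) y \<and> final y"
    if "\<forall>p\<in>#M. good j p" "size (all_leaves M + future plan (Suc j)) \<le> n"
      "hall t (all_leaves M + future plan (Suc j))" for j t M
    using that
  proof (induction j arbitrary: t M rule: less_induct)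
    case (less j)
    note M = less.prems(1) and sz = less.prems(2) and h = less.prems(3)
    let ?P = "\<Sum>b\<in>{b. b < m \<and> stg b = j}. plan b"
    have set: "{b. b < m \<and> stg b < Suc j} = {b. b < m \<and> stg b = j} \<union> {b. b < m \<and> stg b < j}" by auto
    have fut: "future plan (Suc j) = all_leaves ?P + future plan j"
      unfolding future_def set all_leaves_sum by (rule sum.union_disjoint) auto
    have szP: "size (M + ?P) \<le> n"
      using size_le_all_leaves[of "M + ?P"] sz fut by simp
    obtain f where f: "step\<^sup>*\<^sup>* (vec j 0 0 0 t M) (vec j m 0 f t (M + ?P))"
      using steps_bins[OF plan cover room M szP, of m] by auto
    have lR: "\<forall>w\<in>#future plan j. lev w < j \<or> future plan j = {#}"
    proof
      fix w assume "w \<in># future plan j"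
      then obtain b where b: "b < m" "stg b < j" "w \<in># all_leaves (plan b)"
        by (auto simp: future_def set_mset_sum)
      then obtain p where p: "p \<in># plan b" "w \<in># leaves (snd p)" by (auto simp: all_leaves_def)
      have "lev w \<le> lev (val (snd p))" by (rule lev_mono[OF leaves_le_val[OF p(2)]])
      also have "\<dots> \<le> stg b" using plan[OF b(1) p(1)] ok_lev[of "stg b" "fst p"] by (simp add: good_def)
      finally show "lev w < j \<or> future plan j = {#}" using b(2) by simp
    qed
    have "\<exists>t' M'. step\<^sup>*\<^sup>* (vec j m 0 f t (M + ?P)) (vec j m 0 f t' M') \<and> (\<forall>p\<in>#M'. good j p \<and> lev (fst p) < j)
      \<and> hall t' (all_leaves M' + future plan j) \<and> size (all_leaves M') \<le> size (all_leaves (M + ?P))"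
    proof (rule steps_level[OF _ _ _ lR])
      show "\<forall>p\<in>#M + ?P. good j p" using M plan by (auto simp: set_mset_sum)
      show "size (all_leaves (M + ?P)) \<le> n" using sz fut by simp
      show "hall t (all_leaves (M + ?P) + future plan j)" using h fut by (simp add: ac_simps)
    qed simp
    then obtain t' M' where M': "step\<^sup>*\<^sup>* (vec j m 0 f t (M + ?P)) (vec j m 0 f t' M')"
      "\<forall>p\<in>#M'. good j p \<and> lev (fst p) < j" "hall t' (all_leaves M' + future plan j)"
      "size (all_leaves M') \<le> size (all_leaves (M + ?P))" by blast
    have reach: "step\<^sup>*\<^sup>* (vec j 0 0 0 t M) (vec j m 0 f t' M')" using f M'(1) by simp
    show ?case
    proof (cases j)
      case 0
      then have "M' = {#}" using M'(2) by (cases M') auto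
      then have "final (vec j m 0 f t' M')" using 0 by (auto simp: final_def vec_def)
      then show ?thesis using reach by blast
    next
      case (Suc j')
      have g: "\<forall>p\<in>#M'. good j' p" using M'(2) good_down[of j] Suc by auto
      have s': "size (all_leaves M' + future plan j) \<le> n" using M'(4) sz fut by simp
      have "size M' \<le> n" using size_le_all_leaves[of M'] s' by simp
      then have "step (vec j m 0 f t' M') (vec j' 0 0 0 t' M')" using step_down[of j M' f t'] g Suc by simp
      moreover obtain y where "step\<^sup>*\<^sup>* (vec j' 0 0 0 t' M') y" "final y"
        using less.IH[OF _ g] s' M'(3) Suc by auto
      ultimately show ?thesis using reach
        by (meson converse_rtranclp_into_rtranclp rtranclp_trans)
    qed
  qed
  have "{b. b < m \<and> stg b < Suc top} = {..<m}" using stg by (auto simp: less_Suc_eq_le)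
  then have "future plan (Suc top) = (\<Sum>b<m. all_leaves (plan b))" by (simp add: future_def)
  moreover have "start = vec top 0 0 0 0 {#}" by (auto simp: start_def vec_def fun_eq_iff)
  ultimately show ?thesis using main[of "{#}" top 0] total hall by simp
qed

end

section \<open>Rounding and gluing\<close>

lemma floor_log_bounds: "0 < v \<Longrightarrow> 2 ^ floor_log v \<le> v" "v < 2 * 2 ^ floor_log v"
  by (rule floor_log_exp2_le, assumption) (rule floor_log_exp2_gt)

lemma round_down:
  assumes "0 < w" "g \<le> floor_log w"
  defines "v \<equiv> w div 2 ^ g * 2 ^ g"
  shows "v \<le> w" "w < v + 2 ^ g" "floor_log v = floor_log w" "2 ^ g dvd v" "0 < v"
proof -
  let ?l = "floor_log w"
  show le: "v \<le> w" by (simp add: v_def)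
  have "w mod 2 ^ g < 2 ^ g" by simp
  moreover have "w = v + w mod 2 ^ g" unfolding v_def by (rule div_mult_mod_eq[symmetric])
  ultimately show "w < v + 2 ^ g" by linarith
  show "2 ^ g dvd v" by (simp add: v_def)
  have "2 ^ ?l = 2 ^ (?l - g) * (2 ^ g :: nat)" using assms(2) by (simp flip: power_add)
  also have "\<dots> \<le> v"
  proof -
    have "(2::nat) ^ (?l - g) \<le> w div 2 ^ g"
      using floor_log_bounds(1)[OF assms(1)] assms(2)
      by (simp add: less_eq_div_iff_mult_less_eq flip: power_add)
    then show ?thesis by (simp add: v_def)
  qed
  finally have ge: "2 ^ ?l \<le> v" .
  show "0 < v" using ge by (meson less_le_trans zero_less_numeral zero_less_power)
  show "floor_log v = ?l"
    by (rule floor_log_eqI) (use ge le floor_log_bounds(2)[of w] \<open>0 < v\<close> in auto)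
qed

lemma two_elements:
  assumes "2 \<le> size M"
  obtains x y N where "M = add_mset x (add_mset y N)"
proof -
  obtain x M' where M: "M = add_mset x M'" using assms by (cases M) auto
  then obtain y N where "M' = add_mset y N" using assms by (cases M') auto
  with M show thesis by (intro that) simp
qed

definition mantissa :: "nat \<Rightarrow> nat \<Rightarrow> bool" where
  "mantissa e w \<longleftrightarrow> 0 < w \<and> 2 ^ (floor_log w - e) dvd w"

definition level :: "bool \<Rightarrow> nat \<Rightarrow> nat" where
  "level soft v = (if soft then floor_log v else 0)"

text \<open>
  With soft capacities only \<open>O(2 ^ e)\<close> values are allowed in a stage: the precision relative to \<open>v\<close>
  decreases with \<open>j - floor_log v\<close>, which is harmless since two obligations of the same parity and
  level can be glued without rounding, so that at most two per level have to be rounded.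
\<close>

definition allowed :: "bool \<Rightarrow> nat \<Rightarrow> nat \<Rightarrow> nat \<Rightarrow> nat \<Rightarrow> bool" where
  "allowed soft e n j v \<longleftrightarrow> 0 < v \<and> v \<le> n \<and>
     (if soft then floor_log v \<le> j \<and> (j - floor_log v) div 2 \<le> e \<and>
        2 ^ (floor_log v + (j - floor_log v) div 2 - e) dvd v
      else j = 0 \<and> 2 ^ (floor_log v - e) dvd v)"

lemma card_grid:
  assumes "g \<le> l"
  shows "finite {v. 0 < v \<and> floor_log v = l \<and> 2 ^ g dvd v}"
    "card {v. 0 < v \<and> floor_log v = l \<and> 2 ^ g dvd v} \<le> 2 ^ (l - g)"
proof -
  let ?A = "{v. 0 < v \<and> floor_log v = l \<and> 2 ^ g dvd v}"
  have "inj_on (\<lambda>v. v div 2 ^ g) ?A"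
    by (intro inj_onI) (metis (mono_tags, lifting) dvd_div_mult_self mem_Collect_eq)
  moreover have "(\<lambda>v. v div 2 ^ g) ` ?A \<subseteq> {2 ^ (l - g)..<2 * 2 ^ (l - g)}"
  proof (intro image_subsetI)
    fix v assume v: "v \<in> ?A"
    then obtain k where k: "v = 2 ^ g * k" by (auto simp: dvd_def)
    have "2 ^ l = 2 ^ g * (2 ^ (l - g) :: nat)" using assms by (simp flip: power_add)
    moreover have "2 ^ l \<le> v" "v < 2 * 2 ^ l" using v floor_log_bounds[of v] by auto
    ultimately have "2 ^ g * 2 ^ (l - g) \<le> 2 ^ g * k" "2 ^ g * k < 2 ^ g * (2 * 2 ^ (l - g))"
      using k by auto
    then show "v div 2 ^ g \<in> {2 ^ (l - g)..<2 * 2 ^ (l - g)}" using k by simp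
  qed
  ultimately show "finite ?A" "card ?A \<le> 2 ^ (l - g)"
    using card_inj_on_le[of "\<lambda>v. v div 2 ^ g" ?A "{2 ^ (l - g)..<2 * 2 ^ (l - g)}"]
      inj_on_finite[of "\<lambda>v. v div 2 ^ g" ?A] by auto
qed

lemma card_allowed_hard: "card {v. v \<le> n \<and> allowed False e n j v} \<le> 2 ^ e * (floor_log n + 1)"
proof -
  let ?S = "\<lambda>l. {v. 0 < v \<and> floor_log v = l \<and> 2 ^ (l - e) dvd v}"
  have fin: "finite (\<Union>l\<le>floor_log n. ?S l)" by (auto intro!: card_grid)
  have "card {v. v \<le> n \<and> allowed False e n j v} \<le> card (\<Union>l\<le>floor_log n. ?S l)"
    by (rule card_mono[OF fin]) (auto simp: allowed_def floor_log_le_iff)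
  also have "\<dots> \<le> (\<Sum>l\<le>floor_log n. card (?S l))" by (rule card_UN_le) simp
  also have "\<dots> \<le> (\<Sum>l\<le>floor_log n. 2 ^ e)"
  proof (rule sum_mono)
    fix l
    have "card (?S l) \<le> 2 ^ (l - (l - e))" by (rule card_grid) simp
    also have "\<dots> \<le> 2 ^ e" by (rule power_increasing) auto
    finally show "card (?S l) \<le> 2 ^ e" .
  qed
  finally show ?thesis by (simp add: algebra_simps)
qed

lemma sum_half_powers: "k \<le> Suc e \<Longrightarrow> (\<Sum>a<2 * k. 2 ^ (e - a div 2)) + 2 * 2 ^ (Suc e - k) = (4 * 2 ^ e :: nat)"
proof (induction k)
  case (Suc k)
  then have "Suc e - k = Suc (e - k)" by simp
  with Suc show ?case by simp
qed simp

lemma card_allowed_soft: "card {v. v \<le> n \<and> allowed True e n j v} \<le> 4 * 2 ^ e"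
proof -
  let ?S = "\<lambda>a. {v. v \<le> n \<and> allowed True e n j v \<and> j - floor_log v = a}"
  have fin: "finite (?S a)" for a by simp
  have "{v. v \<le> n \<and> allowed True e n j v} \<subseteq> (\<Union>a<2 * Suc e. ?S a)"
    by (auto simp: allowed_def)
  then have "card {v. v \<le> n \<and> allowed True e n j v} \<le> card (\<Union>a<2 * Suc e. ?S a)"
    by (rule card_mono[rotated]) (use fin in auto)
  also have "\<dots> \<le> (\<Sum>a<2 * Suc e. card (?S a))" by (rule card_UN_le) simp
  also have "\<dots> \<le> (\<Sum>a<2 * Suc e. 2 ^ (e - a div 2))"
  proof (rule sum_mono)
    fix a assume "a \<in> {..<2 * Suc e}"
    then have a: "a div 2 \<le> e" by auto
    show "card (?S a) \<le> 2 ^ (e - a div 2)"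
    proof (cases "a \<le> j")
      case True
      let ?l = "j - a" let ?g = "?l + a div 2 - e"
      have g: "?g \<le> ?l" using a by simp
      have "card (?S a) \<le> card {v. 0 < v \<and> floor_log v = ?l \<and> 2 ^ ?g dvd v}"
        by (rule card_mono[OF card_grid(1)[OF g]]) (auto simp: allowed_def)
      also have "\<dots> \<le> 2 ^ (?l - ?g)" by (rule card_grid(2)[OF g])
      also have "\<dots> \<le> 2 ^ (e - a div 2)" by (rule power_increasing) (use a in auto)
      finally show ?thesis .
    next
      case False
      then have "?S a = {}" by auto
      then show ?thesis by (metis card.empty zero_le)
    qed
  qed
  also have "\<dots> \<le> 4 * 2 ^ e" using sum_half_powers[of "Suc e" e] by simp
  finally show ?thesis .
qed

locale rounding = cover_search soft n N m top "allowed soft e n" tau slots stg item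
  for soft n N m top e tau slots stg item +
  assumes sorted: "t \<le> t' \<Longrightarrow> t' < N \<Longrightarrow> item t' \<le> item t"
begin

sublocale cover_levels soft n N m top "allowed soft e n" tau slots stg item "level soft"
proof
  show "level soft v \<le> level soft v'" if "v \<le> v'" for v v'
    using that by (simp add: level_def floor_log_le_iff)
  show "allowed soft e n (j - 1) v" if "allowed soft e n j v" "level soft v < j" for j v
  proof (cases soft)
    case True
    let ?l = "floor_log v"
    have 1: "(j - 1 - ?l) div 2 \<le> (j - ?l) div 2" by (rule div_le_mono) simp
    have "(2::nat) ^ (?l + (j - 1 - ?l) div 2 - e) dvd 2 ^ (?l + (j - ?l) div 2 - e)"
      by (intro le_imp_power_dvd diff_le_mono add_left_mono 1)
    then show ?thesis using that 1 True by (auto simp: allowed_def level_def elim: dvd_trans)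
  qed (use that in \<open>auto simp: allowed_def level_def\<close>)
qed (use sorted in \<open>auto simp: allowed_def level_def split: if_splits\<close>)

definition forest :: "nat \<Rightarrow> nat multiset \<Rightarrow> tree multiset \<Rightarrow> bool" where
  "forest u W F \<longleftrightarrow> (\<Sum>T\<in>#F. leaves T) = W \<and>
     (\<forall>T\<in>#F. wf_tree T \<and> mantissa e (val T) \<and> floor_log (val T) \<le> u)"

lemma glue:
  assumes s: "soft" and un: "2 ^ u \<le> n"
    and T: "wf_tree T" "mantissa e (val T)" "floor_log (val T) = l"
    and T': "wf_tree T'" "mantissa e (val T')" "floor_log (val T') = l"
    and parity: "even (val T div 2 ^ (l - e)) = even (val T' div 2 ^ (l - e))" and l: "l < u"
  shows "wf_tree (Node T T')" "mantissa e (val (Node T T'))" "floor_log (val (Node T T')) = Suc l"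
proof -
  have b: "2 ^ l \<le> val T" "val T < 2 * 2 ^ l" "2 ^ l \<le> val T'" "val T' < 2 * 2 ^ l"
    using floor_log_bounds[of "val T"] floor_log_bounds[of "val T'"] T T' by (auto simp: mantissa_def)
  then have fl: "floor_log (val T + val T') = Suc l" by (intro floor_log_eqI) auto
  then show "floor_log (val (Node T T')) = Suc l" by simp
  have "2 ^ Suc l \<le> (2::nat) ^ u" by (rule power_increasing) (use l in auto)
  then have vn: "val T \<le> n" "val T' \<le> n" using b un by auto
  have pos: "0 < val T" "0 < val T'" using T T' by (auto simp: mantissa_def)
  have al: "allowed soft e n (Suc l) (val T)" "allowed soft e n (Suc l) (val T')"
    using T T' vn pos s by (auto simp: allowed_def mantissa_def)
  have lv: "level soft (val T) = l" "level soft (val T') = l" "level soft (val T + val T') = Suc l"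
    using T T' fl s by (simp_all add: level_def)
  show "wf_tree (Node T T')" unfolding wf_tree.simps lv using T(1) T'(1) al s by blast
  have "2 ^ (Suc l - e) dvd val T + val T'"
  proof (cases "e \<le> l")
    case True
    obtain k k' where k: "val T = 2 ^ (l - e) * k" "val T' = 2 ^ (l - e) * k'"
      using T T' by (auto simp: mantissa_def dvd_def)
    have "val T div 2 ^ (l - e) = k" "val T' div 2 ^ (l - e) = k'" by (simp_all add: k)
    then have "even (k + k')" using parity by simp
    then obtain q where "k + k' = 2 * q" by blast
    then have "val T + val T' = 2 ^ Suc (l - e) * q" unfolding k by (simp flip: distrib_left)
    then show ?thesis using True by (simp add: Suc_diff_le)
  qed simp
  then show "mantissa e (val (Node T T'))" using fl pos by (simp add: mantissa_def)
qed

lemma glued_forest: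
  assumes s: "soft" and un: "2 ^ u \<le> n" and W: "\<forall>w\<in>#W. mantissa e w \<and> floor_log w \<le> u"
  shows "\<exists>F. forest u W F \<and> (\<forall>l<u. size (filter_mset (\<lambda>T. floor_log (val T) = l) F) \<le> 2)"
proof -
  have "forest u W (image_mset Leaf W)"
    using W by (auto simp: forest_def mantissa_def image_mset.compositionality comp_def)
  then obtain F where F: "forest u W F" and min: "\<And>F'. forest u W F' \<Longrightarrow> size F \<le> size F'"
    using ex_has_least_nat[of "forest u W" _ size] by blast
  have "size (filter_mset (\<lambda>T. floor_log (val T) = l) F) \<le> 2" if l: "l < u" for l
  proof (rule ccontr)
    let ?G = "filter_mset (\<lambda>T. floor_log (val T) = l) F"
    let ?P = "\<lambda>T. even (val T div 2 ^ (l - e))"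
    assume "\<not> size ?G \<le> 2"
    then have "2 < size (filter_mset ?P ?G) + size (filter_mset (\<lambda>T. \<not> ?P T) ?G)"
      by (metis multiset_partition not_less size_union)
    then have "2 \<le> size (filter_mset ?P ?G) \<or> 2 \<le> size (filter_mset (\<lambda>T. \<not> ?P T) ?G)"
      by linarith
    then obtain Q where Q: "Q = ?P \<or> Q = (\<lambda>T. \<not> ?P T)" "2 \<le> size (filter_mset Q ?G)" by blast
    obtain T T' R' where R': "filter_mset Q ?G = add_mset T (add_mset T' R')"
      by (rule two_elements[OF Q(2)])
    have "add_mset T (add_mset T' R') \<subseteq># F"
      unfolding R'[symmetric] by (meson multiset_filter_subset subset_mset.order_trans)
    then obtain X where "F = add_mset T (add_mset T' R') + X"
      unfolding mset_subset_eq_exists_conv by blast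
    then obtain F0 where F0: "F = add_mset T (add_mset T' F0)" by simp
    have TT: "T \<in># filter_mset Q ?G" "T' \<in># filter_mset Q ?G" unfolding R' by auto
    have "floor_log (val T) = l" "floor_log (val T') = l" "Q T" "Q T'" using TT by simp_all
    moreover have "even (val T div 2 ^ (l - e)) = even (val T' div 2 ^ (l - e))"
      using Q(1) \<open>Q T\<close> \<open>Q T'\<close> by blast
    moreover have "wf_tree T" "mantissa e (val T)" "wf_tree T'" "mantissa e (val T')"
      using F unfolding forest_def F0 by auto
    ultimately have g: "wf_tree (Node T T')" "mantissa e (val (Node T T'))" "floor_log (val (Node T T')) = Suc l"
      using glue[OF s un _ _ _ _ _ _ _ l] by blast+
    have "forest u W (add_mset (Node T T') F0)"
      using F g l unfolding F0 forest_def by (auto simp: ac_simps simp del: wf_tree.simps val.simps)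
    from min[OF this] show False by (simp add: F0)
  qed
  then show ?thesis using F by blast
qed


definition rounded :: "nat \<Rightarrow> nat" where
  "rounded w = w div 2 ^ (floor_log w - e) * 2 ^ (floor_log w - e)"

lemma rounded:
  assumes "0 < w"
  shows "rounded w \<le> w" "floor_log (rounded w) = floor_log w" "mantissa e (rounded w)"
    "w * (2 ^ e - 1) \<le> rounded w * 2 ^ e"
proof -
  let ?l = "floor_log w"
  note r = round_down[of w "?l - e", folded rounded_def, OF assms]
  show le: "rounded w \<le> w" and "floor_log (rounded w) = ?l" and "mantissa e (rounded w)"
    using r by (simp_all add: mantissa_def)
  show "w * (2 ^ e - 1) \<le> rounded w * 2 ^ e"
  proof (cases "e \<le> ?l")
    case True
    have "(w - rounded w) * 2 ^ e \<le> 2 ^ (?l - e) * 2 ^ e" using r(2) by (intro mult_right_mono) auto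
    also have "\<dots> \<le> w" using True floor_log_bounds(1)[OF assms] by (simp flip: power_add)
    finally show ?thesis using le by (simp add: algebra_simps)
  next
    case False
    then show ?thesis by (simp add: rounded_def)
  qed
qed

definition coarse :: "nat \<Rightarrow> nat \<Rightarrow> nat" where
  "coarse u w = w div 2 ^ (floor_log w + (u - floor_log w) div 2 - e) *
     2 ^ (floor_log w + (u - floor_log w) div 2 - e)"

lemma coarse:
  assumes "0 < w" "floor_log w \<le> u" "(u - floor_log w) div 2 \<le> e"
  shows "coarse u w \<le> w" "floor_log (coarse u w) = floor_log w" "0 < coarse u w"
    "2 ^ (floor_log w + (u - floor_log w) div 2 - e) dvd coarse u w"
    "w < coarse u w + 2 ^ (floor_log w + (u - floor_log w) div 2 - e)"
  using round_down[of w "floor_log w + (u - floor_log w) div 2 - e", folded coarse_def] assms by simp_all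

lemma coarse_mantissa: "mantissa e w \<Longrightarrow> coarse (floor_log w) w = w"
  by (simp add: coarse_def mantissa_def)

definition loss :: "nat \<Rightarrow> nat \<Rightarrow> real" where
  "loss u l = (if l < u then 2 ^ u / (2 ^ e * 2 ^ ((u - l + 1) div 2)) else 0)"

lemma coarse_loss:
  assumes "mantissa e w" "floor_log w \<le> u"
  shows "real w \<le> (if (u - floor_log w) div 2 \<le> e then real (coarse u w) else 0) + loss u (floor_log w)"
proof (cases "floor_log w = u")
  case True
  then show ?thesis using coarse_mantissa[OF assms(1)] by (simp add: loss_def)
next
  case False
  let ?l = "floor_log w" let ?a = "u - ?l"
  have lt: "?l < u" and w: "0 < w" using False assms by (auto simp: mantissa_def)
  have a: "?a = ?a div 2 + (?a + 1) div 2" by presburger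
  show ?thesis
  proof (cases "?a div 2 \<le> e")
    case True
    note c = coarse[OF w assms(2) True]
    show ?thesis
    proof (cases "e \<le> ?l + ?a div 2")
      case ge: True
      let ?g = "?l + ?a div 2 - e"
      have "u = l + x - e + e + y" if "u - l = x + y" "l < u" "e \<le> l + x" for l x y :: nat
        using that by linarith
      from this[OF a lt ge] have u: "u = ?g + e + (?a + 1) div 2" .
      have "(2::real) ^ (?g + e + (?a + 1) div 2) = 2 ^ ?g * (2 ^ e * 2 ^ ((?a + 1) div 2))"
        by (simp only: power_add mult.assoc)
      then have "(2::real) ^ u = 2 ^ ?g * (2 ^ e * 2 ^ ((?a + 1) div 2))"
        using arg_cong[OF u, of "\<lambda>x. (2::real) ^ x"] by (rule trans[rotated])
      then have "loss u ?l = 2 ^ ?g" using lt by (simp add: loss_def)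
      moreover have "real w \<le> real (coarse u w + 2 ^ ?g)"
        unfolding of_nat_le_iff using c(5) by (rule less_imp_le)
      ultimately show ?thesis using True by simp
    next
      case False
      then have "coarse u w = w" by (simp add: coarse_def)
      then show ?thesis using True by (simp add: loss_def)
    qed
  next
    case False
    have "w < 2 * 2 ^ ?l" by (rule floor_log_bounds)
    then have "real w \<le> real (2 * 2 ^ ?l)" unfolding of_nat_le_iff by (rule less_imp_le)
    also have "real (2 * 2 ^ ?l) = 2 * 2 ^ ?l" by simp
    also have "(2::real) * 2 ^ ?l \<le> 2 ^ u / (2 ^ e * 2 ^ ((?a + 1) div 2))"
    proof -
      have "Suc l + (e + y) \<le> u" if "u - l = x + y" "l < u" "\<not> x \<le> e" for l x y :: nat
        using that by linarith
      from this[OF a lt False] have "Suc ?l + (e + (?a + 1) div 2) \<le> u" .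
      then have "(2::real) ^ (Suc ?l + (e + (?a + 1) div 2)) \<le> 2 ^ u" by (intro power_increasing) auto
      then show ?thesis by (simp add: pos_le_divide_eq power_add)
    qed
    finally show ?thesis using False lt by (simp add: loss_def)
  qed
qed

lemma sum_half: "(\<Sum>a<2 * k. 1 / 2 ^ ((a + 2) div 2)) = (2 - 2 / 2 ^ k :: real)"
proof (induction k)
  case (Suc k)
  have "(\<Sum>a<2 * Suc k. 1 / 2 ^ ((a + 2) div 2)) =
    (\<Sum>a<2 * k. 1 / 2 ^ ((a + 2) div 2)) + 1 / 2 ^ Suc k + (1 / 2 ^ Suc k :: real)"
    by simp
  then show ?case unfolding Suc.IH by simp
qed simp

lemma sum_loss: "(\<Sum>l<u. loss u l) \<le> 2 * 2 ^ u / 2 ^ e"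
proof -
  have "(\<Sum>l<u. loss u l) = (\<Sum>a<u. loss u (u - Suc a))"
    by (rule sum.nat_diff_reindex[symmetric])
  also have "\<dots> = (\<Sum>a<u. 2 ^ u / 2 ^ e * (1 / 2 ^ ((a + 2) div 2)))"
    by (rule sum.cong) (auto simp: loss_def)
  also have "\<dots> = 2 ^ u / 2 ^ e * (\<Sum>a<u. 1 / 2 ^ ((a + 2) div 2))"
    by (rule sum_distrib_left[symmetric])
  also have "\<dots> \<le> 2 ^ u / 2 ^ e * 2"
  proof (rule mult_left_mono)
    have "(\<Sum>a<u. 1 / 2 ^ ((a + 2) div 2)) \<le> (\<Sum>a<2 * u. 1 / 2 ^ ((a + 2) div 2) :: real)"
      by (rule sum_mono2) auto
    also have "\<dots> \<le> 2" unfolding sum_half by simp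
    finally show "(\<Sum>a<u. 1 / 2 ^ ((a + 2) div 2)) \<le> (2::real)" .
  qed simp
  finally show ?thesis by (simp add: mult.commute)
qed

lemma sum_mset_by_key:
  fixes h :: "nat \<Rightarrow> real"
  assumes "\<forall>x\<in>#F. key x \<le> u" "h u = 0"
  shows "(\<Sum>x\<in>#F. h (key x)) = (\<Sum>l<u. real (size (filter_mset (\<lambda>x. key x = l) F)) * h l)"
  using assms(1)
proof (induction F)
  case (add x F)
  have "(\<Sum>l<u. real (size (filter_mset (\<lambda>x. key x = l) (add_mset x F))) * h l) =
    (\<Sum>l<u. real (size (filter_mset (\<lambda>x. key x = l) F)) * h l + (if l = key x then h l else 0))"
    by (rule sum.cong) (auto simp: algebra_simps)
  also have "\<dots> = (\<Sum>x\<in>#F. h (key x)) + h (key x)"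
    using add assms(2) by (auto simp: sum.distrib sum.delta' le_less)
  finally show ?case by simp
qed simp

definition leaf_values :: "nat \<Rightarrow> ('q \<Rightarrow> nat) \<Rightarrow> 'q set \<Rightarrow> nat multiset" where
  "leaf_values d c Q = image_mset (\<lambda>q. rounded (min (c q) d)) (mset_set Q)"

lemma sum_leaf_values:
  assumes "finite Q" "\<And>q. q \<in> Q \<Longrightarrow> 0 < c q" "d \<le> (\<Sum>q\<in>Q. c q)" "0 < d"
  shows "real d \<le> real (sum_mset (leaf_values d c Q)) + real d / 2 ^ e"
proof -
  have dm: "d \<le> (\<Sum>q\<in>Q. min (c q) d)"
  proof (cases "\<exists>q\<in>Q. d \<le> c q")
    case True
    then obtain q where q: "q \<in> Q" "d \<le> c q" by blast
    have "min (c q) d \<le> (\<Sum>q\<in>Q. min (c q) d)" by (rule member_le_sum) (use q assms in auto)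
    then show ?thesis using q by simp
  next
    case False
    then have "(\<Sum>q\<in>Q. min (c q) d) = (\<Sum>q\<in>Q. c q)" by (intro sum.cong) auto
    then show ?thesis using assms by simp
  qed
  have "d * (2 ^ e - 1) \<le> (\<Sum>q\<in>Q. min (c q) d) * (2 ^ e - 1)" using dm by (rule mult_right_mono) simp
  also have "\<dots> \<le> (\<Sum>q\<in>Q. rounded (min (c q) d) * 2 ^ e)"
    unfolding sum_distrib_right by (rule sum_mono) (use assms rounded(4) in auto)
  also have "\<dots> = sum_mset (leaf_values d c Q) * 2 ^ e"
    unfolding sum_distrib_right[symmetric] by (simp add: leaf_values_def sum_unfold_sum_mset)
  finally have "real (d * (2 ^ e - 1)) \<le> real (sum_mset (leaf_values d c Q) * 2 ^ e)"
    by (simp only: of_nat_le_iff)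
  then show ?thesis by (simp add: of_nat_diff field_simps)
qed

lemma cover_div:
  assumes "real d \<le> real s + 8 * real d / 2 ^ e" "3 \<le> e"
  shows "d \<le> s + d div 2 ^ (e - 3)"
proof (cases "d \<le> s")
  case False
  have "(2::real) ^ e = 2 ^ (e - 3) * 2 ^ 3" using assms(2) by (metis le_add_diff_inverse2 power_add)
  then have "8 * real d / 2 ^ e = real d / 2 ^ (e - 3)" by simp
  then have "real (d - s) \<le> real d / 2 ^ (e - 3)" using assms(1) False by (simp add: of_nat_diff)
  then have "real ((d - s) * 2 ^ (e - 3)) \<le> real d" by (simp add: pos_le_divide_eq)
  then have "(d - s) * 2 ^ (e - 3) \<le> d" by (simp only: of_nat_le_iff)
  then have "d - s \<le> d div 2 ^ (e - 3)" by (simp add: less_eq_div_iff_mult_less_eq)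
  then show ?thesis by simp
qed simp

lemma bin_plan:
  assumes Q: "finite Q" "\<And>q. q \<in> Q \<Longrightarrow> 0 < c q" "d \<le> (\<Sum>q\<in>Q. c q)" and d: "0 < d" "d \<le> n" and e: "3 \<le> e"
  shows "\<exists>M. (\<forall>p\<in>#M. good (level soft d) p) \<and> d \<le> sum_mset (image_mset fst M) + d div 2 ^ (e - 3)
    \<and> all_leaves M \<subseteq># leaf_values d c Q"
proof -
  let ?W = "leaf_values d c Q" and ?u = "floor_log d"
  have W: "0 < w \<and> w \<le> d \<and> mantissa e w \<and> floor_log w \<le> ?u" if w: "w \<in># ?W" for w
  proof -
    obtain q where q: "q \<in> Q" "w = rounded (min (c q) d)" using w Q(1) by (auto simp: leaf_values_def)
    have "0 < min (c q) d" using q Q d by auto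
    note r = rounded[OF this, folded q(2)]
    have "w \<le> d" using r(1) by simp
    then show ?thesis using r(3) floor_log_le_iff[of w d] by (simp add: mantissa_def)
  qed
  have sW: "real d \<le> real (sum_mset ?W) + real d / 2 ^ e" by (rule sum_leaf_values) (use Q d in auto)
  show ?thesis
  proof (cases soft)
    case False
    let ?M = "image_mset (\<lambda>w. (w, Leaf w)) ?W"
    have "all_leaves (image_mset (\<lambda>w. (w, Leaf w)) X) = X" for X by (induction X) auto
    then have "all_leaves ?M \<subseteq># ?W" by simp
    moreover have "d \<le> sum_mset (image_mset fst ?M) + d div 2 ^ (e - 3)"
    proof -
      have "real d / 2 ^ e \<le> 8 * real d / 2 ^ e" by (simp add: divide_right_mono)
      then show ?thesis using sW by (intro cover_div e) (simp add: image_mset.compositionality comp_def)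
    qed
    moreover have "good (level soft d) p" if "p \<in># ?M" for p
    proof -
      obtain w where w: "w \<in># ?W" "p = (w, Leaf w)" using \<open>p \<in># ?M\<close> by auto
      then have "allowed soft e n (level soft d) w" using W[of w] False d
        by (auto simp: allowed_def level_def mantissa_def)
      then show ?thesis unfolding good_def using w W[of w] by simp
    qed
    ultimately show ?thesis by blast
  next
    case True
    have un: "2 ^ ?u \<le> n" using floor_log_bounds(1)[OF d(1)] d(2) by simp
    obtain F where F: "forest ?u ?W F" and two: "\<And>l. l < ?u \<Longrightarrow> size (filter_mset (\<lambda>T. floor_log (val T) = l) F) \<le> 2"
      using glued_forest[OF True un, of ?W] W by blast
    define w where "w = (\<lambda>T. min (val T) d)"
    define G where "G = filter_mset (\<lambda>T. (?u - floor_log (val T)) div 2 \<le> e) F"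
    let ?M = "image_mset (\<lambda>T. (coarse ?u (w T), T)) G"
    have w: "0 < w T" "floor_log (w T) = floor_log (val T)" "floor_log (val T) \<le> ?u" "w T \<le> d" "mantissa e (val T)" "wf_tree T"
      if "T \<in># F" for T
    proof -
      have T: "wf_tree T" "mantissa e (val T)" "floor_log (val T) \<le> ?u" using F that by (auto simp: forest_def)
      then show "0 < w T" "w T \<le> d" "floor_log (val T) \<le> ?u" "mantissa e (val T)" "wf_tree T"
        using d by (auto simp: w_def mantissa_def)
      show "floor_log (w T) = floor_log (val T)"
        using T(3) floor_log_le_iff[of d "val T"] by (cases "val T \<le> d") (auto simp: w_def min_def)
    qed
    have "good (level soft d) p" if "p \<in># ?M" for p
    proof -
      obtain T where T: "T \<in># F" "(?u - floor_log (val T)) div 2 \<le> e" "p = (coarse ?u (w T), T)"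
      proof -
        obtain T where "T \<in># G" "p = (coarse ?u (w T), T)" using \<open>p \<in># ?M\<close> by auto
        then show thesis by (intro that[of T]) (simp_all add: G_def)
      qed
      note c = coarse[OF w(1)[OF T(1)], of ?u]
      have c: "coarse ?u (w T) \<le> w T" "floor_log (coarse ?u (w T)) = floor_log (val T)" "0 < coarse ?u (w T)"
        "2 ^ (floor_log (val T) + (?u - floor_log (val T)) div 2 - e) dvd coarse ?u (w T)"
        using c w[OF T(1)] T(2) by auto
      have "allowed soft e n (level soft d) (coarse ?u (w T))"
        using True c w[OF T(1)] T(2) d(2) by (auto simp: allowed_def level_def)
      moreover have "coarse ?u (w T) \<le> val T" using c(1) by (simp add: w_def)
      moreover have "level soft (coarse ?u (w T)) = level soft (val T)" using c(2) by (simp add: level_def)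
      ultimately show ?thesis unfolding good_def using T(3) w(6)[OF T(1)] by simp
    qed
    moreover have "all_leaves ?M \<subseteq># ?W"
    proof -
      have "all_leaves (image_mset (\<lambda>T. (v T, T)) X) = (\<Sum>T\<in>#X. leaves T)" for v X
        by (induction X) auto
      moreover have "F = G + filter_mset (\<lambda>T. \<not> (?u - floor_log (val T)) div 2 \<le> e) F"
        unfolding G_def by (rule multiset_partition)
      then have "(\<Sum>T\<in>#F. leaves T) = (\<Sum>T\<in>#G. leaves T) +
          (\<Sum>T\<in>#filter_mset (\<lambda>T. \<not> (?u - floor_log (val T)) div 2 \<le> e) F. leaves T)"
        by (metis image_mset_union sum_mset.union)
      moreover have "(\<Sum>T\<in>#F. leaves T) = ?W" using F unfolding forest_def by blast
      ultimately show ?thesis by (metis mset_subset_eq_add_left)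
    qed
    moreover have "d \<le> sum_mset (image_mset fst ?M) + d div 2 ^ (e - 3)"
    proof (rule cover_div[OF _ e])
      have sM: "sum_mset (image_mset fst ?M) = (\<Sum>T\<in>#G. coarse ?u (w T))"
        by (simp add: image_mset.compositionality comp_def)
      show "real d \<le> real (sum_mset (image_mset fst ?M)) + 8 * real d / 2 ^ e"
      proof (cases "\<exists>T\<in>#F. d \<le> val T")
        case True
        then obtain T where T: "T \<in># F" "d \<le> val T" by blast
        have wT: "w T = d" using T by (simp add: w_def)
        have TG: "T \<in># G" using T w(2)[OF T(1)] wT by (simp add: G_def)
        have cd: "coarse ?u d = rounded d" by (simp add: coarse_def rounded_def)
        have "coarse ?u (w T) \<le> (\<Sum>T\<in>#G. coarse ?u (w T))"
          using TG by (metis (no_types, lifting) image_mset_add_mset le_add1 multi_member_split sum_mset.add_mset)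
        then have 1: "real (rounded d) \<le> real (sum_mset (image_mset fst ?M))" unfolding sM wT cd of_nat_le_iff .
        have "real (d * (2 ^ e - 1)) \<le> real (rounded d * 2 ^ e)" using rounded(4)[OF d(1)] by (simp only: of_nat_le_iff)
        then have "real d \<le> real (rounded d) + real d / 2 ^ e" by (simp add: of_nat_diff field_simps)
        moreover have "real d / 2 ^ e \<le> 8 * real d / 2 ^ e" by (simp add: divide_right_mono)
        ultimately show ?thesis using 1 by linarith
      next
        case False
        then have wv: "w T = val T" if "T \<in># F" for T using that by (auto simp: w_def)
        have sv: "sum_mset ?W = (\<Sum>T\<in>#F. val T)"
        proof -
          have "sum_mset (\<Sum>T\<in>#X. leaves T) = (\<Sum>T\<in>#X. val T)" for X
            by (induction X) (auto simp: sum_leaves)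
          moreover have "(\<Sum>T\<in>#F. leaves T) = ?W" using F unfolding forest_def by blast
          ultimately show ?thesis by metis
        qed
        let ?k = "\<lambda>T. if (?u - floor_log (val T)) div 2 \<le> e then real (coarse ?u (val T)) else 0"
        have "real (\<Sum>T\<in>#X. val T) = (\<Sum>T\<in>#X. real (val T))" for X by (induction X) auto
        then have "real (\<Sum>T\<in>#F. val T) = (\<Sum>T\<in>#F. real (val T))" .
        also have "\<dots> \<le> (\<Sum>T\<in>#F. ?k T + loss ?u (floor_log (val T)))"
          by (rule sum_mset_mono) (use coarse_loss w in blast)
        also have "\<dots> = (\<Sum>T\<in>#F. ?k T) + (\<Sum>T\<in>#F. loss ?u (floor_log (val T)))"
          by (rule sum_mset.distrib)
        also have "(\<Sum>T\<in>#F. ?k T) = real (\<Sum>T\<in>#G. coarse ?u (w T))"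
        proof -
          have "(\<Sum>T\<in>#X. ?k T) = real (\<Sum>T\<in>#filter_mset (\<lambda>T. (?u - floor_log (val T)) div 2 \<le> e) X. coarse ?u (w T))"
            if "X \<subseteq># F" for X
            using that
          proof (induction X)
            case (add x X)
            then have "x \<in># F" "X \<subseteq># F" by (auto dest: mset_subset_eq_insertD mset_subset_eqD)
            then show ?case using add wv by auto
          qed simp
          then show ?thesis unfolding G_def by simp
        qed
        also have "(\<Sum>T\<in>#F. loss ?u (floor_log (val T))) =
            (\<Sum>l<?u. real (size (filter_mset (\<lambda>T. floor_log (val T) = l) F)) * loss ?u l)"
          by (rule sum_mset_by_key) (use w in \<open>auto simp: loss_def\<close>)
        also have "\<dots> \<le> (\<Sum>l<?u. 2 * loss ?u l)"
        proof (rule sum_mono)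
          fix l assume "l \<in> {..<?u}"
          then have "real (size (filter_mset (\<lambda>T. floor_log (val T) = l) F)) \<le> 2" using two[of l] by simp
          then show "real (size (filter_mset (\<lambda>T. floor_log (val T) = l) F)) * loss ?u l \<le> 2 * loss ?u l"
            by (rule mult_right_mono) (simp add: loss_def)
        qed
        also have "\<dots> = 2 * (\<Sum>l<?u. loss ?u l)" by (simp add: sum_distrib_left)
        also have "\<dots> \<le> 2 * (2 * 2 ^ ?u / 2 ^ e)" by (intro mult_left_mono sum_loss) simp
        also have "\<dots> \<le> 4 * real d / 2 ^ e"
        proof -
          have "real (2 ^ ?u) \<le> real d" using floor_log_bounds(1)[OF d(1)] by (simp only: of_nat_le_iff)
          then show ?thesis by (simp add: divide_right_mono)
        qed
        finally have "real (sum_mset ?W) \<le> real (\<Sum>T\<in>#G. coarse ?u (w T)) + 4 * real d / 2 ^ e"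
          unfolding sv by - simp
        then have "real d \<le> real (\<Sum>T\<in>#G. coarse ?u (w T)) + 5 * (real d / 2 ^ e)"
          using sW by linarith
        also have "5 * (real d / 2 ^ e) \<le> 8 * real d / 2 ^ e" by (simp add: field_simps)
        finally show ?thesis unfolding sM by simp
      qed
    qed
    ultimately show ?thesis by blast
  qed
qed

theorem cover_succeeds:
  fixes c :: "'q \<Rightarrow> nat" and Q :: "nat \<Rightarrow> 'q set" and dem :: "nat \<Rightarrow> nat"
  assumes Q: "\<And>b. b < m \<Longrightarrow> finite (Q b)" "\<And>b q. b < m \<Longrightarrow> q \<in> Q b \<Longrightarrow> 0 < c q"
    "\<And>b b'. b < m \<Longrightarrow> b' < m \<Longrightarrow> b \<noteq> b' \<Longrightarrow> Q b \<inter> Q b' = {}"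
    and dem: "\<And>b. b < m \<Longrightarrow> dem b \<le> (\<Sum>q\<in>Q b. c q)" "\<And>b. b < m \<Longrightarrow> 0 < dem b" "\<And>b. b < m \<Longrightarrow> dem b \<le> n"
    and e: "3 \<le> e"
    and total: "card (\<Union>b<m. Q b) \<le> n"
    and items: "\<And>x. 0 < x \<Longrightarrow> card {q \<in> \<Union>b<m. Q b. x \<le> min (c q) n} \<le> card {t. t < N \<and> x \<le> item t}"
    and slots: "\<And>b. b < m \<Longrightarrow> if soft then 0 < slots b else card (Q b) \<le> slots b"
    and tau: "\<And>b. b < m \<Longrightarrow> tau b = dem b - dem b div 2 ^ (e - 3)"
    and stg: "\<And>b. b < m \<Longrightarrow> stg b = level soft (dem b)" "\<And>b. b < m \<Longrightarrow> stg b \<le> top"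
  shows "\<exists>y. step\<^sup>*\<^sup>* start y \<and> final y"
proof -
  let ?W = "\<lambda>b. leaf_values (dem b) c (Q b)"
  have "\<forall>b. \<exists>M. b < m \<longrightarrow> (\<forall>p\<in>#M. good (level soft (dem b)) p) \<and>
      dem b \<le> sum_mset (image_mset fst M) + dem b div 2 ^ (e - 3) \<and> all_leaves M \<subseteq># ?W b"
  proof
    fix b
    show "\<exists>M. b < m \<longrightarrow> (\<forall>p\<in>#M. good (level soft (dem b)) p) \<and>
      dem b \<le> sum_mset (image_mset fst M) + dem b div 2 ^ (e - 3) \<and> all_leaves M \<subseteq># ?W b"
    proof (cases "b < m")
      case True
      from bin_plan[OF Q(1)[OF True] Q(2)[OF True] dem(1-3)[OF True] e] show ?thesis by blast
    qed simp
  qed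
  then obtain plan where plan: "\<And>b p. b < m \<Longrightarrow> p \<in># plan b \<Longrightarrow> good (level soft (dem b)) p"
    "\<And>b. b < m \<Longrightarrow> dem b \<le> sum_mset (image_mset fst (plan b)) + dem b div 2 ^ (e - 3)"
    "\<And>b. b < m \<Longrightarrow> all_leaves (plan b) \<subseteq># ?W b"
    by (metis (no_types, lifting) choice)
  have WQ: "size (?W b) = card (Q b)" if "b < m" for b using Q(1)[OF that] by (simp add: leaf_values_def)
  have sub: "(\<Sum>b<k. all_leaves (plan b)) \<subseteq># (\<Sum>b<k. ?W b)" if "k \<le> m" for k
    using that by (induction k) (auto intro!: subset_mset.add_mono plan(3))
  have W_U: "(\<Sum>b<m. ?W b) = (\<Sum>b<m. image_mset (\<lambda>q. rounded (min (c q) (dem b))) (mset_set (Q b)))"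
    by (simp add: leaf_values_def)
  have disj: "card (\<Union>b<m. A b) = (\<Sum>b<m. card (A b))" if "\<And>b. b < m \<Longrightarrow> A b \<subseteq> Q b" for A
  proof (rule card_UN_disjoint)
    show "\<forall>b\<in>{..<m}. finite (A b)" using that Q(1) finite_subset by blast
    show "\<forall>i\<in>{..<m}. \<forall>j\<in>{..<m}. i \<noteq> j \<longrightarrow> A i \<inter> A j = {}" using that Q(3) by blast
  qed simp
  have "size (\<Sum>b<k. ?W b) = (\<Sum>b<k. size (?W b))" for k by (induction k) auto
  then have sz: "size (\<Sum>b<m. ?W b) = card (\<Union>b<m. Q b)"
    unfolding disj[of Q, simplified] by (auto simp: WQ intro!: sum.cong)
  show ?thesis
  proof (rule reach_final[of plan])
    show "good (stg b) p" if "b < m" "p \<in># plan b" for b p using plan(1)[OF that] stg(1)[OF that(1)] by simp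
    show "tau b \<le> sum_mset (image_mset fst (plan b))" if "b < m" for b using plan(2)[OF that] tau[OF that] by simp
    show "if soft then plan b \<noteq> {#} \<longrightarrow> 0 < slots b else size (plan b) \<le> slots b" if b: "b < m" for b
    proof -
      have "size (plan b) \<le> size (?W b)"
        using size_le_all_leaves[of "plan b"] size_mset_mono[OF plan(3)[OF b]] by linarith
      then show ?thesis using slots[OF b] WQ[OF b] by (cases soft) simp_all
    qed
    show "stg b \<le> top" if "b < m" for b using stg(2)[OF that] .
    show "size (\<Sum>b<m. all_leaves (plan b)) \<le> n"
      using size_mset_mono[OF sub[of m]] sz total by simp
    show "hall 0 (\<Sum>b<m. all_leaves (plan b))" unfolding hall_def
    proof
      fix x assume x: "x \<in># (\<Sum>b<m. all_leaves (plan b))"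
      then have "x \<in># (\<Sum>b<m. ?W b)" using sub[of m] by (meson mset_subset_eqD order_refl)
      then obtain b q where b: "b < m" "q \<in> Q b" "x = rounded (min (c q) (dem b))"
        using Q(1) by (auto simp: leaf_values_def set_mset_sum)
      have "0 < min (c q) (dem b)" using b Q(2) dem(2) by auto
      then have x0: "0 < x" using rounded(3)[of "min (c q) (dem b)"] b(3) by (simp add: mantissa_def)
      have le: "rounded (min (c q) (dem b)) \<le> min (c q) n" if "b < m" "q \<in> Q b" for b q
      proof -
        have "0 < min (c q) (dem b)" using that Q(2) dem(2) by auto
        then show ?thesis using rounded(1)[of "min (c q) (dem b)"] dem(3)[OF that(1)] by linarith
      qed
      have "size (filter_mset (\<lambda>w. x \<le> w) (\<Sum>b<m. all_leaves (plan b))) \<le> size (filter_mset (\<lambda>w. x \<le> w) (\<Sum>b<m. ?W b))"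
        by (rule size_mset_mono[OF multiset_filter_mono[OF sub]]) simp
      also have "\<dots> = (\<Sum>b<m. size (filter_mset (\<lambda>w. x \<le> w) (?W b)))"
        by (induction m) auto
      also have "\<dots> = (\<Sum>b<m. card {q \<in> Q b. x \<le> rounded (min (c q) (dem b))})"
        by (rule sum.cong) (use Q(1) in \<open>auto simp: leaf_values_def filter_mset_image_mset filter_mset_mset_set\<close>)
      also have "\<dots> \<le> (\<Sum>b<m. card {q \<in> Q b. x \<le> min (c q) n})"
        by (intro sum_mono card_mono) (use Q(1) le order_trans in \<open>force+\<close>)
      also have "\<dots> = card (\<Union>b<m. {q \<in> Q b. x \<le> min (c q) n})"
        by (rule disj[symmetric]) auto
      also have "(\<Union>b<m. {q \<in> Q b. x \<le> min (c q) n}) = {q \<in> \<Union>b<m. Q b. x \<le> min (c q) n}" by auto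
      also have "card \<dots> \<le> card {t. t < N \<and> x \<le> item t}" by (rule items[OF x0])
      finally show "0 + size (filter_mset (\<lambda>w'. x \<le> w') (\<Sum>b<m. all_leaves (plan b))) \<le> card {t'. t' < N \<and> x \<le> item t'}"
        by simp
    qed
  qed
qed

end

section \<open>The program\<close>

abbreviation succ_of :: "nexp \<Rightarrow> nexp" where "succ_of e \<equiv> NAdd e (NLit 1)"

definition init :: "bool \<Rightarrow> prog" where
  "init soft =
     Assign ''n1'' (NAdd (var ''n'') (NLit 1));;
     Assign ''n2'' (NAdd (var ''n'') (NLit 2));;
     Assign ''L'' (NAdd (var ''n'') (NLit 6));;
     Assign ''five'' (NLit 5);;
     Assign ''stages'' (if soft then NAdd (var ''n'') (NLit 1) else NLit 1)"

definition bucket :: prog where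
  "bucket =
     For ''p'' ''P'' (When (NLess (NLit 0) (NGet ''k'' (var ''p'')))
       (Assign ''v'' (NGet ''c'' (var ''p''));;
        When (NLess (var ''n'') (var ''v'')) (Assign ''v'' (var ''n''));;
        Put ''next'' (var ''p'') (NGet ''head'' (var ''v''));;
        Put ''head'' (var ''v'') (succ_of (var ''p''))))"

definition powers :: prog where
  "powers =
     Put ''row'' (NLit 0) (NLit 0);; Put ''mul'' (NLit 0) (NLit 0);; Put ''pow'' (NLit 0) (NLit 1);;
     Put ''half'' (NLit 0) (NLit 0);; Put ''half'' (NLit 1) (NLit 0);;
     For ''i'' ''n1''
       (Put ''row'' (succ_of (var ''i'')) (NAdd (NGet ''row'' (var ''i'')) (var ''n1''));;
        Put ''mul'' (succ_of (var ''i'')) (NAdd (NGet ''mul'' (var ''i'')) (var ''n''));;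
        Put ''pow'' (succ_of (var ''i'')) (NAdd (NGet ''pow'' (var ''i'')) (NGet ''pow'' (var ''i'')));;
        Put ''half'' (NAdd (var ''i'') (NLit 2)) (succ_of (NGet ''half'' (var ''i''))))"

definition quotients :: "vname \<Rightarrow> nat \<Rightarrow> prog" where
  "quotients x D =
     Assign ''rem'' (NLit 0);; Assign ''quo'' (NLit 0);; Put x (NLit 0) (NLit 0);;
     For ''i'' ''n''
       (Assign ''rem'' (succ_of (var ''rem''));;
        When (NEq (var ''rem'') (NLit D))
          (Assign ''rem'' (NLit 0);; Assign ''quo'' (succ_of (var ''quo'')));;
        Put x (succ_of (var ''i'')) (var ''quo''))"

definition mark_level :: prog where
  "mark_level =
     Assign ''v'' (NGet ''pow'' (var ''l''));;
     For ''i'' ''n1''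
       (When (BAnd (NLess (var ''v'') (NGet ''pow'' (succ_of (var ''l'')))) (NLe (var ''v'') (var ''n'')))
          (Put ''ok'' (NAdd (NGet ''row'' (var ''j'')) (var ''v'')) (NLit 1));;
        Assign ''v'' (NAdd (var ''v'') (var ''g'')))"

definition mark_all :: "bool \<Rightarrow> nat \<Rightarrow> prog" where
  "mark_all soft e =
     For ''j'' ''stages'' (For ''l'' ''n1''
       (When (BAnd (NLe (NSub (var ''l'') (if soft then NLit 0 else var ''l'')) (var ''j''))
               (NLe (NGet ''half'' (NSub (var ''j'') (var ''l''))) (NLit e)))
         (Assign ''g'' (NGet ''pow'' (NSub (NAdd (var ''l'') (NGet ''half'' (NSub (var ''j'') (var ''l'')))) (NLit e)));;
          mark_level)))"

definition scale :: "vname \<Rightarrow> vname \<Rightarrow> prog" where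
  "scale x l =
     Assign ''acc'' (NLit 0);; For ''z'' l (Assign ''acc'' (NAdd (var ''acc'') (var x)));; Assign x (var ''acc'')"

definition count_states :: prog where
  "count_states =
     Assign ''S'' (NLit 0);;
     For ''j'' ''stages''
       (Assign ''pr'' (NLit 1);;
        For ''v'' ''n1''
          (When (NLess (NLit 0) (NGet ''ok'' (NAdd (NGet ''row'' (var ''j'')) (var ''v'')))) (scale ''pr'' ''n1''));;
        Assign ''S'' (NAdd (var ''S'') (var ''pr'')));;
     For ''h'' ''five'' (scale ''S'' ''n2'')"

definition pop_item :: prog where
  "pop_item =
     When (NLess (NLit 0) (var ''ptr''))
       (Put ''item'' (var ''N'') (var ''v'');;
        Put ''itype'' (var ''N'') (NSub (var ''ptr'') (NLit 1));;
        Assign ''N'' (succ_of (var ''N''));;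
        Assign ''used'' (succ_of (var ''used''));;
        When (NLe (NGet ''k'' (NSub (var ''ptr'') (NLit 1))) (var ''used''))
          (Assign ''ptr'' (NGet ''next'' (NSub (var ''ptr'') (NLit 1)));; Assign ''used'' (NLit 0)))"

definition list_items :: prog where
  "list_items =
     Assign ''N'' (NLit 0);;
     For ''i'' ''n''
       (Assign ''v'' (NSub (var ''n'') (var ''i''));;
        Assign ''ptr'' (NGet ''head'' (var ''v''));; Assign ''used'' (NLit 0);;
        For ''z'' ''n'' pop_item)"

definition tables :: "bool \<Rightarrow> nat \<Rightarrow> prog" where
  "tables soft e =
     powers;; quotients ''tol'' (2 ^ (e - 3));; quotients ''ext'' (2 ^ (e - 5));; mark_all soft e;;
     count_states;; list_items"

definition facilities_near :: prog where
  "facilities_near =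
     For ''f'' ''n''
       (Put ''G'' (var ''f'') (NLit 0);;
        When (BAnd (NLess (NLit 0) (NGet ''F'' (var ''f''))) (NEq (NGet ''cf'' (var ''f'')) (NLit 0)))
          (For ''z'' ''n''
            (When (BAnd (NLess (NLit 0) (NGet ''inJ'' (var ''z'')))
                (BNot (RLess (RGet ''R'' (NLit 0)) (RGet ''d'' (NAdd (NGet ''mul'' (var ''z'')) (var ''f''))))))
              (Put ''G'' (var ''f'') (NLit 1)))))"

definition clients_near :: prog where
  "clients_near =
     Assign ''nK'' (NLit 0);;
     For ''z'' ''n''
       (Put ''K'' (var ''z'') (NGet ''inJ'' (var ''z''));;
        When (BAnd (NLess (NLit 0) (NGet ''C'' (var ''z''))) (NEq (NGet ''cc'' (var ''z'')) (NLit 0)))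
          (For ''f'' ''n''
            (When (BAnd (NLess (NLit 0) (NGet ''G'' (var ''f'')))
                (BNot (RLess (RGet ''R'' (NLit 0)) (RGet ''d'' (NAdd (NGet ''mul'' (var ''z'')) (var ''f''))))))
              (Put ''K'' (var ''z'') (NLit 1))));;
        Assign ''nK'' (NAdd (var ''nK'') (NGet ''K'' (var ''z''))))"

definition grow :: prog where
  "grow =
     For ''z'' ''n'' (Put ''inJ'' (var ''z'') (NLit 0));;
     Put ''inJ'' (var ''x'') (NLit 1);; Assign ''nJ'' (NLit 1);; Assign ''done'' (NLit 0);;
     For ''st'' ''n1'' (When (NEq (var ''done'') (NLit 0))
       (facilities_near;; clients_near;;
        If (NLe (var ''nK'') (NAdd (var ''nJ'') (NGet ''tol'' (var ''nJ''))))
          (Assign ''done'' (NLit 1))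
          (For ''z'' ''n'' (Put ''inJ'' (var ''z'') (NGet ''K'' (var ''z'')));; Assign ''nJ'' (var ''nK''))))"

definition record_cluster :: "bool \<Rightarrow> prog" where
  "record_cluster soft =
     Put ''dem'' (var ''m'') (var ''nJ'');;
     Put ''tau'' (var ''m'') (NSub (var ''nJ'') (NGet ''tol'' (var ''nJ'')));;
     Put ''stg'' (var ''m'') (NLit 0);;
     (if soft then For ''l'' ''n1'' (When (NLe (NGet ''pow'' (var ''l'')) (var ''nJ'')) (Put ''stg'' (var ''m'') (var ''l'')))
      else Nop);;
     Assign ''nf'' (NLit 0);;
     For ''f'' ''n'' (When (NLess (NLit 0) (NGet ''G'' (var ''f'')))
       (Put ''cf'' (var ''f'') (succ_of (var ''m''));;
        Put ''loc'' (NAdd (NGet ''row'' (var ''m'')) (var ''nf'')) (var ''f'');;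
        Assign ''nf'' (succ_of (var ''nf''))));;
     Put ''slots'' (var ''m'') (var ''nf'');;
     For ''z'' ''n'' (When (NLess (NLit 0) (NGet ''K'' (var ''z''))) (Put ''cc'' (var ''z'') (succ_of (var ''m''))));;
     Assign ''m'' (succ_of (var ''m''))"

definition clustering :: "bool \<Rightarrow> prog" where
  "clustering soft =
     For ''z'' ''n'' (Put ''cf'' (var ''z'') (NLit 0);; Put ''cc'' (var ''z'') (NLit 0));; Assign ''m'' (NLit 0);;
     For ''x'' ''n''
       (When (BAnd (NLess (NLit 0) (NGet ''C'' (var ''x''))) (NEq (NGet ''cc'' (var ''x'')) (NLit 0)))
          (grow;; record_cluster soft))"

abbreviation reg :: "nat \<Rightarrow> nexp" where "reg i \<equiv> NAdd (var ''n'') (NLit i)"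

abbreviation cell :: "nexp \<Rightarrow> nexp" where "cell e \<equiv> NGet ''y'' e"

abbreviation row_of :: "nexp \<Rightarrow> nexp" where "row_of e \<equiv> NGet ''base'' e"

definition load_state :: prog where
  "load_state = For ''l'' ''L'' (Put ''y'' (var ''l'') (NGet ''X'' (NAdd (row_of (var ''q'')) (var ''l''))))"

definition make_move :: "bool \<Rightarrow> prog" where
  "make_move soft =
     Assign ''good'' (NLit 0);;
     If (NEq (var ''kk'') (NLit 0))
       (When (BAnd (NLess (NLit 0) (var ''v'')) (NLess (NLit 0) (cell (reg 4))))
         (Assign ''good'' (NLit 1);;
          Put ''y'' (var ''v'') (succ_of (cell (var ''v'')));;
          Put ''y'' (reg 3) (NSub (cell (reg 3)) (var ''v''));;
          Put ''y'' (reg 4) (NSub (cell (reg 4)) (NLit (if soft then 0 else 1)))))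
     (If (NEq (var ''kk'') (NLit 1))
       (When (BAnd (NLess (cell (reg 2)) (var ''m'')) (NEq (cell (reg 3)) (NLit 0)))
         (Assign ''good'' (NLit 1);;
          If (NEq (NGet ''stg'' (cell (reg 2))) (cell (reg 1)))
            (Put ''y'' (reg 3) (NGet ''tau'' (cell (reg 2)));; Put ''y'' (reg 4) (NGet ''slots'' (cell (reg 2))))
            (Put ''y'' (reg 3) (NLit 0);; Put ''y'' (reg 4) (NLit 0));;
          Put ''y'' (reg 2) (succ_of (cell (reg 2)))))
     (If (NEq (var ''kk'') (NLit 2))
       (When (BAnd (NLess (NLit 0) (cell (var ''v'')))
               (BAnd (NLess (cell (reg 5)) (var ''N'')) (NLe (var ''v'') (NGet ''item'' (cell (reg 5))))))
         (Assign ''good'' (NLit 1);;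
          Put ''y'' (var ''v'') (NSub (cell (var ''v'')) (NLit 1));;
          Put ''y'' (reg 5) (succ_of (cell (reg 5)))))
     (If (NEq (var ''kk'') (NLit 3))
       (When (BAnd (NLess (NLit 0) (NLit (if soft then 1 else 0)))
          (BAnd (NLess (NLit 0) (cell (var ''v'')))
          (BAnd (NLess (NLit 0) (var ''w'')) (BAnd (NLess (var ''w'') (var ''v''))
          (BAnd (NLess (NLit 0) (var ''u'')) (BAnd (NLess (var ''u'') (var ''v''))
            (NLe (var ''v'') (NAdd (var ''w'') (var ''u'')))))))))
         (Assign ''good'' (NLit 1);;
          Put ''y'' (var ''v'') (NSub (cell (var ''v'')) (NLit 1));;
          Put ''y'' (var ''w'') (succ_of (cell (var ''w'')));;
          Put ''y'' (var ''u'') (succ_of (cell (var ''u'')))))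
       (When (BAnd (NLess (NLit 0) (cell (reg 1)))
               (BAnd (NEq (cell (reg 2)) (var ''m'')) (NEq (cell (reg 3)) (NLit 0))))
         (Assign ''good'' (NLit 1);;
          Put ''y'' (reg 1) (NSub (cell (reg 1)) (NLit 1));;
          Put ''y'' (reg 2) (NLit 0);;
          Put ''y'' (reg 4) (NLit 0))))))"

definition check_state :: prog where
  "check_state =
     For ''l'' ''n1''
       (When (BAnd (NLess (NLit 0) (cell (var ''l'')))
               (BNot (BAnd (NLess (NLit 0) (NGet ''ok'' (NAdd (NGet ''row'' (cell (reg 1))) (var ''l''))))
                 (NLe (cell (var ''l'')) (var ''n'')))))
         (Assign ''good'' (NLit 0)))"

definition find_state :: prog where
  "find_state =
     For ''i'' ''S'' (When (NLess (var ''i'') (var ''cnt''))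
       (Assign ''eq'' (NLit 1);;
        For ''l'' ''L''
          (When (BNot (NEq (cell (var ''l'')) (NGet ''X'' (NAdd (row_of (var ''i'')) (var ''l'')))))
            (Assign ''eq'' (NLit 0)));;
        When (NEq (var ''eq'') (NLit 1)) (Assign ''good'' (NLit 0))))"

definition append_state :: prog where
  "append_state =
     When (NEq (var ''good'') (NLit 1))
       (For ''l'' ''L'' (Put ''X'' (NAdd (row_of (var ''cnt'')) (var ''l'')) (cell (var ''l'')));;
        Put ''par'' (var ''cnt'') (var ''q'');;
        Put ''mk'' (var ''cnt'') (var ''kk'');;
        Put ''mv'' (var ''cnt'') (var ''v'');;
        Put ''mw'' (var ''cnt'') (var ''w'');;
        Put ''mu'' (var ''cnt'') (var ''u'');;
        Put ''base'' (succ_of (var ''cnt'')) (NAdd (row_of (var ''cnt'')) (var ''L''));;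
        Assign ''cnt'' (succ_of (var ''cnt'')))"

definition search :: "bool \<Rightarrow> prog" where
  "search soft =
     Put ''base'' (NLit 0) (NLit 0);;
     For ''l'' ''L'' (Put ''X'' (var ''l'') (NLit 0));;
     Put ''X'' (reg 1) (NSub (var ''stages'') (NLit 1));;
     Put ''base'' (NLit 1) (var ''L'');;
     Assign ''cnt'' (NLit 1);;
     For ''q'' ''S'' (When (NLess (var ''q'') (var ''cnt''))
       (For ''kk'' ''five'' (For ''v'' ''n1'' (For ''w'' ''n1'' (For ''u'' ''n1''
         (load_state;; make_move soft;; check_state;; find_state;; append_state))))))"

definition find_final :: prog where
  "find_final =
     Assign ''found'' (NLit 0);;
     For ''q'' ''S'' (When (NLess (var ''q'') (var ''cnt''))
       (load_state;;
        Assign ''eq'' (NLit 0);;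
        When (BAnd (NEq (cell (reg 1)) (NLit 0)) (BAnd (NEq (cell (reg 2)) (var ''m'')) (NEq (cell (reg 3)) (NLit 0))))
          (Assign ''eq'' (NLit 1));;
        For ''l'' ''n1'' (When (NLess (NLit 0) (cell (var ''l''))) (Assign ''eq'' (NLit 0)));;
        When (NEq (var ''eq'') (NLit 1)) (Assign ''found'' (NLit 1);; Assign ''fin'' (var ''q''))))"

definition trace :: prog where
  "trace =
     Assign ''len'' (NLit 0);; Assign ''q'' (var ''fin'');;
     For ''z'' ''S'' (When (NLess (NLit 0) (var ''q''))
       (Put ''path'' (var ''len'') (var ''q'');;
        Assign ''len'' (succ_of (var ''len''));;
        Assign ''q'' (NGet ''par'' (var ''q''))))"

abbreviation own_at :: "nexp \<Rightarrow> nexp \<Rightarrow> nexp" where "own_at v i \<equiv> NAdd (NGet ''row'' v) i"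

abbreviation st_at :: "nexp \<Rightarrow> nexp \<Rightarrow> nexp" where "st_at q l \<equiv> NGet ''X'' (NAdd (row_of q) l)"

definition replay_move :: prog where
  "replay_move =
     Assign ''q'' (NGet ''path'' (NSub (NSub (var ''len'') (NLit 1)) (var ''z'')));;
     Assign ''p'' (NGet ''par'' (var ''q''));;
     Assign ''v'' (NGet ''mv'' (var ''q''));; Assign ''w'' (NGet ''mw'' (var ''q''));; Assign ''u'' (NGet ''mu'' (var ''q''));;
     Assign ''o'' (NGet ''own'' (own_at (var ''v'') (NSub (st_at (var ''p'') (var ''v'')) (NLit 1))));;
     If (NEq (NGet ''mk'' (var ''q'')) (NLit 0))
       (Put ''own'' (own_at (var ''v'') (st_at (var ''p'') (var ''v''))) (NSub (st_at (var ''p'') (reg 2)) (NLit 1)))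
     (If (NEq (NGet ''mk'' (var ''q'')) (NLit 2))
       (Put ''asg'' (st_at (var ''p'') (reg 5)) (var ''o''))
     (When (NEq (NGet ''mk'' (var ''q'')) (NLit 3))
       (Put ''own'' (own_at (var ''w'') (st_at (var ''p'') (var ''w''))) (var ''o'');;
        Put ''own'' (own_at (var ''u'') (NSub (st_at (var ''q'') (var ''u'')) (NLit 1))) (var ''o''))))"

definition replay :: prog where
  "replay = For ''z'' ''S'' (When (NLess (var ''z'') (var ''len'')) replay_move)"

definition serve :: prog where
  "serve =
     Assign ''ld'' (NLit 0);;
     For ''z'' ''n''
       (When (BAnd (NLess (NLit 0) (NGet ''C'' (var ''z'')))
               (BAnd (NEq (NGet ''cc'' (var ''z'')) (succ_of (var ''o'')))
               (BAnd (NEq (NGet ''av'' (var ''z'')) (NLit 0))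
                 (NLe (var ''ld'') (NAdd (NGet ''item'' (var ''t'')) (NGet ''ext'' (NGet ''item'' (var ''t''))))))))
         (Put ''assignment'' (var ''z'') (var ''t'');;
          Put ''av'' (var ''z'') (NLit 1);;
          Assign ''ld'' (succ_of (var ''ld''))))"

definition emit_output :: "bool \<Rightarrow> prog" where
  "emit_output soft =
     Assign ''facilities'' (st_at (var ''fin'') (reg 5));;
     For ''z'' ''n'' (Put ''lc'' (var ''z'') (NLit 0);; Put ''av'' (var ''z'') (NLit 0));;
     For ''t'' ''N'' (When (NLess (var ''t'') (var ''facilities''))
       (Put ''type'' (var ''t'') (NGet ''itype'' (var ''t''));;
        Assign ''o'' (NGet ''asg'' (var ''t''));;
        Put ''location'' (var ''t'') (NGet ''loc'' (own_at (var ''o'') (NGet ''lc'' (var ''o''))));;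
        Put ''lc'' (var ''o'') (NAdd (NGet ''lc'' (var ''o'')) (NLit (if soft then 0 else 1)));;
        serve))"

definition attempt :: "bool \<Rightarrow> prog" where
  "attempt soft =
     clustering soft;; search soft;; find_final;;
     When (NEq (var ''found'') (NLit 1))
       (trace;; replay;; emit_output soft;; PutR ''best'' (NLit 0) (RGet ''R'' (NLit 0));; Assign ''solved'' (NLit 1))"

definition main_loop :: "bool \<Rightarrow> prog" where
  "main_loop soft =
     For ''a'' ''n'' (For ''b'' ''n''
       (PutR ''R'' (NLit 0) (RGet ''d'' (NAdd (NGet ''mul'' (var ''a'')) (var ''b'')));;
        When (BNot (BAnd (NEq (var ''solved'') (NLit 1)) (BNot (RLess (RGet ''R'' (NLit 0)) (RGet ''best'' (NLit 0))))))
          (attempt soft)))"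

definition hck_program :: "bool \<Rightarrow> nat \<Rightarrow> prog" where
  "hck_program soft e = init soft;; bucket;; tables soft e;; main_loop soft"

lemma proper_hck_program: "proper (hck_program soft e)"
  by (simp add: hck_program_def init_def bucket_def tables_def powers_def quotients_def mark_level_def
      mark_all_def scale_def count_states_def pop_item_def list_items_def facilities_near_def
      clients_near_def grow_def record_cluster_def clustering_def load_state_def make_move_def
      check_state_def find_state_def append_state_def search_def find_final_def trace_def
      replay_move_def replay_def serve_def emit_output_def attempt_def main_loop_def)

section \<open>Correctness of the preprocessing\<close>

lemma powers_post:
  assumes "fst s ''n'' 0 = n" "fst s ''n1'' 0 = Suc n"
  shows "post powers s (\<lambda>s'. \<forall>i\<le>Suc n. fst s' ''row'' i = i * Suc n \<and> fst s' ''mul'' i = i * n \<and>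
    fst s' ''pow'' i = 2 ^ i \<and> fst s' ''half'' i = i div 2)"
  unfolding powers_def post_simps
proof (rule post_For[where N = "Suc n" and I = "\<lambda>i s'. (\<forall>j\<le>i. fst s' ''row'' j = j * Suc n \<and>
    fst s' ''mul'' j = j * n \<and> fst s' ''pow'' j = 2 ^ j) \<and> (\<forall>j\<le>Suc i. fst s' ''half'' j = j div 2)"], goal_cases)
  case (5 i s')
  note ag = agreeD[OF 5(3)]
  have "fst s' ''row'' i = i * Suc n" "fst s' ''mul'' i = i * n" "fst s' ''pow'' i = 2 ^ i" "fst s' ''half'' i = i div 2"
    using 5(2) by simp_all
  then have "fst s' ''row'' i + fst s' ''n1'' 0 = Suc i * Suc n" "fst s' ''mul'' i + fst s' ''n'' 0 = Suc i * n"
    "fst s' ''pow'' i + fst s' ''pow'' i = 2 ^ Suc i" "Suc (fst s' ''half'' i) = Suc (Suc i) div 2"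
    using assms by (simp_all add: ag)
  then show ?case using 5(2,4) by (simp add: le_Suc_eq del: mult_Suc mult_Suc_right power_Suc)
qed (use assms in \<open>auto simp: le_Suc_eq\<close>)

lemma quotients_post:
  assumes "fst s ''n'' 0 = n" "0 < D" "x \<notin> {''rem'', ''quo'', ''i'', ''n''}"
  shows "post (quotients x D) s (\<lambda>s'. \<forall>i\<le>n. fst s' x i = i div D)"
  unfolding quotients_def post_simps
proof (rule post_For[where N = n and I = "\<lambda>i s'. (\<forall>j\<le>i. fst s' x j = j div D) \<and>
    fst s' ''rem'' 0 = i mod D \<and> fst s' ''quo'' 0 = i div D"], goal_cases)
  case (5 i s')
  note ag = agreeD[OF 5(3)]
  show ?case using 5(1,2,4) assms by (auto simp: ag le_Suc_eq mod_Suc div_Suc)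
qed (use assms in auto)

lemma addr_inject: "v \<le> n \<Longrightarrow> v' \<le> n \<Longrightarrow> j * Suc n + v = j' * Suc n + v' \<longleftrightarrow> j = j' \<and> v = v'"
proof
  assume v: "v \<le> n" "v' \<le> n" and e: "j * Suc n + v = j' * Suc n + v'"
  have "(j * Suc n + v) div Suc n = j" if "v \<le> n" for j v
    using that div_mult_self1[of "Suc n" v j] by (simp add: add.commute del: mult_Suc_right)
  from this[OF v(1)] this[OF v(2)] have "(j * Suc n + v) div Suc n = j" "(j' * Suc n + v') div Suc n = j'" .
  then show "j = j' \<and> v = v'" using e by simp
qed simp

lemma mark_level_post:
  assumes "fst s ''n'' 0 = n" "fst s ''n1'' 0 = Suc n" "\<forall>i\<le>Suc n. fst s ''pow'' i = 2 ^ i"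
    "fst s ''l'' 0 = l" "l \<le> n" "fst s ''g'' 0 = 2 ^ g" "g \<le> l" "fst s ''row'' (fst s ''j'' 0) = r"
  shows "post mark_level s (\<lambda>s'. \<forall>x. fst s' ''ok'' x =
    (if \<exists>v. x = r + v \<and> 2 ^ l \<le> v \<and> v < 2 * 2 ^ l \<and> v \<le> n \<and> 2 ^ g dvd v then 1 else fst s ''ok'' x))"
  unfolding mark_level_def post_simps
proof (rule post_For[where N = "Suc n" and I = "\<lambda>i s'. fst s' ''v'' 0 = 2 ^ l + i * 2 ^ g \<and>
  (\<forall>x. fst s' ''ok'' x =
    (if \<exists>v. x = r + v \<and> 2 ^ l \<le> v \<and> v < 2 * 2 ^ l \<and> v \<le> n \<and> 2 ^ g dvd v \<and> v < 2 ^ l + i * 2 ^ g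
     then 1 else fst s ''ok'' x))"], goal_cases)
  case (5 i s')
  note ag = agreeD[OF 5(3)]
  have dl: "(2::nat) ^ g dvd 2 ^ l" using assms(7) by (rule le_imp_power_dvd)
  have nxt: "2 ^ g dvd v \<and> v < 2 ^ l + Suc i * 2 ^ g \<longleftrightarrow>
      (2 ^ g dvd v \<and> v < 2 ^ l + i * 2 ^ g) \<or> v = 2 ^ l + i * 2 ^ g" for v :: nat
  proof -
    obtain q where q: "(2::nat) ^ l = 2 ^ g * q" using dl by blast
    show ?thesis
    proof (cases "2 ^ g dvd v")
      case True
      then obtain k where "v = 2 ^ g * k" by blast
      moreover have "2 ^ g * k < 2 ^ g * q + x * 2 ^ g \<longleftrightarrow> k < q + x" for x :: nat
        using mult_less_cancel1[of "2 ^ g" k "q + x"] by (simp add: algebra_simps)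
      moreover have "2 ^ g * k = 2 ^ g * q + x * 2 ^ g \<longleftrightarrow> k = q + x" for x :: nat
        using mult_cancel1[of "2 ^ g" k "q + x"] by (simp add: algebra_simps)
      ultimately show ?thesis unfolding q by (auto simp: less_Suc_eq simp del: mult_Suc)
    next
      case False
      then show ?thesis using dl by auto
    qed
  qed
  let ?v = "2 ^ l + i * 2 ^ g" and ?v' = "2 ^ l + Suc i * 2 ^ g"
  let ?P = "\<lambda>v. 2 ^ l \<le> v \<and> v < 2 * 2 ^ l \<and> v \<le> n \<and> 2 ^ g dvd v"
  let ?E = "\<lambda>b x. \<exists>v. x = r + v \<and> 2 ^ l \<le> v \<and> v < 2 * 2 ^ l \<and> v \<le> n \<and> 2 ^ g dvd v \<and> v < b"
  have E: "?E ?v' x \<longleftrightarrow> ?E ?v x \<or> x = r + ?v \<and> ?v < 2 * 2 ^ l \<and> ?v \<le> n" for x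
  proof -
    have "?P ?v \<longleftrightarrow> ?v < 2 * 2 ^ l \<and> ?v \<le> n" using dl by simp
    then show ?thesis using nxt by (smt (verit, best))
  qed
  have v: "fst s' ''v'' 0 = ?v" and ok: "\<And>x. fst s' ''ok'' x = (if ?E ?v x then 1 else fst s ''ok'' x)"
    using 5(2) by blast+
  have r: "fst s' ''row'' (fst s' ''j'' 0) = r" "fst s' ''pow'' (Suc (fst s' ''l'' 0)) = 2 * 2 ^ l" "fst s' ''n'' 0 = n"
    "fst s' ''g'' 0 = 2 ^ g"
    using assms by (simp_all add: ag)
  have v': "?v + 2 ^ g = ?v'" by simp
  show ?case
  proof (cases "?v < 2 * 2 ^ l \<and> ?v \<le> n")
    case True
    then show ?thesis
      using r v v' ok by (simp add: E del: mult_Suc) blast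
  next
    case False
    then have "?E ?v' x \<longleftrightarrow> ?E ?v x" for x using E by blast
    then show ?thesis
      using r v v' ok False by (simp del: mult_Suc) blast
  qed
next
  case (6 s')
  have "v < 2 ^ l + Suc n * 2 ^ g" if "v \<le> n" for v :: nat
  proof -
    have "v < Suc n * 1" using that by simp
    also have "\<dots> \<le> Suc n * 2 ^ g" by (intro mult_le_mono2) simp
    finally show ?thesis by simp
  qed
  then have "(\<exists>v. x = r + v \<and> 2 ^ l \<le> v \<and> v < 2 * 2 ^ l \<and> v \<le> n \<and> 2 ^ g dvd v \<and> v < 2 ^ l + Suc n * 2 ^ g) \<longleftrightarrow>
    (\<exists>v. x = r + v \<and> 2 ^ l \<le> v \<and> v < 2 * 2 ^ l \<and> v \<le> n \<and> 2 ^ g dvd v)" for x by blast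
  then show ?case using 6(1) by simp
qed (use assms in auto)

lemma floor_log_iff: "0 < v \<Longrightarrow> floor_log v = l \<longleftrightarrow> 2 ^ l \<le> v \<and> v < 2 * 2 ^ l"
  using floor_log_bounds[of v] floor_log_eqI[of v l] by auto

lemma floor_log_less: "0 < v \<Longrightarrow> floor_log v < v"
  using floor_log_bounds(1)[of v] less_exp[of "floor_log v"] by linarith

lemma mark_all_post:
  assumes "fst s ''n'' 0 = n" "fst s ''n1'' 0 = Suc n" "fst s ''stages'' 0 = Suc tp"
    "tp = (if soft then n else 0)"
    "\<forall>i\<le>Suc n. fst s ''row'' i = i * Suc n \<and> fst s ''pow'' i = 2 ^ i \<and> fst s ''half'' i = i div 2"
    "fst s ''ok'' = (\<lambda>_. 0)"
  shows "post (mark_all soft e) s (\<lambda>s'. \<forall>j\<le>tp. \<forall>v\<le>n.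
    fst s' ''ok'' (j * Suc n + v) = (if allowed soft e n j v then 1 else 0))"
  unfolding mark_all_def
proof (rule post_For[where N = "Suc tp" and I = "\<lambda>j s'. \<forall>j'\<le>n. \<forall>v\<le>n.
    fst s' ''ok'' (j' * Suc n + v) = (if j' < j \<and> allowed soft e n j' v then 1 else 0)"], goal_cases)
  case (5 j s1)
  note ag1 = agreeD[OF 5(3)]
  have jn: "j \<le> n" using 5(1) assms(4) by (auto split: if_splits)
  show ?case
  proof (rule post_For[where N = "Suc n" and I = "\<lambda>l s'. \<forall>j'\<le>n. \<forall>v\<le>n.
      fst s' ''ok'' (j' * Suc n + v) =
      (if (j' < j \<or> j' = j \<and> floor_log v < l \<and> 0 < v) \<and> allowed soft e n j' v then 1 else 0)"], goal_cases)
    case (5 l s2)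
    note ag2 = agreeD[OF 5(3)]
    have R: "fst s2 ''n'' 0 = n" "fst s2 ''n1'' 0 = Suc n" "fst s2 ''j'' 0 = j" "fst s2 ''l'' 0 = l"
      "\<forall>i\<le>Suc n. fst s2 ''row'' i = i * Suc n \<and> fst s2 ''pow'' i = 2 ^ i \<and> fst s2 ''half'' i = i div 2"
      using assms 5(4) \<open>fst s1 ''j'' 0 = j\<close> by (simp_all add: ag1 ag2 mark_level_def)
    let ?gd = "(soft \<longrightarrow> l \<le> j) \<and> (j - l) div 2 \<le> e"
    let ?g = "l + (j - l) div 2 - e"
    have bv: "bval (BAnd (NLe (NSub (var ''l'') (if soft then NLit 0 else var ''l'')) (var ''j''))
               (NLe (NGet ''half'' (NSub (var ''j'') (var ''l''))) (NLit e))) s2 \<longleftrightarrow> ?gd"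
      using R jn by auto
    have al: "allowed soft e n j v \<longleftrightarrow> ?gd \<and> 2 ^ ?g dvd v \<and> v \<le> n"
      if "floor_log v = l" "0 < v" for v
      using that 5(1) jn assms(4) \<open>j < Suc tp\<close> by (auto simp: allowed_def)
    show ?case
    proof (cases ?gd)
      case True
      have gl: "?g \<le> l" using True by linarith
      have gn: "?g \<le> Suc n" using gl 5(1) by simp
      have lj: "l + (j - l) div 2 - e \<le> Suc n" using gn .
      have upd: "post mark_level (nupd ''g'' 0 (2 ^ ?g) s2) (\<lambda>s'. \<forall>x. fst s' ''ok'' x =
        (if \<exists>v. x = j * Suc n + v \<and> 2 ^ l \<le> v \<and> v < 2 * 2 ^ l \<and> v \<le> n \<and> 2 ^ ?g dvd v then 1
         else fst (nupd ''g'' 0 (2 ^ ?g) s2) ''ok'' x))"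
        by (rule mark_level_post) (use R 5(1) gl jn in auto)
      have "post mark_level (nupd ''g'' 0 (2 ^ ?g) s2) (\<lambda>s'. \<forall>j'\<le>n. \<forall>v\<le>n.
        fst s' ''ok'' (j' * Suc n + v) =
        (if (j' < j \<or> j' = j \<and> floor_log v < Suc l \<and> 0 < v) \<and> allowed soft e n j' v then 1 else 0))"
      proof (rule post_weaken[OF upd], intro allI impI)
        fix s' j' v assume s': "\<forall>x. fst s' ''ok'' x =
          (if \<exists>v. x = j * Suc n + v \<and> 2 ^ l \<le> v \<and> v < 2 * 2 ^ l \<and> v \<le> n \<and> 2 ^ ?g dvd v then 1
           else fst (nupd ''g'' 0 (2 ^ ?g) s2) ''ok'' x)" and v: "j' \<le> n" "v \<le> n"
        have ex: "(\<exists>u. j' * Suc n + v = j * Suc n + u \<and> 2 ^ l \<le> u \<and> u < 2 * 2 ^ l \<and> u \<le> n \<and> 2 ^ ?g dvd u) \<longleftrightarrow>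
          j' = j \<and> 0 < v \<and> floor_log v = l \<and> allowed soft e n j v"
        proof -
          have "(\<exists>u. j' * Suc n + v = j * Suc n + u \<and> 2 ^ l \<le> u \<and> u < 2 * 2 ^ l \<and> u \<le> n \<and> 2 ^ ?g dvd u) \<longleftrightarrow>
            j' = j \<and> 2 ^ l \<le> v \<and> v < 2 * 2 ^ l \<and> 2 ^ ?g dvd v"
            using addr_inject[of v n _ j' j] v by blast
          also have "\<dots> \<longleftrightarrow> j' = j \<and> 0 < v \<and> floor_log v = l \<and> 2 ^ ?g dvd v"
            using floor_log_iff[of v l] by (cases "v = 0") auto
          also have "\<dots> \<longleftrightarrow> j' = j \<and> 0 < v \<and> floor_log v = l \<and> allowed soft e n j v"
            using al True v by blast
          finally show ?thesis .
        qed
        show "fst s' ''ok'' (j' * Suc n + v) =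
          (if (j' < j \<or> j' = j \<and> floor_log v < Suc l \<and> 0 < v) \<and> allowed soft e n j' v then 1 else 0)"
          using s'[rule_format, of "j' * Suc n + v"] 5(2)[rule_format, OF v]
          unfolding ex by (auto simp: less_Suc_eq)
      qed
      moreover have "fst s2 ''pow'' (l + fst s2 ''half'' (j - l) - e) = 2 ^ ?g" "fst s2 ''half'' (j - l) = (j - l) div 2"
        using R(5) gn jn by auto
      ultimately show ?thesis using bv True R(3,4) by simp
    next
      case False
      have "fst s2 ''ok'' (j' * Suc n + v) =
        (if (j' < j \<or> j' = j \<and> floor_log v < Suc l \<and> 0 < v) \<and> allowed soft e n j' v then 1 else 0)"
        if "j' \<le> n" "v \<le> n" for j' v
        using 5(2)[rule_format, OF that] al[of v] False by (auto simp: less_Suc_eq)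
      then show ?thesis unfolding post_simps bv if_not_P[OF False] by blast
    qed
  next
    case (6 s2)
    show ?case
    proof (intro allI impI)
      fix j' v assume v: "j' \<le> n" "v \<le> n"
      have "0 < v \<Longrightarrow> floor_log v < Suc n" using floor_log_less[of v] v by linarith
      moreover have "allowed soft e n j' v \<Longrightarrow> 0 < v" by (simp add: allowed_def)
      ultimately show "fst s2 ''ok'' (j' * Suc n + v) = (if j' < Suc j \<and> allowed soft e n j' v then 1 else 0)"
        using 6(1)[rule_format, OF v] by (auto simp: less_Suc_eq)
    qed
  qed (use 5 assms in \<open>auto simp: ag1 mark_level_def\<close>)
next
  case (6 s')
  show ?case
  proof (intro allI impI)
    fix j v assume "j \<le> tp" "v \<le> n"
    moreover then have "j \<le> n" using assms(4) by (simp split: if_splits)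
    ultimately show "fst s' ''ok'' (j * Suc n + v) = (if allowed soft e n j v then 1 else 0)"
      using 6(1)[rule_format, of j v] by simp
  qed
qed (use assms in \<open>auto simp: mark_level_def\<close>)

lemma scale_post:
  assumes "x \<notin> {''acc'', ''z''}" "l \<notin> {''acc'', ''z''}" "x \<noteq> l"
  shows "post (scale x l) s (\<lambda>s'. fst s' x 0 = fst s l 0 * fst s x 0)"
  unfolding scale_def post_simps
proof (rule post_For[where N = "fst s l 0" and I = "\<lambda>i s'. fst s' ''acc'' 0 = i * fst s x 0"], goal_cases)
  case (5 i s')
  note ag = agreeD[OF 5(3)]
  show ?case using 5(2) assms by (auto simp: ag)
qed (use assms in auto)

lemma count_states_post:
  assumes "fst s ''n1'' 0 = Suc n" "fst s ''n2'' 0 = n + 2" "fst s ''five'' 0 = 5" "fst s ''stages'' 0 = Suc tp"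
    "tp \<le> n" "\<forall>i\<le>Suc n. fst s ''row'' i = i * Suc n"
    "\<forall>j\<le>tp. \<forall>v\<le>n. fst s ''ok'' (j * Suc n + v) = (if A j v then 1 else 0)"
  shows "post count_states s (\<lambda>s'. fst s' ''S'' 0 =
    (\<Sum>j\<le>tp. Suc n ^ card {v. v \<le> n \<and> A j v}) * (n + 2) ^ 5)"
  unfolding count_states_def post_simps
proof (rule post_For[where N = "Suc tp" and I = "\<lambda>j s'. fst s' ''S'' 0 =
    (\<Sum>j<j. Suc n ^ card {v. v \<le> n \<and> A j v})"], goal_cases)
  case (5 j s1)
  note ag1 = agreeD[OF 5(3)]
  show ?case unfolding post_simps
  proof (rule post_For[where N = "Suc n" and I = "\<lambda>v s'. fst s' ''pr'' 0 = Suc n ^ card {u. u < v \<and> A j u}"], goal_cases)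
    case (5 v s2)
    note ag2 = agreeD[OF 5(3)]
    have *: "fst s2 ''j'' 0 = j" "fst s2 ''row'' j = j * Suc n" "fst s2 ''n1'' 0 = Suc n"
      "fst s2 ''ok'' (j * Suc n + v) = (if A j v then 1 else 0)"
      using assms \<open>j < Suc tp\<close> \<open>v < Suc n\<close> \<open>fst s1 ''j'' 0 = j\<close>
      by (simp_all add: ag1 ag2 scale_def)
    have set: "{u. u < Suc v \<and> A j u} = (if A j v then insert v {u. u < v \<and> A j u} else {u. u < v \<and> A j u})"
      by (auto simp: less_Suc_eq)
    show ?case
    proof (cases "A j v")
      case True
      have "post (scale ''pr'' ''n1'') s2 (\<lambda>s'. fst s' ''pr'' 0 = Suc n ^ card {u. u < Suc v \<and> A j u})"
        by (rule post_weaken[OF scale_post]) (use 5(2) True * in \<open>auto simp: set\<close>)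
      then show ?thesis using * True 5(4) by simp
    next
      case False
      then show ?thesis using * 5(2,4) by (simp add: set)
    qed
  next
    case (6 s2)
    note ag2 = agreeD[OF 6(2)]
    have "{u. u < Suc n \<and> A j u} = {v. v \<le> n \<and> A j v}" by auto
    then show ?case using 6(1) \<open>fst s1 ''S'' 0 = _\<close> by (simp add: ag2 scale_def)
  qed (use assms in \<open>auto simp: ag1 scale_def\<close>)
next
  case (6 s1)
  note ag1 = agreeD[OF 6(2)]
  let ?T = "\<Sum>j\<le>tp. Suc n ^ card {v. v \<le> n \<and> A j v}"
  have s1: "fst s1 ''S'' 0 = ?T" using 6(1) by (simp only: lessThan_Suc_atMost)
  show ?case
  proof (rule post_For[where N = 5 and I = "\<lambda>h s'. fst s' ''S'' 0 = ?T * (n + 2) ^ h"], goal_cases)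
    case (5 h s2)
    note ag2 = agreeD[OF 5(3)]
    have "fst s2 ''n2'' 0 = n + 2" using assms(2) by (simp add: ag1 ag2 scale_def)
    then have "fst s2 ''n2'' 0 * fst s2 ''S'' 0 = ?T * (n + 2) ^ Suc h"
      unfolding 5(2) by (simp only: power_Suc mult_ac)
    then have "post (scale ''S'' ''n2'') s2 (\<lambda>s'. fst s' ''S'' 0 = ?T * (n + 2) ^ Suc h)"
      using scale_post[of "''S''" "''n2''" s2] by simp
    then show ?case .
  qed (use assms s1 in \<open>auto simp: ag1 scale_def\<close>)
qed (use assms in \<open>auto simp: scale_def\<close>)

fun chain :: "(nat \<Rightarrow> nat) \<Rightarrow> nat list \<Rightarrow> nat \<Rightarrow> bool" where
  "chain nxt [] ptr \<longleftrightarrow> ptr = 0"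
| "chain nxt (p # ps) ptr \<longleftrightarrow> ptr = Suc p \<and> chain nxt ps (nxt p)"

lemma chain_update: "p \<notin> set ps \<Longrightarrow> chain (nxt(p := x)) ps ptr = chain nxt ps ptr"
  by (induction ps arbitrary: ptr) auto

definition cap_of :: "(nat \<times> nat) list \<Rightarrow> nat \<Rightarrow> nat \<Rightarrow> nat" where
  "cap_of caps n p = min (snd (caps ! p)) n"

definition types_of :: "(nat \<times> nat) list \<Rightarrow> nat \<Rightarrow> nat \<Rightarrow> nat \<Rightarrow> nat list" where
  "types_of caps n P v = rev (filter (\<lambda>p. 0 < fst (caps ! p) \<and> cap_of caps n p = v) [0..<P])"

definition copies :: "(nat \<times> nat) list \<Rightarrow> nat list \<Rightarrow> nat list" where
  "copies caps ps = concat (map (\<lambda>p. replicate (fst (caps ! p)) p) ps)"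

lemma copies_simps [simp]: "copies caps [] = []"
  "copies caps (p # ps) = replicate (fst (caps ! p)) p @ copies caps ps"
  by (simp_all add: copies_def)

definition block :: "(nat \<times> nat) list \<Rightarrow> nat \<Rightarrow> nat \<Rightarrow> nat list" where
  "block caps n v = take n (copies caps (types_of caps n (length caps) v))"

definition item_prefix :: "(nat \<times> nat) list \<Rightarrow> nat \<Rightarrow> nat \<Rightarrow> nat list" where
  "item_prefix caps n i = concat (map (\<lambda>i. block caps n (n - i)) [0..<i])"

definition item_types :: "(nat \<times> nat) list \<Rightarrow> nat \<Rightarrow> nat list" where
  "item_types caps n = item_prefix caps n n"

definition items_listed :: "(nat \<times> nat) list \<Rightarrow> nat \<Rightarrow> nat list \<Rightarrow> state \<Rightarrow> bool" where
  "items_listed caps n l s \<longleftrightarrow> fst s ''N'' 0 = length l \<and>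
     (\<forall>t<length l. fst s ''itype'' t = l ! t \<and> fst s ''item'' t = cap_of caps n (l ! t))"

lemma bucket_post:
  assumes "fst s ''n'' 0 = n" "fst s ''P'' 0 = length caps" "fst s ''head'' = (\<lambda>_. 0)"
    "\<forall>p<length caps. fst s ''k'' p = fst (caps ! p) \<and> fst s ''c'' p = snd (caps ! p)"
  shows "post bucket s (\<lambda>s'. \<forall>v. chain (fst s' ''next'') (types_of caps n (length caps) v) (fst s' ''head'' v))"
  unfolding bucket_def
proof (rule post_For[where N = "length caps" and
    I = "\<lambda>i s'. \<forall>v. chain (fst s' ''next'') (types_of caps n i v) (fst s' ''head'' v)"], goal_cases)
  case (5 i s')
  note ag = agreeD[OF 5(3)]
  have R: "fst s' ''n'' 0 = n" "fst s' ''k'' i = fst (caps ! i)" "fst s' ''c'' i = snd (caps ! i)"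
    using assms 5(1) by (simp_all add: ag)
  have T: "types_of caps n (Suc i) v =
    (if 0 < fst (caps ! i) \<and> cap_of caps n i = v then i # types_of caps n i v else types_of caps n i v)" for v
    by (simp add: types_of_def)
  have i: "i \<notin> set (types_of caps n i v)" for v by (simp add: types_of_def)
  show ?case
    using R 5(2,4) by (auto simp: T chain_update[OF i] cap_of_def min_def)
qed (use assms in \<open>auto simp: types_of_def\<close>)

lemma pop_item_post:
  assumes l: "items_listed caps n (l @ take z cs) s"
    and ch: "chain (fst s ''next'') ps (fst s ''ptr'' 0)" "fst s ''used'' 0 = u" "ps = [] \<Longrightarrow> u = 0"
      "ps \<noteq> [] \<Longrightarrow> u < fst (caps ! hd ps)"
    and ps: "\<forall>p\<in>set ps. 0 < fst (caps ! p) \<and> cap_of caps n p = v \<and> p < length caps"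
    and cs: "drop z cs = drop u (copies caps ps)"
    and R: "fst s ''v'' 0 = v" "\<forall>p<length caps. fst s ''k'' p = fst (caps ! p)"
  shows "post pop_item s (\<lambda>s'. items_listed caps n (l @ take (Suc z) cs) s' \<and>
    (\<exists>ps u. chain (fst s' ''next'') ps (fst s' ''ptr'' 0) \<and> fst s' ''used'' 0 = u \<and> (ps = [] \<longrightarrow> u = 0) \<and>
      (ps \<noteq> [] \<longrightarrow> u < fst (caps ! hd ps)) \<and>
      (\<forall>p\<in>set ps. 0 < fst (caps ! p) \<and> cap_of caps n p = v \<and> p < length caps) \<and>
      drop (Suc z) cs = drop u (copies caps ps)))"
proof (cases ps)
  case Nil
  then have z: "length cs \<le> z" using cs by simp
  then have e: "take (Suc z) cs = take z cs" by simp
  have "drop (Suc z) cs = drop 0 (copies caps [])" using z by simp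
  then show ?thesis using Nil l ch
    unfolding pop_item_def e by (auto intro!: exI[of _ "[]"])
next
  case (Cons p ps')
  then have ptr: "fst s ''ptr'' 0 = Suc p" and u: "u < fst (caps ! p)" using ch by auto
  have d: "drop z cs = replicate (fst (caps ! p) - u) p @ copies caps ps'"
    using cs u unfolding Cons by simp
  have rep: "replicate (fst (caps ! p) - u) p = p # replicate (fst (caps ! p) - Suc u) p"
    using u by (metis Suc_diff_Suc replicate_Suc)
  have z: "z < length cs" using d unfolding rep by (metis append_Cons drop_all linorder_not_less list.distinct(1))
  have czp: "cs ! z = p" "drop (Suc z) cs = replicate (fst (caps ! p) - Suc u) p @ copies caps ps'"
    using d z unfolding rep by (simp_all add: Cons_nth_drop_Suc[symmetric])
  have tk: "l @ take (Suc z) cs = (l @ take z cs) @ [p]" using z czp by (simp add: take_Suc_conv_app_nth)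
  have p: "0 < fst (caps ! p)" "cap_of caps n p = v" "p < length caps" using ps Cons by auto
  have li: "items_listed caps n (l @ take (Suc z) cs) s'"
    if "fst s' ''N'' = (fst s ''N'')(0 := Suc (fst s ''N'' 0))" "fst s' ''item'' = (fst s ''item'')(fst s ''N'' 0 := v)"
      "fst s' ''itype'' = (fst s ''itype'')(fst s ''N'' 0 := p)" for s'
    using l that p unfolding tk items_listed_def by (auto simp: nth_append less_Suc_eq)
  have k: "fst s ''k'' p = fst (caps ! p)" using R p by simp
  show ?thesis
  proof (cases "Suc u < fst (caps ! p)")
    case True
    have "drop (Suc z) cs = drop (Suc u) (copies caps ps)" using czp True Cons by simp
    then show ?thesis using ptr ch R k True ps Cons
      unfolding pop_item_def by (auto intro!: li exI[of _ ps])
  next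
    case False
    then have "Suc u = fst (caps ! p)" using u by simp
    then have "drop (Suc z) cs = drop 0 (copies caps ps')" using czp by simp
    moreover have "ps' \<noteq> [] \<Longrightarrow> 0 < fst (caps ! hd ps')" using ps Cons by (cases ps') auto
    moreover have "chain (fst s ''next'') ps' (fst s ''next'' p)" using ch Cons by simp
    ultimately show ?thesis using ptr ch R k False ps Cons
      unfolding pop_item_def by (auto intro!: li exI[of _ ps'])
  qed
qed

lemma list_items_post:
  assumes "fst s ''n'' 0 = n" "\<forall>p<length caps. fst s ''k'' p = fst (caps ! p)"
    "\<forall>v. chain (fst s ''next'') (types_of caps n (length caps) v) (fst s ''head'' v)"
  shows "post list_items s (items_listed caps n (item_types caps n))"
  unfolding list_items_def post_simps
proof (rule post_For[where N = n and I = "\<lambda>i. items_listed caps n (item_prefix caps n i)"], goal_cases)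
  case (5 i s1)
  note ag1 = agreeD[OF 5(3)]
  let ?v = "n - i" let ?ps = "types_of caps n (length caps) ?v"
  let ?cs = "copies caps ?ps" let ?l = "item_prefix caps n i"
  have tp: "\<forall>p\<in>set ?ps. 0 < fst (caps ! p) \<and> cap_of caps n p = ?v \<and> p < length caps"
    by (auto simp: types_of_def)
  have Suc: "item_prefix caps n (Suc i) = ?l @ take n ?cs"
    by (simp add: item_prefix_def block_def)
  have R: "fst s1 ''n'' 0 = n" "\<forall>p<length caps. fst s1 ''k'' p = fst (caps ! p)" "chain (fst s1 ''next'') ?ps (fst s1 ''head'' ?v)"
    using assms by (simp_all add: ag1 pop_item_def)
  let ?J = "\<lambda>z s'. items_listed caps n (?l @ take z ?cs) s' \<and>
    (\<exists>ps u. chain (fst s' ''next'') ps (fst s' ''ptr'' 0) \<and> fst s' ''used'' 0 = u \<and> (ps = [] \<longrightarrow> u = 0) \<and>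
      (ps \<noteq> [] \<longrightarrow> u < fst (caps ! hd ps)) \<and>
      (\<forall>p\<in>set ps. 0 < fst (caps ! p) \<and> cap_of caps n p = ?v \<and> p < length caps) \<and>
      drop z ?cs = drop u (copies caps ps))"
  show ?case unfolding post_simps
  proof (rule post_For[where N = n and I = ?J], goal_cases)
    case 3
    have "?ps \<noteq> [] \<Longrightarrow> 0 < fst (caps ! hd ?ps)" using tp by (cases ?ps) auto
    then show ?case using R tp 5(2,4) by (auto simp: items_listed_def intro!: exI[of _ ?ps])
  next
    case (4 z k s')
    then show ?case by (simp add: items_listed_def)
  next
    case (5 z s2)
    note ag2 = agreeD[OF 5(3)]
    obtain ps u where J: "items_listed caps n (?l @ take z ?cs) s2"
      "chain (fst s2 ''next'') ps (fst s2 ''ptr'' 0)" "fst s2 ''used'' 0 = u" "ps = [] \<Longrightarrow> u = 0"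
      "ps \<noteq> [] \<Longrightarrow> u < fst (caps ! hd ps)"
      "\<forall>p\<in>set ps. 0 < fst (caps ! p) \<and> cap_of caps n p = ?v \<and> p < length caps"
      "drop z ?cs = drop u (copies caps ps)" using 5(2) by blast
    show ?case
      by (rule pop_item_post[OF J]) (use R \<open>fst s1 ''i'' 0 = i\<close> in \<open>simp_all add: ag2 pop_item_def\<close>)
  next
    case (6 s2)
    then show ?case unfolding Suc by blast
  qed (use R in \<open>simp_all add: pop_item_def\<close>)
next
  case (6 s')
  then show ?case by (simp add: item_types_def)
qed (use assms in \<open>simp_all add: pop_item_def items_listed_def item_prefix_def\<close>)

lemma set_copies: "x \<in> set (copies caps ps) \<Longrightarrow> x \<in> set ps"
  by (auto simp: copies_def split: if_splits)

lemma set_block: "p \<in> set (block caps n v) \<Longrightarrow> cap_of caps n p = v \<and> p < length caps"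
  by (auto simp: block_def types_of_def dest!: in_set_takeD set_copies)

lemma item_prefix_Suc: "item_prefix caps n (Suc i) = item_prefix caps n i @ block caps n (n - i)"
  by (simp add: item_prefix_def)

lemma item_prefix_props:
  assumes "i \<le> n"
  shows "length (item_prefix caps n i) \<le> i * n \<and>
    (\<forall>p\<in>set (item_prefix caps n i). p < length caps \<and> n - i < cap_of caps n p \<and> cap_of caps n p \<le> n) \<and>
    sorted_wrt (\<lambda>p q. cap_of caps n q \<le> cap_of caps n p) (item_prefix caps n i)"
  using assms
proof (induction i)
  case (Suc i)
  have "length (block caps n (n - i)) \<le> n" by (simp add: block_def)
  moreover have "sorted_wrt (\<lambda>p q. cap_of caps n q \<le> cap_of caps n p) (block caps n (n - i))"
  proof -
    have "cap_of caps n (block caps n (n - i) ! a) = n - i" if "a < length (block caps n (n - i))" for a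
      using set_block nth_mem[OF that] by blast
    then show ?thesis by (simp add: sorted_wrt_iff_nth_less)
  qed
  ultimately show ?case using Suc set_block[of _ caps n "n - i"]
    unfolding item_prefix_Suc by (fastforce simp: sorted_wrt_append)
qed (simp add: item_prefix_def)

lemma count_copies: "distinct ps \<Longrightarrow> count_list (copies caps ps) p \<le> fst (caps ! p)"
proof (induction ps)
  case (Cons q ps)
  have r: "count_list (replicate k q) p = (if q = p then k else 0)" for k by (induction k) auto
  have "p \<notin> set ps \<Longrightarrow> count_list (copies caps ps) p = 0"
    using set_copies[of p caps ps] by (metis count_list_0_iff)
  then show ?case using Cons by (auto simp: r)
qed simp

lemma count_block: "count_list (block caps n v) p \<le> (if cap_of caps n p = v then fst (caps ! p) else 0)"
proof (cases "cap_of caps n p = v")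
  case True
  have "count_list (copies caps (types_of caps n (length caps) v)) p \<le> fst (caps ! p)"
    by (rule count_copies) (simp add: types_of_def)
  moreover have "count_list (take n xs) p \<le> count_list xs p" for xs :: "nat list"
    by (metis append_take_drop_id count_list_append le_add1)
  ultimately show ?thesis using True by (auto simp: block_def intro: order_trans)
next
  case False
  then have "p \<notin> set (block caps n v)" using set_block by blast
  then show ?thesis using False by (simp add: count_list_0_iff)
qed

lemma count_item_prefix:
  "i \<le> n \<Longrightarrow> count_list (item_prefix caps n i) p \<le> (if n - cap_of caps n p < i then fst (caps ! p) else 0)"
proof (induction i)
  case (Suc i)
  have c: "cap_of caps n p \<le> n" by (simp add: cap_of_def)
  show ?case using Suc count_block[of caps n "n - i" p] c unfolding item_prefix_Suc
    by (auto split: if_splits)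
qed (simp add: item_prefix_def)

lemma filter_item_prefix:
  "i \<le> n \<Longrightarrow> 0 < v \<Longrightarrow> v \<le> n \<Longrightarrow>
   length (filter (\<lambda>p. cap_of caps n p = v) (item_prefix caps n i)) =
   (if n - v < i then length (block caps n v) else 0)"
proof (induction i)
  case (Suc i)
  have "filter (\<lambda>p. cap_of caps n p = v) (block caps n (n - i)) = (if n - i = v then block caps n v else [])"
    using set_block[of _ caps n "n - i"] by (auto simp: filter_id_conv filter_empty_conv)
  then show ?case using Suc unfolding item_prefix_Suc by (auto split: if_splits)
qed (simp add: item_prefix_def)

lemma length_copies: "length (copies caps ps) = (\<Sum>p\<leftarrow>ps. fst (caps ! p))"
  by (induction ps) auto

lemma items_enough:
  fixes A :: "'q set"
  assumes A: "finite A" "card A \<le> n" "\<And>q. q \<in> A \<Longrightarrow> ty q < length caps"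
    "\<And>p. p < length caps \<Longrightarrow> card {q \<in> A. ty q = p} \<le> fst (caps ! p)" and x: "0 < x"
  shows "card {q \<in> A. x \<le> cap_of caps n (ty q)} \<le>
    card {t. t < length (item_types caps n) \<and> x \<le> cap_of caps n (item_types caps n ! t)}"
proof -
  let ?l = "item_types caps n"
  have le: "cap_of caps n p \<le> n" for p by (simp add: cap_of_def)
  have val: "card {q \<in> A. cap_of caps n (ty q) = v} \<le> card {t. t < length ?l \<and> cap_of caps n (?l ! t) = v}"
    if v: "0 < v" "v \<le> n" for v
  proof -
    let ?ps = "types_of caps n (length caps) v"
    have "{q \<in> A. cap_of caps n (ty q) = v} \<subseteq> (\<Union>p\<in>set ?ps. {q \<in> A. ty q = p})"
    proof
      fix q assume q: "q \<in> {q \<in> A. cap_of caps n (ty q) = v}"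
      have "0 < card {q' \<in> A. ty q' = ty q}" using q A(1) by (auto simp: card_gt_0_iff)
      then have "0 < fst (caps ! ty q)" using A(3)[of q] A(4)[of "ty q"] q by fastforce
      then show "q \<in> (\<Union>p\<in>set ?ps. {q \<in> A. ty q = p})" using q A(3) by (auto simp: types_of_def)
    qed
    then have "card {q \<in> A. cap_of caps n (ty q) = v} \<le> card (\<Union>p\<in>set ?ps. {q \<in> A. ty q = p})"
      by (rule card_mono[rotated]) (use A(1) in auto)
    also have "\<dots> \<le> (\<Sum>p\<in>set ?ps. card {q \<in> A. ty q = p})" by (rule card_UN_le) simp
    also have "\<dots> \<le> (\<Sum>p\<in>set ?ps. fst (caps ! p))"
      by (rule sum_mono) (use A(4) in \<open>auto simp: types_of_def\<close>)
    also have "\<dots> = length (copies caps ?ps)"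
      unfolding length_copies by (rule sum_list_distinct_conv_sum_set[symmetric]) (simp add: types_of_def)
    finally have 1: "card {q \<in> A. cap_of caps n (ty q) = v} \<le> length (copies caps ?ps)" .
    have "card {q \<in> A. cap_of caps n (ty q) = v} \<le> n"
      using card_mono[of A "{q \<in> A. cap_of caps n (ty q) = v}"] A by auto
    with 1 have "card {q \<in> A. cap_of caps n (ty q) = v} \<le> length (block caps n v)" by (simp add: block_def)
    also have "\<dots> = length (filter (\<lambda>p. cap_of caps n p = v) ?l)"
      unfolding item_types_def using filter_item_prefix[of n n v caps] v by simp
    also have "\<dots> = card {t. t < length ?l \<and> cap_of caps n (?l ! t) = v}" by (rule length_filter_conv_card)
    finally show ?thesis .
  qed
  have "{q \<in> A. x \<le> cap_of caps n (ty q)} = (\<Union>v\<in>{x..n}. {q \<in> A. cap_of caps n (ty q) = v})"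
    using le by auto
  then have "card {q \<in> A. x \<le> cap_of caps n (ty q)} \<le> (\<Sum>v\<in>{x..n}. card {q \<in> A. cap_of caps n (ty q) = v})"
    by (simp add: card_UN_le)
  also have "\<dots> \<le> (\<Sum>v\<in>{x..n}. card {t. t < length ?l \<and> cap_of caps n (?l ! t) = v})"
    by (rule sum_mono) (use val x in auto)
  also have "\<dots> = card (\<Union>v\<in>{x..n}. {t. t < length ?l \<and> cap_of caps n (?l ! t) = v})"
    by (rule card_UN_disjoint[symmetric]) auto
  also have "(\<Union>v\<in>{x..n}. {t. t < length ?l \<and> cap_of caps n (?l ! t) = v}) =
    {t. t < length ?l \<and> x \<le> cap_of caps n (?l ! t)}" using le by auto
  finally show ?thesis .
qed

lemmas program_defs = init_def bucket_def tables_def powers_def quotients_def mark_level_def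
  mark_all_def scale_def count_states_def pop_item_def list_items_def facilities_near_def
  clients_near_def grow_def record_cluster_def clustering_def load_state_def make_move_def
  check_state_def find_state_def append_state_def search_def find_final_def trace_def
  replay_move_def replay_def serve_def emit_output_def attempt_def main_loop_def

locale hck_instance =
  fixes soft :: bool and e n :: nat and F C :: "nat set" and d :: "nat \<Rightarrow> nat \<Rightarrow> real" and caps :: "(nat \<times> nat) list"
  assumes FC: "F \<union> C = {..<n}" and metric: "Metric_space {..<n} d" and e5: "5 \<le> e"
begin

definition last_stage :: nat where "last_stage = (if soft then n else 0)"

abbreviation types :: "nat list" where "types \<equiv> item_types caps n"

definition size_of :: "nat \<Rightarrow> nat" where "size_of t = cap_of caps n (types ! t)"

definition rows_bound :: nat where
  "rows_bound = (\<Sum>j\<le>last_stage. Suc n ^ card {v. v \<le> n \<and> allowed soft e n j v}) * (n + 2) ^ 5"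

definition ready :: "state \<Rightarrow> bool" where
  "ready s \<longleftrightarrow> fst s ''n'' 0 = n \<and> fst s ''n1'' 0 = Suc n \<and> fst s ''L'' 0 = n + 6 \<and> fst s ''five'' 0 = 5 \<and>
     fst s ''stages'' 0 = Suc last_stage \<and> fst s ''S'' 0 = rows_bound \<and> fst s ''N'' 0 = length types \<and>
     (\<forall>t<length types. fst s ''itype'' t = types ! t \<and> fst s ''item'' t = size_of t) \<and>
     (\<forall>i\<le>Suc n. fst s ''row'' i = i * Suc n \<and> fst s ''mul'' i = i * n \<and> fst s ''pow'' i = 2 ^ i) \<and>
     (\<forall>i\<le>n. fst s ''tol'' i = i div 2 ^ (e - 3) \<and> fst s ''ext'' i = i div 2 ^ (e - 5)) \<and>
     (\<forall>j\<le>last_stage. \<forall>v\<le>n. fst s ''ok'' (j * Suc n + v) = (if allowed soft e n j v then 1 else 0)) \<and>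
     (\<forall>i<n. fst s ''F'' i = (if i \<in> F then 1 else 0) \<and> fst s ''C'' i = (if i \<in> C then 1 else 0)) \<and>
     (\<forall>i<n. \<forall>j<n. snd s ''d'' (i * n + j) = d i j)"

definition ready_vars :: "vname set" where
  "ready_vars = {''n'', ''n1'', ''L'', ''five'', ''stages'', ''S'', ''N'', ''itype'', ''item'', ''row'', ''mul'', ''pow'',
     ''tol'', ''ext'', ''ok'', ''F'', ''C''}"

lemma ready_agree:
  assumes "agree W V s s'" "W \<inter> ready_vars = {}" "''d'' \<notin> V" "ready s"
  shows "ready s'"
proof -
  have "fst s' y = fst s y" if "y \<in> ready_vars" for y
    using assms(1,2) that by (auto simp: agree_def)
  moreover have "snd s' ''d'' = snd s ''d''" using assms(1,3) by (auto simp: agree_def)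
  ultimately show ?thesis using assms(4) by (simp add: ready_def ready_vars_def)
qed

lemma tables_post:
  assumes s: "fst s ''n'' 0 = n" "fst s ''n1'' 0 = Suc n" "fst s ''n2'' 0 = n + 2" "fst s ''L'' 0 = n + 6"
      "fst s ''five'' 0 = 5" "fst s ''stages'' 0 = Suc last_stage" "fst s ''ok'' = (\<lambda>_. 0)"
    and k: "\<forall>p<length caps. fst s ''k'' p = fst (caps ! p)"
    and ch: "\<forall>v. chain (fst s ''next'') (types_of caps n (length caps) v) (fst s ''head'' v)"
    and FC: "\<forall>i<n. fst s ''F'' i = (if i \<in> F then 1 else 0) \<and> fst s ''C'' i = (if i \<in> C then 1 else 0)"
    and d: "\<forall>i<n. \<forall>j<n. snd s ''d'' (i * n + j) = d i j"
  shows "post (tables soft e) s ready"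
  unfolding tables_def post_simps
proof (rule post_weaken[OF powers_post[where n = n]], goal_cases)
  case (3 s1)
  note a1 = agreeD[OF 3(2), unfolded powers_def]
  show ?case
  proof (rule post_weaken[OF quotients_post[where n = n]], goal_cases)
    case (4 s2)
    note a2 = agreeD[OF 4(2), unfolded quotients_def]
    show ?case
    proof (rule post_weaken[OF quotients_post[where n = n]], goal_cases)
      case (4 s3)
      note a3 = agreeD[OF 4(2), unfolded quotients_def]
      have l: "last_stage \<le> n" by (simp add: last_stage_def)
      have r3: "\<forall>i\<le>Suc n. fst s3 ''row'' i = i * Suc n \<and> fst s3 ''mul'' i = i * n \<and> fst s3 ''pow'' i = 2 ^ i \<and> fst s3 ''half'' i = i div 2"
        using 3(1) by (simp add: a2 a3)
      show ?case
      proof (rule post_weaken[OF mark_all_post[where n = n and tp = last_stage]], goal_cases)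
        case (7 s4)
        note a4 = agreeD[OF 7(2), unfolded program_defs]
        show ?case
        proof (rule post_weaken[OF count_states_post[where n = n and tp = last_stage and A = "allowed soft e n"]], goal_cases)
          case (8 s5)
          note a5 = agreeD[OF 8(2), unfolded program_defs]
          show ?case
          proof (rule post_weaken[OF list_items_post[where n = n and caps = caps]], goal_cases)
            case (4 s6)
            note a6 = agreeD[OF 4(2), unfolded program_defs]
            have "\<forall>i\<le>n. fst s6 ''tol'' i = i div 2 ^ (e - 3)" "\<forall>i\<le>n. fst s6 ''ext'' i = i div 2 ^ (e - 5)"
              using \<open>\<forall>i\<le>n. fst s2 ''tol'' i = _\<close> \<open>\<forall>i\<le>n. fst s3 ''ext'' i = _\<close> by (simp_all add: a3 a4 a5 a6)
            moreover have "\<forall>j\<le>last_stage. \<forall>v\<le>n. fst s6 ''ok'' (j * Suc n + v) = (if allowed soft e n j v then 1 else 0)"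
              using 7(1) by (simp add: a5 a6)
            moreover have "fst s6 ''S'' 0 = rows_bound" using 8(1) by (simp add: a6 rows_bound_def)
            moreover have "\<forall>i\<le>Suc n. fst s6 ''row'' i = i * Suc n \<and> fst s6 ''mul'' i = i * n \<and> fst s6 ''pow'' i = 2 ^ i"
              using r3 by (simp add: a4 a5 a6)
            ultimately show ?case
              using 4(1) s FC d unfolding ready_def items_listed_def size_of_def
              by (simp add: a1 a2 a3 a4 a5 a6)
          qed (use s k ch in \<open>simp_all add: a1 a2 a3 a4 a5\<close>)
        qed (use s l 7(1) r3 in \<open>simp_all add: a1 a2 a3 a4\<close>)
      qed (use s r3 in \<open>simp_all add: a1 a2 a3 last_stage_def\<close>)
    qed (use s in \<open>simp_all add: a1 a2\<close>)
  qed (use s in \<open>simp_all add: a1\<close>)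
qed (use s in simp_all)

lemma ready_start:
  "post (init soft ;; bucket ;; tables soft e) (input_state n F C d caps)
    (\<lambda>s. ready s \<and> fst s ''solved'' 0 = 0 \<and> fst s ''facilities'' 0 = 0)"
proof -
  let ?s0 = "input_state n F C d caps"
  define s1 where "s1 = den (init soft) ?s0"
  have s1: "fst s1 ''n'' 0 = n" "fst s1 ''n1'' 0 = Suc n" "fst s1 ''n2'' 0 = n + 2" "fst s1 ''L'' 0 = n + 6"
      "fst s1 ''five'' 0 = 5" "fst s1 ''stages'' 0 = Suc last_stage" "fst s1 ''ok'' = (\<lambda>_. 0)" "fst s1 ''P'' 0 = length caps"
      "\<forall>p<length caps. fst s1 ''k'' p = fst (caps ! p) \<and> fst s1 ''c'' p = snd (caps ! p)" "fst s1 ''head'' = (\<lambda>_. 0)"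
      "\<forall>i<n. fst s1 ''F'' i = (if i \<in> F then 1 else 0) \<and> fst s1 ''C'' i = (if i \<in> C then 1 else 0)"
      "fst s1 ''solved'' 0 = 0" "fst s1 ''facilities'' 0 = 0" "snd s1 = snd ?s0"
    by (simp_all add: s1_def init_def input_state_def last_stage_def)
  have d: "\<forall>i<n. \<forall>j<n. snd s1 ''d'' (i * n + j) = d i j"
  proof (intro allI impI)
    fix i j assume ij: "i < n" "j < n"
    have "i * n + j < Suc i * n" using ij by simp
    also have "\<dots> \<le> n * n" using ij by (intro mult_le_mono1) simp
    finally show "snd s1 ''d'' (i * n + j) = d i j"
      using ij by (simp add: s1(14) input_state_def)
  qed
  have "post (bucket ;; tables soft e) s1 (\<lambda>s. ready s \<and> fst s ''solved'' 0 = 0 \<and> fst s ''facilities'' 0 = 0)"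
    unfolding post_simps
  proof (rule post_weaken[OF bucket_post[OF s1(1,8,10,9)]], goal_cases)
    case (1 s2)
    note a2 = agreeD[OF 1(2), unfolded program_defs]
    have "post (tables soft e) s2 ready"
      by (rule tables_post) (use s1 d 1(1) in \<open>simp_all add: a2\<close>)
    then show ?case
    proof (rule post_weaken, goal_cases)
      case (1 s3)
      note a3 = agreeD[OF 1(2), unfolded program_defs]
      show ?case using 1(1) s1 by (simp add: a2 a3)
    qed
  qed
  then show ?thesis by (simp add: post_def s1_def)
qed

end

section \<open>Clustering\<close>

context hck_instance
begin

lemma readyD:
  assumes "ready s"
  shows "fst s ''n'' 0 = n" "fst s ''n1'' 0 = Suc n" "fst s ''L'' 0 = n + 6" "fst s ''five'' 0 = 5"
    "fst s ''stages'' 0 = Suc last_stage" "fst s ''S'' 0 = rows_bound" "fst s ''N'' 0 = length types"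
    "t < length types \<Longrightarrow> fst s ''itype'' t = types ! t" "t < length types \<Longrightarrow> fst s ''item'' t = size_of t"
    "i \<le> Suc n \<Longrightarrow> fst s ''row'' i = i * Suc n" "i \<le> Suc n \<Longrightarrow> fst s ''mul'' i = i * n"
    "i \<le> Suc n \<Longrightarrow> fst s ''pow'' i = 2 ^ i"
    "i \<le> n \<Longrightarrow> fst s ''tol'' i = i div 2 ^ (e - 3)" "i \<le> n \<Longrightarrow> fst s ''ext'' i = i div 2 ^ (e - 5)"
    "j \<le> last_stage \<Longrightarrow> v \<le> n \<Longrightarrow> fst s ''ok'' (j * Suc n + v) = (if allowed soft e n j v then 1 else 0)"
    "i < n \<Longrightarrow> fst s ''F'' i = (if i \<in> F then 1 else 0)" "i < n \<Longrightarrow> fst s ''C'' i = (if i \<in> C then 1 else 0)"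
    "i < n \<Longrightarrow> j < n \<Longrightarrow> snd s ''d'' (i * n + j) = d i j"
  using assms unfolding ready_def by blast+

lemma FC_less: "f \<in> F \<Longrightarrow> f < n" "z \<in> C \<Longrightarrow> z < n"
  using FC by auto

lemma dist: "x < n \<Longrightarrow> y < n \<Longrightarrow> 0 \<le> d x y" "x < n \<Longrightarrow> y < n \<Longrightarrow> d x y = d y x"
  "x < n \<Longrightarrow> y < n \<Longrightarrow> z < n \<Longrightarrow> d x z \<le> d x y + d y z" "x < n \<Longrightarrow> d x x = 0"
  using Metric_space.nonneg[OF metric, of x y] Metric_space.commute[OF metric, of x y]
    Metric_space.triangle[OF metric, of x y z] Metric_space.mdist_zero[OF metric, of x] by auto

definition near_fac :: "(nat \<Rightarrow> nat) \<Rightarrow> real \<Rightarrow> nat set \<Rightarrow> nat set" where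
  "near_fac cf R J = {f \<in> F. cf f = 0 \<and> (\<exists>z\<in>J. d z f \<le> R)}"

definition near_cli :: "(nat \<Rightarrow> nat) \<Rightarrow> real \<Rightarrow> nat set \<Rightarrow> nat set \<Rightarrow> nat set" where
  "near_cli cc R J G = J \<union> {z \<in> C. cc z = 0 \<and> (\<exists>f\<in>G. d z f \<le> R)}"

definition marks :: "(nat \<Rightarrow> nat) \<Rightarrow> nat set \<Rightarrow> bool" where
  "marks a A \<longleftrightarrow> (\<forall>z<n. a z = (if z \<in> A then 1 else 0))"

lemma marksD: "marks a A \<Longrightarrow> z < n \<Longrightarrow> a z = (if z \<in> A then 1 else 0)"
  by (simp add: marks_def)

lemma facilities_near_post:
  assumes r: "ready s" and J: "marks (fst s ''inJ'') J" "J \<subseteq> {..<n}"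
  shows "post facilities_near s (\<lambda>s'. marks (fst s' ''G'') (near_fac (fst s ''cf'') (snd s ''R'' 0) J))"
  unfolding facilities_near_def
proof (rule post_For[where N = n and I = "\<lambda>i s'. \<forall>f<i.
    fst s' ''G'' f = (if f \<in> near_fac (fst s ''cf'') (snd s ''R'' 0) J then 1 else 0)"], goal_cases)
  case (5 f s1)
  note ag1 = agreeD[OF 5(3)]
  have r1: "ready s1" by (rule ready_agree[OF 5(3) _ _ r]) (simp_all add: ready_vars_def)
  let ?G = "near_fac (fst s ''cf'') (snd s ''R'' 0) J"
  have c1: "fst s1 ''cf'' = fst s ''cf''" "snd s1 ''R'' = snd s ''R''" "fst s1 ''inJ'' = fst s ''inJ''" by (simp_all add: ag1)
  have Ff: "fst s1 ''F'' f = (if f \<in> F then 1 else 0)" using readyD(16)[OF r1 5(1)] .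
  show ?case
  proof (cases "f \<in> F \<and> fst s ''cf'' f = 0")
    case True
    let ?s = "nupd ''G'' f 0 s1"
    have "post (For ''z'' ''n'' (When (BAnd (NLess (NLit 0) (NGet ''inJ'' (var ''z'')))
                (BNot (RLess (RGet ''R'' (NLit 0)) (RGet ''d'' (NAdd (NGet ''mul'' (var ''z'')) (var ''f''))))))
              (Put ''G'' (var ''f'') (NLit 1)))) ?s
      (\<lambda>s'. \<forall>f'<Suc f. fst s' ''G'' f' = (if f' \<in> ?G then 1 else 0))"
    proof (rule post_For[where N = n and I = "\<lambda>z s'. (\<forall>f'<f. fst s' ''G'' f' = (if f' \<in> ?G then 1 else 0)) \<and>
        fst s' ''G'' f = (if \<exists>z'<z. z' \<in> J \<and> d z' f \<le> snd s ''R'' 0 then 1 else 0)"], goal_cases)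
      case inner: (5 z s2)
      note ag2 = agreeD[OF inner(3)]
      have r2: "ready s2"
        by (rule ready_agree[OF inner(3)]) (use r1 in \<open>simp_all add: ready_vars_def ready_def\<close>)
      have R: "fst s2 ''mul'' z = z * n" "snd s2 ''d'' (z * n + f) = d z f" "fst s2 ''inJ'' z = (if z \<in> J then 1 else 0)"
        "snd s2 ''R'' 0 = snd s ''R'' 0" "fst s2 ''f'' 0 = f"
        using readyD(11)[OF r2, of z] readyD(18)[OF r2 inner(1) 5(1)] inner(1) marksD[OF J(1) inner(1)] 5(4)
        by (simp_all add: ag2 c1)
      show ?case using inner(2,4) R by (auto simp: less_Suc_eq)
    next
      case inner: (6 s2)
      have "(\<exists>z'<n. z' \<in> J \<and> d z' f \<le> snd s ''R'' 0) \<longleftrightarrow> f \<in> ?G"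
        using True J(2) by (auto simp: near_fac_def)
      then show ?case using inner(1) by (auto simp: less_Suc_eq)
    qed (use 5(2) readyD(1)[OF r1] in auto)
    then show ?thesis using True Ff c1 5(4) by simp
  next
    case False
    then show ?thesis using Ff c1 5(2,4) by (auto simp: less_Suc_eq near_fac_def)
  qed
qed (use readyD(1)[OF r] in \<open>auto simp: marks_def\<close>)

lemma clients_near_post:
  assumes r: "ready s" and J: "marks (fst s ''inJ'') J" "J \<subseteq> {..<n}" and G: "marks (fst s ''G'') G" "G \<subseteq> {..<n}"
  shows "post clients_near s (\<lambda>s'. marks (fst s' ''K'') (near_cli (fst s ''cc'') (snd s ''R'' 0) J G) \<and>
    fst s' ''nK'' 0 = card (near_cli (fst s ''cc'') (snd s ''R'' 0) J G))"
  unfolding clients_near_def post_simps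
proof (rule post_For[where N = n and I = "\<lambda>i s'. (\<forall>z<i.
    fst s' ''K'' z = (if z \<in> near_cli (fst s ''cc'') (snd s ''R'' 0) J G then 1 else 0)) \<and>
    fst s' ''nK'' 0 = card {z. z < i \<and> z \<in> near_cli (fst s ''cc'') (snd s ''R'' 0) J G}"], goal_cases)
  case (5 z s1)
  note ag1 = agreeD[OF 5(3)]
  have r1: "ready s1" by (rule ready_agree[OF 5(3)]) (use r in \<open>simp_all add: ready_vars_def ready_def\<close>)
  let ?K = "near_cli (fst s ''cc'') (snd s ''R'' 0) J G"
  have c1: "fst s1 ''cc'' = fst s ''cc''" "snd s1 ''R'' = snd s ''R''" "fst s1 ''inJ'' = fst s ''inJ''" "fst s1 ''G'' = fst s ''G''"
    by (simp_all add: ag1)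
  have Cz: "fst s1 ''C'' z = (if z \<in> C then 1 else 0)" using readyD(17)[OF r1 5(1)] .
  have Jz: "fst s1 ''inJ'' z = (if z \<in> J then 1 else 0)" using marksD[OF J(1) 5(1)] c1 by simp
  have set: "{x. x < Suc z \<and> x \<in> ?K} = (if z \<in> ?K then insert z {x. x < z \<and> x \<in> ?K} else {x. x < z \<and> x \<in> ?K})"
    by (auto simp: less_Suc_eq)
  have fin: "post (Assign ''nK'' (NAdd (var ''nK'') (NGet ''K'' (var ''z'')))) s2
      (\<lambda>s'. (\<forall>x<Suc z. fst s' ''K'' x = (if x \<in> ?K then 1 else 0)) \<and> fst s' ''nK'' 0 = card {x. x < Suc z \<and> x \<in> ?K})"
    if "\<forall>x<z. fst s2 ''K'' x = (if x \<in> ?K then 1 else 0)" "fst s2 ''K'' z = (if z \<in> ?K then 1 else 0)"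
      "fst s2 ''nK'' 0 = card {x. x < z \<and> x \<in> ?K}" "fst s2 ''z'' 0 = z" for s2
    using that unfolding set by (auto simp: less_Suc_eq)
  show ?case
  proof (cases "z \<in> C \<and> fst s ''cc'' z = 0")
    case True
    let ?s = "nupd ''K'' z (fst s ''inJ'' z) s1"
    have "post (For ''f'' ''n'' (When (BAnd (NLess (NLit 0) (NGet ''G'' (var ''f'')))
                (BNot (RLess (RGet ''R'' (NLit 0)) (RGet ''d'' (NAdd (NGet ''mul'' (var ''z'')) (var ''f''))))))
              (Put ''K'' (var ''z'') (NLit 1)))) ?s
      (\<lambda>s2. post (Assign ''nK'' (NAdd (var ''nK'') (NGet ''K'' (var ''z'')))) s2
      (\<lambda>s'. (\<forall>x<Suc z. fst s' ''K'' x = (if x \<in> ?K then 1 else 0)) \<and> fst s' ''nK'' 0 = card {x. x < Suc z \<and> x \<in> ?K}))"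
    proof (rule post_For[where N = n and I = "\<lambda>f s'. (\<forall>x<z. fst s' ''K'' x = (if x \<in> ?K then 1 else 0)) \<and>
        fst s' ''K'' z = (if z \<in> J \<or> (\<exists>f'<f. f' \<in> G \<and> d z f' \<le> snd s ''R'' 0) then 1 else 0)"], goal_cases)
      case inner: (5 f s2)
      note ag2 = agreeD[OF inner(3)]
      have r2: "ready s2"
        by (rule ready_agree[OF inner(3)]) (use r1 in \<open>simp_all add: ready_vars_def ready_def\<close>)
      have R: "fst s2 ''mul'' z = z * n" "snd s2 ''d'' (z * n + f) = d z f" "fst s2 ''G'' f = (if f \<in> G then 1 else 0)"
        "snd s2 ''R'' 0 = snd s ''R'' 0" "fst s2 ''z'' 0 = z"
        using readyD(11)[OF r2, of z] readyD(18)[OF r2 5(1) inner(1)] 5(1) marksD[OF G(1) inner(1)] 5(4)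
        by (simp_all add: ag2 c1)
      show ?case using inner(2,4) R by (auto simp: less_Suc_eq)
    next
      case inner: (6 s2)
      note ag2 = agreeD[OF inner(2)]
      have "z \<in> J \<or> (\<exists>f'<n. f' \<in> G \<and> d z f' \<le> snd s ''R'' 0) \<longleftrightarrow> z \<in> ?K"
        using True G(2) by (auto simp: near_cli_def)
      then show ?case using inner(1) 5(2,4) by (intro fin) (simp_all add: ag2)
    qed (use 5(2) Jz c1 readyD(1)[OF r1] in auto)
    then show ?thesis using True Cz c1 5(4) by simp
  next
    case False
    then have "z \<in> ?K \<longleftrightarrow> z \<in> J" by (auto simp: near_cli_def)
    then have "post (Assign ''nK'' (NAdd (var ''nK'') (NGet ''K'' (var ''z'')))) (nupd ''K'' z (fst s1 ''inJ'' z) s1)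
      (\<lambda>s'. (\<forall>x<Suc z. fst s' ''K'' x = (if x \<in> ?K then 1 else 0)) \<and> fst s' ''nK'' 0 = card {x. x < Suc z \<and> x \<in> ?K})"
      using Jz 5(2,4) by (intro fin) simp_all
    then show ?thesis using 5(4) False Cz c1 by (cases "z \<in> C") simp_all
  qed
next
  case (6 s')
  have "near_cli (fst s ''cc'') (snd s ''R'' 0) J G \<subseteq> {..<n}" using J(2) FC_less by (auto simp: near_cli_def)
  then have "{z. z < n \<and> z \<in> near_cli (fst s ''cc'') (snd s ''R'' 0) J G} = near_cli (fst s ''cc'') (snd s ''R'' 0) J G" by auto
  then show ?case using 6(1) by (simp add: marks_def)
qed (use readyD(1)[OF r] in auto)

definition growth :: "nat \<Rightarrow> real" where "growth t = (1 + 1 / 2 ^ (e - 3)) ^ t"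

definition grown :: "state \<Rightarrow> nat \<Rightarrow> nat set \<Rightarrow> nat \<Rightarrow> bool" where
  "grown s x J t \<longleftrightarrow> x \<in> J \<and> J \<subseteq> {z \<in> C. fst s ''cc'' z = 0} \<and> growth t \<le> card J \<and>
     (\<forall>z\<in>J. d x z \<le> 2 * real t * snd s ''R'' 0)"

definition grown_out :: "state \<Rightarrow> state \<Rightarrow> nat set \<Rightarrow> bool" where
  "grown_out s s' J \<longleftrightarrow>
     (let G = near_fac (fst s ''cf'') (snd s ''R'' 0) J; K = near_cli (fst s ''cc'') (snd s ''R'' 0) J G
      in marks (fst s' ''G'') G \<and> marks (fst s' ''K'') K \<and> fst s' ''nJ'' 0 = card J \<and>
         card K \<le> card J + card J div 2 ^ (e - 3))"

lemma grow_post: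
  assumes r: "ready s" and x: "x \<in> C" "fst s ''cc'' x = 0" "fst s ''x'' 0 = x" and R: "0 \<le> snd s ''R'' 0"
  shows "post grow s (\<lambda>s'. \<exists>J t. grown s x J t \<and> grown_out s s' J)"
proof -
  have xn: "x < n" using x FC_less by simp
  have JC: "J \<subseteq> {..<n}" "finite J" if "grown s x J t" for J t
    using that FC_less by (auto simp: grown_def intro: finite_subset[of _ "{..<n}"])
  let ?I = "\<lambda>i s'. \<exists>J t. grown s x J t \<and> fst s' ''nJ'' 0 = card J \<and> marks (fst s' ''inJ'') J \<and> fst s' ''done'' 0 \<le> 1 \<and>
    (if fst s' ''done'' 0 = 1 then grown_out s s' J else i < card J)"
  show ?thesis unfolding grow_def post_simps
  proof (rule post_For[where N = n and I = "\<lambda>i s'. \<forall>z<i. fst s' ''inJ'' z = 0"], goal_cases)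
    case (6 s0)
    note ag0 = agreeD[OF 6(2)]
    have x0: "fst s0 ''x'' 0 = x" using x by (simp add: ag0)
    show ?case
    proof (rule post_For[where N = "Suc n" and I = ?I], goal_cases)
      case 3
      have "grown s x {x} 0" using x xn dist(4) by (simp add: grown_def growth_def)
      moreover have "marks ((fst s0 ''inJ'')(x := Suc 0)) {x}" using 6(1) by (simp add: marks_def)
      ultimately show ?case using x0 by (intro exI[of _ "{x}"] exI[of _ 0]) simp
    next
      case (5 i s1)
      note ag1 = agreeD[OF 5(3)]
      have "agree UNIV {} s s1 \<and> (\<forall>y. y \<notin> {''z'', ''inJ'', ''nJ'', ''done'', ''st'', ''G'', ''f'', ''K'', ''nK''} \<longrightarrow> fst s1 y = fst s y)"
        using agreeD(2)[OF 5(3)] agreeD(2)[OF 6(2)]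
        by (auto simp: agree_def ag0 ag1 facilities_near_def clients_near_def)
      then have ags1: "agree {''z'', ''inJ'', ''nJ'', ''done'', ''st'', ''G'', ''f'', ''K'', ''nK''} {} s s1"
        by (auto simp: agree_def)
      have r1: "ready s1" by (rule ready_agree[OF ags1 _ _ r]) (simp_all add: ready_vars_def)
      note as1 = agreeD[OF ags1]
      obtain J t where J: "grown s x J t" "fst s1 ''nJ'' 0 = card J" "marks (fst s1 ''inJ'') J" "fst s1 ''done'' 0 \<le> 1"
        "if fst s1 ''done'' 0 = 1 then grown_out s s1 J else i < card J" using 5(2) by blast
      show ?case
      proof (cases "fst s1 ''done'' 0 = 0")
        case False
        then have "fst s1 ''done'' 0 = 1" using J(4) by simp
        then show ?thesis using 5(2) by simp
      next
        case True
        have iJ: "i < card J" using J(5) True by simp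
        let ?G = "near_fac (fst s ''cf'') (snd s ''R'' 0) J"
        let ?K = "near_cli (fst s ''cc'') (snd s ''R'' 0) J ?G"
        have Gn: "?G \<subseteq> {..<n}" using FC_less by (auto simp: near_fac_def)
        have Kn: "?K \<subseteq> {..<n}" using JC(1)[OF J(1)] FC_less by (auto simp: near_cli_def)
        have cardJ: "card J \<le> n" using card_mono[OF _ JC(1)[OF J(1)]] by simp
        have "post facilities_near s1 (\<lambda>s2. post clients_near s2 (\<lambda>s3. marks (fst s3 ''G'') ?G \<and> marks (fst s3 ''K'') ?K \<and>
            fst s3 ''nK'' 0 = card ?K \<and> fst s3 ''nJ'' 0 = card J \<and> marks (fst s3 ''inJ'') J \<and> fst s3 ''done'' 0 = 0 \<and>
            fst s3 ''tol'' (card J) = card J div 2 ^ (e - 3) \<and> fst s3 ''n'' 0 = n))"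
        proof (rule post_weaken[OF facilities_near_post[OF r1 J(3) JC(1)[OF J(1)]]], goal_cases)
          case (1 s2)
          note ag2 = agreeD[OF 1(2), unfolded facilities_near_def]
          have r2: "ready s2" by (rule ready_agree[OF 1(2) _ _ r1]) (simp_all add: ready_vars_def facilities_near_def)
          have G2: "marks (fst s2 ''G'') ?G" using 1(1) by (simp add: as1)
          have J2: "marks (fst s2 ''inJ'') J" using J(3) by (simp add: ag2)
          show ?case
          proof (rule post_weaken[OF clients_near_post[OF r2 J2 JC(1)[OF J(1)] G2 Gn]], goal_cases)
            case (1 s3)
            note ag3 = agreeD[OF 1(2), unfolded clients_near_def]
            have r3: "ready s3" by (rule ready_agree[OF 1(2) _ _ r2]) (simp_all add: ready_vars_def clients_near_def)
            show ?case using 1(1) G2 J2 J(2) True readyD(13)[OF r3 cardJ] readyD(1)[OF r3] by (simp add: ag2 ag3 as1)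
          qed
        qed
        then have "post facilities_near s1 (\<lambda>s2. post clients_near s2 (\<lambda>s3. post
          (If (NLe (var ''nK'') (NAdd (var ''nJ'') (NGet ''tol'' (var ''nJ''))))
          (Assign ''done'' (NLit 1))
          (For ''z'' ''n'' (Put ''inJ'' (var ''z'') (NGet ''K'' (var ''z'')));; Assign ''nJ'' (var ''nK''))) s3 (?I (Suc i))))"
        proof (rule post_weaken, goal_cases)
          case (1 s2)
          show ?case
          proof (rule post_weaken[OF 1(1)], goal_cases)
            case (1 s3)
            then have s3: "marks (fst s3 ''G'') ?G" "marks (fst s3 ''K'') ?K" "fst s3 ''nK'' 0 = card ?K"
              "fst s3 ''nJ'' 0 = card J" "marks (fst s3 ''inJ'') J" "fst s3 ''done'' 0 = 0"
              "fst s3 ''tol'' (card J) = card J div 2 ^ (e - 3)" "fst s3 ''n'' 0 = n" by blast+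
            show ?case
            proof (cases "card ?K \<le> card J + card J div 2 ^ (e - 3)")
              case True
              then have "?I (Suc i) (nupd ''done'' 0 1 s3)"
                using s3 J(1) by (intro exI[of _ J] exI[of _ t]) (simp add: grown_out_def Let_def)
              then show ?thesis using True s3 by simp
            next
              case False
              have fK: "finite ?K" using Kn finite_subset by blast
              have R': "\<forall>z\<in>?K. d x z \<le> 2 * real (Suc t) * snd s ''R'' 0"
              proof
                fix z assume z: "z \<in> ?K"
                show "d x z \<le> 2 * real (Suc t) * snd s ''R'' 0"
                proof (cases "z \<in> J")
                  case True
                  then have "d x z \<le> 2 * real t * snd s ''R'' 0" using J(1) by (simp add: grown_def)
                  also have "\<dots> \<le> 2 * real (Suc t) * snd s ''R'' 0" using R by (intro mult_right_mono) auto
                  finally show ?thesis .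
                next
                  case False
                  then obtain f where f0: "f \<in> ?G" "d z f \<le> snd s ''R'' 0" using z unfolding near_cli_def by blast
                  then obtain z' where z': "z' \<in> J" "d z' f \<le> snd s ''R'' 0" unfolding near_fac_def by blast
                  have f: "f < n" "z < n" "z' \<in> J" "z' < n" "d z f \<le> snd s ''R'' 0" "d z' f \<le> snd s ''R'' 0"
                    using f0 z' z Kn Gn JC(1)[OF J(1)] by blast+
                  have "d x z \<le> d x z' + (d z' f + d f z)"
                    using dist(3)[OF xn f(4) f(2)] dist(3)[OF f(4) f(1) f(2)] by linarith
                  moreover have "d x z' \<le> 2 * real t * snd s ''R'' 0" using J(1) f(3) by (simp add: grown_def)
                  ultimately show ?thesis using f dist(2)[OF f(1,2)] by (simp add: algebra_simps)
                qed
              qed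
              have gr: "growth (Suc t) \<le> card ?K"
              proof -
                have "growth (Suc t) = (1 + 1 / 2 ^ (e - 3)) * growth t" by (simp add: growth_def)
                also have "\<dots> \<le> (1 + 1 / 2 ^ (e - 3)) * card J"
                  using J(1) by (intro mult_left_mono) (auto simp: grown_def add_nonneg_nonneg)
                also have "\<dots> = card J + card J / 2 ^ (e - 3)" by (simp add: field_simps)
                also have "\<dots> \<le> card J + (card J div 2 ^ (e - 3) + 1)"
                proof -
                  have "card J < (card J div 2 ^ (e - 3) + 1) * 2 ^ (e - 3)"
                  proof -
                    have "card J mod 2 ^ (e - 3) < 2 ^ (e - 3)" by simp
                    then show ?thesis
                      using div_mult_mod_eq[of "card J" "2 ^ (e - 3)"] unfolding add_mult_distrib by linarith
                  qed
                  then have "real (card J) \<le> real ((card J div 2 ^ (e - 3) + 1) * 2 ^ (e - 3))" by (simp only: of_nat_le_iff less_imp_le)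
                  then show ?thesis by (simp add: pos_divide_le_eq distrib_right add.commute)
                qed
                also have "\<dots> \<le> card ?K" using False by linarith
                finally show ?thesis by simp
              qed
              have "?K \<subseteq> {z \<in> C. fst s ''cc'' z = 0}" "x \<in> ?K" using J(1) by (auto simp: grown_def near_cli_def)
              then have gK: "grown s x ?K (Suc t)" using R' gr by (simp add: grown_def)
              have iK: "Suc i < card ?K" using False iJ by linarith
              have "post (For ''z'' ''n'' (Put ''inJ'' (var ''z'') (NGet ''K'' (var ''z'')));; Assign ''nJ'' (var ''nK'')) s3 (?I (Suc i))"
                unfolding post_simps
              proof (rule post_For[where N = n and I = "\<lambda>i s'. \<forall>z<i. fst s' ''inJ'' z = (if z \<in> ?K then 1 else 0)"], goal_cases)
                case (5 z s4)
                note ag4 = agreeD[OF 5(3)]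
                have "fst s4 ''K'' z = (if z \<in> ?K then 1 else 0)" using marksD[OF s3(2) 5(1)] by (simp add: ag4)
                then show ?case using 5(2,4) by (auto simp: less_Suc_eq)
              next
                case (6 s4)
                note ag4 = agreeD[OF 6(2)]
                have "marks (fst s4 ''inJ'') ?K" using 6(1) by (simp add: marks_def)
                then show ?case using gK iK s3 by (intro exI[of _ ?K] exI[of _ "Suc t"]) (simp add: ag4)
              qed (use s3 in auto)
              then show ?thesis using False s3 by simp
            qed
          qed
        qed
        then show ?thesis using True by simp
      qed
    next
      case (6 s1)
      then obtain J t where J: "grown s x J t" "if fst s1 ''done'' 0 = 1 then grown_out s s1 J else Suc n < card J" by blast
      have "card J \<le> n" using card_mono[OF _ JC(1)[OF J(1)]] by simp
      then show ?case using J by (auto split: if_splits)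
    qed (use readyD(2)[OF r] in \<open>auto simp: ag0 facilities_near_def clients_near_def marks_def grown_out_def Let_def\<close>)
  qed (use readyD(1)[OF r] in \<open>auto simp: less_Suc_eq\<close>)
qed


definition clients_of :: "state \<Rightarrow> nat \<Rightarrow> nat set" where
  "clients_of s i = {z. z < n \<and> fst s ''cc'' z = Suc i}"

definition facs_of :: "state \<Rightarrow> nat \<Rightarrow> nat set" where
  "facs_of s i = {f. f < n \<and> fst s ''cf'' f = Suc i}"

definition cluster_ok :: "state \<Rightarrow> nat \<Rightarrow> bool" where
  "cluster_ok s i \<longleftrightarrow>
     (let a = fst s ''dem'' i in
      0 < a \<and> a \<le> n \<and> fst s ''tau'' i = a - a div 2 ^ (e - 3) \<and> fst s ''stg'' i = level soft a \<and>
      card (clients_of s i) \<le> a + a div 2 ^ (e - 3) \<and>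
      fst s ''slots'' i = card (facs_of s i) \<and>
      inj_on (\<lambda>j. fst s ''loc'' (i * Suc n + j)) {..<fst s ''slots'' i} \<and>
      (\<forall>j<fst s ''slots'' i. fst s ''loc'' (i * Suc n + j) \<in> facs_of s i) \<and>
      (\<exists>t. growth t \<le> n \<and> (\<forall>z\<in>clients_of s i. \<forall>f\<in>facs_of s i. d z f \<le> (4 * real t + 3) * snd s ''R'' 0)) \<and>
      (\<exists>J\<subseteq>clients_of s i. card J = a \<and> (\<forall>x\<in>J. \<forall>f\<in>F. d x f \<le> snd s ''R'' 0 \<longrightarrow> f \<in> facs_of s i)))"

definition clustered :: "nat \<Rightarrow> state \<Rightarrow> bool" where
  "clustered k s \<longleftrightarrow> fst s ''m'' 0 \<le> k \<and>
     (\<forall>z<n. fst s ''cc'' z \<le> fst s ''m'' 0 \<and> (fst s ''cc'' z \<noteq> 0 \<longrightarrow> z \<in> C)) \<and>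
     (\<forall>f<n. fst s ''cf'' f \<le> fst s ''m'' 0 \<and> (fst s ''cf'' f \<noteq> 0 \<longrightarrow> f \<in> F)) \<and>
     (\<forall>z<k. z \<in> C \<longrightarrow> fst s ''cc'' z \<noteq> 0) \<and>
     (\<forall>z\<in>C. fst s ''cc'' z = 0 \<longrightarrow> (\<forall>f\<in>F. d z f \<le> snd s ''R'' 0 \<longrightarrow> fst s ''cf'' f = 0)) \<and>
     (\<forall>i<fst s ''m'' 0. cluster_ok s i)"

definition cluster_vars :: "vname set" where
  "cluster_vars = {''m'', ''cc'', ''cf'', ''dem'', ''tau'', ''stg'', ''slots'', ''loc''}"

lemma clustered_agree:
  assumes "agree W V s s'" "W \<inter> cluster_vars = {}" "''R'' \<notin> V"
  shows "clustered k s' = clustered k s"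
proof -
  have "fst s' y = fst s y" if "y \<in> cluster_vars" for y
    using assms(1,2) that by (auto simp: agree_def)
  moreover have "snd s' ''R'' = snd s ''R''" using assms(1,3) by (auto simp: agree_def)
  ultimately show ?thesis
    unfolding clustered_def cluster_ok_def clients_of_def facs_of_def by (simp add: cluster_vars_def)
qed

lemma level_loop:
  assumes r: "ready s" and a: "fst s ''nJ'' 0 = a" "0 < a" "a \<le> n" and m: "fst s ''m'' 0 = m"
  shows "post (Put ''stg'' (var ''m'') (NLit 0);;
     (if soft then For ''l'' ''n1'' (When (NLe (NGet ''pow'' (var ''l'')) (var ''nJ'')) (Put ''stg'' (var ''m'') (var ''l'')))
      else Nop)) s (\<lambda>s'. fst s' ''stg'' = (fst s ''stg'')(m := level soft a))"
proof (cases soft)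
  case True
  have "post (For ''l'' ''n1'' (When (NLe (NGet ''pow'' (var ''l'')) (var ''nJ'')) (Put ''stg'' (var ''m'') (var ''l''))))
    (nupd ''stg'' m 0 s) (\<lambda>s'. fst s' ''stg'' = (fst s ''stg'')(m := floor_log a))"
  proof (rule post_For[where N = "Suc n" and I = "\<lambda>i s'. fst s' ''stg'' = (fst s ''stg'')(m := min (i - 1) (floor_log a))"], goal_cases)
    case (5 l s1)
    note ag1 = agreeD[OF 5(3)]
    have R: "fst s1 ''pow'' l = 2 ^ l" "fst s1 ''nJ'' 0 = a" "fst s1 ''m'' 0 = m"
      using readyD(12)[OF r, of l] 5(1) a m by (simp_all add: ag1)
    have "2 ^ l \<le> a \<longleftrightarrow> l \<le> floor_log a"
    proof
      assume "2 ^ l \<le> a"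
      then show "l \<le> floor_log a" using floor_log_le_iff[of "2 ^ l" a] by simp
    next
      assume "l \<le> floor_log a"
      then have "(2::nat) ^ l \<le> 2 ^ floor_log a" by (rule power_increasing) simp
      then show "2 ^ l \<le> a" using floor_log_bounds(1)[OF a(2)] by linarith
    qed
    then show ?case
      using R 5(2,4) min_absorb2[of "floor_log a" "l - 1"] min_absorb2[of "floor_log a" l] min_absorb1[of l "floor_log a"]
      by (cases "l \<le> floor_log a") auto
  next
    case (6 s1)
    have "floor_log a \<le> n" using floor_log_less[OF a(2)] a(3) by linarith
    then show ?case using 6(1) by (simp add: min_def)
  qed (use readyD(2)[OF r] in auto)
  then show ?thesis using True m by (simp add: level_def)
next
  case False
  then show ?thesis using m by (simp add: level_def)
qed

lemma list_facilities:
  assumes r: "ready s" and G: "marks (fst s ''G'') G" and m: "fst s ''m'' 0 = m" "m \<le> n" and nf: "fst s ''nf'' 0 = 0"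
  shows "post (For ''f'' ''n'' (When (NLess (NLit 0) (NGet ''G'' (var ''f'')))
       (Put ''cf'' (var ''f'') (succ_of (var ''m''));;
        Put ''loc'' (NAdd (NGet ''row'' (var ''m'')) (var ''nf'')) (var ''f'');;
        Assign ''nf'' (succ_of (var ''nf''))))) s
    (\<lambda>s'. (\<forall>f<n. fst s' ''cf'' f = (if f \<in> G then Suc m else fst s ''cf'' f)) \<and>
      fst s' ''nf'' 0 = card {f. f < n \<and> f \<in> G} \<and>
      bij_betw (\<lambda>j. fst s' ''loc'' (m * Suc n + j)) {..<fst s' ''nf'' 0} {f. f < n \<and> f \<in> G} \<and>
      (\<forall>a. a < m * Suc n \<longrightarrow> fst s' ''loc'' a = fst s ''loc'' a))"
proof (rule post_For[where N = n and I = "\<lambda>i s'.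
      (\<forall>f<n. fst s' ''cf'' f = (if f < i \<and> f \<in> G then Suc m else fst s ''cf'' f)) \<and>
      fst s' ''nf'' 0 = card {f. f < i \<and> f \<in> G} \<and>
      bij_betw (\<lambda>j. fst s' ''loc'' (m * Suc n + j)) {..<fst s' ''nf'' 0} {f. f < i \<and> f \<in> G} \<and>
      (\<forall>a. a < m * Suc n \<longrightarrow> fst s' ''loc'' a = fst s ''loc'' a)"], goal_cases)
  case (5 f s1)
  note ag1 = agreeD[OF 5(3)]
  have R: "fst s1 ''row'' m = m * Suc n" "fst s1 ''m'' 0 = m" "fst s1 ''G'' f = (if f \<in> G then 1 else 0)"
    using readyD(10)[OF r, of m] m marksD[OF G 5(1)] by (simp_all add: ag1)
  have set: "{x. x < Suc f \<and> x \<in> G} = (if f \<in> G then insert f {x. x < f \<and> x \<in> G} else {x. x < f \<and> x \<in> G})"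
    by (auto simp: less_Suc_eq)
  show ?case
  proof (cases "f \<in> G")
    case True
    let ?k = "fst s1 ''nf'' 0"
    let ?g = "\<lambda>j. ((fst s1 ''loc'')(m * Suc n + ?k := f)) (m * Suc n + j)"
    have "bij_betw (\<lambda>j. fst s1 ''loc'' (m * Suc n + j)) {..<?k} {x. x < f \<and> x \<in> G}" using 5(2) by blast
    then have "bij_betw ?g {..<?k} {x. x < f \<and> x \<in> G}"
      by (rule bij_betw_cong[THEN iffD1, rotated]) auto
    then have "bij_betw ?g (insert ?k {..<?k}) (insert (?g ?k) {x. x < f \<and> x \<in> G})"
      using notIn_Un_bij_betw[of ?k "{..<?k}" ?g "{x. x < f \<and> x \<in> G}"] by simp
    then have "bij_betw ?g {..<Suc ?k} {x. x < Suc f \<and> x \<in> G}"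
      using True by (simp add: set lessThan_Suc)
    moreover have "card {x. x < Suc f \<and> x \<in> G} = Suc ?k" using True 5(2) by (simp add: set)
    moreover have "\<forall>x<n. ((fst s1 ''cf'')(f := Suc m)) x = (if x < Suc f \<and> x \<in> G then Suc m else fst s ''cf'' x)"
      using True 5(2) by (auto simp: less_Suc_eq)
    moreover have "\<forall>a<m * Suc n. ((fst s1 ''loc'')(m * Suc n + ?k := f)) a = fst s ''loc'' a" using 5(2) by simp
    ultimately show ?thesis using True R 5(4) by (simp cong: if_cong)
  next
    case False
    then have "x < Suc f \<and> x \<in> G \<longleftrightarrow> x < f \<and> x \<in> G" for x using less_Suc_eq by auto
    then show ?thesis using False R 5(2,4) by clarsimp
  qed
qed (use readyD(1)[OF r] nf in \<open>auto simp: bij_betw_def\<close>)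

lemma record_post:
  assumes r: "ready s" and c: "clustered k s" and J: "grown s k J t" "fst s ''x'' 0 = k"
    and out: "grown_out s0 s J" and s0: "fst s0 ''cf'' = fst s ''cf''" "fst s0 ''cc'' = fst s ''cc''" "snd s0 ''R'' = snd s ''R''"
    and k: "k < n" and R0: "0 \<le> snd s ''R'' 0"
  shows "post (record_cluster soft) s (clustered (Suc k))"
proof -
  let ?R = "snd s ''R'' 0" and ?m = "fst s ''m'' 0" and ?cf = "fst s ''cf''" and ?cc = "fst s ''cc''"
  define G where "G = near_fac ?cf ?R J"
  define K where "K = near_cli ?cc ?R J G"
  let ?a = "card J"
  have JC: "J \<subseteq> C" "\<forall>z\<in>J. ?cc z = 0" "k \<in> J" "J \<subseteq> {..<n}" "finite J"
    using J(1) FC_less by (auto simp: grown_def intro: finite_subset[of _ "{..<n}"])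
  have GF: "G \<subseteq> F" "\<forall>f\<in>G. ?cf f = 0" "G \<subseteq> {..<n}" using FC_less by (auto simp: G_def near_fac_def)
  have KC: "K \<subseteq> C" "\<forall>z\<in>K. ?cc z = 0" "K \<subseteq> {..<n}" "J \<subseteq> K" using JC FC_less by (auto simp: K_def near_cli_def)
  have out': "marks (fst s ''G'') G" "marks (fst s ''K'') K" "fst s ''nJ'' 0 = ?a" "card K \<le> ?a + ?a div 2 ^ (e - 3)"
    using out s0 by (simp_all add: grown_out_def Let_def G_def K_def)
  have a: "0 < ?a" "?a \<le> n" using JC card_mono[OF _ JC(4)] by (auto simp: card_gt_0_iff)
  have m: "?m \<le> k" "?m < n" "?m \<le> n" using c k by (auto simp: clustered_def)
  let ?s1 = "nupd ''tau'' ?m (?a - ?a div 2 ^ (e - 3)) (nupd ''dem'' ?m ?a s)"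
  have r1: "ready ?s1" using r by (simp add: ready_def)
  have tol: "fst s ''tol'' ?a = ?a div 2 ^ (e - 3)" using readyD(13)[OF r a(2)] .
  let ?final = "\<lambda>s'. fst s' ''dem'' = (fst s ''dem'')(?m := ?a) \<and> fst s' ''tau'' = (fst s ''tau'')(?m := ?a - ?a div 2 ^ (e - 3)) \<and>
    fst s' ''stg'' = (fst s ''stg'')(?m := level soft ?a) \<and> fst s' ''m'' 0 = Suc ?m \<and> snd s' ''R'' 0 = ?R \<and>
    (\<forall>f<n. fst s' ''cf'' f = (if f \<in> G then Suc ?m else ?cf f)) \<and> (\<forall>z<n. fst s' ''cc'' z = (if z \<in> K then Suc ?m else ?cc z)) \<and>
    fst s' ''slots'' = (fst s ''slots'')(?m := card G) \<and>
    bij_betw (\<lambda>j. fst s' ''loc'' (?m * Suc n + j)) {..<card G} G \<and>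
    (\<forall>a. a < ?m * Suc n \<longrightarrow> fst s' ''loc'' a = fst s ''loc'' a)"
  have Gn: "{f. f < n \<and> f \<in> G} = G" using GF by auto
  have "post (record_cluster soft) s ?final"
  proof -
    let ?P = "Put ''stg'' (var ''m'') (NLit 0);;
     (if soft then For ''l'' ''n1'' (When (NLe (NGet ''pow'' (var ''l'')) (var ''nJ'')) (Put ''stg'' (var ''m'') (var ''l'')))
      else Nop)"
    let ?rest = "Assign ''nf'' (NLit 0);;
     For ''f'' ''n'' (When (NLess (NLit 0) (NGet ''G'' (var ''f'')))
       (Put ''cf'' (var ''f'') (succ_of (var ''m''));;
        Put ''loc'' (NAdd (NGet ''row'' (var ''m'')) (var ''nf'')) (var ''f'');;
        Assign ''nf'' (succ_of (var ''nf''))));;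
     Put ''slots'' (var ''m'') (var ''nf'');;
     For ''z'' ''n'' (When (NLess (NLit 0) (NGet ''K'' (var ''z''))) (Put ''cc'' (var ''z'') (succ_of (var ''m''))));;
     Assign ''m'' (succ_of (var ''m''))"
    have "post ?P ?s1 (\<lambda>s'. post ?rest s' ?final)"
    proof (rule post_weaken[OF level_loop[OF r1, of ?a ?m]], goal_cases)
      case (5 s2)
      have "agree {''stg'', ''l''} {} ?s1 s2" using 5(2) by (auto simp: agree_def split: if_splits)
      note ag2 = agreeD[OF this]
      let ?s2 = "nupd ''nf'' 0 0 s2"
      have r2: "ready ?s2"
        by (rule ready_agree[of "{''stg'', ''l'', ''nf''}" "{}" ?s1]) (use r1 in \<open>auto simp: ag2 agree_def ready_vars_def\<close>)
      have l: "post (For ''f'' ''n'' (When (NLess (NLit 0) (NGet ''G'' (var ''f'')))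
       (Put ''cf'' (var ''f'') (succ_of (var ''m''));;
        Put ''loc'' (NAdd (NGet ''row'' (var ''m'')) (var ''nf'')) (var ''f'');;
        Assign ''nf'' (succ_of (var ''nf''))))) ?s2
        (\<lambda>s'. (\<forall>f<n. fst s' ''cf'' f = (if f \<in> G then Suc ?m else fst ?s2 ''cf'' f)) \<and>
        fst s' ''nf'' 0 = card {f. f < n \<and> f \<in> G} \<and>
        bij_betw (\<lambda>j. fst s' ''loc'' (?m * Suc n + j)) {..<fst s' ''nf'' 0} {f. f < n \<and> f \<in> G} \<and>
        (\<forall>a. a < ?m * Suc n \<longrightarrow> fst s' ''loc'' a = fst ?s2 ''loc'' a))"
        by (rule list_facilities[OF r2]) (use out' m in \<open>simp_all add: ag2\<close>)
      show ?case unfolding post_simps nval.simps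
      proof (rule post_weaken[OF l], goal_cases)
        case (1 s3)
        note ag3 = agreeD[OF 1(2)]
        have r3: "ready s3" by (rule ready_agree[OF 1(2) _ _ r2]) (simp_all add: ready_vars_def)
        let ?s3 = "nupd ''slots'' (fst s3 ''m'' 0) (fst s3 ''nf'' 0) s3"
        have "post (For ''z'' ''n'' (When (NLess (NLit 0) (NGet ''K'' (var ''z''))) (Put ''cc'' (var ''z'') (succ_of (var ''m''))))) ?s3
          (\<lambda>s4. ?final (nupd ''m'' 0 (fst s4 ''m'' 0 + 1) s4))"
        proof (rule post_For[where N = n and I = "\<lambda>i s'. \<forall>z<n. fst s' ''cc'' z = (if z < i \<and> z \<in> K then Suc ?m else ?cc z)"], goal_cases)
          case inner: (5 z s4)
          note ag4 = agreeD[OF inner(3)]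
          have "fst s4 ''K'' z = (if z \<in> K then 1 else 0)" "fst s4 ''m'' 0 = ?m"
            using marksD[OF out'(2) inner(1)] by (simp_all add: ag2 ag3 ag4)
          then show ?case using inner(2,4) by (auto simp: less_Suc_eq)
        next
          case inner: (6 s4)
          note ag4 = agreeD[OF inner(2)]
          have nf: "fst s3 ''nf'' 0 = card {f. f < n \<and> f \<in> G}"
            and "bij_betw (\<lambda>j. fst s3 ''loc'' (?m * Suc n + j)) {..<fst s3 ''nf'' 0} {f. f < n \<and> f \<in> G}"
            using 1(1) by blast+
          then have "bij_betw (\<lambda>j. fst s3 ''loc'' (?m * Suc n + j)) {..<card G} G" unfolding nf Gn by blast
          then show ?case using inner(1) 1(1) 5(1) by (simp add: ag2 ag3 ag4 Gn)
        qed (use readyD(1)[OF r3] in \<open>auto simp: ag2 ag3\<close>)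
        then show ?case by simp
      qed
    qed (use out' a m in auto)
    then show ?thesis unfolding record_cluster_def using out'(3) tol by simp
  qed
  then show ?thesis
  proof (rule post_weaken, goal_cases)
    case (1 s')
    then have f: "?final s'" by blast
    have ccm: "?cc z \<noteq> Suc ?m" and cfm: "?cf z \<noteq> Suc ?m" if "z < n" for z
      using c that unfolding clustered_def by (metis Suc_n_not_le_n)+
    have "fst s' ''cc'' z = Suc ?m \<longleftrightarrow> z \<in> K" "fst s' ''cf'' z = Suc ?m \<longleftrightarrow> z \<in> G" if "z < n" for z
      using f ccm[OF that] cfm[OF that] that by simp_all
    then have cl: "clients_of s' ?m = K" "facs_of s' ?m = G"
      using KC(3) GF(3) unfolding clients_of_def facs_of_def by blast+
    have old: "clients_of s' i = clients_of s i" "facs_of s' i = facs_of s i" if "i < ?m" for i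
    proof -
      have "fst s' ''cc'' z = Suc i \<longleftrightarrow> ?cc z = Suc i" "fst s' ''cf'' z = Suc i \<longleftrightarrow> ?cf z = Suc i" if "z < n" for z
        using f that KC(2) GF(2) \<open>i < ?m\<close> by auto
      then show "clients_of s' i = clients_of s i" "facs_of s' i = facs_of s i"
        unfolding clients_of_def facs_of_def by blast+
    qed
    have "cluster_ok s' ?m"
    proof -
      have "\<forall>z\<in>K. \<forall>f\<in>G. d z f \<le> (4 * real t + 3) * ?R"
      proof (intro ballI)
        fix z f assume z: "z \<in> K" "f \<in> G"
        obtain z' where z': "z' \<in> J" "d z' f \<le> ?R" using z(2) by (auto simp: G_def near_fac_def)
        have nn: "z < n" "f < n" "z' < n" "k < n" using z z' KC GF JC by auto
        have k1: "d k z' \<le> 2 * real t * ?R" using J(1) z' by (simp add: grown_def)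
        have k2: "d k z \<le> 2 * real t * ?R + 2 * ?R"
        proof (cases "z \<in> J")
          case True
          then have "d k z \<le> 2 * real t * ?R" using J(1) by (simp add: grown_def)
          then show ?thesis using R0 by simp
        next
          case False
          then obtain g where g: "g \<in> G" "d z g \<le> ?R" using z(1) unfolding K_def near_cli_def by blast
          then obtain y where y: "y \<in> J" "d y g \<le> ?R" unfolding G_def near_fac_def by blast
          have nn': "g < n" "y < n" using g y GF JC by auto
          have "d k y \<le> 2 * real t * ?R" using J(1) y by (simp add: grown_def)
          moreover have "d k z \<le> d k y + (d y g + d g z)"
            using dist(3)[OF nn(4) nn'(2) nn(1)] dist(3)[OF nn'(2,1) nn(1)] by linarith
          ultimately show ?thesis using g y dist(2)[OF nn'(1) nn(1)] by simp
        qed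
        have "d z f \<le> d z k + (d k z' + d z' f)"
          using dist(3)[OF nn(1) nn(4) nn(2)] dist(3)[OF nn(4,3,2)] by linarith
        then show "d z f \<le> (4 * real t + 3) * ?R"
          using k1 k2 z' dist(2)[OF nn(1,4)] by (simp add: algebra_simps)
      qed
      moreover have "growth t \<le> n" using J(1) a(2) by (simp add: grown_def)
      moreover have "\<forall>x\<in>J. \<forall>f\<in>F. d x f \<le> ?R \<longrightarrow> f \<in> G"
      proof (intro ballI impI)
        fix x f assume x: "x \<in> J" "f \<in> F" "d x f \<le> ?R"
        then have "?cf f = 0" using c JC by (auto simp: clustered_def)
        then show "f \<in> G" using x by (auto simp: G_def near_fac_def)
      qed
      moreover have "inj_on (\<lambda>j. fst s' ''loc'' (?m * Suc n + j)) {..<card G}"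
        "\<forall>j<card G. fst s' ''loc'' (?m * Suc n + j) \<in> G"
        using f by (auto simp: bij_betw_def)
      ultimately show ?thesis using f a out'(4) KC(4) unfolding cluster_ok_def cl Let_def by auto
    qed
    moreover have "cluster_ok s' i" if i: "i < ?m" for i
    proof -
      have "fst s' ''loc'' (i * Suc n + j) = fst s ''loc'' (i * Suc n + j)" if "j \<le> n" for j
      proof -
        have "i * Suc n + j < Suc i * Suc n" using that by simp
        also have "\<dots> \<le> ?m * Suc n" using i by (intro mult_le_mono1) simp
        finally show ?thesis using f by blast
      qed
      moreover have "fst s ''slots'' i \<le> n"
      proof -
        have "fst s ''slots'' i = card (facs_of s i)" using c i by (simp add: clustered_def cluster_ok_def Let_def)
        also have "\<dots> \<le> card {..<n}" by (rule card_mono) (auto simp: facs_of_def)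
        finally show ?thesis by simp
      qed
      ultimately have "\<And>j. j < fst s ''slots'' i \<Longrightarrow> fst s' ''loc'' (i * Suc n + j) = fst s ''loc'' (i * Suc n + j)"
        by simp
      then have I: "inj_on (\<lambda>j. fst s' ''loc'' (i * Suc n + j)) {..<fst s ''slots'' i} =
          inj_on (\<lambda>j. fst s ''loc'' (i * Suc n + j)) {..<fst s ''slots'' i}"
        "(\<forall>j<fst s ''slots'' i. fst s' ''loc'' (i * Suc n + j) \<in> facs_of s i) =
          (\<forall>j<fst s ''slots'' i. fst s ''loc'' (i * Suc n + j) \<in> facs_of s i)"
        by (auto intro!: inj_on_cong)
      have ok: "cluster_ok s i" using c i by (simp add: clustered_def)
      have E: "fst s' ''dem'' i = fst s ''dem'' i" "fst s' ''tau'' i = fst s ''tau'' i"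
        "fst s' ''stg'' i = fst s ''stg'' i" "fst s' ''slots'' i = fst s ''slots'' i" "snd s' ''R'' 0 = ?R"
        using f i by simp_all
      show ?thesis using ok unfolding cluster_ok_def old[OF i] Let_def E unfolding I .
    qed
    moreover have "fst s' ''cf'' f = 0" if z: "z \<in> C" "fst s' ''cc'' z = 0" "f \<in> F" "d z f \<le> ?R" for z f
    proof -
      have nn: "z < n" "f < n" using z FC_less by auto
      then have zK: "z \<notin> K" "?cc z = 0" using f z by (auto split: if_splits)
      then have "?cf f = 0" using c z by (auto simp: clustered_def)
      moreover have "f \<notin> G" using zK z by (auto simp: K_def near_cli_def)
      ultimately show ?thesis using f nn by simp
    qed
    moreover have "fst s' ''cc'' z \<le> Suc ?m \<and> (fst s' ''cc'' z \<noteq> 0 \<longrightarrow> z \<in> C)" if "z < n" for z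
      using f c KC that by (auto simp: clustered_def le_SucI)
    moreover have "fst s' ''cf'' x \<le> Suc ?m \<and> (fst s' ''cf'' x \<noteq> 0 \<longrightarrow> x \<in> F)" if "x < n" for x
      using f c GF that by (auto simp: clustered_def le_SucI)
    moreover have "fst s' ''cc'' z \<noteq> 0" if "z < Suc k" "z \<in> C" for z
      using f c KC JC that k by (auto simp: clustered_def less_Suc_eq)
    ultimately show ?case using f m(1) unfolding clustered_def by (auto simp: less_Suc_eq)
  qed
qed

lemma clustering_post:
  assumes r: "ready s" and R: "0 \<le> snd s ''R'' 0"
  shows "post (clustering soft) s (clustered n)"
  unfolding clustering_def post_simps
proof (rule post_For[where N = n and I = "\<lambda>i s'. \<forall>z<i. fst s' ''cf'' z = 0 \<and> fst s' ''cc'' z = 0"], goal_cases)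
  case (6 s0)
  note ag0 = agreeD[OF 6(2)]
  have r0: "ready s0" by (rule ready_agree[OF 6(2) _ _ r]) (simp_all add: ready_vars_def)
  show ?case
  proof (rule post_For[where N = n and I = clustered], goal_cases)
    case 3
    show ?case using 6(1) FC_less by (auto simp: clustered_def)
  next
    case (4 i k s1)
    have "agree {''x''} {} s1 (nupd ''x'' 0 k s1)" by (simp add: agree_def)
    from clustered_agree[OF this] show ?case using 4 by (simp add: cluster_vars_def)
  next
    case (5 k s1)
    note ag1 = agreeD[OF 5(3), unfolded program_defs]
    have "snd s1 ''R'' = snd s0 ''R''" "snd s1 ''d'' = snd s0 ''d''" "\<And>y. y \<in> ready_vars \<Longrightarrow> fst s1 y = fst s0 y"
      by (cases soft; auto simp: ag1 ready_vars_def program_defs)+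
    then have R1: "0 \<le> snd s1 ''R'' 0" and r1: "ready s1"
      using R r0 by (auto simp: ag0 ready_def ready_vars_def)
    show ?case
    proof (cases "k \<in> C \<and> fst s1 ''cc'' k = 0")
      case True
      have "post grow s1 (\<lambda>s2. post (record_cluster soft) s2 (clustered (Suc k)))"
      proof (rule post_weaken[OF grow_post[OF r1 _ _ 5(4) R1]], goal_cases)
        case (3 s2)
        note ag2 = agreeD[OF 3(2), unfolded program_defs]
        obtain J t where J: "grown s1 k J t" "grown_out s1 s2 J" using 3(1) by blast
        have r2: "ready s2" by (rule ready_agree[OF 3(2) _ _ r1]) (simp_all add: ready_vars_def program_defs)
        have c2: "clustered k s2" using clustered_agree[OF 3(2), of k] 5(2) by (simp add: cluster_vars_def program_defs)
        have J2: "grown s2 k J t" using J(1) by (simp add: grown_def ag2)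
        show ?case
          by (rule record_post[OF r2 c2 J2 _ J(2)]) (use 5(1,4) R1 in \<open>simp_all add: ag2\<close>)
      qed (use True in auto)
      then show ?thesis using True 5(4) readyD(17)[OF r1 5(1)] by simp
    next
      case False
      then have "clustered (Suc k) s1" using 5(2) by (auto simp: clustered_def less_Suc_eq)
      then show ?thesis using False 5(4) readyD(17)[OF r1 5(1)] by auto
    qed
  qed (use readyD(1)[OF r0] in \<open>auto simp: program_defs\<close>)
qed (use readyD(1)[OF r] in \<open>auto simp: less_Suc_eq\<close>)

end

section \<open>Breadth-first search\<close>

locale hck_search = hck_instance +
  fixes m :: nat and tau slots stg :: "nat \<Rightarrow> nat"
  assumes mn: "m \<le> n"
    and bins: "\<And>b. b < m \<Longrightarrow> tau b \<le> n \<and> slots b \<le> n" "\<And>b. b < m \<Longrightarrow> stg b \<le> last_stage"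
begin

lemma size_of_sorted: "t \<le> t' \<Longrightarrow> t' < length types \<Longrightarrow> size_of t' \<le> size_of t"
  using item_prefix_props[of n n caps] unfolding item_types_def[symmetric]
  by (cases "t = t'") (auto simp: sorted_wrt_iff_nth_less size_of_def)

sublocale rounding soft n "length types" m last_stage e tau slots stg size_of
  by unfold_locales (rule size_of_sorted)

definition search_ready :: "state \<Rightarrow> bool" where
  "search_ready s \<longleftrightarrow> ready s \<and> fst s ''m'' 0 = m \<and> fst s ''tau'' = tau \<and> fst s ''slots'' = slots \<and> fst s ''stg'' = stg"

lemma search_ready_agree:
  assumes "agree W V s s'" "W \<inter> ready_vars = {}" "''d'' \<notin> V" "W \<inter> {''m'', ''tau'', ''slots'', ''stg''} = {}"
    "search_ready s"
  shows "search_ready s'"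
  using ready_agree[OF assms(1-3)] assms(1,4,5) by (auto simp: search_ready_def agree_def)

definition trim :: "(nat \<Rightarrow> nat) \<Rightarrow> nat \<Rightarrow> nat" where
  "trim a = (\<lambda>l. if l < n + 6 then a l else 0)"

definition vec_of :: "state \<Rightarrow> nat \<Rightarrow> nat \<Rightarrow> nat" where
  "vec_of s q = trim (\<lambda>l. fst s ''X'' (q * (n + 6) + l))"

definition move_ok :: "state \<Rightarrow> nat \<Rightarrow> bool" where
  "move_ok s q \<longleftrightarrow> fst s ''par'' q < q \<and> fst s ''mk'' q < 5 \<and> fst s ''mv'' q \<le> n \<and> fst s ''mw'' q \<le> n \<and> fst s ''mu'' q \<le> n \<and>
     legal (fst s ''mk'' q) (fst s ''mv'' q) (fst s ''mw'' q) (fst s ''mu'' q) (vec_of s (fst s ''par'' q)) \<and>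
     vec_of s q = next_state (fst s ''mk'' q) (fst s ''mv'' q) (fst s ''mw'' q) (fst s ''mu'' q) (vec_of s (fst s ''par'' q))"

definition bfs :: "state \<Rightarrow> bool" where
  "bfs s \<longleftrightarrow> search_ready s \<and> 0 < fst s ''cnt'' 0 \<and> (\<forall>q\<le>fst s ''cnt'' 0. fst s ''base'' q = q * (n + 6)) \<and>
     vec_of s 0 = start \<and> inj_on (vec_of s) {..<fst s ''cnt'' 0} \<and> (\<forall>q<fst s ''cnt'' 0. vec_of s q \<in> space) \<and>
     (\<forall>q. 0 < q \<and> q < fst s ''cnt'' 0 \<longrightarrow> move_ok s q)"

definition extends :: "state \<Rightarrow> state \<Rightarrow> bool" where
  "extends s s' \<longleftrightarrow> fst s ''cnt'' 0 \<le> fst s' ''cnt'' 0 \<and> (\<forall>q<fst s ''cnt'' 0. vec_of s' q = vec_of s q)"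

lemma extends_refl: "extends s s" and extends_trans: "extends s s' \<Longrightarrow> extends s' s'' \<Longrightarrow> extends s s''"
  by (auto simp: extends_def)

definition bfs_vars :: "vname set" where
  "bfs_vars = {''cnt'', ''base'', ''X'', ''par'', ''mk'', ''mv'', ''mw'', ''mu''}"

lemma vec_of_agree: "agree W V s s' \<Longrightarrow> ''X'' \<notin> W \<Longrightarrow> vec_of s' = vec_of s"
  by (auto simp: vec_of_def agree_def fun_eq_iff)

lemma bfs_agree:
  assumes "agree W V s s'" "W \<inter> bfs_vars = {}" "W \<inter> ready_vars = {}" "''d'' \<notin> V"
    "W \<inter> {''m'', ''tau'', ''slots'', ''stg''} = {}" "bfs s"
  shows "bfs s'" "extends s s'" "extends s' s"
proof -
  have "fst s' y = fst s y" if "y \<in> bfs_vars" for y using assms(1,2) that by (auto simp: agree_def)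
  moreover have "vec_of s' = vec_of s" by (rule vec_of_agree[OF assms(1)]) (use assms(2) in \<open>auto simp: bfs_vars_def\<close>)
  ultimately show "bfs s'" "extends s s'" "extends s' s"
    using search_ready_agree[OF assms(1,3,4,5)] assms(6)
    by (simp_all add: bfs_def extends_def move_ok_def bfs_vars_def)
qed

lemma stage_le_n: "j \<le> last_stage \<Longrightarrow> j \<le> n"
  by (auto simp: last_stage_def split: if_splits)

lemma load_state_post:
  assumes b: "bfs s" and q: "fst s ''q'' 0 = q" "q < fst s ''cnt'' 0"
  shows "post load_state s (\<lambda>s'. trim (fst s' ''y'') = vec_of s q)"
  unfolding load_state_def
proof (rule post_For[where N = "n + 6" and I = "\<lambda>i s'. \<forall>l<i. fst s' ''y'' l = fst s ''X'' (q * (n + 6) + l)"], goal_cases)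
  case (5 l s1)
  note ag1 = agreeD[OF 5(3)]
  have "fst s ''base'' q = q * (n + 6)" using b q by (simp add: bfs_def)
  then show ?case using 5(2,4) q by (auto simp: ag1 less_Suc_eq)
qed (use b readyD(3) in \<open>auto simp: bfs_def search_ready_def trim_def vec_of_def\<close>)

lemma trim_apply: "l < n + 6 \<Longrightarrow> trim a l = a l"
  by (simp add: trim_def)

lemma trim_upd: "l < n + 6 \<Longrightarrow> trim (a(l := x)) = (trim a)(l := x)"
  by (auto simp: trim_def fun_eq_iff)

lemma make_move_post:
  assumes r: "search_ready s" and Y: "trim (fst s ''y'') = Y" and k: "fst s ''kk'' 0 = k" "k < 5"
    and v: "fst s ''v'' 0 = v" "v \<le> n" "fst s ''w'' 0 = w" "w \<le> n" "fst s ''u'' 0 = u" "u \<le> n"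
  shows "post (make_move soft) s (\<lambda>s'. if legal k v w u Y then fst s' ''good'' 0 = 1 \<and> trim (fst s' ''y'') = next_state k v w u Y
    else fst s' ''good'' 0 = 0)"
proof -
  have R: "fst s ''n'' 0 = n" "fst s ''N'' 0 = length types" "fst s ''m'' 0 = m" "fst s ''tau'' = tau" "fst s ''slots'' = slots" "fst s ''stg'' = stg"
    using r readyD(1,7) by (auto simp: search_ready_def)
  have it: "t < length types \<Longrightarrow> fst s ''item'' t = size_of t" for t using r readyD(9) by (auto simp: search_ready_def)
  have y: "fst s ''y'' l = Y l" if "l < n + 6" for l using trim_apply[OF that, of "fst s ''y''"] Y by simp
  have yv: "fst s ''y'' v = Y v" "fst s ''y'' w = Y w" "fst s ''y'' u = Y u" "fst s ''y'' (n + 1) = Y (n + 1)"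
    "fst s ''y'' (n + 2) = Y (n + 2)" "fst s ''y'' (n + 3) = Y (n + 3)" "fst s ''y'' (n + 4) = Y (n + 4)" "fst s ''y'' (n + 5) = Y (n + 5)"
    using v by (simp_all add: y)
  have t: "trim ((fst s ''y'')(l := x)) = Y(l := x)" if "l < n + 6" for l x using trim_upd[OF that] Y by simp
  have vl: "v < n + 6" "w < n + 6" "u < n + 6" using v by simp_all
  note S = post_simps nupd_simps nval.simps bval.simps bval_NEq bval_NLe R k v fun_upd_same
  from k(2) consider "k = 0" | "k = 1" | "k = 2" | "k = 3" | "k = 4" by linarith
  then show ?thesis
  proof cases
    case 1
    have n3: "n + 3 \<noteq> v" "n + 4 \<noteq> v" using v by simp_all
    show ?thesis unfolding make_move_def legal_def next_state_def
      using 1 k v R yv n3 vl by (simp add: trim_upd Y)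
  next
    case 2
    show ?thesis unfolding make_move_def legal_def next_state_def
      using 2 k v R yv vl by (simp add: trim_upd Y) (auto simp: fun_eq_iff)
  next
    case 3
    show ?thesis unfolding make_move_def legal_def next_state_def
      using 3 k v R yv vl it[of "Y (n + 5)"] by (simp add: trim_upd Y)
  next
    case 4
    show ?thesis unfolding make_move_def legal_def next_state_def Let_def
      using 4 k v R yv vl by (simp add: trim_upd Y)
  next
    case 5
    show ?thesis unfolding make_move_def legal_def next_state_def
      using 5 k v R yv vl by (simp add: trim_upd Y)
  qed
qed

lemma check_state_post:
  assumes r: "ready s" and Y: "trim (fst s ''y'') = Y" "Y (n + 1) \<le> last_stage" and g: "fst s ''good'' 0 = g"
  shows "post check_state s (\<lambda>s'. fst s' ''good'' 0 = (if admissible Y then g else 0))"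
  unfolding check_state_def
proof (rule post_For[where N = "Suc n" and I = "\<lambda>i s'. fst s' ''good'' 0 =
    (if \<forall>v<i. 0 < Y v \<longrightarrow> allowed soft e n (Y (n + 1)) v \<and> Y v \<le> n then g else 0)"], goal_cases)
  case (5 l s1)
  note ag1 = agreeD[OF 5(3)]
  have y: "fst s1 ''y'' l = Y l" if "l < n + 6" for l using trim_apply[OF that, of "fst s ''y''"] Y by (simp add: ag1)
  have R: "fst s1 ''y'' l = Y l" "fst s1 ''y'' (Suc n) = Y (Suc n)" "fst s1 ''n'' 0 = n" "fst s1 ''row'' (Y (Suc n)) = Y (Suc n) * Suc n"
    "fst s1 ''ok'' (Y (Suc n) * Suc n + l) = (if allowed soft e n (Y (Suc n)) l then 1 else 0)"
    using y 5(1) readyD(1)[OF r] readyD(10)[OF r, of "Y (Suc n)"] readyD(15)[OF r, of "Y (Suc n)" l] Y(2) stage_le_n[of "Y (Suc n)"]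
    by (simp_all add: ag1)
  show ?case using 5(2,4) R by (auto simp: less_Suc_eq)
next
  case (6 s1)
  have "(\<forall>v<Suc n. 0 < Y v \<longrightarrow> allowed soft e n (Y (n + 1)) v \<and> Y v \<le> n) \<longleftrightarrow> admissible Y"
    by (auto simp: admissible_def less_Suc_eq_le)
  then show ?case using 6(1) by simp
qed (use readyD(2)[OF r] g in auto)

lemma find_state_post:
  assumes b: "bfs s" and S: "fst s ''cnt'' 0 \<le> rows_bound" and Y: "trim (fst s ''y'') = Y" and g: "fst s ''good'' 0 = g"
  shows "post find_state s (\<lambda>s'. fst s' ''good'' 0 = (if Y \<in> vec_of s ` {..<fst s ''cnt'' 0} then 0 else g))"
  unfolding find_state_def
proof (rule post_For[where N = rows_bound and I = "\<lambda>i s'. fst s' ''good'' 0 =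
    (if \<exists>q<i. q < fst s ''cnt'' 0 \<and> Y = vec_of s q then 0 else g)"], goal_cases)
  case (5 i s1)
  note ag1 = agreeD[OF 5(3)]
  show ?case
  proof (cases "i < fst s ''cnt'' 0")
    case True
    have "post (For ''l'' ''L''
          (When (BNot (NEq (cell (var ''l'')) (NGet ''X'' (NAdd (row_of (var ''i'')) (var ''l'')))))
            (Assign ''eq'' (NLit 0)))) (nupd ''eq'' 0 1 s1)
       (\<lambda>s2. post (When (NEq (var ''eq'') (NLit 1)) (Assign ''good'' (NLit 0))) s2
        (\<lambda>s'. fst s' ''good'' 0 = (if \<exists>q<Suc i. q < fst s ''cnt'' 0 \<and> Y = vec_of s q then 0 else g)))"
    proof (rule post_For[where N = "n + 6" and I = "\<lambda>l s'. fst s' ''eq'' 0 = (if \<forall>l'<l. Y l' = vec_of s i l' then 1 else 0)"], goal_cases)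
      case inner: (5 l s2)
      note ag2 = agreeD[OF inner(3)]
      have "fst s ''base'' i = i * (n + 6)" using b True by (simp add: bfs_def)
      moreover have "fst s2 ''y'' l = Y l" using trim_apply[OF inner(1), of "fst s ''y''"] Y by (simp add: ag1 ag2)
      moreover have "vec_of s i l = fst s ''X'' (i * (n + 6) + l)" using inner(1) by (simp add: vec_of_def trim_def)
      ultimately show ?case using inner(2,4) 5(4) by (auto simp: ag1 ag2 less_Suc_eq)
    next
      case inner: (6 s2)
      note ag2 = agreeD[OF inner(2)]
      have "(\<forall>l'<n + 6. Y l' = vec_of s i l') \<longleftrightarrow> Y = vec_of s i"
      proof -
        have "Y l' = vec_of s i l'" if "\<not> l' < n + 6" for l'
          unfolding Y[symmetric] using that by (simp add: trim_def vec_of_def)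
        then show ?thesis by (metis ext)
      qed
      then show ?case using inner(1) 5(2) True by (auto simp: ag2 less_Suc_eq)
    qed (use b readyD(3) in \<open>auto simp: bfs_def search_ready_def ag1\<close>)
    then show ?thesis using True 5(4) by (simp add: ag1)
  next
    case False
    then show ?thesis using 5(2,4) by (auto simp: ag1 less_Suc_eq)
  qed
next
  case (6 s1)
  have "(\<exists>q<rows_bound. q < fst s ''cnt'' 0 \<and> Y = vec_of s q) \<longleftrightarrow> Y \<in> vec_of s ` {..<fst s ''cnt'' 0}"
    using S by (force intro: order_less_le_trans)
  then show ?case using 6(1) by simp
qed (use b readyD(6) g in \<open>auto simp: bfs_def search_ready_def\<close>)

lemma append_state_post:
  assumes b: "bfs s" and g: "fst s ''good'' 0 = g" "g \<le> 1"
    and vars: "fst s ''q'' 0 = q" "fst s ''kk'' 0 = k" "fst s ''v'' 0 = v" "fst s ''w'' 0 = w" "fst s ''u'' 0 = u"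
    and le: "q < fst s ''cnt'' 0" "k < 5" "v \<le> n" "w \<le> n" "u \<le> n"
    and new: "g = 1 \<Longrightarrow> legal k v w u (vec_of s q) \<and> trim (fst s ''y'') = next_state k v w u (vec_of s q) \<and>
      admissible (next_state k v w u (vec_of s q)) \<and> next_state k v w u (vec_of s q) \<notin> vec_of s ` {..<fst s ''cnt'' 0}"
  shows "post append_state s (\<lambda>s'. bfs s' \<and> extends s s' \<and>
    (g = 1 \<longrightarrow> next_state k v w u (vec_of s q) \<in> vec_of s' ` {..<fst s' ''cnt'' 0}))"
proof (cases "g = 1")
  case False
  then show ?thesis using g b by (simp add: append_state_def extends_refl)
next
  case True
  let ?c = "fst s ''cnt'' 0" let ?Y = "next_state k v w u (vec_of s q)"
  have B: "\<And>q. q \<le> ?c \<Longrightarrow> fst s ''base'' q = q * (n + 6)" "vec_of s 0 = start" "inj_on (vec_of s) {..<?c}"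
    "\<And>q. q < ?c \<Longrightarrow> vec_of s q \<in> space" "\<And>q. 0 < q \<Longrightarrow> q < ?c \<Longrightarrow> move_ok s q" "search_ready s" "0 < ?c"
    using b by (auto simp: bfs_def)
  note new = new[OF True]
  have Ysp: "?Y \<in> space"
  proof (rule step_space[OF _ B(4)[OF le(1)] bins(1)])
    show "step (vec_of s q) ?Y" by (rule stepI[of k v w u]) (use new le in auto)
  qed
  have "post append_state s (\<lambda>s'. (\<forall>a<?c * (n + 6). fst s' ''X'' a = fst s ''X'' a) \<and> vec_of s' ?c = ?Y \<and>
    fst s' ''par'' = (fst s ''par'')(?c := q) \<and> fst s' ''mk'' = (fst s ''mk'')(?c := k) \<and> fst s' ''mv'' = (fst s ''mv'')(?c := v) \<and>
    fst s' ''mw'' = (fst s ''mw'')(?c := w) \<and> fst s' ''mu'' = (fst s ''mu'')(?c := u) \<and>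
    fst s' ''base'' = (fst s ''base'')(Suc ?c := Suc ?c * (n + 6)) \<and> fst s' ''cnt'' 0 = Suc ?c)"
  proof -
    have "post (For ''l'' ''L'' (Put ''X'' (NAdd (row_of (var ''cnt'')) (var ''l'')) (cell (var ''l'')))) s
      (\<lambda>s1. post (Put ''par'' (var ''cnt'') (var ''q'');;
        Put ''mk'' (var ''cnt'') (var ''kk'');;
        Put ''mv'' (var ''cnt'') (var ''v'');;
        Put ''mw'' (var ''cnt'') (var ''w'');;
        Put ''mu'' (var ''cnt'') (var ''u'');;
        Put ''base'' (succ_of (var ''cnt'')) (NAdd (row_of (var ''cnt'')) (var ''L''));;
        Assign ''cnt'' (succ_of (var ''cnt''))) s1
      (\<lambda>s'. (\<forall>a<?c * (n + 6). fst s' ''X'' a = fst s ''X'' a) \<and> vec_of s' ?c = ?Y \<and>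
    fst s' ''par'' = (fst s ''par'')(?c := q) \<and> fst s' ''mk'' = (fst s ''mk'')(?c := k) \<and> fst s' ''mv'' = (fst s ''mv'')(?c := v) \<and>
    fst s' ''mw'' = (fst s ''mw'')(?c := w) \<and> fst s' ''mu'' = (fst s ''mu'')(?c := u) \<and>
    fst s' ''base'' = (fst s ''base'')(Suc ?c := Suc ?c * (n + 6)) \<and> fst s' ''cnt'' 0 = Suc ?c))"
    proof (rule post_For[where N = "n + 6" and I = "\<lambda>i s'. (\<forall>a<?c * (n + 6). fst s' ''X'' a = fst s ''X'' a) \<and>
        (\<forall>l<i. fst s' ''X'' (?c * (n + 6) + l) = fst s ''y'' l)"], goal_cases)
      case (5 l s1)
      note ag1 = agreeD[OF 5(3)]
      show ?case using 5(2,4) B(1)[of ?c] by (auto simp: ag1 less_Suc_eq)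
    next
      case (6 s1)
      note ag1 = agreeD[OF 6(2)]
      have "vec_of s1 ?c = trim (fst s ''y'')" using 6(1) by (auto simp: vec_of_def trim_def fun_eq_iff)
      then have v1: "vec_of s1 ?c = ?Y" using new by simp
      have "vec_of (den (Put ''par'' (var ''cnt'') (var ''q'');;
        Put ''mk'' (var ''cnt'') (var ''kk'');;
        Put ''mv'' (var ''cnt'') (var ''v'');;
        Put ''mw'' (var ''cnt'') (var ''w'');;
        Put ''mu'' (var ''cnt'') (var ''u'');;
        Put ''base'' (succ_of (var ''cnt'')) (NAdd (row_of (var ''cnt'')) (var ''L''));;
        Assign ''cnt'' (succ_of (var ''cnt''))) s1) ?c = ?Y"
        using v1 by (simp add: vec_of_def)
      moreover have "fst s ''L'' 0 = n + 6" using B(6) readyD(3) by (simp add: search_ready_def)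
      ultimately show ?case using 6(1) vars B(1)[of ?c] by (simp add: ag1 add.commute)
    qed (use B(6) readyD(3) in \<open>auto simp: search_ready_def\<close>)
    then show ?thesis using True g by (simp add: append_state_def)
  qed
  then show ?thesis
  proof (rule post_weaken, goal_cases)
    case (1 s')
    note ag = agreeD[OF 1(2)]
    have f: "\<forall>a<?c * (n + 6). fst s' ''X'' a = fst s ''X'' a" "vec_of s' ?c = ?Y"
      "fst s' ''par'' = (fst s ''par'')(?c := q)" "fst s' ''mk'' = (fst s ''mk'')(?c := k)" "fst s' ''mv'' = (fst s ''mv'')(?c := v)"
      "fst s' ''mw'' = (fst s ''mw'')(?c := w)" "fst s' ''mu'' = (fst s ''mu'')(?c := u)"
      "fst s' ''base'' = (fst s ''base'')(Suc ?c := Suc ?c * (n + 6))" "fst s' ''cnt'' 0 = Suc ?c"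
      using 1(1) by blast+
    have vo: "vec_of s' p = vec_of s p" if "p < ?c" for p
    proof -
      have "p * (n + 6) + l < ?c * (n + 6)" if "l < n + 6" for l
      proof -
        have "p * (n + 6) + l < Suc p * (n + 6)" using that by simp
        also have "\<dots> \<le> ?c * (n + 6)" using \<open>p < ?c\<close> by (intro mult_le_mono1) simp
        finally show ?thesis .
      qed
      then show ?thesis using f(1) by (auto simp: vec_of_def trim_def fun_eq_iff)
    qed
    have im: "vec_of s' ` {..<?c} = vec_of s ` {..<?c}" using vo by auto
    have sr: "search_ready s'"
      by (rule search_ready_agree[OF 1(2) _ _ _ B(6)]) (simp_all add: append_state_def ready_vars_def)
    have inj: "inj_on (vec_of s') {..<Suc ?c}"
    proof -
      have "inj_on (vec_of s') {..<?c}" using B(3) vo by (auto simp: inj_on_def)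
      moreover have "vec_of s' ?c \<notin> vec_of s' ` {..<?c}" unfolding im f(2) using new by blast
      ultimately show ?thesis unfolding lessThan_Suc by simp
    qed
    have mv: "move_ok s' p" if "0 < p" "p < Suc ?c" for p
    proof (cases "p = ?c")
      case True
      then show ?thesis unfolding move_ok_def True f(3-7) using le new vo[OF le(1)] f(2) by simp
    next
      case False
      then have "move_ok s p" "p < ?c" using B(5) that by auto
      then show ?thesis unfolding move_ok_def f(3-7) using vo by simp
    qed
    have bs: "\<forall>p\<le>Suc ?c. fst s' ''base'' p = p * (n + 6)" using B(1) f(8) by (auto simp: le_Suc_eq)
    have sp: "\<forall>p<Suc ?c. vec_of s' p \<in> space" using vo B(4) Ysp f(2) by (auto simp: less_Suc_eq)
    have v0: "vec_of s' 0 = start" using vo[of 0] B(2,7) by simp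
    have "bfs s'" unfolding bfs_def f(9)
      by (intro conjI sr inj bs sp v0 allI impI mv) simp_all
    moreover have "?Y \<in> vec_of s' ` {..<Suc ?c}" using f(2) by (metis imageI lessI lessThan_iff)
    ultimately show ?case using vo f(9) by (simp add: extends_def)
  qed
qed

definition tried :: "nat \<Rightarrow> nat \<Rightarrow> nat \<Rightarrow> nat \<Rightarrow> nat \<Rightarrow> state \<Rightarrow> bool" where
  "tried q k v w u s \<longleftrightarrow> (legal k v w u (vec_of s q) \<and> admissible (next_state k v w u (vec_of s q)) \<longrightarrow>
     next_state k v w u (vec_of s q) \<in> vec_of s ` {..<fst s ''cnt'' 0})"

lemma tried_extends:
  assumes "q < fst s ''cnt'' 0" "extends s s'" "tried q k v w u s"
  shows "tried q k v w u s'"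
proof -
  have "vec_of s' q = vec_of s q" "vec_of s ` {..<fst s ''cnt'' 0} \<subseteq> vec_of s' ` {..<fst s' ''cnt'' 0}"
  proof -
    show "vec_of s' q = vec_of s q" using assms(1,2) by (auto simp: extends_def)
    show "vec_of s ` {..<fst s ''cnt'' 0} \<subseteq> vec_of s' ` {..<fst s' ''cnt'' 0}"
    proof
      fix y assume "y \<in> vec_of s ` {..<fst s ''cnt'' 0}"
      then obtain p where "p < fst s ''cnt'' 0" "y = vec_of s p" by blast
      then have "p < fst s' ''cnt'' 0" "y = vec_of s' p" using assms(2) by (auto simp: extends_def)
      then show "y \<in> vec_of s' ` {..<fst s' ''cnt'' 0}" by blast
    qed
  qed
  then show ?thesis using assms(3) by (auto simp: tried_def)
qed

lemma tried_mono:
  "q < fst s ''cnt'' 0 \<Longrightarrow> extends s s1 \<Longrightarrow> extends s1 s2 \<Longrightarrow> tried q k v w u s1 \<Longrightarrow> tried q k v w u s2"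
  by (rule tried_extends[of q s1]) (auto simp: extends_def)

lemma cnt_bound:
  assumes "bfs s"
  shows "fst s ''cnt'' 0 \<le> rows_bound"
proof -
  have "fst s ''cnt'' 0 = card (vec_of s ` {..<fst s ''cnt'' 0})" using assms by (simp add: bfs_def card_image)
  also have "\<dots> \<le> card space" by (rule card_mono) (use assms space_card in \<open>auto simp: bfs_def\<close>)
  also have "\<dots> \<le> state_bound" using space_card by blast
  also have "\<dots> \<le> rows_bound"
  proof -
    have N: "length types \<le> n * n" using item_prefix_props[of n n caps] by (simp add: item_types_def)
    have "Suc m * Suc n * Suc n * Suc (length types) \<le> (n + 2) * (n + 2) * (n + 2) * ((n + 2) * (n + 2))"
      by (intro mult_le_mono) (use mn N in auto)
    also have "\<dots> = (n + 2) ^ 5"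
    proof -
      have "x * x * x * (x * x) = x ^ 5" for x :: nat by (simp add: eval_nat_numeral)
      then show ?thesis .
    qed
    finally show ?thesis unfolding state_bound_def rows_bound_def by (rule mult_le_mono2)
  qed
  finally show ?thesis .
qed

abbreviation try_move :: prog where
  "try_move \<equiv> load_state;; make_move soft;; check_state;; find_state;; append_state"

lemma try_move_post:
  assumes b: "bfs s" and vars: "fst s ''q'' 0 = q" "fst s ''kk'' 0 = k" "fst s ''v'' 0 = v" "fst s ''w'' 0 = w" "fst s ''u'' 0 = u"
    and le: "q < fst s ''cnt'' 0" "k < 5" "v \<le> n" "w \<le> n" "u \<le> n"
  shows "post try_move s (\<lambda>s'. bfs s' \<and> extends s s' \<and> tried q k v w u s')"
  unfolding post_simps
proof (rule post_weaken[OF load_state_post[OF b vars(1) le(1)]], goal_cases)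
  case (1 s1)
  note ag1 = agreeD[OF 1(2), unfolded load_state_def]
  note b1 = bfs_agree[OF 1(2) _ _ _ _ b, simplified load_state_def bfs_vars_def ready_vars_def, simplified]
  have sr1: "search_ready s1" using b1(1) by (simp add: bfs_def)
  let ?B = "vec_of s q" let ?Y = "next_state k v w u ?B"
  have Y1: "trim (fst s1 ''y'') = ?B" using 1(1) .
  have st0: "?B (n + 1) \<le> last_stage" using b le(1) by (auto simp: bfs_def space_def)
  show ?case
  proof (rule post_weaken[OF make_move_post[where k = k and v = v and w = w and u = u, OF sr1 Y1]], goal_cases)
    case (9 s2)
    have a2: "agree {''y'', ''good''} {} s1 s2" using 9(2) by (auto simp: agree_def make_move_def)
    note ag2 = agreeD[OF a2]
    note b2 = bfs_agree[OF a2 _ _ _ _ b1(1), simplified bfs_vars_def ready_vars_def, simplified]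
    have r2: "ready s2" using b2(1) by (simp add: bfs_def search_ready_def)
    define g2 where "g2 = fst s2 ''good'' 0"
    define Y2 where "Y2 = trim (fst s2 ''y'')"
    have g2: "g2 = (if legal k v w u ?B then 1 else 0)" "legal k v w u ?B \<Longrightarrow> Y2 = ?Y"
      using 9(1) by (auto simp: g2_def Y2_def split: if_splits)
    show ?case
    proof (cases "legal k v w u ?B")
      case True
      have st: "Y2 (n + 1) \<le> last_stage"
        unfolding g2(2)[OF True] using st0 le(3-5) by (auto simp: next_state_def Let_def)
      show ?thesis
      proof (rule post_weaken[OF check_state_post[OF r2 Y2_def[symmetric] st g2_def[symmetric]]], goal_cases)
        case (1 s3)
        note ag3 = agreeD[OF 1(2), unfolded check_state_def]
        note b3 = bfs_agree[OF 1(2) _ _ _ _ b2(1), simplified check_state_def bfs_vars_def ready_vars_def, simplified]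
        have Y3: "trim (fst s3 ''y'') = Y2" by (simp add: ag3 Y2_def)
        show ?case
        proof (rule post_weaken[OF find_state_post[OF b3(1) cnt_bound[OF b3(1)] Y3 1(1)]], goal_cases)
          case (1 s4)
          note ag4 = agreeD[OF 1(2), unfolded find_state_def]
          note b4 = bfs_agree[OF 1(2) _ _ _ _ b3(1), simplified find_state_def bfs_vars_def ready_vars_def, simplified]
          have ex: "extends s s4" using b1(2) b2(2) b3(2) b4(2) extends_trans by blast
          have v4: "vec_of s4 = vec_of s3" by (rule vec_of_agree[OF 1(2)]) (simp add: find_state_def)
          have c4: "fst s4 ''cnt'' 0 = fst s ''cnt'' 0" "fst s3 ''cnt'' 0 = fst s ''cnt'' 0"
            by (simp_all add: ag1 ag2 ag3 ag4)
          have q4: "vec_of s4 q = ?B" "q < fst s4 ''cnt'' 0" using ex le(1) c4 by (auto simp: extends_def)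
          have q3: "vec_of s3 q = ?B" using q4(1) v4 by simp
          let ?g = "if Y2 \<in> vec_of s3 ` {..<fst s3 ''cnt'' 0} then 0 else if admissible Y2 then g2 else 0"
          have g4: "fst s4 ''good'' 0 = ?g" using 1(1) .
          have nw: "?g = 1 \<Longrightarrow> legal k v w u (vec_of s4 q) \<and> trim (fst s4 ''y'') = next_state k v w u (vec_of s4 q) \<and>
            admissible (next_state k v w u (vec_of s4 q)) \<and> next_state k v w u (vec_of s4 q) \<notin> vec_of s4 ` {..<fst s4 ''cnt'' 0}"
            unfolding v4 c4 q3 using True g2 Y3 by (auto simp: ag4 split: if_splits)
          have g1: "?g \<le> 1" using g2(1) by auto
          show ?case
          proof (rule post_weaken[OF append_state_post[OF b4(1) g4 g1 _ _ _ _ _ q4(2) le(2-5) nw]], goal_cases)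
            case (7 s5)
            have "tried q k v w u s5"
            proof (cases "Y2 \<in> vec_of s3 ` {..<fst s3 ''cnt'' 0}")
              case in3: True
              then have "tried q k v w u s4" using True g2(2) unfolding tried_def v4 c4 q3 by simp
              then show ?thesis using tried_extends[OF q4(2)] 7(1) by blast
            next
              case False
              then show ?thesis using 7(1) True g2 q4 unfolding tried_def by (auto simp: extends_def)
            qed
            then show ?case using 7(1) ex extends_trans by blast
          qed (use vars in \<open>simp_all add: ag1 ag2 ag3 ag4\<close>)
        qed
      qed
    next
      case False
      have st: "post check_state s2 (\<lambda>s'. fst s' ''good'' 0 = 0)"
      proof -
        have "post check_state s2 (\<lambda>s'. fst s' ''good'' 0 = 0)" unfolding check_state_def
          by (rule post_For[where N = "Suc n" and I = "\<lambda>i s'. fst s' ''good'' 0 = 0"])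
            (use g2 False readyD(2)[OF r2] in \<open>auto simp: g2_def\<close>)
        then show ?thesis .
      qed
      show ?thesis
      proof (rule post_weaken[OF st], goal_cases)
        case (1 s3)
        note ag3 = agreeD[OF 1(2), unfolded check_state_def]
        note b3 = bfs_agree[OF 1(2) _ _ _ _ b2(1), simplified check_state_def bfs_vars_def ready_vars_def, simplified]
        show ?case
        proof (rule post_weaken[OF find_state_post[OF b3(1) cnt_bound[OF b3(1)] refl 1(1)]], goal_cases)
          case (1 s4)
          note b4 = bfs_agree[OF 1(2) _ _ _ _ b3(1), simplified find_state_def bfs_vars_def ready_vars_def, simplified]
          have ex: "extends s s4" using b1(2) b2(2) b3(2) b4(2) extends_trans by blast
          then have "vec_of s4 q = ?B" using le(1) by (auto simp: extends_def)
          then have "tried q k v w u s4" using False by (simp add: tried_def)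
          moreover have "fst s4 ''good'' 0 = 0" using 1(1) by simp
          ultimately show ?case using b4(1) ex by (simp add: append_state_def)
        qed
      qed
    qed
  qed (use vars le in \<open>simp_all add: ag1\<close>)
qed

lemma extend_loop:
  assumes p: "proper (For x l p)" "fst s l 0 = N" "bfs s"
    and x: "x \<notin> bfs_vars" "x \<notin> ready_vars" "x \<notin> {''m'', ''tau'', ''slots'', ''stg''}"
    and mono: "\<And>i s1 s2. i < N \<Longrightarrow> extends s s1 \<Longrightarrow> extends s1 s2 \<Longrightarrow> D i s1 \<Longrightarrow> D i s2"
    and body: "\<And>i s1. i < N \<Longrightarrow> bfs s1 \<Longrightarrow> extends s s1 \<Longrightarrow> agree (insert x (nwrites p)) (rwrites p) s s1 \<Longrightarrow> fst s1 x 0 = i \<Longrightarrow>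
      post p s1 (\<lambda>s'. bfs s' \<and> extends s1 s' \<and> D i s')"
  shows "post (For x l p) s (\<lambda>s'. bfs s' \<and> extends s s' \<and> (\<forall>i<N. D i s'))"
proof (rule post_For[where N = N and I = "\<lambda>i s'. bfs s' \<and> extends s s' \<and> (\<forall>i'<i. i' < N \<longrightarrow> D i' s')"], goal_cases)
  case 3
  show ?case using p(3) by (simp add: extends_refl)
next
  case (4 i k s1)
  have "agree {x} {} s1 (nupd x 0 k s1)" by (simp add: agree_def)
  have c: "bfs (nupd x 0 k s1)" "extends s1 (nupd x 0 k s1)"
    using bfs_agree[OF \<open>agree {x} {} s1 (nupd x 0 k s1)\<close>] x 4 by auto
  show ?case
  proof (intro conjI allI impI)
    show "bfs (nupd x 0 k s1)" by (rule c)
    show "extends s (nupd x 0 k s1)" using 4 c(2) extends_trans by blast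
    show "D i' (nupd x 0 k s1)" if "i' < i" "i' < N" for i'
      using mono[OF that(2) _ c(2)] 4 that by blast
  qed
next
  case (5 i s1)
  show ?case
  proof (rule post_weaken[OF body[OF 5(1) _ _ 5(3,4)]], goal_cases)
    case (3 s2)
    then show ?case using 5(2) mono[of _ s1 s2] extends_trans[of s s1 s2] by (auto simp: less_Suc_eq)
  qed (use 5(2) in auto)
qed (use p in auto)

definition closed :: "nat \<Rightarrow> state \<Rightarrow> bool" where
  "closed q s \<longleftrightarrow> (\<forall>k<5. \<forall>v<Suc n. \<forall>w<Suc n. \<forall>u<Suc n. tried q k v w u s)"

lemma closed_extends: "q < fst s ''cnt'' 0 \<Longrightarrow> extends s s' \<Longrightarrow> closed q s \<Longrightarrow> closed q s'"
  using tried_extends unfolding closed_def by blast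

lemma try_moves_post:
  assumes b: "bfs s" and q: "fst s ''q'' 0 = q" "q < fst s ''cnt'' 0"
  shows "post (For ''kk'' ''five'' (For ''v'' ''n1'' (For ''w'' ''n1'' (For ''u'' ''n1'' try_move)))) s
    (\<lambda>s'. bfs s' \<and> extends s s' \<and> closed q s')"
  unfolding closed_def
proof (rule extend_loop[where N = 5], goal_cases)
  have rd: "bfs s \<Longrightarrow> ready s" for s by (simp add: bfs_def search_ready_def)
  note defs = load_state_def make_move_def check_state_def find_state_def append_state_def
  note simps = ready_vars_def bfs_vars_def defs
  case (8 k s1)
  note ag1 = agreeD[OF 8(4), unfolded defs]
  have q1: "q < fst s1 ''cnt'' 0" using 8(3) q by (simp add: extends_def)
  show ?case
  proof (rule extend_loop[where N = "Suc n"], goal_cases)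
    case inner: (8 v s2)
    note ag2 = agreeD[OF inner(4), unfolded defs]
    have q2: "q < fst s2 ''cnt'' 0" using inner(3) q1 by (simp add: extends_def)
    show ?case
    proof (rule extend_loop[where N = "Suc n"], goal_cases)
      case inner3: (8 w s3)
      note ag3 = agreeD[OF inner3(4), unfolded defs]
      have q3: "q < fst s3 ''cnt'' 0" using inner3(3) q2 by (simp add: extends_def)
      show ?case
      proof (rule extend_loop[where N = "Suc n"], goal_cases)
        case inner4: (8 u s4)
        note ag4 = agreeD[OF inner4(4), unfolded defs]
        have q4: "q < fst s4 ''cnt'' 0" using inner4(3) q3 by (simp add: extends_def)
        show ?case
          by (rule try_move_post[OF inner4(2) _ _ _ _ _ q4])
            (use q 8(1,5) inner(1,5) inner3(1,5) inner4(1,5) in \<open>simp_all add: ag1 ag2 ag3 ag4\<close>)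
      next
        case inner4: (7 u s4 s5)
        then show ?case using tried_mono[OF q3] by blast
      qed (use inner3(2) rd[OF inner3(2)] in \<open>simp_all add: readyD(2) simps\<close>)
    next
      case inner3: (7 w s4 s5)
      then show ?case using tried_mono[OF q2] by blast
    qed (use inner(2) rd[OF inner(2)] in \<open>simp_all add: readyD(2) simps\<close>)
  next
    case inner: (7 w s4 s5)
    then show ?case using tried_mono[OF q1] by blast
  qed (use 8(2) rd[OF 8(2)] in \<open>simp_all add: readyD(2) simps\<close>)
next
  case (7 w s4 s5)
  then show ?case using tried_mono[OF q(2)] by blast
qed (use b readyD(4) in \<open>simp_all add: bfs_def search_ready_def ready_vars_def bfs_vars_def load_state_def make_move_def
  check_state_def find_state_def append_state_def\<close>)

lemma search_post:
  assumes r: "search_ready s"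
  shows "post (search soft) s (\<lambda>s'. bfs s' \<and> (\<forall>q<fst s' ''cnt'' 0. closed q s'))"
  unfolding search_def post_simps
proof (rule post_For[where N = "n + 6" and I = "\<lambda>i s'. \<forall>l<i. fst s' ''X'' l = 0"], goal_cases)
  case (6 s1)
  note ag1 = agreeD[OF 6(2)]
  have rs: "ready s" using r by (simp add: search_ready_def)
  let ?s2 = "nupd ''cnt'' 0 1 (nupd ''base'' 1 (n + 6) (nupd ''X'' (n + 1) last_stage s1))"
  have X: "vec_of ?s2 0 = start"
    using 6(1) by (auto simp: vec_of_def trim_def start_def fun_eq_iff)
  have "search_ready ?s2"
    by (rule search_ready_agree[of "{''cnt'', ''base'', ''X'', ''l''}" "{}" s])
      (use r in \<open>auto simp: agree_def ag1 ready_vars_def\<close>)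
  moreover have "fst ?s2 ''base'' q = q * (n + 6)" if "q \<le> 1" for q using that by (cases "q = 0") (auto simp: ag1)
  ultimately have b2: "bfs ?s2" using X start_space unfolding bfs_def by (auto simp: lessThan_Suc)
  have "post (For ''q'' ''S'' (When (NLess (var ''q'') (var ''cnt''))
       (For ''kk'' ''five'' (For ''v'' ''n1'' (For ''w'' ''n1'' (For ''u'' ''n1'' try_move)))))) ?s2
    (\<lambda>s'. bfs s' \<and> (\<forall>q<fst s' ''cnt'' 0. closed q s'))"
  proof (rule post_For[where N = rows_bound and I = "\<lambda>i s'. bfs s' \<and> (\<forall>q<i. q < fst s' ''cnt'' 0 \<longrightarrow> closed q s')"], goal_cases)
    case (4 i k s3)
    have "agree {''q''} {} s3 (nupd ''q'' 0 k s3)" by (simp add: agree_def)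
    note c = bfs_agree[OF this]
    have c: "bfs (nupd ''q'' 0 k s3)" "extends s3 (nupd ''q'' 0 k s3)"
      using c 4 by (auto simp: bfs_vars_def ready_vars_def)
    then show ?case using 4 closed_extends[OF _ c(2)] by auto
  next
    case (5 i s3)
    show ?case
    proof (cases "i < fst s3 ''cnt'' 0")
      case True
      have "post (For ''kk'' ''five'' (For ''v'' ''n1'' (For ''w'' ''n1'' (For ''u'' ''n1'' try_move)))) s3
        (\<lambda>s'. bfs s' \<and> (\<forall>q<Suc i. q < fst s' ''cnt'' 0 \<longrightarrow> closed q s'))"
      proof (rule post_weaken[OF try_moves_post[OF _ 5(4) True]], goal_cases)
        case (2 s4)
        have "closed q s4" if "q < i" for q
          using closed_extends[of q s3 s4] 5(2) 2(1) that True by auto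
        then show ?case using 2(1) by (auto simp: less_Suc_eq)
      qed (use 5(2) in auto)
      then show ?thesis using True 5(4) by simp
    next
      case False
      then show ?thesis using 5(2,4) by (auto simp: less_Suc_eq)
    qed
  next
    case (6 s3)
    then show ?case using cnt_bound[of s3] by auto
  qed (use b2 readyD(6)[OF rs] in \<open>simp_all add: ag1 load_state_def make_move_def check_state_def find_state_def append_state_def\<close>)
  then show ?case using readyD(1,3,5)[OF rs] by (simp add: ag1)
qed (use r readyD(3) in \<open>auto simp: search_ready_def less_Suc_eq\<close>)

lemma bfs_complete:
  assumes b: "bfs s" "\<And>q. q < fst s ''cnt'' 0 \<Longrightarrow> closed q s" and y: "step\<^sup>*\<^sup>* start y"
  shows "\<exists>q<fst s ''cnt'' 0. vec_of s q = y"
  using y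
proof (induction rule: rtranclp_induct)
  case base
  then show ?case using b(1) by (auto simp: bfs_def)
next
  case (step y z)
  then obtain q where q: "q < fst s ''cnt'' 0" "vec_of s q = y" by blast
  obtain k v w u where "k < 5" "v \<le> n" "w \<le> n" "u \<le> n" "legal k v w u y" "z = next_state k v w u y" "admissible z"
    using step(2) unfolding step_def by blast
  then have "z \<in> vec_of s ` {..<fst s ''cnt'' 0}"
    using b(2)[OF q(1)] q(2) unfolding closed_def tried_def by (auto simp: less_Suc_eq_le)
  then show ?case by auto
qed

end

section \<open>Replaying the search and writing the solution\<close>

lemma allow_enough:
  fixes sz :: "nat \<Rightarrow> nat"
  assumes D: "0 < D" and A: "finite A" and a: "a - a div (4 * D) \<le> (\<Sum>t\<in>A. sz t)"
  shows "a + a div (4 * D) \<le> (\<Sum>t\<in>A. sz t + sz t div D + 1)"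
proof -
  let ?x = "a div (4 * D)" and ?E = "\<Sum>t\<in>A. sz t div D + 1"
  have "sz t \<le> D * (sz t div D + 1)" for t
  proof -
    have "sz t mod D < D" using D by simp
    then show ?thesis using mult_div_mod_eq[of D "sz t"] unfolding add_mult_distrib2 by linarith
  qed
  then have "(\<Sum>t\<in>A. sz t) \<le> D * ?E" unfolding sum_distrib_left by (rule sum_mono)
  with a have 1: "a - ?x \<le> D * ?E" by linarith
  have "4 * D * ?x \<le> a" by simp
  moreover have "?x \<le> D * ?x" using D by simp
  moreover have "D * (2 * ?x) = 2 * (D * ?x)" "4 * D * ?x = 4 * (D * ?x)" by simp_all
  ultimately have "D * (2 * ?x) \<le> a - ?x" by linarith
  with 1 have "D * (2 * ?x) \<le> D * ?E" by linarith
  then have "2 * ?x \<le> ?E" using D by simp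
  moreover have "(\<Sum>t\<in>A. sz t + sz t div D + 1) = (\<Sum>t\<in>A. sz t) + ?E"
    unfolding sum.distrib[symmetric] by (simp add: add.assoc)
  ultimately show ?thesis using a by linarith
qed

definition (in hck_instance) allow :: "nat \<Rightarrow> nat" where
  "allow t = size_of t + size_of t div 2 ^ (e - 5) + 1"

context hck_search
begin

lemma bfs_ready: "bfs s \<Longrightarrow> ready s"
  by (simp add: bfs_def search_ready_def)

lemma find_final_post:
  assumes b: "bfs s"
  shows "post find_final s (\<lambda>s'. fst s' ''found'' 0 \<le> 1 \<and>
    (fst s' ''found'' 0 = 1 \<longrightarrow> fst s' ''fin'' 0 < fst s ''cnt'' 0 \<and> final (vec_of s (fst s' ''fin'' 0))) \<and>
    (fst s' ''found'' 0 = 0 \<longrightarrow> (\<forall>q<fst s ''cnt'' 0. \<not> final (vec_of s q))))"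
  unfolding find_final_def post_simps
proof (rule post_For[where N = rows_bound and I = "\<lambda>i s'. fst s' ''found'' 0 \<le> 1 \<and>
    (fst s' ''found'' 0 = 1 \<longrightarrow> fst s' ''fin'' 0 < fst s ''cnt'' 0 \<and> final (vec_of s (fst s' ''fin'' 0))) \<and>
    (fst s' ''found'' 0 = 0 \<longrightarrow> (\<forall>q<i. q < fst s ''cnt'' 0 \<longrightarrow> \<not> final (vec_of s q)))"], goal_cases)
  case (5 q s1)
  note ag1 = agreeD[OF 5(3), unfolded load_state_def]
  have ags: "agree {''q'', ''found'', ''fin'', ''eq'', ''l'', ''y''} {} s s1"
    using 5(3) by (auto simp: agree_def load_state_def)
  note b1 = bfs_agree[OF ags _ _ _ _ b, simplified bfs_vars_def ready_vars_def, simplified]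
  have v1: "vec_of s1 = vec_of s" by (rule vec_of_agree[OF ags]) simp
  have c1: "fst s1 ''cnt'' 0 = fst s ''cnt'' 0" by (simp add: ag1)
  show ?case
  proof (cases "q < fst s ''cnt'' 0")
    case False
    then show ?thesis using 5(2,4) c1 by (auto simp: less_Suc_eq)
  next
    case True
    let ?Y = "vec_of s q"
    let ?g = "BAnd (NEq (cell (reg 1)) (NLit 0)) (BAnd (NEq (cell (reg 2)) (var ''m'')) (NEq (cell (reg 3)) (NLit 0)))"
    have "post (load_state;;
        Assign ''eq'' (NLit 0);;
        When ?g (Assign ''eq'' (NLit 1));;
        For ''l'' ''n1'' (When (NLess (NLit 0) (cell (var ''l''))) (Assign ''eq'' (NLit 0)));;
        When (NEq (var ''eq'') (NLit 1)) (Assign ''found'' (NLit 1);; Assign ''fin'' (var ''q''))) s1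
      (\<lambda>s'. fst s' ''found'' 0 = (if final ?Y then 1 else fst s1 ''found'' 0) \<and>
        fst s' ''fin'' 0 = (if final ?Y then q else fst s1 ''fin'' 0))"
      unfolding post_simps
    proof (rule post_weaken[OF load_state_post[OF b1(1) 5(4)]], goal_cases)
      case 1
      show ?case using True c1 by simp
    next
      case (2 s2)
      note ag2 = agreeD[OF 2(2), unfolded load_state_def]
      have y: "fst s2 ''y'' l = ?Y l" if "l < n + 6" for l
        using 2(1) trim_apply[OF that, of "fst s2 ''y''"] v1 by simp
      have yr: "fst s2 ''y'' (Suc n) = ?Y (n + 1)" "fst s2 ''y'' (Suc (Suc n)) = ?Y (n + 2)" "fst s2 ''y'' (n + 3) = ?Y (n + 3)"
        by (simp_all add: y)
      have r2: "ready s2" by (rule ready_agree[OF 2(2) _ _ bfs_ready[OF b1(1)]]) (simp_all add: load_state_def ready_vars_def)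
      have R: "fst s2 ''n'' 0 = n" "fst s2 ''m'' 0 = m" using readyD(1)[OF r2] b1(1) by (simp_all add: bfs_def search_ready_def ag2)
      let ?e = "if ?Y (n + 1) = 0 \<and> ?Y (n + 2) = m \<and> ?Y (n + 3) = 0 then 1 else 0 :: nat"
      have loop: "post (For ''l'' ''n1'' (When (NLess (NLit 0) (cell (var ''l''))) (Assign ''eq'' (NLit 0))))
        (nupd ''eq'' 0 x s2) (\<lambda>s3. post (When (NEq (var ''eq'') (NLit 1)) (Assign ''found'' (NLit 1);; Assign ''fin'' (var ''q''))) s3
          (\<lambda>s'. fst s' ''found'' 0 = (if final ?Y then 1 else fst s1 ''found'' 0) \<and>
        fst s' ''fin'' 0 = (if final ?Y then q else fst s1 ''fin'' 0)))" if x: "x = ?e" for x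
      proof (rule post_For[where N = "Suc n" and I = "\<lambda>i s'. fst s' ''eq'' 0 = (if \<forall>v<i. ?Y v = 0 then ?e else 0)"], goal_cases)
        case inner: (5 l s3)
        note ag3 = agreeD[OF inner(3)]
        have "fst s3 ''y'' l = ?Y l" using y[of l] inner(1) by (simp add: ag3)
        then show ?case using inner(2,4) by (auto simp: less_Suc_eq)
      next
        case inner: (6 s3)
        note ag3 = agreeD[OF inner(2)]
        have "fst s3 ''eq'' 0 = 1 \<longleftrightarrow> final ?Y" using inner(1) by (auto simp: final_def less_Suc_eq_le)
        then show ?case using 5(4) by (auto simp: ag2 ag3)
      qed (use x readyD(2)[OF r2] in auto)
      have e0: "nupd ''eq'' 0 1 (nupd ''eq'' 0 0 s2) = nupd ''eq'' 0 1 s2" by (simp add: nupd_def)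
      show ?case
      proof (cases "?Y (n + 1) = 0 \<and> ?Y (n + 2) = m \<and> ?Y (n + 3) = 0")
        case True
        then have g: "bval ?g (nupd ''eq'' 0 0 s2)" using yr R by simp
        show ?thesis unfolding nval.simps if_P[OF g] e0
          by (rule loop[of 1, unfolded post_simps nval.simps]) (use True in simp)
      next
        case False
        then have g: "\<not> bval ?g (nupd ''eq'' 0 0 s2)" using yr R by simp
        show ?thesis unfolding nval.simps if_not_P[OF g]
          by (rule loop[of 0, unfolded post_simps nval.simps]) (use False in simp)
      qed
    qed
    then have "post (load_state;;
        Assign ''eq'' (NLit 0);;
        When ?g (Assign ''eq'' (NLit 1));;
        For ''l'' ''n1'' (When (NLess (NLit 0) (cell (var ''l''))) (Assign ''eq'' (NLit 0)));;
        When (NEq (var ''eq'') (NLit 1)) (Assign ''found'' (NLit 1);; Assign ''fin'' (var ''q''))) s1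
      (\<lambda>s'. fst s' ''found'' 0 \<le> 1 \<and>
    (fst s' ''found'' 0 = 1 \<longrightarrow> fst s' ''fin'' 0 < fst s ''cnt'' 0 \<and> final (vec_of s (fst s' ''fin'' 0))) \<and>
    (fst s' ''found'' 0 = 0 \<longrightarrow> (\<forall>q'<Suc q. q' < fst s ''cnt'' 0 \<longrightarrow> \<not> final (vec_of s q'))))"
      by (rule post_weaken) (use 5(2) True in \<open>auto simp: less_Suc_eq split: if_splits\<close>)
    then show ?thesis using True 5(4) c1 by simp
  qed
next
  case (6 s1)
  then show ?case using cnt_bound[OF b] by auto
qed (use readyD(6)[OF bfs_ready[OF b]] in \<open>auto simp: load_state_def\<close>)

text \<open>The \<open>i\<close>-th state on the way back from the final state to the start.\<close>

definition node :: "state \<Rightarrow> nat \<Rightarrow> nat" where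
  "node s i = (if i < fst s ''len'' 0 then fst s ''path'' i else 0)"

definition traced :: "state \<Rightarrow> bool" where
  "traced s \<longleftrightarrow> node s 0 = fst s ''fin'' 0 \<and> fst s ''len'' 0 \<le> rows_bound \<and>
     (\<forall>i<fst s ''len'' 0. 0 < node s i \<and> node s i < fst s ''cnt'' 0 \<and> fst s ''par'' (node s i) = node s (Suc i))"

lemma trace_post:
  assumes b: "bfs s" and f: "fst s ''fin'' 0 < fst s ''cnt'' 0"
  shows "post trace s traced"
  unfolding trace_def post_simps
proof (rule post_For[where N = rows_bound and I = "\<lambda>z s'. let k = fst s' ''len'' 0; q = fst s' ''q'' 0 in
    k \<le> z \<and> q < fst s ''cnt'' 0 \<and> (q = 0 \<or> q + z \<le> fst s ''fin'' 0) \<and> (if k = 0 then q = fst s ''fin'' 0 else fst s' ''path'' 0 = fst s ''fin'' 0) \<and>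
    (\<forall>i<k. 0 < fst s' ''path'' i \<and> fst s' ''path'' i < fst s ''cnt'' 0 \<and>
      fst s ''par'' (fst s' ''path'' i) = (if Suc i < k then fst s' ''path'' (Suc i) else q))"], goal_cases)
  case (5 z s1)
  note ag1 = agreeD[OF 5(3)]
  let ?k = "fst s1 ''len'' 0" and ?q = "fst s1 ''q'' 0"
  show ?case
  proof (cases "?q = 0")
    case True
    then show ?thesis using 5(2) by (simp add: Let_def)
  next
    case False
    have p: "fst s ''par'' ?q < ?q" using b 5(2) False by (auto simp: bfs_def move_ok_def Let_def)
    show ?thesis using 5(2) False p unfolding Let_def
      by (simp add: ag1) (auto simp: less_Suc_eq)
  qed
next
  case (6 s1)
  note ag1 = agreeD[OF 6(2)]
  have q0: "fst s1 ''q'' 0 = 0" using 6(1) cnt_bound[OF b] f by (auto simp: Let_def)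
  show ?case using 6(1) q0 unfolding traced_def node_def Let_def
    by (auto simp: ag1 split: if_splits)
qed (use b f readyD(6)[OF bfs_ready[OF b]] in \<open>auto simp: Let_def\<close>)

definition own_fn :: "state \<Rightarrow> nat \<Rightarrow> nat \<Rightarrow> nat" where
  "own_fn s v i = fst s ''own'' (v * Suc n + i)"

lemma space_counts: "y \<in> space \<Longrightarrow> v \<le> n \<Longrightarrow> y v \<le> n"
  unfolding space_def admissible_def by (cases "y v = 0") auto

lemma replay_move_post:
  assumes b: "bfs s" and t: "traced s" and z: "fst s ''z'' 0 = z" "z < fst s ''len'' 0"
    and c: "consistent (vec_of s (node s (fst s ''len'' 0 - z))) (own_fn s) (fst s ''asg'')"
  shows "post replay_move s (\<lambda>s'. consistent (vec_of s (node s (fst s ''len'' 0 - Suc z))) (own_fn s') (fst s' ''asg''))"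
proof -
  let ?len = "fst s ''len'' 0"
  define i where "i = ?len - Suc z"
  define q where "q = node s i"
  have i: "i < ?len" "Suc i = ?len - z" "?len - Suc 0 - z = i" using z(2) by (simp_all add: i_def)
  have q: "0 < q" "q < fst s ''cnt'' 0" "fst s ''par'' q = node s (?len - z)" "fst s ''path'' i = q"
    using t i unfolding traced_def q_def by (auto simp: node_def)
  define p where "p = node s (?len - z)"
  have mo: "move_ok s q" using b q by (simp add: bfs_def)
  let ?k = "fst s ''mk'' q" and ?v = "fst s ''mv'' q" and ?w = "fst s ''mw'' q" and ?u = "fst s ''mu'' q"
  have par: "fst s ''par'' q = p" using q by (simp add: p_def)
  define Y where "Y = vec_of s p"
  have m: "p < q" "?k < 5" "?v \<le> n" "?w \<le> n" "?u \<le> n" "legal ?k ?v ?w ?u Y" "vec_of s q = next_state ?k ?v ?w ?u Y"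
    using mo unfolding move_ok_def par Y_def by blast+
  have pc: "p < fst s ''cnt'' 0" using m q by simp
  have B: "fst s ''base'' p = p * (n + 6)" "fst s ''base'' q = q * (n + 6)" using b pc q by (simp_all add: bfs_def)
  have X: "fst s ''X'' (p * (n + 6) + l) = Y l" "fst s ''X'' (q * (n + 6) + l) = vec_of s q l" if "l < n + 6" for l
    using that by (simp_all add: Y_def vec_of_def trim_def)
  have Xr: "fst s ''X'' (p * (n + 6) + ?v) = Y ?v" "fst s ''X'' (p * (n + 6) + ?w) = Y ?w" "fst s ''X'' (q * (n + 6) + ?u) = vec_of s q ?u"
    "fst s ''X'' (p * (n + 6) + Suc (Suc n)) = Y (n + 2)" "fst s ''X'' (p * (n + 6) + (n + 5)) = Y (n + 5)"
    using X(1)[of ?v] X(1)[of ?w] X(2)[of ?u] X(1)[of "n + 2"] X(1)[of "n + 5"] m(3-5) by simp_all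
  have n: "fst s ''n'' 0 = n" using readyD(1)[OF bfs_ready[OF b]] .
  have row: "fst s ''row'' v = v * Suc n" if "v \<le> n" for v using readyD(10)[OF bfs_ready[OF b], of v] that by simp
  have rows: "fst s ''row'' ?v = ?v * Suc n" "fst s ''row'' ?w = ?w * Suc n" "fst s ''row'' ?u = ?u * Suc n"
    using row m by blast+
  have Ysp: "Y \<in> space" "vec_of s q \<in> space" using b pc q unfolding Y_def bfs_def by blast+
  have cY: "Y v \<le> n" "vec_of s q v \<le> n" if "v \<le> n" for v using space_counts that Ysp by blast+
  let ?own = "own_update ?k ?v ?w ?u Y (own_fn s)" and ?asg = "asg_update ?k ?v Y (own_fn s) (fst s ''asg'')"
  have cons: "consistent (vec_of s q) ?own ?asg"
    unfolding m(7) by (rule consistent_step) (use m c in \<open>auto simp: Y_def p_def\<close>)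
  let ?o = "own_fn s ?v (Y ?v - 1)"
  have o: "fst s ''own'' (?v * Suc n + (Y ?v - Suc 0)) = ?o" by (simp add: own_fn_def)
  have upd: "((fst s' ''own'')(v * Suc n + j := x)) (v' * Suc n + j') = (if v' = v \<and> j' = j then x else own_fn s' v' j')"
    if "j \<le> n" "j' \<le> n" for s' v j x v' j'
    using addr_inject[OF that(2,1), of v' v] by (simp add: own_fn_def)
  let ?Q = "\<lambda>s'. (\<forall>v\<le>n. \<forall>j<vec_of s q v. own_fn s' v j = ?own v j) \<and> fst s' ''asg'' = ?asg"
  let ?pre = "Assign ''q'' (NGet ''path'' (NSub (NSub (var ''len'') (NLit 1)) (var ''z'')));;
     Assign ''p'' (NGet ''par'' (var ''q''));;
     Assign ''v'' (NGet ''mv'' (var ''q''));; Assign ''w'' (NGet ''mw'' (var ''q''));; Assign ''u'' (NGet ''mu'' (var ''q''));;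
     Assign ''o'' (NGet ''own'' (own_at (var ''v'') (NSub (st_at (var ''p'') (var ''v'')) (NLit 1))))"
  have pre: "post ?pre s (\<lambda>s0. fst s0 ''q'' 0 = q \<and> fst s0 ''p'' 0 = p \<and> fst s0 ''v'' 0 = ?v \<and> fst s0 ''w'' 0 = ?w \<and>
      fst s0 ''u'' 0 = ?u \<and> fst s0 ''o'' 0 = ?o)"
    using z(1) i(3) q(4) par B(1) Xr(1) rows(1) o by simp
  have "post ?pre s (\<lambda>s0. post (If (NEq (NGet ''mk'' (var ''q'')) (NLit 0))
       (Put ''own'' (own_at (var ''v'') (st_at (var ''p'') (var ''v''))) (NSub (st_at (var ''p'') (reg 2)) (NLit 1)))
     (If (NEq (NGet ''mk'' (var ''q'')) (NLit 2))
       (Put ''asg'' (st_at (var ''p'') (reg 5)) (var ''o''))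
     (When (NEq (NGet ''mk'' (var ''q'')) (NLit 3))
       (Put ''own'' (own_at (var ''w'') (st_at (var ''p'') (var ''w''))) (var ''o'');;
        Put ''own'' (own_at (var ''u'') (NSub (st_at (var ''q'') (var ''u'')) (NLit 1))) (var ''o''))))) s0 ?Q)"
    using pre
  proof (rule post_weaken, goal_cases)
    case (1 s0)
    note ag0 = agreeD(1)[OF 1(2)]
    have E: "fst s0 ''mk'' q = ?k" "fst s0 ''n'' 0 = n" "fst s0 ''base'' p = p * (n + 6)" "fst s0 ''base'' q = q * (n + 6)"
      "fst s0 ''row'' ?v = ?v * Suc n" "fst s0 ''row'' ?w = ?w * Suc n" "fst s0 ''row'' ?u = ?u * Suc n"
      "fst s0 ''own'' = fst s ''own''" "fst s0 ''asg'' = fst s ''asg''" "fst s0 ''X'' = fst s ''X''"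
      using n B rows by (simp_all add: ag0)
    from m(2) consider "?k = 0" | "?k = 2" | "?k = 3" | "?k = 1 \<or> ?k = 4" by linarith
    then show ?case
    proof cases
      case c: 1
      have "((fst s ''own'')(?v * Suc n + Y ?v := Y (n + 2) - 1)) (v * Suc n + j) = ?own v j"
        if "v \<le> n" "j < vec_of s q v" for v j
      proof -
        have "j \<le> n" using cY(2)[OF that(1)] that(2) by simp
        then show ?thesis using upd[of "Y ?v" j s ?v _ v] cY(1)[OF m(3)] c by (simp add: own_update_def)
      qed
      then show ?thesis using c 1(1) E Xr by (simp add: own_fn_def asg_update_def)
    next
      case c: 2
      then show ?thesis using 1(1) E Xr by (simp add: own_fn_def asg_update_def own_update_def)
    next
      case c: 3
      have l3: "?w \<noteq> ?v" "?u \<noteq> ?v" using m(6) c by (auto simp: legal_def)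
      define k where "k = (if ?w = ?u then Suc (Y ?w) else Y ?u)"
      have vu: "vec_of s q ?u = Suc k" unfolding m(7) next_state_def Let_def using c l3 m(3-5) by (auto simp: k_def)
      then have jn: "k \<le> n" using cY(2)[OF m(5)] by linarith
      have j: "vec_of s q ?u - Suc 0 = k" using vu by (simp only: diff_Suc_1')
      have own: "((fst s ''own'')(?w * Suc n + Y ?w := ?o, ?u * Suc n + k := ?o)) (v * Suc n + j) = ?own v j"
        if "v \<le> n" "j < vec_of s q v" for v j
      proof -
        have jn': "j \<le> n" using cY(2)[OF that(1)] that(2) by simp
        have "v * Suc n + j = ?u * Suc n + k \<longleftrightarrow> v = ?u \<and> j = k"
          "v * Suc n + j = ?w * Suc n + Y ?w \<longleftrightarrow> v = ?w \<and> j = Y ?w"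
          using addr_inject[OF jn' jn, of v ?u] addr_inject[OF jn' cY(1)[OF m(4)], of v ?w] by blast+
        moreover have "?own = (let own1 = (own_fn s)(?w := (own_fn s ?w)(Y ?w := ?o)) in own1(?u := (own1 ?u)(k := ?o)))"
          using c by (simp add: own_update_def Let_def k_def)
        ultimately show ?thesis unfolding fun_upd_apply Let_def by (auto simp: own_fn_def)
      qed
      have "post (Put ''own'' (own_at (var ''w'') (st_at (var ''p'') (var ''w''))) (var ''o'');;
        Put ''own'' (own_at (var ''u'') (NSub (st_at (var ''q'') (var ''u'')) (NLit 1))) (var ''o'')) s0
        (\<lambda>s'. fst s' ''own'' = (fst s ''own'')(?w * Suc n + Y ?w := ?o, ?u * Suc n + k := ?o) \<and> fst s' ''asg'' = fst s ''asg'')"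
        using 1(1) E(2-10) Xr j by simp
      then have "post (Put ''own'' (own_at (var ''w'') (st_at (var ''p'') (var ''w''))) (var ''o'');;
        Put ''own'' (own_at (var ''u'') (NSub (st_at (var ''q'') (var ''u'')) (NLit 1))) (var ''o'')) s0 ?Q"
      proof (rule post_weaken, goal_cases)
        case (1 s')
        have "own_fn s' v j = ?own v j" if "v \<le> n" "j < vec_of s q v" for v j
          using own[OF that] 1(1) unfolding own_fn_def[of s'] by argo
        moreover have "?asg = fst s ''asg''" using c by (simp add: asg_update_def)
        ultimately show ?case using 1(1) by simp
      qed
      then show ?thesis using c 1(1) E(1) by simp
    next
      case c: 4
      then have "?own = own_fn s" "?asg = fst s ''asg''" by (auto simp: own_update_def asg_update_def)
      moreover have "\<not> bval (NEq (NGet ''mk'' (var ''q'')) (NLit 0)) s0" "\<not> bval (NEq (NGet ''mk'' (var ''q'')) (NLit 2)) s0"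
        "\<not> bval (NEq (NGet ''mk'' (var ''q'')) (NLit 3)) s0" using c 1(1) E(1) by auto
      ultimately show ?thesis using E(8,9) unfolding post_simps by (simp only: if_False own_fn_def) blast
    qed
  qed
  then have "post replay_move s ?Q" unfolding replay_move_def post_simps(4) .
  then show ?thesis
  proof (rule post_weaken, goal_cases)
    case (1 s')
    show ?case using consistent_cong[OF cons, of "own_fn s'" "fst s' ''asg''"] 1(1)
      unfolding q_def i_def by auto
  qed
qed

lemma replay_post:
  assumes b: "bfs s" and t: "traced s"
  shows "post replay s (\<lambda>s'. \<exists>own. consistent (vec_of s (fst s ''fin'' 0)) own (fst s' ''asg''))"
  unfolding replay_def
proof (rule post_For[where N = rows_bound and I = "\<lambda>z s'.
    consistent (vec_of s (node s (fst s ''len'' 0 - z))) (own_fn s') (fst s' ''asg'')"], goal_cases)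
  case 3
  have "node s (fst s ''len'' 0 - 0) = 0" by (simp add: node_def)
  then show ?case using b consistent_start bins(2) by (simp add: bfs_def)
next
  case (4 i k s1)
  then show ?case by (simp add: own_fn_def[abs_def])
next
  case (5 z s1)
  have ags: "agree {''z'', ''q'', ''p'', ''v'', ''w'', ''u'', ''o'', ''own'', ''asg''} {} s s1"
    using 5(3) by (auto simp: agree_def replay_move_def)
  note b1 = bfs_agree[OF ags _ _ _ _ b, simplified bfs_vars_def ready_vars_def, simplified]
  note ag1 = agreeD[OF ags]
  have v1: "vec_of s1 = vec_of s" by (rule vec_of_agree[OF ags]) simp
  have n1: "node s1 = node s" by (simp add: node_def[abs_def] ag1 cong: if_cong)
  have t1: "traced s1" using t by (simp add: traced_def n1 ag1)
  have l1: "fst s1 ''len'' 0 = fst s ''len'' 0" by (simp add: ag1)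
  show ?case
  proof (cases "z < fst s ''len'' 0")
    case True
    have "post replay_move s1 (\<lambda>s'. consistent (vec_of s1 (node s1 (fst s1 ''len'' 0 - Suc z))) (own_fn s') (fst s' ''asg''))"
      by (rule replay_move_post[OF b1(1) t1 5(4)]) (use True 5(2) in \<open>simp_all add: v1 n1 l1\<close>)
    then show ?thesis using True 5(4) by (simp add: v1 n1 l1)
  next
    case False
    then show ?thesis using 5(2,4) by (simp add: l1)
  qed
next
  case (6 s1)
  have "fst s ''len'' 0 - rows_bound = 0" "node s 0 = fst s ''fin'' 0" using t by (simp_all add: traced_def)
  then show ?case using 6(1) by auto
qed (use readyD(6)[OF bfs_ready[OF b]] in \<open>auto simp: replay_move_def\<close>)

definition open_clients :: "state \<Rightarrow> nat \<Rightarrow> nat set" where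
  "open_clients s b = {z \<in> C. fst s ''cc'' z = Suc b \<and> fst s ''av'' z = 0}"

lemma serve_post:
  assumes r: "ready s" and t: "fst s ''t'' 0 = t" "t < length types" and o: "fst s ''o'' 0 = b"
  shows "post serve s (\<lambda>s'. \<exists>V\<subseteq>open_clients s b. card V \<le> allow t \<and> (V = open_clients s b \<or> card V = allow t) \<and>
    fst s' ''av'' = (\<lambda>z. if z \<in> V then 1 else fst s ''av'' z) \<and> fst s' ''assignment'' = (\<lambda>z. if z \<in> V then t else fst s ''assignment'' z))"
  unfolding serve_def post_simps
proof (rule post_For[where N = n and I = "\<lambda>i s'. \<exists>V\<subseteq>{z \<in> open_clients s b. z < i}. fst s' ''ld'' 0 = card V \<and> card V \<le> allow t \<and>
    (V = {z \<in> open_clients s b. z < i} \<or> card V = allow t) \<and>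
    fst s' ''av'' = (\<lambda>z. if z \<in> V then 1 else fst s ''av'' z) \<and> fst s' ''assignment'' = (\<lambda>z. if z \<in> V then t else fst s ''assignment'' z)"], goal_cases)
  case (5 z s1)
  note ag1 = agreeD[OF 5(3)]
  obtain V where V: "V \<subseteq> {x \<in> open_clients s b. x < z}" "fst s1 ''ld'' 0 = card V" "card V \<le> allow t"
    "V = {x \<in> open_clients s b. x < z} \<or> card V = allow t" "fst s1 ''av'' = (\<lambda>z. if z \<in> V then 1 else fst s ''av'' z)"
    "fst s1 ''assignment'' = (\<lambda>z. if z \<in> V then t else fst s ''assignment'' z)" using 5(2) by blast
  have zV: "z \<notin> V" "finite V" using V(1) finite_subset[of V "{..<z}"] by auto
  have st: "size_of t \<le> n" by (simp add: size_of_def cap_of_def)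
  have R: "fst s1 ''C'' z = (if z \<in> C then 1 else 0)" "fst s1 ''item'' t = size_of t" "fst s1 ''ext'' (size_of t) = size_of t div 2 ^ (e - 5)"
    using readyD(17)[OF r 5(1)] readyD(9)[OF r t(2)] readyD(14)[OF r st] by (simp_all add: ag1)
  let ?g = "BAnd (NLess (NLit 0) (NGet ''C'' (var ''z'')))
               (BAnd (NEq (NGet ''cc'' (var ''z'')) (succ_of (var ''o'')))
               (BAnd (NEq (NGet ''av'' (var ''z'')) (NLit 0))
                 (NLe (var ''ld'') (NAdd (NGet ''item'' (var ''t'')) (NGet ''ext'' (NGet ''item'' (var ''t'')))))))"
  have g: "bval ?g s1 \<longleftrightarrow> z \<in> open_clients s b \<and> card V < allow t"
    using R V zV 5(4) t o by (auto simp: ag1 open_clients_def allow_def)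
  show ?case
  proof (cases "z \<in> open_clients s b \<and> card V < allow t")
    case True
    have 1: "insert z V \<subseteq> {x \<in> open_clients s b. x < Suc z}" using True V(1) by auto
    have 2: "insert z V = {x \<in> open_clients s b. x < Suc z}" using True V(4) by (auto simp: less_Suc_eq)
    have c: "card (insert z V) = Suc (card V)" using zV by simp
    have "post (Put ''assignment'' (var ''z'') (var ''t'');;
          Put ''av'' (var ''z'') (NLit 1);;
          Assign ''ld'' (succ_of (var ''ld''))) s1 (\<lambda>s'. fst s' ''ld'' 0 = card (insert z V) \<and>
      fst s' ''av'' = (\<lambda>x. if x \<in> insert z V then 1 else fst s ''av'' x) \<and>
      fst s' ''assignment'' = (\<lambda>x. if x \<in> insert z V then t else fst s ''assignment'' x))"
      using V(2,5,6) c 5(4) t by (auto simp: ag1 fun_eq_iff)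
    then have "post (Put ''assignment'' (var ''z'') (var ''t'');;
          Put ''av'' (var ''z'') (NLit 1);;
          Assign ''ld'' (succ_of (var ''ld''))) s1 (\<lambda>s'. \<exists>V\<subseteq>{x \<in> open_clients s b. x < Suc z}. fst s' ''ld'' 0 = card V \<and> card V \<le> allow t \<and>
    (V = {x \<in> open_clients s b. x < Suc z} \<or> card V = allow t) \<and>
    fst s' ''av'' = (\<lambda>z. if z \<in> V then 1 else fst s ''av'' z) \<and> fst s' ''assignment'' = (\<lambda>z. if z \<in> V then t else fst s ''assignment'' z))"
    proof (rule post_weaken, goal_cases)
      case (1 s2)
      then show ?case using 2 c True by (intro exI[of _ "insert z V"]) simp
    qed
    then show ?thesis unfolding post_simps(5) if_P[OF g[THEN iffD2, OF True]] .
  next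
    case False
    have "\<exists>V\<subseteq>{x \<in> open_clients s b. x < Suc z}. fst s1 ''ld'' 0 = card V \<and> card V \<le> allow t \<and>
    (V = {x \<in> open_clients s b. x < Suc z} \<or> card V = allow t) \<and>
    fst s1 ''av'' = (\<lambda>z. if z \<in> V then 1 else fst s ''av'' z) \<and> fst s1 ''assignment'' = (\<lambda>z. if z \<in> V then t else fst s ''assignment'' z)"
    proof (intro exI[of _ V] conjI)
      show "V \<subseteq> {x \<in> open_clients s b. x < Suc z}" using V(1) by auto
      show "V = {x \<in> open_clients s b. x < Suc z} \<or> card V = allow t"
        using V(3,4) False by (auto simp: less_Suc_eq)
    qed (use V in auto)
    moreover have g': "\<not> bval ?g s1" using g False by blast
    ultimately show ?thesis unfolding post_simps(1,5) if_not_P[OF g'] by blast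
  qed
next
  case (6 s1)
  have "{z \<in> open_clients s b. z < n} = open_clients s b" using FC_less by (auto simp: open_clients_def)
  then show ?case using 6(1) by auto
qed (use readyD(1)[OF r] in \<open>auto intro!: exI[of _ "{}"]\<close>)

definition served :: "(nat \<Rightarrow> nat) \<Rightarrow> (nat \<Rightarrow> nat) \<Rightarrow> nat \<Rightarrow> (nat \<Rightarrow> nat) \<Rightarrow> (nat \<Rightarrow> nat) \<Rightarrow> bool" where
  "served cc asg k av g \<longleftrightarrow>
     (\<forall>z\<in>C. av z = 0 \<or> av z = 1 \<and> g z < k \<and> cc z = Suc (asg (g z))) \<and>
     (\<forall>t<k. card {z \<in> C. av z = 1 \<and> g z = t} \<le> allow t) \<and>
     (\<forall>b. (\<forall>z\<in>C. cc z = Suc b \<longrightarrow> av z = 1) \<or>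
        (\<Sum>t | t < k \<and> asg t = b. allow t) \<le> card {z \<in> C. cc z = Suc b \<and> av z = 1})"

lemma finite_C: "finite C"
  using FC_less(2) finite_subset[of C "{..<n}"] by auto

lemma served_step:
  assumes s: "served cc asg k av g" and V: "V \<subseteq> {z \<in> C. cc z = Suc (asg k) \<and> av z = 0}"
    and c: "card V \<le> allow k" "V = {z \<in> C. cc z = Suc (asg k) \<and> av z = 0} \<or> card V = allow k"
  shows "served cc asg (Suc k) (\<lambda>z. if z \<in> V then 1 else av z) (\<lambda>z. if z \<in> V then k else g z)"
    (is "served _ _ _ ?av ?g")
proof -
  have s1: "\<And>z. z \<in> C \<Longrightarrow> av z = 0 \<or> av z = 1 \<and> g z < k \<and> cc z = Suc (asg (g z))"
    and s2: "\<And>t. t < k \<Longrightarrow> card {z \<in> C. av z = 1 \<and> g z = t} \<le> allow t"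
    and s3: "\<And>b. (\<forall>z\<in>C. cc z = Suc b \<longrightarrow> av z = 1) \<or>
        (\<Sum>t | t < k \<and> asg t = b. allow t) \<le> card {z \<in> C. cc z = Suc b \<and> av z = 1}"
    using s unfolding served_def by blast+
  have 1: "{z \<in> C. ?av z = 1 \<and> ?g z = t} = {z \<in> C. av z = 1 \<and> g z = t}" if "t < k" for t
    using V that by auto
  have 2: "{z \<in> C. ?av z = 1 \<and> ?g z = k} = V"
  proof (rule set_eqI)
    fix z show "z \<in> {z \<in> C. ?av z = 1 \<and> ?g z = k} \<longleftrightarrow> z \<in> V"
      by (cases "z \<in> V") (use V s1[of z] in auto)
  qed
  have 3: "(\<forall>z\<in>C. cc z = Suc b \<longrightarrow> ?av z = 1) \<or>
        (\<Sum>t | t < Suc k \<and> asg t = b. allow t) \<le> card {z \<in> C. cc z = Suc b \<and> ?av z = 1}" for b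
  proof (cases "b = asg k")
    case True
    have sum: "(\<Sum>t | t < Suc k \<and> asg t = b. allow t) = (\<Sum>t | t < k \<and> asg t = b. allow t) + allow k"
    proof -
      have "{t. t < Suc k \<and> asg t = b} = insert k {t. t < k \<and> asg t = b}" using True by (auto simp: less_Suc_eq)
      then show ?thesis by simp
    qed
    have "{z \<in> C. cc z = Suc b \<and> ?av z = 1} = {z \<in> C. cc z = Suc b \<and> av z = 1} \<union> V" using V True by auto
    moreover have "card ({z \<in> C. cc z = Suc b \<and> av z = 1} \<union> V) = card {z \<in> C. cc z = Suc b \<and> av z = 1} + card V"
      using V finite_C finite_subset[of V C] by (intro card_Un_disjoint) auto
    ultimately have card: "card {z \<in> C. cc z = Suc b \<and> ?av z = 1} = card {z \<in> C. cc z = Suc b \<and> av z = 1} + card V"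
      by simp
    from s3[of b] show ?thesis
    proof
      assume "\<forall>z\<in>C. cc z = Suc b \<longrightarrow> av z = 1"
      then show ?thesis by auto
    next
      assume l: "(\<Sum>t | t < k \<and> asg t = b. allow t) \<le> card {z \<in> C. cc z = Suc b \<and> av z = 1}"
      from c(2) show ?thesis
      proof
        assume "V = {z \<in> C. cc z = Suc (asg k) \<and> av z = 0}"
        then have "\<forall>z\<in>C. cc z = Suc b \<longrightarrow> ?av z = 1" using s1 True by force
        then show ?thesis ..
      qed (use l sum card in linarith)
    qed
  next
    case False
    then have "{t. t < Suc k \<and> asg t = b} = {t. t < k \<and> asg t = b}" by (auto simp: less_Suc_eq)
    moreover have "{z \<in> C. cc z = Suc b \<and> ?av z = 1} = {z \<in> C. cc z = Suc b \<and> av z = 1}" using V False by auto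
    ultimately show ?thesis using s3[of b] by auto
  qed
  have "\<forall>t<Suc k. card {z \<in> C. ?av z = 1 \<and> ?g z = t} \<le> allow t"
  proof (intro allI impI)
    fix t assume "t < Suc k"
    then consider "t < k" | "t = k" by linarith
    then show "card {z \<in> C. ?av z = 1 \<and> ?g z = t} \<le> allow t"
      by cases (use 1 2 s2 c(1) in presburger)+
  qed
  moreover have "\<forall>z\<in>C. ?av z = 0 \<or> ?av z = 1 \<and> ?g z < Suc k \<and> cc z = Suc (asg (?g z))"
  proof
    fix z assume "z \<in> C"
    then show "?av z = 0 \<or> ?av z = 1 \<and> ?g z < Suc k \<and> cc z = Suc (asg (?g z))"
      by (cases "z \<in> V") (use V s1[of z] in auto)
  qed
  ultimately show ?thesis unfolding served_def using 3 by blast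
qed

definition rank :: "(nat \<Rightarrow> nat) \<Rightarrow> nat \<Rightarrow> nat \<Rightarrow> nat" where
  "rank asg k b = (if soft then 0 else card {t. t < k \<and> asg t = b})"

lemma rank_Suc: "rank asg (Suc k) b = rank asg k b + (if asg k = b \<and> \<not> soft then 1 else 0)"
proof -
  have "{t. t < Suc k \<and> asg t = b} = (if asg k = b then insert k {t. t < k \<and> asg t = b} else {t. t < k \<and> asg t = b})"
    by (auto simp: less_Suc_eq)
  then show ?thesis unfolding rank_def by (cases soft) (auto split: if_splits)
qed

definition emitted :: "state \<Rightarrow> nat \<Rightarrow> state \<Rightarrow> bool" where
  "emitted s k s' \<longleftrightarrow> (\<forall>t<k. fst s' ''type'' t = types ! t \<and>
       fst s' ''location'' t = fst s ''loc'' (fst s ''asg'' t * Suc n + rank (fst s ''asg'') t (fst s ''asg'' t))) \<and>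
     (\<forall>b<n. fst s' ''lc'' b = rank (fst s ''asg'') k b) \<and>
     served (fst s ''cc'') (fst s ''asg'') k (fst s' ''av'') (fst s' ''assignment'')"

lemma emit_output_post:
  assumes b: "bfs s" and f: "fst s ''fin'' 0 < fst s ''cnt'' 0"
    and asg: "\<And>t. t < vec_of s (fst s ''fin'' 0) (n + 5) \<Longrightarrow> fst s ''asg'' t < m"
  shows "post (emit_output soft) s (\<lambda>s'. fst s' ''facilities'' 0 = vec_of s (fst s ''fin'' 0) (n + 5) \<and>
    emitted s (vec_of s (fst s ''fin'' 0) (n + 5)) s')"
proof -
  define T where "T = vec_of s (fst s ''fin'' 0) (n + 5)"
  have r: "ready s" using bfs_ready[OF b] .
  have "vec_of s (fst s ''fin'' 0) \<in> space" using b f unfolding bfs_def by blast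
  then have TN: "T \<le> length types" by (simp add: T_def space_def)
  have X: "fst s ''X'' (fst s ''base'' (fst s ''fin'' 0) + (n + 5)) = T"
    using b f by (simp add: T_def vec_of_def trim_def bfs_def)
  let ?rd = "\<lambda>s'. agree (nwrites (emit_output soft)) {} s s'"
  show ?thesis unfolding emit_output_def post_simps
  proof (rule post_For[where N = n and I = "\<lambda>i s'. fst s' ''facilities'' 0 = T \<and> (\<forall>z<i. fst s' ''lc'' z = 0 \<and> fst s' ''av'' z = 0)"], goal_cases)
    case (6 s0)
    note ag0 = agreeD[OF 6(2)]
    show ?case
    proof (rule post_For[where N = "length types" and I = "\<lambda>i s'. fst s' ''facilities'' 0 = T \<and> emitted s (min i T) s'"], goal_cases)
      case 3
      have "served (fst s ''cc'') (fst s ''asg'') 0 (fst s0 ''av'') (fst s0 ''assignment'')"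
        using 6(1) FC_less by (simp add: served_def)
      moreover have "rank (fst s ''asg'') 0 b = 0" for b by (simp add: rank_def)
      ultimately show ?case using 6(1) by (simp add: emitted_def)
    next
      case (4 i k s')
      then show ?case by (simp add: emitted_def)
    next
      case (5 t s1)
      note ag1 = agreeD[OF 5(3), unfolded serve_def]
      have ags: "agree {''facilities'', ''z'', ''lc'', ''av'', ''t'', ''type'', ''o'', ''location'', ''ld'', ''assignment''} {} s s1"
        using 5(3) 6(2) by (auto simp: agree_def serve_def)
      have r1: "ready s1" by (rule ready_agree[OF ags _ _ r]) (simp_all add: ready_vars_def)
      note as1 = agreeD[OF ags]
      show ?case
      proof (cases "t < T")
        case True
        have ab: "fst s ''asg'' t < m" using asg True by (simp add: T_def)
        have abn: "fst s ''asg'' t < n" using ab mn by linarith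
        define s2 where "s2 = den (Put ''type'' (var ''t'') (NGet ''itype'' (var ''t''));;
       Assign ''o'' (NGet ''asg'' (var ''t''));;
       Put ''location'' (var ''t'') (NGet ''loc'' (own_at (var ''o'') (NGet ''lc'' (var ''o''))));;
       Put ''lc'' (var ''o'') (NAdd (NGet ''lc'' (var ''o'')) (NLit (if soft then 0 else 1)))) s1"
        have em: "emitted s t s1" using 5(2) True by simp
        have R: "fst s1 ''itype'' t = types ! t" "fst s1 ''asg'' = fst s ''asg''" "fst s1 ''loc'' = fst s ''loc''"
          "fst s1 ''row'' (fst s ''asg'' t) = fst s ''asg'' t * Suc n" "fst s1 ''lc'' (fst s ''asg'' t) = rank (fst s ''asg'') t (fst s ''asg'' t)"
          using readyD(8)[OF r1, of t] readyD(10)[OF r1, of "fst s ''asg'' t"] abn True TN em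
          by (simp_all add: as1 emitted_def)
        have s2: "fst s2 ''type'' = (fst s1 ''type'')(t := types ! t)" "fst s2 ''t'' 0 = t" "fst s2 ''o'' 0 = fst s ''asg'' t"
          "fst s2 ''location'' = (fst s1 ''location'')(t := fst s ''loc'' (fst s ''asg'' t * Suc n + rank (fst s ''asg'') t (fst s ''asg'' t)))"
          "fst s2 ''lc'' = (fst s1 ''lc'')(fst s ''asg'' t := rank (fst s ''asg'') (Suc t) (fst s ''asg'' t))"
          "fst s2 ''facilities'' 0 = T" "fst s2 ''av'' = fst s1 ''av''" "fst s2 ''assignment'' = fst s1 ''assignment''" "fst s2 ''cc'' = fst s ''cc''"
          using R 5(2,4) unfolding rank_Suc by (simp_all add: s2_def as1)
        have r2: "ready s2" unfolding s2_def by (rule ready_agree[OF agree_den _ _ r1]) (auto simp: ready_vars_def)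
        have "post serve s2 (\<lambda>s'. fst s' ''facilities'' 0 = T \<and> emitted s (Suc t) s')"
        proof (rule post_weaken[OF serve_post[OF r2 s2(2) _ s2(3)]], goal_cases)
          case 1
          then show ?case using True TN by simp
        next
          case (2 s3)
          note ag3 = agreeD[OF 2(2), unfolded serve_def]
          obtain V where V: "V \<subseteq> open_clients s2 (fst s ''asg'' t)" "card V \<le> allow t"
            "V = open_clients s2 (fst s ''asg'' t) \<or> card V = allow t"
            "fst s3 ''av'' = (\<lambda>z. if z \<in> V then 1 else fst s1 ''av'' z)" "fst s3 ''assignment'' = (\<lambda>z. if z \<in> V then t else fst s1 ''assignment'' z)"
            using 2(1) unfolding s2 by blast
          have "served (fst s ''cc'') (fst s ''asg'') (Suc t) (fst s3 ''av'') (fst s3 ''assignment'')"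
            unfolding V(4,5) by (rule served_step) (use em V(1-3) in \<open>simp_all add: emitted_def open_clients_def s2\<close>)
          moreover have "fst s3 ''type'' = fst s2 ''type''" "fst s3 ''location'' = fst s2 ''location''" "fst s3 ''lc'' = fst s2 ''lc''"
            "fst s3 ''facilities'' = fst s2 ''facilities''" by (simp_all add: ag3)
          moreover have "\<forall>b<n. ((fst s1 ''lc'')(fst s ''asg'' t := rank (fst s ''asg'') (Suc t) (fst s ''asg'' t))) b = rank (fst s ''asg'') (Suc t) b"
            using em by (simp add: emitted_def rank_Suc)
          ultimately show ?case using em s2 unfolding emitted_def by (simp add: less_Suc_eq)
        qed
        then have "post (Put ''type'' (var ''t'') (NGet ''itype'' (var ''t''));;
       Assign ''o'' (NGet ''asg'' (var ''t''));;
       Put ''location'' (var ''t'') (NGet ''loc'' (own_at (var ''o'') (NGet ''lc'' (var ''o''))));;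
       Put ''lc'' (var ''o'') (NAdd (NGet ''lc'' (var ''o'')) (NLit (if soft then 0 else 1)));; serve) s1
       (\<lambda>s'. fst s' ''facilities'' 0 = T \<and> emitted s (Suc t) s')" by (simp only: post_def den.simps s2_def)
        moreover have g: "bval (NLess (var ''t'') (var ''facilities'')) s1" using 5(2,4) True by simp
        moreover have eq: "min (Suc t) T = Suc t" using True by simp
        ultimately show ?thesis unfolding post_simps(5) if_P[OF g] eq by blast
      next
        case False
        have g: "\<not> bval (NLess (var ''t'') (var ''facilities'')) s1" using 5(2,4) False by simp
        have "min (Suc t) T = min t T" using False by simp
        then show ?thesis using 5(2) unfolding post_simps(1,5) if_not_P[OF g] by argo
      qed
    next
      case (6 s')
      then show ?case using TN by (simp add: T_def min_absorb2)
    qed (use readyD(7)[OF r] in \<open>simp_all add: ag0 serve_def\<close>)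
  qed (use readyD(1)[OF r] X in \<open>auto simp: less_Suc_eq\<close>)
qed

end

section \<open>Correctness of the program\<close>

definition (in hck_instance) solves :: "state \<Rightarrow> real \<Rightarrow> bool" where
  "solves s R \<longleftrightarrow> (let T = fst s ''facilities'' 0; f = fst s ''location''; g = fst s ''assignment'' in
     T \<le> length types \<and> (\<forall>t<T. fst s ''type'' t = types ! t \<and> f t \<in> F) \<and> (\<not> soft \<longrightarrow> inj_on f {..<T}) \<and>
     (\<forall>z\<in>C. g z < T \<and> (\<exists>i. growth i \<le> n \<and> d z (f (g z)) \<le> (4 * real i + 3) * R)) \<and>
     (\<forall>t<T. card {z \<in> C. g z = t} \<le> allow t))"

definition (in hck_instance) achievable :: "real \<Rightarrow> bool" where
  "achievable R \<longleftrightarrow> (\<exists>fac \<sigma>. feasible_solution soft F C caps fac \<sigma> \<and> (\<forall>x\<in>C. d x (fst (fac ! \<sigma> x)) \<le> R))"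

lemma (in hck_instance) clusteredD:
  assumes "clustered n s"
  shows "b < fst s ''m'' 0 \<Longrightarrow> cluster_ok s b" "clients_of s b \<subseteq> C" "facs_of s b \<subseteq> F"
    "z \<in> C \<Longrightarrow> \<exists>b<fst s ''m'' 0. z \<in> clients_of s b"
proof -
  have c: "\<And>z. z < n \<Longrightarrow> fst s ''cc'' z \<le> fst s ''m'' 0" "\<And>z. z < n \<Longrightarrow> fst s ''cc'' z \<noteq> 0 \<Longrightarrow> z \<in> C"
    "\<And>f. f < n \<Longrightarrow> fst s ''cf'' f \<noteq> 0 \<Longrightarrow> f \<in> F" "\<And>z. z < n \<Longrightarrow> z \<in> C \<Longrightarrow> fst s ''cc'' z \<noteq> 0"
    "\<And>b. b < fst s ''m'' 0 \<Longrightarrow> cluster_ok s b"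
    using assms unfolding clustered_def by blast+
  show "b < fst s ''m'' 0 \<Longrightarrow> cluster_ok s b" by (rule c(5))
  show "clients_of s b \<subseteq> C" "facs_of s b \<subseteq> F" using c(2,3) by (auto simp: clients_of_def facs_of_def)
  show "\<exists>b<fst s ''m'' 0. z \<in> clients_of s b" if z: "z \<in> C"
  proof -
    have zn: "z < n" using FC_less z by blast
    obtain b where "fst s ''cc'' z = Suc b" using c(4)[OF zn z] not0_implies_Suc by blast
    then show ?thesis using c(1)[OF zn] zn by (auto simp: clients_of_def Suc_le_eq)
  qed
qed

lemma (in hck_instance) cluster_okD:
  assumes "cluster_ok s b"
  shows "0 < fst s ''dem'' b" "fst s ''dem'' b \<le> n"
    "fst s ''tau'' b = fst s ''dem'' b - fst s ''dem'' b div 2 ^ (e - 3)" "fst s ''stg'' b = level soft (fst s ''dem'' b)"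
    "card (clients_of s b) \<le> fst s ''dem'' b + fst s ''dem'' b div 2 ^ (e - 3)"
    "fst s ''slots'' b = card (facs_of s b)" "inj_on (\<lambda>j. fst s ''loc'' (b * Suc n + j)) {..<fst s ''slots'' b}"
    "j < fst s ''slots'' b \<Longrightarrow> fst s ''loc'' (b * Suc n + j) \<in> facs_of s b"
    "\<exists>t. growth t \<le> n \<and> (\<forall>z\<in>clients_of s b. \<forall>f\<in>facs_of s b. d z f \<le> (4 * real t + 3) * snd s ''R'' 0)"
    "\<exists>J\<subseteq>clients_of s b. card J = fst s ''dem'' b \<and> (\<forall>x\<in>J. \<forall>f\<in>F. d x f \<le> snd s ''R'' 0 \<longrightarrow> f \<in> facs_of s b)"
    "0 < fst s ''tau'' b"
proof -
  show k: "0 < fst s ''dem'' b" "fst s ''dem'' b \<le> n"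
    "fst s ''tau'' b = fst s ''dem'' b - fst s ''dem'' b div 2 ^ (e - 3)" "fst s ''stg'' b = level soft (fst s ''dem'' b)"
    "card (clients_of s b) \<le> fst s ''dem'' b + fst s ''dem'' b div 2 ^ (e - 3)"
    "fst s ''slots'' b = card (facs_of s b)" "inj_on (\<lambda>j. fst s ''loc'' (b * Suc n + j)) {..<fst s ''slots'' b}"
    "j < fst s ''slots'' b \<Longrightarrow> fst s ''loc'' (b * Suc n + j) \<in> facs_of s b"
    "\<exists>t. growth t \<le> n \<and> (\<forall>z\<in>clients_of s b. \<forall>f\<in>facs_of s b. d z f \<le> (4 * real t + 3) * snd s ''R'' 0)"
    "\<exists>J\<subseteq>clients_of s b. card J = fst s ''dem'' b \<and> (\<forall>x\<in>J. \<forall>f\<in>F. d x f \<le> snd s ''R'' 0 \<longrightarrow> f \<in> facs_of s b)"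
    using assms unfolding cluster_ok_def Let_def by blast+
  have "1 < (2::nat) ^ (e - 3)" by (rule one_less_power) (use e5 in auto)
  then have "fst s ''dem'' b div 2 ^ (e - 3) < fst s ''dem'' b" using k(1) by (intro div_less_dividend)
  then show "0 < fst s ''tau'' b" using k(3) by simp
qed

lemma (in hck_instance) cluster_unique:
  "z \<in> clients_of s b \<Longrightarrow> z \<in> clients_of s b' \<Longrightarrow> b = b'" "f \<in> facs_of s b \<Longrightarrow> f \<in> facs_of s b' \<Longrightarrow> b = b'"
  by (simp_all add: clients_of_def facs_of_def)

context hck_search
begin

lemma searchD:
  assumes "search_ready s"
  shows "ready s" "fst s ''m'' 0 = m" "fst s ''tau'' = tau" "fst s ''slots'' = slots" "fst s ''stg'' = stg"
  using assms by (simp_all add: search_ready_def)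

lemma emitted_solves:
  assumes r: "search_ready s" and c: "clustered n s" and fin: "final Y" and cons: "consistent Y own (fst s ''asg'')"
    and TN: "Y (n + 5) \<le> length types" and em: "emitted s (Y (n + 5)) s'" and fa: "fst s' ''facilities'' 0 = Y (n + 5)"
  shows "solves s' (snd s ''R'' 0)"
proof -
  define T where "T = Y (n + 5)"
  define asg where "asg = fst s ''asg''"
  let ?f = "fst s' ''location''" and ?g = "fst s' ''assignment''" and ?av = "fst s' ''av''"
  note cD = clusteredD[OF c, unfolded searchD(2)[OF r]]
  have ok: "cluster_ok s b" if "b < m" for b using cD(1) that .
  have asgm: "asg t < m" if "t < T" for t using cons that unfolding consistent_def T_def asg_def by blast
  have rank_lt: "rank asg t (asg t) < fst s ''slots'' (asg t)" if t: "t < T" for t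
  proof -
    have a: "asg t < m" using asgm[OF t] .
    show ?thesis
    proof (cases soft)
      case True
      have "0 < tau (asg t)" using cluster_okD(11)[OF ok[OF a]] unfolding searchD(3)[OF r] .
      then have "0 < slots (asg t)" using consistent_final(3)[OF cons fin a True] by blast
      then show ?thesis unfolding rank_def searchD(4)[OF r] if_P[OF True] .
    next
      case False
      have "card {t'. t' < t \<and> asg t' = asg t} < card {t'. t' < T \<and> asg t' = asg t}"
        by (rule psubset_card_mono) (use t in auto)
      also have "\<dots> \<le> slots (asg t)"
        using consistent_final(4)[OF cons fin a False] unfolding T_def asg_def .
      finally show ?thesis unfolding rank_def searchD(4)[OF r] if_not_P[OF False] .
    qed
  qed
  have emD: "\<And>t. t < T \<Longrightarrow> fst s' ''type'' t = types ! t"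
    "\<And>t. t < T \<Longrightarrow> ?f t = fst s ''loc'' (asg t * Suc n + rank asg t (asg t))"
    "served (fst s ''cc'') asg T ?av ?g"
    using em unfolding emitted_def T_def asg_def by blast+
  have loc: "?f t \<in> facs_of s (asg t)" if t: "t < T" for t
    unfolding emD(2)[OF t] by (rule cluster_okD(8)[OF ok[OF asgm[OF t]] rank_lt[OF t]])
  have inj: "inj_on ?f {..<T}" if hard: "\<not> soft"
  proof -
    have ne: "?f t \<noteq> ?f t'" if t: "t < t'" "t' < T" for t t'
    proof
      assume eq: "?f t = ?f t'"
      have tT: "t < T" using t by linarith
      have a: "asg t = asg t'" using cluster_unique(2)[OF loc[OF tT]] loc[OF t(2)] eq by simp
      have "rank asg t (asg t) = rank asg t' (asg t')"
        using inj_onD[OF cluster_okD(7)[OF ok[OF asgm[OF tT]]], of "rank asg t (asg t)" "rank asg t' (asg t')"]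
          eq rank_lt[OF tT] rank_lt[OF t(2)] unfolding emD(2)[OF tT] emD(2)[OF t(2)] a by simp
      moreover have "card {u. u < t \<and> asg u = asg t'} < card {u. u < t' \<and> asg u = asg t'}"
        by (rule psubset_card_mono) (use t a in auto)
      ultimately show False unfolding rank_def if_not_P[OF hard] a by simp
    qed
    show ?thesis
    proof (rule inj_onI)
      fix t t' assume "t \<in> {..<T}" "t' \<in> {..<T}" "?f t = ?f t'"
      then show "t = t'" using ne[of t t'] ne[of t' t] by (cases t t' rule: linorder_cases) auto
    qed
  qed
  have sv: "\<And>z. z \<in> C \<Longrightarrow> ?av z = 0 \<or> ?av z = 1 \<and> ?g z < T \<and> fst s ''cc'' z = Suc (asg (?g z))"
    "\<And>t. t < T \<Longrightarrow> card {z \<in> C. ?av z = 1 \<and> ?g z = t} \<le> allow t"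
    "\<And>b. (\<forall>z\<in>C. fst s ''cc'' z = Suc b \<longrightarrow> ?av z = 1) \<or>
        (\<Sum>t | t < T \<and> asg t = b. allow t) \<le> card {z \<in> C. fst s ''cc'' z = Suc b \<and> ?av z = 1}"
    using emD(3) unfolding served_def by blast+
  have av: "?av z = 1" if z: "z \<in> C" for z
  proof -
    obtain b where b: "b < m" "z \<in> clients_of s b" using cD(4)[OF z] by blast
    have cc: "fst s ''cc'' z = Suc b" using b(2) by (simp add: clients_of_def)
    from sv(3)[of b] show ?thesis
    proof
      assume l: "(\<Sum>t | t < T \<and> asg t = b. allow t) \<le> card {z \<in> C. fst s ''cc'' z = Suc b \<and> ?av z = 1}"
      let ?a = "fst s ''dem'' b" and ?V = "{z \<in> C. fst s ''cc'' z = Suc b \<and> ?av z = 1}"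
      have "tau b \<le> (\<Sum>t<T. if asg t = b then size_of t else 0)"
        using consistent_final(1)[OF cons fin b(1)] unfolding T_def asg_def .
      also have "\<dots> = (\<Sum>t | t < T \<and> asg t = b. size_of t)"
        unfolding sum.inter_filter[symmetric, OF finite_lessThan] by (rule sum.cong) auto
      finally have t: "tau b \<le> \<dots>" .
      have "e - 3 = 2 + (e - 5)" using e5 by linarith
      then have p4: "(2::nat) ^ (e - 3) = 4 * 2 ^ (e - 5)" by (simp add: power_add)
      moreover have "tau b = ?a - ?a div (4 * 2 ^ (e - 5))"
        using cluster_okD(3)[OF ok[OF b(1)]] p4 unfolding searchD(3)[OF r] by presburger
      ultimately have "?a + ?a div (4 * 2 ^ (e - 5)) \<le> (\<Sum>t | t < T \<and> asg t = b. allow t)"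
        unfolding allow_def using t by (intro allow_enough) auto
      with l cluster_okD(5)[OF ok[OF b(1)]] have "card (clients_of s b) \<le> card ?V" unfolding p4 by linarith
      moreover have "?V \<subseteq> clients_of s b" "finite (clients_of s b)"
        using FC_less(2) by (auto simp: clients_of_def)
      ultimately have "?V = clients_of s b" using card_seteq by blast
      then show ?thesis using b(2) by blast
    qed (use z cc in blast)
  qed
  have asgn: "?g z < T" "z \<in> clients_of s (asg (?g z))" if z: "z \<in> C" for z
    using sv(1)[OF z] av[OF z] FC_less(2)[OF z] by (simp_all add: clients_of_def)
  have "\<exists>i. growth i \<le> n \<and> d z (?f (?g z)) \<le> (4 * real i + 3) * snd s ''R'' 0" if z: "z \<in> C" for z
    using cluster_okD(9)[OF ok[OF asgm[OF asgn(1)[OF z]]]] asgn(2)[OF z] loc[OF asgn(1)[OF z]] by blast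
  moreover have "card {z \<in> C. ?g z = t} \<le> allow t" if "t < T" for t
  proof -
    have "{z \<in> C. ?g z = t} = {z \<in> C. ?av z = 1 \<and> ?g z = t}" using av by auto
    then show ?thesis using sv(2)[OF that] by argo
  qed
  moreover have "?f t \<in> F" if "t < T" for t using loc[OF that] cD(3) by blast
  ultimately show ?thesis
    unfolding solves_def Let_def fa T_def[symmetric] using TN emD(1) inj asgn(1) unfolding T_def[symmetric] by blast
qed

lemma write_post:
  assumes b: "bfs s" and f: "fst s ''fin'' 0 < fst s ''cnt'' 0" "final (vec_of s (fst s ''fin'' 0))" and c: "clustered n s"
  shows "post (trace;; replay;; emit_output soft) s (\<lambda>s'. solves s' (snd s ''R'' 0))"
  unfolding post_simps(4)
proof (rule post_weaken[OF trace_post[OF b f(1)]], goal_cases)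
  case (1 s1)
  have a1: "agree {''len'', ''q'', ''z'', ''path''} {} s s1" using 1(2) by (simp add: trace_def agree_def)
  note b1 = bfs_agree[OF a1 _ _ _ _ b, simplified bfs_vars_def ready_vars_def, simplified]
  show ?case
  proof (rule post_weaken[OF replay_post[OF b1(1) 1(1)]], goal_cases)
    case (1 s2)
    then obtain own where own: "consistent (vec_of s1 (fst s1 ''fin'' 0)) own (fst s2 ''asg'')" by blast
    have a2: "agree {''len'', ''path'', ''z'', ''q'', ''p'', ''v'', ''w'', ''u'', ''o'', ''own'', ''asg''} {} s s2"
      using a1 1(2) by (simp add: replay_def replay_move_def agree_def)
    note b2 = bfs_agree[OF a2 _ _ _ _ b, simplified bfs_vars_def ready_vars_def, simplified]
    have v: "vec_of s1 = vec_of s" "vec_of s2 = vec_of s" by (rule vec_of_agree[OF a1], simp, rule vec_of_agree[OF a2], simp)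
    have f2: "fst s1 ''fin'' 0 = fst s ''fin'' 0" "fst s2 ''fin'' 0 = fst s ''fin'' 0" "fst s2 ''cnt'' 0 = fst s ''cnt'' 0"
      "snd s2 ''R'' = snd s ''R''" using agreeD[OF a1] agreeD[OF a2] by simp_all
    have c2: "clustered n s2" unfolding clustered_agree[OF a2, simplified cluster_vars_def, simplified] by fact
    let ?Y = "vec_of s (fst s ''fin'' 0)"
    have own': "consistent ?Y own (fst s2 ''asg'')" using own unfolding v f2 .
    have sp: "?Y (n + 5) \<le> length types" using b f(1) unfolding bfs_def space_def by blast
    have "post (emit_output soft) s2 (\<lambda>s'. fst s' ''facilities'' 0 = ?Y (n + 5) \<and> emitted s2 (?Y (n + 5)) s')"
      by (rule emit_output_post[OF b2(1), unfolded v f2]) (use f(1) own' in \<open>auto simp: consistent_def\<close>)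
    then show ?case
    proof (rule post_weaken, goal_cases)
      case (1 s3)
      have "search_ready s2" using b2(1) by (simp add: bfs_def)
      then show ?case using emitted_solves[OF _ c2 f(2) own' sp] 1(1) unfolding f2 by blast
    qed
  qed
qed

lemma achievable_final:
  assumes r: "search_ready s" and c: "clustered n s" and R: "achievable (snd s ''R'' 0)"
  shows "\<exists>y. step\<^sup>*\<^sup>* start y \<and> final y"
proof -
  obtain fac \<sigma> where sol: "hck_solution soft (\<lambda>c. c) F C caps fac \<sigma>" and dR: "\<And>x. x \<in> C \<Longrightarrow> d x (fst (fac ! \<sigma> x)) \<le> snd s ''R'' 0"
    using R unfolding achievable_def feasible_solution_def by blast
  note cD = clusteredD[OF c, unfolded searchD(2)[OF r]]
  note okD = cluster_okD[OF cD(1)]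
  have fac: "\<And>q. q < length fac \<Longrightarrow> fst (fac ! q) \<in> F \<and> snd (fac ! q) < length caps" "\<not> soft \<Longrightarrow> distinct (map fst fac)"
    "\<And>p. p < length caps \<Longrightarrow> length (filter (\<lambda>f. snd f = p) fac) \<le> fst (caps ! p)" "\<And>x. x \<in> C \<Longrightarrow> \<sigma> x < length fac"
    "\<And>q. q < length fac \<Longrightarrow> card {x \<in> C. \<sigma> x = q} \<le> snd (caps ! snd (fac ! q))"
    using sol unfolding hck_solution_def by (force dest: nth_mem)+
  have "\<exists>J. \<forall>b. b < m \<longrightarrow> J b \<subseteq> clients_of s b \<and> card (J b) = fst s ''dem'' b \<and>
      (\<forall>x\<in>J b. \<forall>f\<in>F. d x f \<le> snd s ''R'' 0 \<longrightarrow> f \<in> facs_of s b)"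
    by (rule choice) (use okD(10) in blast)
  then obtain J where J: "\<And>b. b < m \<Longrightarrow> J b \<subseteq> clients_of s b" "\<And>b. b < m \<Longrightarrow> card (J b) = fst s ''dem'' b"
      "\<And>b x f. b < m \<Longrightarrow> x \<in> J b \<Longrightarrow> f \<in> F \<Longrightarrow> d x f \<le> snd s ''R'' 0 \<Longrightarrow> f \<in> facs_of s b" by blast
  have JC: "J b \<subseteq> C" "finite (J b)" if "b < m" for b using J(1)[OF that] cD(2) finite_subset[OF _ finite_C] by blast+
  define Q where "Q = (\<lambda>b. \<sigma> ` J b)"
  define cq where "cq = (\<lambda>q. snd (caps ! snd (fac ! q)))"
  have Qlen: "q < length fac" "fst (fac ! q) \<in> facs_of s b" if b: "b < m" "q \<in> Q b" for b q
  proof -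
    obtain x where x: "x \<in> J b" "q = \<sigma> x" using b(2) by (auto simp: Q_def)
    have "x \<in> C" using JC(1)[OF b(1)] x(1) by blast
    then show "q < length fac" "fst (fac ! q) \<in> facs_of s b" using fac(1,4) dR J(3)[OF b(1) x(1)] x(2) by blast+
  qed
  let ?U = "\<Union>b<m. Q b"
  have US: "?U \<subseteq> \<sigma> ` C" using JC(1) by (auto simp: Q_def)
  have Ufin: "finite ?U" using US finite_C finite_surj by blast
  have Ulen: "q < length fac" if "q \<in> ?U" for q using that Qlen(1) by blast
  have Ucard: "card ?U \<le> n"
  proof -
    have "card ?U \<le> card (\<sigma> ` C)" using US finite_C by (intro card_mono) auto
    also have "\<dots> \<le> card C" by (rule card_image_le[OF finite_C])
    also have "\<dots> \<le> card {..<n}" using FC by (intro card_mono) auto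
    finally show ?thesis by simp
  qed
  have dem: "fst s ''dem'' b \<le> (\<Sum>q\<in>Q b. cq q)" if b: "b < m" for b
  proof -
    have "J b = (\<Union>q\<in>Q b. {x \<in> J b. \<sigma> x = q})" by (auto simp: Q_def)
    then have "card (J b) \<le> (\<Sum>q\<in>Q b. card {x \<in> J b. \<sigma> x = q})"
      using card_UN_le[of "Q b" "\<lambda>q. {x \<in> J b. \<sigma> x = q}"] JC(2)[OF b] by (simp add: Q_def)
    also have "\<dots> \<le> (\<Sum>q\<in>Q b. cq q)"
    proof (rule sum_mono)
      fix q assume q: "q \<in> Q b"
      have "card {x \<in> J b. \<sigma> x = q} \<le> card {x \<in> C. \<sigma> x = q}" using JC(1)[OF b] finite_C by (intro card_mono) auto
      then show "card {x \<in> J b. \<sigma> x = q} \<le> cq q" using fac(5)[OF Qlen(1)[OF b q]] unfolding cq_def by linarith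
    qed
    finally show ?thesis using J(2)[OF b] by simp
  qed
  show ?thesis
  proof (rule cover_succeeds[where Q = Q and c = cq and dem = "fst s ''dem''"], goal_cases)
    case (1 b) then show ?case using JC(2) by (simp add: Q_def)
  next
    case (2 b q)
    then obtain x where x: "x \<in> C" "q = \<sigma> x" using JC(1) by (auto simp: Q_def)
    have "0 < card {x \<in> C. \<sigma> x = q}" using x finite_C by (auto simp: card_gt_0_iff)
    then show ?case using fac(5)[OF Qlen(1)[OF 2]] unfolding cq_def by linarith
  next
    case (3 b b') then show ?case using Qlen(2) cluster_unique(2) by blast
  next
    case (4 b) then show ?case by (rule dem)
  next
    case (5 b) then show ?case by (rule okD(1))
  next
    case (6 b) then show ?case by (rule okD(2))
  next
    case 7 show ?case using e5 by simp
  next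
    case 8 show ?case by (rule Ucard)
  next
    case (9 x)
    have "card {q \<in> ?U. x \<le> cap_of caps n (snd (fac ! q))} \<le>
      card {t. t < length types \<and> x \<le> cap_of caps n (types ! t)}"
    proof (rule items_enough[OF Ufin Ucard _ _ 9])
      fix q assume "q \<in> ?U" then show "snd (fac ! q) < length caps" using fac(1)[OF Ulen] by blast
    next
      fix p assume p: "p < length caps"
      have "card {q \<in> ?U. snd (fac ! q) = p} \<le> card {i. i < length fac \<and> snd (fac ! i) = p}"
        using Ulen by (intro card_mono) auto
      then show "card {q \<in> ?U. snd (fac ! q) = p} \<le> fst (caps ! p)"
        using fac(3)[OF p] unfolding length_filter_conv_card by linarith
    qed
    moreover have "cap_of caps n (snd (fac ! q)) = min (cq q) n" for q by (simp add: cap_of_def cq_def min.commute)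
    ultimately show ?case unfolding size_of_def by simp
  next
    case (10 b)
    have sl: "slots b = card (facs_of s b)" using okD(6)[OF 10] unfolding searchD(4)[OF r] .
    have ff: "finite (facs_of s b)" by (simp add: facs_of_def)
    show ?case
    proof (cases soft)
      case True
      have "J b \<noteq> {}" using okD(1)[OF 10] J(2)[OF 10] by force
      then obtain q where "q \<in> Q b" by (auto simp: Q_def)
      then have "0 < card (facs_of s b)" using Qlen(2)[OF 10] ff by (auto simp: card_gt_0_iff)
      then show ?thesis unfolding if_P[OF True] sl .
    next
      case False
      have "card (Q b) \<le> card (facs_of s b)"
      proof (rule card_inj_on_le[OF _ _ ff])
        show "inj_on (\<lambda>q. fst (fac ! q)) (Q b)"
        proof (rule inj_onI)
          fix q q' assume "q \<in> Q b" "q' \<in> Q b" and eq: "fst (fac ! q) = fst (fac ! q')"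
          then have l: "q < length fac" "q' < length fac" using Qlen(1)[OF 10] by blast+
          then show "q = q'" using nth_eq_iff_index_eq[OF fac(2)[OF False], of q q'] eq by simp
        qed
        show "(\<lambda>q. fst (fac ! q)) ` Q b \<subseteq> facs_of s b" using Qlen(2)[OF 10] by blast
      qed
      then show ?thesis unfolding if_not_P[OF False] sl .
    qed
  next
    case (11 b) show ?case using okD(3)[OF 11] unfolding searchD(3)[OF r] .
  next
    case (12 b) show ?case using okD(4)[OF 12] unfolding searchD(5)[OF r] .
  next
    case (13 b) then show ?case by (rule bins(2))
  qed
qed

end

context hck_instance
begin

lemma attempt_writes:
  "nwrites (attempt soft) \<inter> ({''a'', ''b''} \<union> ready_vars) = {}" "''d'' \<notin> rwrites (attempt soft)"
  by (simp_all add: program_defs ready_vars_def)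

lemma attempt_post:
  assumes r: "ready s" and R: "0 \<le> snd s ''R'' 0"
  shows "post (attempt soft) s (\<lambda>s'.
    fst s' ''solved'' 0 = 1 \<and> snd s' ''best'' 0 = snd s ''R'' 0 \<and> solves s' (snd s ''R'' 0) \<or>
    \<not> achievable (snd s ''R'' 0) \<and> snd s' ''best'' = snd s ''best'' \<and>
    (\<forall>y\<in>{''solved'', ''facilities'', ''type'', ''location'', ''assignment''}. fst s' y = fst s y))"
    (is "post _ _ ?Q")
  unfolding attempt_def post_simps(4)
proof (rule post_weaken[OF clustering_post[OF r R]], goal_cases)
  case (1 s1)
  have r1: "ready s1" by (rule ready_agree[OF 1(2) _ _ r]) (simp_all add: program_defs ready_vars_def)
  have R1: "snd s1 = snd s" using agreeD(2)[OF 1(2)] by (simp add: program_defs fun_eq_iff)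
  have o1: "fst s1 y = fst s y" if "y \<in> {''solved'', ''facilities'', ''type'', ''location'', ''assignment''}" for y
    using that by (auto intro!: agreeD(1)[OF 1(2)] simp: program_defs split: if_splits)
  note okD = cluster_okD[OF clusteredD(1)[OF 1(1)]]
  interpret S: hck_search soft e n F C d caps "fst s1 ''m'' 0" "fst s1 ''tau''" "fst s1 ''slots''" "fst s1 ''stg''"
  proof (unfold_locales, goal_cases)
    case 1
    show ?case using \<open>clustered n s1\<close> by (simp add: clustered_def)
  next
    case (2 b)
    have "card (facs_of s1 b) \<le> card {..<n}" by (rule card_mono) (auto simp: facs_of_def)
    then show ?case using okD(2,3,6)[OF 2] by simp
  next
    case (3 b)
    have "floor_log (fst s1 ''dem'' b) \<le> n" using floor_log_less[OF okD(1)[OF 3]] okD(2)[OF 3] by linarith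
    then show ?case unfolding okD(4)[OF 3] level_def last_stage_def by (cases soft) auto
  qed
  have sr1: "S.search_ready s1" using r1 by (simp add: S.search_ready_def)
  show ?case
  proof (rule post_weaken[OF S.search_post[OF sr1]], goal_cases)
    case (1 s2)
    have c2: "clustered n s2"
      using clustered_agree[OF 1(2)] \<open>clustered n s1\<close> by (simp add: program_defs cluster_vars_def)
    have R2: "snd s2 = snd s" using agreeD(2)[OF 1(2)] by (simp add: R1 program_defs fun_eq_iff)
    have o2: "fst s2 y = fst s y" if y: "y \<in> {''solved'', ''facilities'', ''type'', ''location'', ''assignment''}" for y
    proof -
      have "fst s2 y = fst s1 y" using y by (auto intro!: agreeD(1)[OF 1(2)] simp: program_defs split: if_splits)
      then show ?thesis using o1[OF y] by simp
    qed
    have b2: "S.bfs s2" and cl2: "\<And>q. q < fst s2 ''cnt'' 0 \<Longrightarrow> S.closed q s2" using 1(1) by blast+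
    show ?case
    proof (rule post_weaken[OF S.find_final_post[OF b2]], goal_cases)
      case (1 s3)
      have a3: "agree {''q'', ''found'', ''fin'', ''eq'', ''l'', ''y''} {} s2 s3"
        using 1(2) by (auto simp: agree_def program_defs)
      note b3 = S.bfs_agree[OF a3 _ _ _ _ b2, simplified S.bfs_vars_def ready_vars_def, simplified]
      note ag3 = agreeD[OF a3]
      have v3: "S.vec_of s3 = S.vec_of s2" by (rule S.vec_of_agree[OF a3]) simp
      have c3: "clustered n s3" unfolding clustered_agree[OF a3, simplified cluster_vars_def, simplified] by (rule c2)
      have R3: "snd s3 = snd s" using ag3(2) by (simp add: R2 fun_eq_iff)
      have o3: "fst s3 y = fst s y" if y: "y \<in> {''solved'', ''facilities'', ''type'', ''location'', ''assignment''}" for y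
        using o2[OF y] y by (auto simp: ag3)
      have cnt: "fst s3 ''cnt'' 0 = fst s2 ''cnt'' 0" by (simp add: ag3)
      show ?case
      proof (cases "fst s3 ''found'' 0 = 1")
        case True
        have g: "bval (NEq (var ''found'') (NLit 1)) s3" using True by simp
        have "post (trace;; replay;; emit_output soft) s3 (\<lambda>s'. solves s' (snd s3 ''R'' 0))"
          by (rule S.write_post[OF b3(1) _ _ c3]) (use 1(1) True v3 cnt in auto)
        then have "post (trace;; replay;; emit_output soft) s3
          (\<lambda>s'. post (PutR ''best'' (NLit 0) (RGet ''R'' (NLit 0));; Assign ''solved'' (NLit 1)) s' ?Q)"
        proof (rule post_weaken, goal_cases)
          case (1 s4)
          have R4: "snd s4 = snd s" using agreeD(2)[OF 1(2)] by (simp add: R3 program_defs fun_eq_iff)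
          show ?case using 1(1) R3 R4 by (simp add: solves_def)
        qed
        then show ?thesis unfolding post_simps(5) if_P[OF g] post_simps(4) .
      next
        case False
        have g: "\<not> bval (NEq (var ''found'') (NLit 1)) s3" using False by simp
        have nf: "\<not> S.final (S.vec_of s2 q)" if "q < fst s2 ''cnt'' 0" for q
          using 1(1) False that by (cases "fst s3 ''found'' 0 = 0") auto
        have "\<not> achievable (snd s3 ''R'' 0)"
        proof
          assume a: "achievable (snd s3 ''R'' 0)"
          have "S.search_ready s3" using b3(1) by (simp add: S.bfs_def)
          then obtain y where y: "S.step\<^sup>*\<^sup>* S.start y" "S.final y" using S.achievable_final[OF _ c3 a] by blast
          then show False using S.bfs_complete[OF b2 cl2 y(1)] nf by blast
        qed
        then show ?thesis unfolding post_simps(1,5) if_not_P[OF g] using R3 o3 by simp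
      qed
    qed
  qed
qed

definition progress :: "(nat \<times> nat) set \<Rightarrow> state \<Rightarrow> bool" where
  "progress A s \<longleftrightarrow> fst s ''solved'' 0 \<le> 1 \<and> (fst s ''solved'' 0 = 1 \<longrightarrow> solves s (snd s ''best'' 0)) \<and>
     (fst s ''solved'' 0 = 0 \<longrightarrow> fst s ''facilities'' 0 = 0) \<and>
     (\<forall>(a, b)\<in>A. achievable (d a b) \<longrightarrow> fst s ''solved'' 0 = 1 \<and> snd s ''best'' 0 \<le> d a b)"

lemma pair_post:
  assumes r: "ready s" and p: "progress A s" and ab: "fst s ''a'' 0 = a" "a < n" "fst s ''b'' 0 = b" "b < n"
  shows "post (PutR ''R'' (NLit 0) (RGet ''d'' (NAdd (NGet ''mul'' (var ''a'')) (var ''b'')));;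
        When (BNot (BAnd (NEq (var ''solved'') (NLit 1)) (BNot (RLess (RGet ''R'' (NLit 0)) (RGet ''best'' (NLit 0))))))
          (attempt soft)) s (progress (insert (a, b) A))"
proof -
  define s1 where "s1 = rupd ''R'' 0 (d a b) s"
  have mul: "fst s ''mul'' a = a * n" "snd s ''d'' (a * n + b) = d a b"
    using readyD(11)[OF r, of a] readyD(18)[OF r ab(2,4)] ab by simp_all
  have s1: "snd s1 ''R'' 0 = d a b" "fst s1 = fst s" "snd s1 ''best'' = snd s ''best''" by (simp_all add: s1_def)
  have r1: "ready s1" unfolding s1_def using r by (simp add: ready_def)
  have p1: "progress A s1" using p unfolding progress_def solves_def s1 .
  let ?g = "BNot (BAnd (NEq (var ''solved'') (NLit 1)) (BNot (RLess (RGet ''R'' (NLit 0)) (RGet ''best'' (NLit 0)))))"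
  have g: "bval ?g s1 \<longleftrightarrow> \<not> (fst s ''solved'' 0 = 1 \<and> snd s ''best'' 0 \<le> d a b)" using s1 by auto
  have "post (When ?g (attempt soft)) s1 (progress (insert (a, b) A))"
  proof (cases "bval ?g s1")
    case True
    have "post (attempt soft) s1 (progress (insert (a, b) A))"
    proof (rule post_weaken[OF attempt_post[OF r1]], goal_cases)
      case 1
      show ?case using dist(1) ab by (simp add: s1)
    next
      case (2 s2)
      from 2(1) show ?case
      proof
        assume f: "fst s2 ''solved'' 0 = 1 \<and> snd s2 ''best'' 0 = snd s1 ''R'' 0 \<and> solves s2 (snd s1 ''R'' 0)"
        have "d a b \<le> d a' b'" if "(a', b') \<in> A" "achievable (d a' b')" for a' b'
          using p that True g unfolding progress_def by fastforce
        then show ?case using f s1 unfolding progress_def by auto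
      next
        assume u: "\<not> achievable (snd s1 ''R'' 0) \<and> snd s2 ''best'' = snd s1 ''best'' \<and>
          (\<forall>y\<in>{''solved'', ''facilities'', ''type'', ''location'', ''assignment''}. fst s2 y = fst s1 y)"
        then have "progress A s2" using p1 by (simp add: progress_def solves_def)
        then show ?case using u s1 by (simp add: progress_def)
      qed
    qed
    then show ?thesis unfolding post_simps(5) if_P[OF True] .
  next
    case False
    then have "progress (insert (a, b) A) s1" using p1 g unfolding progress_def s1 by auto
    then show ?thesis unfolding post_simps(1,5) if_not_P[OF False] .
  qed
  then show ?thesis unfolding post_simps(3,4) s1_def using ab mul by simp
qed

lemma main_loop_post:
  assumes r: "ready s" and z: "fst s ''solved'' 0 = 0" "fst s ''facilities'' 0 = 0"
  shows "post (main_loop soft) s (progress {(a, b). a < n \<and> b < n})"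
  unfolding main_loop_def
proof (rule post_For[where N = n and I = "\<lambda>i. progress {(a, b). a < i \<and> b < n}"], goal_cases)
  case 1 show ?case using attempt_writes proper_hck_program[of soft e] by (simp add: hck_program_def main_loop_def)
next
  case (5 i s1)
  have r1: "ready s1" by (rule ready_agree[OF 5(3) _ _ r]) (use attempt_writes in \<open>auto simp: ready_vars_def\<close>)
  show ?case
  proof (rule post_For[where N = n and I = "\<lambda>j. progress ({(a, b). a < i \<and> b < n} \<union> {(a, b). a = i \<and> b < j})"], goal_cases)
    case 1 show ?case using proper_hck_program[of soft e] by (simp add: hck_program_def main_loop_def)
  next
    case (5 j s2)
    have r2: "ready s2" by (rule ready_agree[OF 5(3) _ _ r1]) (use attempt_writes in \<open>auto simp: ready_vars_def\<close>)
    have a2: "fst s2 ''a'' 0 = i"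
      using agreeD(1)[OF 5(3), of "''a''"] attempt_writes(1) \<open>fst s1 ''a'' 0 = i\<close> by auto
    have eq: "{(a, b). a < i \<and> b < n} \<union> {(a, b). a = i \<and> b < Suc j} =
      insert (i, j) ({(a, b). a < i \<and> b < n} \<union> {(a, b). a = i \<and> b < j})" by auto
    show ?case unfolding eq by (rule pair_post[OF r2 5(2) a2 _ 5(4,1)]) (rule \<open>i < n\<close>)
  next
    case (6 s2)
    have "{(a, b). a < i \<and> b < n} \<union> {(a, b). a = i \<and> b < n} = {(a, b). a < Suc i \<and> b < n}" by auto
    then show ?case using 6(1) by simp
  qed (use 5(2) readyD(1)[OF r1] in \<open>auto simp: progress_def solves_def\<close>)
qed (use z readyD(1)[OF r] in \<open>auto simp: progress_def solves_def\<close>)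

lemma radius_props:
  shows "0 \<le> radius C d fac \<sigma>" "x \<in> C \<Longrightarrow> d x (fst (fac ! \<sigma> x)) \<le> radius C d fac \<sigma>"
    "radius C d fac \<sigma> = 0 \<or> (\<exists>x\<in>C. radius C d fac \<sigma> = d x (fst (fac ! \<sigma> x)))"
proof -
  let ?S = "insert 0 ((\<lambda>x. d x (fst (fac ! \<sigma> x))) ` C)"
  have fin: "finite C" using FC_less(2) finite_subset[of C "{..<n}"] by auto
  then have S: "finite ?S" by simp
  show "0 \<le> radius C d fac \<sigma>" "x \<in> C \<Longrightarrow> d x (fst (fac ! \<sigma> x)) \<le> radius C d fac \<sigma>"
    unfolding radius_def by (rule Max_ge[OF S], simp)+
  have "radius C d fac \<sigma> \<in> ?S" unfolding radius_def by (rule Max_in[OF S]) simp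
  then show "radius C d fac \<sigma> = 0 \<or> (\<exists>x\<in>C. radius C d fac \<sigma> = d x (fst (fac ! \<sigma> x)))" by auto
qed

lemma OPT_attained:
  assumes "\<exists>fac \<sigma>. feasible_solution soft F C caps fac \<sigma>"
  shows "0 \<le> OPT soft F C d caps" "achievable (OPT soft F C d caps)"
    "0 < n \<Longrightarrow> \<exists>a<n. \<exists>b<n. OPT soft F C d caps = d a b"
proof -
  let ?D = "insert 0 ((\<lambda>(x, y). d x y) ` ({..<n} \<times> {..<n}))"
  let ?S = "{radius C d fac \<sigma> | fac \<sigma>. feasible_solution soft F C caps fac \<sigma>}"
  have loc: "fst (fac ! \<sigma> x) < n" if "feasible_solution soft F C caps fac \<sigma>" "x \<in> C" for fac \<sigma> x
  proof -
    have "\<sigma> x < length fac" "\<forall>(v, p)\<in>set fac. v \<in> F \<and> p < length caps"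
      using that unfolding feasible_solution_def hck_solution_def by auto
    then have "fst (fac ! \<sigma> x) \<in> F" using nth_mem by fastforce
    then show ?thesis by (rule FC_less)
  qed
  have "?S \<subseteq> ?D"
  proof
    fix r assume "r \<in> ?S"
    then obtain fac \<sigma> where f: "r = radius C d fac \<sigma>" "feasible_solution soft F C caps fac \<sigma>" by blast
    from radius_props(3)[of fac \<sigma>] show "r \<in> ?D" using f loc FC_less(2) by force
  qed
  then have fin: "finite ?S" using finite_subset by fastforce
  have ne: "?S \<noteq> {}" using assms by blast
  have "OPT soft F C d caps \<in> ?S"
    unfolding OPT_def using cInf_eq_Min[OF fin ne] Min_in[OF fin ne] by simp
  then obtain fac \<sigma> where opt: "OPT soft F C d caps = radius C d fac \<sigma>" "feasible_solution soft F C caps fac \<sigma>" by blast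
  show "0 \<le> OPT soft F C d caps" unfolding opt(1) by (rule radius_props)
  show "achievable (OPT soft F C d caps)" unfolding achievable_def opt(1) using opt(2) radius_props(2) by blast
  show "\<exists>a<n. \<exists>b<n. OPT soft F C d caps = d a b" if n: "0 < n"
    using radius_props(3)[of fac \<sigma>] loc[OF opt(2)] FC_less(2) n dist(4)[OF n] unfolding opt(1) by metis
qed

lemma program_post:
  assumes feas: "\<exists>fac \<sigma>. feasible_solution soft F C caps fac \<sigma>"
  shows "post (hck_program soft e) (input_state n F C d caps) (\<lambda>s. \<exists>R\<le>OPT soft F C d caps. solves s R)"
proof -
  have "post (init soft ;; bucket ;; tables soft e) (input_state n F C d caps)
    (\<lambda>s. post (main_loop soft) s (\<lambda>s. \<exists>R\<le>OPT soft F C d caps. solves s R))"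
  proof (rule post_weaken[OF ready_start], goal_cases)
    case (1 s)
    have "post (main_loop soft) s (progress {(a, b). a < n \<and> b < n})" by (rule main_loop_post) (use 1(1) in auto)
    then show ?case
    proof (rule post_weaken, goal_cases)
      case (1 s')
      show ?case
      proof (cases "n = 0")
        case True
        have C: "C = {}" using FC_less(2) True by blast
        have "fst s' ''facilities'' 0 = 0 \<or> solves s' (snd s' ''best'' 0)" using 1(1) unfolding progress_def by linarith
        moreover have "fst s' ''facilities'' 0 = 0" if "solves s' (snd s' ''best'' 0)"
          using that FC True unfolding solves_def Let_def by auto
        ultimately have "fst s' ''facilities'' 0 = 0" by blast
        then have "solves s' (OPT soft F C d caps)" unfolding solves_def Let_def using C by simp
        then show ?thesis by blast
      next
        case False
        then obtain a b where ab: "a < n" "b < n" "OPT soft F C d caps = d a b" using OPT_attained(3)[OF feas] by blast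
        then have "achievable (d a b)" using OPT_attained(2)[OF feas] by simp
        then have "fst s' ''solved'' 0 = 1 \<and> snd s' ''best'' 0 \<le> d a b" using 1(1) ab unfolding progress_def by blast
        then show ?thesis using 1(1) ab unfolding progress_def by auto
      qed
    qed
  qed
  then show ?thesis unfolding hck_program_def post_simps(4) .
qed

lemma solves_approximate:
  assumes s: "solves s R" "R \<le> OPT soft F C d caps" "0 \<le> OPT soft F C d caps"
    and a: "\<And>i. growth i \<le> n \<Longrightarrow> 4 * real i + 3 \<le> a"
    and b: "\<And>v c. 0 < v \<Longrightarrow> v \<le> c \<Longrightarrow> v + v div 2 ^ (e - 5) + 1 \<le> nat \<lceil>b * real c\<rceil>"
  shows "approximate_solution soft a b F C d caps (output_facilities s) (output_assignment s)"
proof -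
  define T where "T = fst s ''facilities'' 0"
  let ?f = "fst s ''location''" and ?g = "fst s ''assignment''" and ?out = "output_facilities s"
  have S: "T \<le> length types" "\<And>t. t < T \<Longrightarrow> fst s ''type'' t = types ! t" "\<And>t. t < T \<Longrightarrow> ?f t \<in> F"
    "\<not> soft \<Longrightarrow> inj_on ?f {..<T}" "\<And>z. z \<in> C \<Longrightarrow> ?g z < T"
    "\<And>z. z \<in> C \<Longrightarrow> \<exists>i. growth i \<le> n \<and> d z (?f (?g z)) \<le> (4 * real i + 3) * R"
    "\<And>t. t < T \<Longrightarrow> card {z \<in> C. ?g z = t} \<le> allow t"
    using s(1) unfolding solves_def Let_def T_def[symmetric] by blast+
  have len: "length ?out = T" and out: "\<And>t. t < T \<Longrightarrow> ?out ! t = (?f t, types ! t)"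
    using S(2) by (simp_all add: output_facilities_def T_def)
  have ty: "types ! t < length caps" "0 < size_of t" if "t < T" for t
  proof -
    have "types ! t \<in> set types" using that S(1) by simp
    then show "types ! t < length caps" "0 < size_of t"
      using item_prefix_props[of n n caps] unfolding size_of_def item_types_def by auto
  qed
  have cnt: "length (filter (\<lambda>f. snd f = p) ?out) \<le> fst (caps ! p)" if "p < length caps" for p
  proof -
    have "map snd ?out = take T types" by (rule nth_equalityI) (use len out S(1) in auto)
    then have "count_list (take T types) p = length (filter (\<lambda>f. snd f = p) ?out)"
      by (metis (mono_tags, lifting) count_list_eq_length_filter filter_cong filter_map length_map o_apply)
    moreover have "count_list (take T types) p \<le> count_list types p"
      by (metis append_take_drop_id count_list_append le_add1)
    moreover have "count_list types p \<le> fst (caps ! p)"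
      using count_item_prefix[of n n caps p] unfolding item_types_def by (auto split: if_splits)
    ultimately show ?thesis by linarith
  qed
  have "hck_solution soft (\<lambda>c. nat \<lceil>b * real c\<rceil>) F C caps ?out ?g"
    unfolding hck_solution_def
  proof (intro conjI allI impI ballI, goal_cases)
    case (1 x)
    then obtain t where "t < T" "x = ?out ! t" by (auto simp: in_set_conv_nth len)
    then show ?case using S(3) ty(1) out by simp
  next
    case 2
    have "map fst ?out = map ?f [0..<T]" by (simp add: output_facilities_def T_def)
    then show ?case using S(4)[OF 2] by (simp add: distinct_map atLeast0LessThan)
  next
    case (3 p) then show ?case by (rule cnt)
  next
    case (4 x) then show ?case using S(5) len by simp
  next
    case (5 i)
    then have i: "i < T" using len by simp
    have "card {x \<in> C. ?g x = i} \<le> size_of i + size_of i div 2 ^ (e - 5) + 1" using S(7)[OF i] unfolding allow_def .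
    also have "\<dots> \<le> nat \<lceil>b * real (snd (caps ! (types ! i)))\<rceil>"
      by (rule b[OF ty(2)[OF i]]) (simp add: size_of_def cap_of_def)
    finally show ?case using out[OF i] by simp
  qed
  moreover have "d x (fst (?out ! ?g x)) \<le> a * OPT soft F C d caps" if x: "x \<in> C" for x
  proof -
    obtain i where i: "growth i \<le> n" "d x (?f (?g x)) \<le> (4 * real i + 3) * R" using S(6)[OF x] by blast
    have "(4 * real i + 3) * R \<le> (4 * real i + 3) * OPT soft F C d caps" using s(2) by (intro mult_left_mono) auto
    also have "\<dots> \<le> a * OPT soft F C d caps" using a[OF i(1)] s(3) by (intro mult_right_mono)
    finally show ?thesis using i(2) out[OF S(5)[OF x]] by simp
  qed
  ultimately show ?thesis unfolding approximate_solution_def output_assignment_def by blast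
qed

end

section \<open>Running time and approximation guarantee\<close>

lemma depth_tables: "depth (tables soft e) \<le> 9" and depth_main_loop: "depth (main_loop soft) \<le> 9"
  by (simp_all add: program_defs)

lemma pcost_program: "pcost (hck_program soft e) = pcost (hck_program soft 0)"
  by (simp add: hck_program_def tables_def quotients_def mark_all_def NEq_def NLe_def)

context hck_instance
begin

lemma rows_bound_le:
  assumes "\<And>j. j \<le> last_stage \<Longrightarrow> card {v. v \<le> n \<and> allowed soft e n j v} \<le> M"
  shows "rows_bound \<le> (n + 2) ^ (M + 6)"
proof -
  have "(\<Sum>j\<le>last_stage. Suc n ^ card {v. v \<le> n \<and> allowed soft e n j v}) \<le> (\<Sum>j\<le>last_stage. (n + 2) ^ M)"
  proof (rule sum_mono)
    fix j assume "j \<in> {..last_stage}"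
    then have "Suc n ^ card {v. v \<le> n \<and> allowed soft e n j v} \<le> Suc n ^ M"
      using assms by (intro power_increasing) auto
    also have "\<dots> \<le> (n + 2) ^ M" by (rule power_mono) auto
    finally show "Suc n ^ card {v. v \<le> n \<and> allowed soft e n j v} \<le> (n + 2) ^ M" .
  qed
  also have "\<dots> = Suc last_stage * (n + 2) ^ M" by simp
  also have "\<dots> \<le> (n + 2) * (n + 2) ^ M" by (rule mult_right_mono) (simp_all add: last_stage_def)
  finally have "rows_bound \<le> (n + 2) * (n + 2) ^ M * (n + 2) ^ 5" unfolding rows_bound_def by (rule mult_right_mono) simp
  also have "(n + 2) * (n + 2) ^ M * (n + 2) ^ 5 = (n + 2) ^ (1 + M + 5)" by (simp only: power_add power_one_right)
  finally show ?thesis by (simp add: add.commute)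
qed

lemma program_exec:
  assumes M: "\<And>j. j \<le> last_stage \<Longrightarrow> card {v. v \<le> n \<and> allowed soft e n j v} \<le> M"
    and A: "A = pcost (hck_program soft e)"
  shows "\<exists>t. exec (compile (hck_program soft e)) (input_state n F C d caps) t
      (den (hck_program soft e) (input_state n F C d caps)) \<and>
    t \<le> A * length caps + (n + 2) ^ (9 * (M + 7) + 2 * A)"
proof -
  define Z where "Z = rows_bound + n * n + n + 6"
  define z1 where "z1 = den (init soft) (input_state n F C d caps)"
  define z2 where "z2 = den bucket z1"
  define z3 where "z3 = den (tables soft e) z2"
  have z3: "ready z3"
    using ready_start unfolding post_simps(4) by (simp add: post_def z1_def z2_def z3_def)
  have proper: "proper (init soft)" "proper bucket" "proper (tables soft e)" "proper (main_loop soft)"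
    using proper_hck_program[of soft e] by (simp_all add: hck_program_def)
  have lim0: "limits (init soft) = {}" by (simp add: init_def)
  have d0: "depth (init soft) = 0" "depth bucket = 1" by (simp_all add: init_def bucket_def)
  obtain t1 where t1: "exec (compile (init soft)) (input_state n F C d caps) t1 z1" "t1 \<le> pcost (init soft)"
    using exec_compile[OF proper(1), of "input_state n F C d caps" 0] lim0 d0 unfolding z1_def by auto
  have P: "fst z1 ''P'' 0 = length caps" by (simp add: z1_def init_def input_state_def)
  obtain t2 where t2: "exec (compile bucket) z1 t2 z2" "t2 \<le> pcost bucket * Suc (length caps)"
    using exec_compile[OF proper(2), of z1 "length caps"] P d0 unfolding z2_def by (auto simp: bucket_def)
  have z2: "fst z2 ''n'' 0 = n" "fst z2 ''n1'' 0 = Suc n" "fst z2 ''n2'' 0 = n + 2" "fst z2 ''five'' 0 = 5"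
    "fst z2 ''stages'' 0 = Suc last_stage"
    by (simp_all add: z2_def z1_def den_nat_frame bucket_def init_def input_state_def last_stage_def)
  have ls: "last_stage \<le> n" by (simp add: last_stage_def)
  have "\<forall>l\<in>limits (tables soft e). l \<notin> nwrites (tables soft e) \<and> fst z2 l 0 \<le> Z"
    using ls by (simp add: program_defs z2 Z_def)
  then obtain t3 where t3: "exec (compile (tables soft e)) z2 t3 z3" "t3 \<le> pcost (tables soft e) * Suc Z ^ depth (tables soft e)"
    using exec_compile[OF proper(3)] unfolding z3_def by blast
  have N: "length types \<le> n * n" using item_prefix_props[of n n caps] by (simp add: item_types_def)
  have z3': "fst z3 ''n'' 0 = n" "fst z3 ''n1'' 0 = Suc n" "fst z3 ''L'' 0 = n + 6" "fst z3 ''five'' 0 = 5"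
    "fst z3 ''S'' 0 = rows_bound" "fst z3 ''N'' 0 = length types"
    using readyD[OF z3] by auto
  have "\<forall>l\<in>limits (main_loop soft). l \<notin> nwrites (main_loop soft) \<and> fst z3 l 0 \<le> Z"
    using N by (auto simp: program_defs z3' Z_def)
  then obtain t4 where t4: "exec (compile (main_loop soft)) z3 t4 (den (main_loop soft) z3)"
      "t4 \<le> pcost (main_loop soft) * Suc Z ^ depth (main_loop soft)"
    using exec_compile[OF proper(4)] by blast
  have ex: "exec (compile (hck_program soft e)) (input_state n F C d caps) (t1 + (t2 + (t3 + t4)))
      (den (hck_program soft e) (input_state n F C d caps))"
    unfolding hck_program_def compile.simps den.simps
    by (intro exec.Seq[OF t1(1)] exec.Seq[OF t2(1)] exec.Seq[OF t3(1)]) (use t4(1) in \<open>simp add: z1_def z2_def z3_def\<close>)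
  have c9: "c * Suc Z ^ k \<le> c * Suc Z ^ 9" if "k \<le> 9" for c k :: nat
    using that by (intro mult_left_mono power_increasing) auto
  have "t3 \<le> pcost (tables soft e) * Suc Z ^ 9" by (rule order_trans[OF t3(2) c9[OF depth_tables]])
  moreover have "t4 \<le> pcost (main_loop soft) * Suc Z ^ 9" by (rule order_trans[OF t4(2) c9[OF depth_main_loop]])
  moreover have "A = pcost (init soft) + (pcost bucket + (pcost (tables soft e) + pcost (main_loop soft)))"
    unfolding A hck_program_def by simp
  moreover have "1 \<le> Suc Z ^ 9" by simp
  then have "pcost (init soft) + pcost bucket \<le> (pcost (init soft) + pcost bucket) * Suc Z ^ 9"
    by (metis mult.right_neutral mult_le_mono2)
  ultimately have "t1 + (t2 + (t3 + t4)) \<le> A * Suc Z ^ 9 + pcost bucket * length caps"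
    using t1(2) t2(2) by (simp add: add_mult_distrib)
  also have "\<dots> \<le> A * length caps + A * Suc Z ^ 9"
    unfolding A hck_program_def by (simp add: add_mult_distrib)
  also have "A * Suc Z ^ 9 \<le> (n + 2) ^ (2 * A) * (n + 2) ^ (9 * (M + 7))"
  proof (rule mult_mono)
    have "A < 2 ^ A" by (rule less_exp)
    also have "\<dots> \<le> (n + 2) ^ A" by (rule power_mono) auto
    also have "\<dots> \<le> (n + 2) ^ (2 * A)" by (rule power_increasing) auto
    finally show "A \<le> (n + 2) ^ (2 * A)" by simp
    have "Suc Z \<le> (n + 2) ^ (M + 6) + (n + 2) ^ 3"
      using rows_bound_le[OF M] by (simp add: Z_def power3_eq_cube algebra_simps)
    also have "\<dots> \<le> (n + 2) ^ (M + 6) + (n + 2) ^ (M + 6)" by (intro add_left_mono power_increasing) auto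
    also have "\<dots> \<le> (n + 2) ^ (M + 7)" by (simp add: eval_nat_numeral)
    finally have "Suc Z ^ 9 \<le> ((n + 2) ^ (M + 7)) ^ 9" by (rule power_mono) simp
    then show "Suc Z ^ 9 \<le> (n + 2) ^ (9 * (M + 7))" by (simp only: power_mult[symmetric] mult.commute)
  qed auto
  finally have "t1 + (t2 + (t3 + t4)) \<le> A * length caps + (n + 2) ^ (9 * (M + 7) + 2 * A)"
    by (simp only: power_add mult.commute)
  then show ?thesis using ex by blast
qed

lemma growth_bound:
  assumes "growth i \<le> n"
  shows "4 * real i + 3 \<le> 11 * 2 ^ (e - 3) * lg n"
proof -
  define D :: real where "D = 2 ^ (e - 3)"
  have D: "1 \<le> D / 2"
  proof -
    have "(2::real) ^ 1 \<le> 2 ^ (e - 3)" by (rule power_increasing) (use e5 in auto)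
    then show ?thesis by (simp add: D_def)
  qed
  have g: "(1 + 1 / D) ^ i \<le> real n" using assms by (simp add: growth_def D_def)
  have "(1::real) \<le> (1 + 1 / D) ^ i" using D by (intro one_le_power) simp
  with g have n: "1 \<le> real n" by linarith
  have "1 / (2 * D) \<le> 1 / D - (1 / D)\<^sup>2" using D by (simp add: field_simps power2_eq_square)
  also have "\<dots> \<le> ln (1 + 1 / D)" using D by (intro ln_one_plus_pos_lower_bound) (auto simp: field_simps)
  finally have "real i * (1 / (2 * D)) \<le> real i * ln (1 + 1 / D)" by (rule mult_left_mono) simp
  also have "\<dots> = ln ((1 + 1 / D) ^ i)" using D by (simp add: ln_realpow add_pos_pos)
  also have "\<dots> \<le> ln (real n)"
    using g n D by (subst ln_le_cancel_iff) (auto intro!: zero_less_power add_pos_pos)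
  also have "\<dots> \<le> lg n"
  proof -
    have "ln (real n) \<le> ln (real n + 2)" using n by simp
    also have "\<dots> \<le> ln (real n + 2) / ln 2"
    proof -
      have "ln (real n + 2) * ln 2 \<le> ln (real n + 2) * 1" using n ln_2_less_1 by (intro mult_left_mono) auto
      then show ?thesis by (simp add: field_simps)
    qed
    finally show ?thesis by (simp add: lg_def log_def)
  qed
  finally have i: "real i \<le> 2 * D * lg n" using D by (simp add: field_simps)
  have "1 \<le> lg n" by (simp add: lg_def)
  then have "1 * 1 \<le> D * lg n" using D by (intro mult_mono) auto
  then show ?thesis using i unfolding D_def[symmetric] by (simp add: algebra_simps)
qed

end

lemma hck_bicriteria:
  assumes e: "5 \<le> e" and a: "\<And>n. 11 * 2 ^ (e - 3) * lg n \<le> a n"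
    and b: "\<And>v c. 0 < v \<Longrightarrow> v \<le> c \<Longrightarrow> v + v div 2 ^ (e - 5) + 1 \<le> nat \<lceil>b * real c\<rceil>"
    and M: "\<And>n j. card {v. v \<le> n \<and> allowed soft e n j v} \<le> M n"
    and T: "\<And>n P. real (pcost (hck_program soft e) * P + (n + 2) ^ (9 * (M n + 7) + 2 * pcost (hck_program soft e))) \<le> T n P"
  shows "bicriteria_algorithm soft a b T (compile (hck_program soft e))"
  unfolding bicriteria_algorithm_def
proof (intro allI impI)
  fix n F C and d :: "nat \<Rightarrow> nat \<Rightarrow> real" and caps
  assume FC: "F \<union> C = {..<n} \<and> Metric_space {..<n} d"
  interpret hck_instance soft e n F C d caps using FC e unfolding hck_instance_def by blast
  define A where "A = pcost (hck_program soft e)"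
  let ?s = "den (hck_program soft e) (input_state n F C d caps)"
  obtain t where t: "exec (compile (hck_program soft e)) (input_state n F C d caps) t ?s"
    "t \<le> A * length caps + (n + 2) ^ (9 * (M n + 7) + 2 * A)"
    using program_exec[OF M A_def] by blast
  have "real t \<le> real (A * length caps + (n + 2) ^ (9 * (M n + 7) + 2 * A))" using t(2) by (simp only: of_nat_le_iff)
  also have "\<dots> \<le> T n (length caps)" unfolding A_def by (rule T)
  finally have "real t \<le> T n (length caps)" .
  moreover have "approximate_solution soft (a n) b F C d caps (output_facilities ?s) (output_assignment ?s)"
    if feas: "\<exists>fac \<sigma>. feasible_solution soft F C caps fac \<sigma>"
  proof -
    obtain R where R: "R \<le> OPT soft F C d caps" "solves ?s R"
      using program_post[OF feas] unfolding post_def by blast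
    show ?thesis
      proof (rule solves_approximate[OF R(2,1) OPT_attained(1)[OF feas] _ b])
      show "4 * real i + 3 \<le> a n" if "growth i \<le> n" for i
        by (rule order_trans[OF growth_bound[OF that] a])
    qed
  qed
  ultimately show "\<exists>t s. exec (compile (hck_program soft e)) (input_state n F C d caps) t s \<and> real t \<le> T n (length caps) \<and>
    ((\<exists>fac \<sigma>. feasible_solution soft F C caps fac \<sigma>) \<longrightarrow>
      approximate_solution soft (a n) b F C d caps (output_facilities s) (output_assignment s))"
    using t(1) by blast
qed

lemma precision_exists:
  assumes "1 \<le> (x::real)"
  shows "\<exists>e\<ge>5. 2 * x \<le> 2 ^ (e - 5) \<and> 2 ^ (e - 5) \<le> 4 * x"
proof -
  obtain k0 where "2 * x < 2 ^ k0" using real_arch_pow[of 2 "2 * x"] by auto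
  then have ex: "2 * x \<le> 2 ^ k0" by simp
  define k where "k = (LEAST k. 2 * x \<le> (2::real) ^ k)"
  have k: "2 * x \<le> 2 ^ k" unfolding k_def by (rule LeastI[of _ k0]) (rule ex)
  have "k \<noteq> 0" using k assms by (cases k) auto
  then obtain l where l: "k = Suc l" by (cases k) auto
  have "\<not> 2 * x \<le> 2 ^ l" using not_less_Least[of l "\<lambda>k. 2 * x \<le> (2::real) ^ k"] l unfolding k_def by simp
  then have "2 ^ k \<le> 4 * x" using l by simp
  then show ?thesis using k by (intro exI[of _ "k + 5"]) simp
qed

text \<open>The summand \<open>1\<close> is absorbed by the ceiling when \<open>v\<close> is small, and by \<open>\<epsilon> * v\<close> when it is large.\<close>

lemma capacity_enough:
  assumes eps: "0 < (\<epsilon>::real)" and M: "2 * inv_eps \<epsilon> \<le> real M" and v: "0 < v" "v \<le> c"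
  shows "v + v div M + 1 \<le> nat \<lceil>(1 + \<epsilon>) * real c\<rceil>"
proof (cases "v < M")
  case True
  have "real c < (1 + \<epsilon>) * real c" using eps v by (simp add: algebra_simps)
  then have "int c < \<lceil>(1 + \<epsilon>) * real c\<rceil>" by (simp add: less_ceiling_iff)
  then show ?thesis using True v by simp
next
  case False
  have ie: "1 / \<epsilon> \<le> inv_eps \<epsilon>" "1 \<le> inv_eps \<epsilon>" by (simp_all add: inv_eps_def)
  have M0: "0 < real M" using M ie by linarith
  have "2 / \<epsilon> \<le> real M" using M ie by linarith
  then have eM: "2 \<le> \<epsilon> * real M" using eps by (simp add: field_simps)
  have "2 * real v \<le> \<epsilon> * real M * real v" by (rule mult_right_mono[OF eM]) simp
  then have q: "real v / real M \<le> \<epsilon> * real v / 2" using M0 by (simp add: field_simps)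
  have "real (v div M) \<le> real v / real M" by (rule of_nat_div_le_of_nat)
  moreover have "1 \<le> real v / real M" using False M0 by simp
  ultimately have "real (v + v div M + 1) \<le> real v + \<epsilon> * real v"
    using q unfolding of_nat_add of_nat_1 by linarith
  also have "\<dots> \<le> (1 + \<epsilon>) * real c" using mult_left_mono[of "real v" "real c" "1 + \<epsilon>"] eps v by (simp add: algebra_simps)
  finally have "int (v + v div M + 1) \<le> \<lceil>(1 + \<epsilon>) * real c\<rceil>" by linarith
  then show ?thesis by linarith
qed

lemma floor_log_le_lg: "real (floor_log n) \<le> lg n"
proof (cases "n = 0")
  case False
  have "(2::nat) ^ floor_log n \<le> n + 2" using floor_log_exp2_le[of n] False by linarith
  then have "(2::real) ^ floor_log n \<le> real n + 2" using of_nat_le_iff[where 'a = real, of "2 ^ floor_log n" "n + 2"] by simp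
  then show ?thesis unfolding lg_def by (simp add: le_log_iff powr_realpow)
qed (simp add: lg_def)

lemma power_lg: "(real n + 2) ^ k = 2 powr (lg n * real k)"
proof -
  have "2 powr (lg n * real k) = (2 powr lg n) powr real k" by (simp add: powr_powr)
  also have "2 powr lg n = real n + 2" unfolding lg_def by (rule powr_log_cancel) auto
  finally show ?thesis by (simp add: powr_realpow)
qed


theorem theorem1:
  "\<exists>(K::real) (j::nat). K \<ge> 1 \<and>
     (\<forall>\<epsilon>::real. \<epsilon> > 0 \<longrightarrow>
        (\<exists>(C\<^sub>\<epsilon>::real) prog. C\<^sub>\<epsilon> \<ge> 1 \<and>
           bicriteria_algorithm False
             (\<lambda>n. K * (lg n * inv_eps \<epsilon>)) (1 + \<epsilon>)
             (\<lambda>n P. C\<^sub>\<epsilon> powr (K * (lg n ^ 3 * log 2 (lg n + 1) ^ j)) + K * real P) prog) \<and>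
        (\<exists>prog.
           bicriteria_algorithm True
             (\<lambda>n. K * (lg n * inv_eps \<epsilon>)) (1 + \<epsilon>)
             (\<lambda>n P. (real n + 2) powr (K * inv_eps \<epsilon>) + K * real P) prog))"
proof -
  define A where "A = pcost (hck_program False 0) + pcost (hck_program True 0)"
  define K :: real where "K = 4847 + 2 * real A"
  have K1: "1 \<le> K" by (simp add: K_def)
  have lg1: "1 \<le> lg n" for n by (simp add: lg_def)
  have main: "(\<exists>(C\<^sub>\<epsilon>::real) prog. C\<^sub>\<epsilon> \<ge> 1 \<and>
           bicriteria_algorithm False
             (\<lambda>n. K * (lg n * inv_eps \<epsilon>)) (1 + \<epsilon>)
             (\<lambda>n P. C\<^sub>\<epsilon> powr (K * (lg n ^ 3 * log 2 (lg n + 1) ^ 0)) + K * real P) prog) \<and>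
        (\<exists>prog.
           bicriteria_algorithm True
             (\<lambda>n. K * (lg n * inv_eps \<epsilon>)) (1 + \<epsilon>)
             (\<lambda>n P. (real n + 2) powr (K * inv_eps \<epsilon>) + K * real P) prog)"
    if eps: "0 < \<epsilon>" for \<epsilon> :: real
  proof -
    define x where "x = inv_eps \<epsilon>"
    have x1: "1 \<le> x" by (simp add: x_def inv_eps_def)
    obtain e where e: "5 \<le> e" "2 * x \<le> 2 ^ (e - 5)" "2 ^ (e - 5) \<le> 4 * x" using precision_exists[OF x1] by blast
    have e53: "e - 3 = 2 + (e - 5)" "e = 5 + (e - 5)" using e(1) by linarith+
    have pow: "(2::real) ^ (e - 3) = 4 * 2 ^ (e - 5)" "(2::real) ^ e = 32 * 2 ^ (e - 5)"
      by (subst e53, simp only: power_add, simp)+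
    have a: "11 * 2 ^ (e - 3) * lg n \<le> K * (lg n * x)" for n
    proof -
      have "11 * 2 ^ (e - 3) \<le> K * x"
      proof -
        have "11 * 2 ^ (e - 3) \<le> 176 * x" unfolding pow using e(3) by simp
        also have "\<dots> \<le> K * x" using x1 by (intro mult_right_mono) (auto simp: K_def)
        finally show ?thesis .
      qed
      then have "11 * 2 ^ (e - 3) * lg n \<le> K * x * lg n" using lg1[of n] by (intro mult_right_mono) auto
      then show ?thesis by (simp add: mult_ac)
    qed
    have b: "v + v div 2 ^ (e - 5) + 1 \<le> nat \<lceil>(1 + \<epsilon>) * real c\<rceil>" if "0 < v" "v \<le> c" for v c
      by (rule capacity_enough[OF eps _ that]) (use e(2) in \<open>simp add: x_def\<close>)
    have AK: "real (pcost (hck_program soft e)) * real P \<le> K * real P" "pcost (hck_program soft e) \<le> A" for soft P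
    proof -
      show le: "pcost (hck_program soft e) \<le> A" unfolding pcost_program[of soft e] A_def by (cases soft) auto
      show "real (pcost (hck_program soft e)) * real P \<le> K * real P" using le by (intro mult_right_mono) (auto simp: K_def)
    qed
    define G where "G = 18 * 2 ^ e + 63 + 2 * A"
    have hard: "bicriteria_algorithm False (\<lambda>n. K * (lg n * x)) (1 + \<epsilon>)
      (\<lambda>n P. (2 powr real G) powr (K * (lg n ^ 3 * log 2 (lg n + 1) ^ 0)) + K * real P) (compile (hck_program False e))"
    proof (rule hck_bicriteria[OF e(1) a b card_allowed_hard], assumption, assumption)
      fix n P
      let ?k = "9 * (2 ^ e * (floor_log n + 1) + 7) + 2 * pcost (hck_program False e)"
      have "real ?k \<le> real G * lg n"
      proof -
        have "real ?k = 9 * 2 ^ e * (real (floor_log n) + 1) + (63 + 2 * real (pcost (hck_program False e)))"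
          by (simp add: algebra_simps)
        also have "\<dots> \<le> 9 * 2 ^ e * (2 * lg n) + (63 + 2 * real A) * lg n"
        proof (rule add_mono)
          show "9 * 2 ^ e * (real (floor_log n) + 1) \<le> 9 * 2 ^ e * (2 * lg n)"
            using floor_log_le_lg[of n] lg1[of n] by (intro mult_left_mono) auto
          have "63 + 2 * real (pcost (hck_program False e)) \<le> (63 + 2 * real A) * 1" using AK(2)[of False] by simp
          also have "\<dots> \<le> (63 + 2 * real A) * lg n" using lg1[of n] by (intro mult_left_mono) auto
          finally show "63 + 2 * real (pcost (hck_program False e)) \<le> (63 + 2 * real A) * lg n" .
        qed
        also have "\<dots> = real G * lg n" by (simp add: G_def algebra_simps)
        finally show ?thesis .
      qed
      then have "lg n * real ?k \<le> lg n * (real G * lg n)" using lg1[of n] by (intro mult_left_mono) auto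
      also have "\<dots> = real G * lg n ^ 2" by (simp add: power2_eq_square)
      also have "\<dots> \<le> real G * lg n ^ 3" using lg1[of n] by (intro mult_left_mono power_increasing) auto
      also have "\<dots> \<le> real G * (K * lg n ^ 3)"
        using K1 lg1[of n] by (intro mult_left_mono) (auto simp: mult_le_cancel_right1)
      finally have "2 powr (lg n * real ?k) \<le> 2 powr (real G * (K * lg n ^ 3))" by (intro powr_mono) auto
      then have "(real n + 2) ^ ?k \<le> (2 powr real G) powr (K * (lg n ^ 3 * log 2 (lg n + 1) ^ 0))"
        unfolding power_lg powr_powr by simp
      then show "real (pcost (hck_program False e) * P + (n + 2) ^ ?k)
        \<le> (2 powr real G) powr (K * (lg n ^ 3 * log 2 (lg n + 1) ^ 0)) + K * real P"
        using AK(1)[of False P] by (simp add: add.commute del: power_0)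
    qed
    have soft: "bicriteria_algorithm True (\<lambda>n. K * (lg n * x)) (1 + \<epsilon>)
      (\<lambda>n P. (real n + 2) powr (K * x) + K * real P) (compile (hck_program True e))"
    proof (rule hck_bicriteria[OF e(1) a b card_allowed_soft], assumption, assumption)
      fix n P
      let ?k = "9 * (4 * 2 ^ e + 7) + 2 * pcost (hck_program True e)"
      have "real ?k \<le> 36 * 2 ^ e + (63 + 2 * real A)" using AK(2)[of True] by simp
      also have "\<dots> \<le> 4608 * x + (63 + 2 * real A) * x"
      proof (rule add_mono)
        show "36 * 2 ^ e \<le> 4608 * x" unfolding pow using e(3) by simp
        have "(63 + 2 * real A) * 1 \<le> (63 + 2 * real A) * x" using x1 by (intro mult_left_mono) auto
        then show "63 + 2 * real A \<le> (63 + 2 * real A) * x" by simp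
      qed
      also have "\<dots> \<le> K * x" using x1 by (simp add: K_def algebra_simps)
      finally have "(real n + 2) powr real ?k \<le> (real n + 2) powr (K * x)" by (intro powr_mono) auto
      then have "(real n + 2) ^ ?k \<le> (real n + 2) powr (K * x)" by (subst (asm) powr_realpow) auto
      then show "real (pcost (hck_program True e) * P + (n + 2) ^ ?k) \<le> (real n + 2) powr (K * x) + K * real P"
        using AK(1)[of True P] by (simp add: add.commute)
    qed
    have "1 \<le> 2 powr real G" by (rule ge_one_powr_ge_zero) auto
    then show ?thesis using hard soft unfolding x_def by blast
  qed
  show ?thesis by (rule exI[of _ K], rule exI[of _ "0::nat"], rule conjI[OF K1], intro allI impI, rule main)
qed



end
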